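(* Let $\mu\in\mathcal M_a(\mathcal N')$ be a non-degenerate probability measure. The $S_\mu$-transform is a topological isomorphism from $(\mathcal N)^{-1}_\mu$ onto $\mathrm{Hol}_0(\mathcal N_{\mathbb C})$.
   Context: Nuclear triple: $\mathcal H$ is a real separable Hilbert space with norm $|\cdot|$; $\mathcal N\subset\mathcal H$ is a separable nuclear Fréchet space, densely and continuously embedded, $\mathcal N=\bigcap_{p\in\mathbb N}\mathcal H_p$ with the projective limit topology, where the $\mathcal H_p$ are Hilbert spaces with norms $|\cdot|_p$, $|\cdot|\le|\cdot|_p\le|\cdot|_q$ for $p<q$, and for every $p$ there is $p'>p$ such that the embedding $\mathcal H_{p'}\hookrightarrow\mathcal H_p$ is Hilbert–Schmidt. $\mathcal N'=\bigcup_p\mathcal H_{-p}$ is the dual, $\mathcal H_{-p}$ being the dual of $\mathcal H_p$ with respect to $\mathcal H$, with norm $|\cdot|_{-p}$; $\langle\cdot,\cdot\rangle$ is the bilinear dual pairing. A subscript $\mathbb C$ denotes complexification, $\hat\otimes$ the symmetric tensor product; $|\cdot|_{\pm p}$ also denotes the norm on $\mathcal H_{\pm p,\mathbb C}^{\hat\otimes n}$ (complex modulus if $n=0$); $\mathcal N_{\mathbb C}^{\hat\otimes n}$ is the projective limit of the $\mathcal H_{p,\mathbb C}^{\hat\otimes n}$, and its dual is the inductive limit of the $\mathcal H_{-p,\mathbb C}^{\hat\otimes n}$. Measures: $\mathcal M_a(\mathcal N')$ is the set of measures $\mu$ on the cylinder $\sigma$-algebra of $\mathcal N'$ whose Laplace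 transform $l_\mu(\theta)=\int_{\mathcal N'}e^{\langle x,\theta\rangle}\,d\mu(x)$ is holomorphic in a neighborhood of $0\in\mathcal N_{\mathbb C}$ (holomorphic = Gâteaux-holomorphic and locally bounded). $\mathcal P(\mathcal N')$ is the set of functions $\varphi(x)=\sum_{n=0}^N\langle x^{\otimes n},\tilde\varphi^{(n)}\rangle$ on $\mathcal N'$ with $\tilde\varphi^{(n)}\in\mathcal N_{\mathbb C}^{\hat\otimes n}$, topologized as the topological direct sum $\bigoplus_n\mathcal N_{\mathbb C}^{\hat\otimes n}$; $\mu$ is non-degenerate if $\varphi\in\mathcal P(\mathcal N')$, $\varphi=0$ $\mu$-a.e. implies $\varphi\equiv0$. Appell system: $e_\mu(\theta;z)=e^{\langle z,\theta\rangle}/l_\mu(\theta)=\sum_{n}\frac1{n!}\langle P_n^\mu(z),\theta^{\otimes n}\rangle$ ($\theta$ near $0$ in $\mathcal N_{\mathbb C}$, $z\in\mathcal N'_{\mathbb C}$) defines $P_n^\mu(z)\in(\mathcal N_{\mathbb C}^{\hat\otimes n})'$. Every $\varphi\in\mathcal P(\mathcal N')$ is uniquely $\sum_{n=0}^N\langle P_n^\mu,\varphi^{(n)}\rangle$ with $\varphi^{(n)}\in\mathcal N_{\mathbb C}^{\hat\otimes n}$. $\mathcal P'_\mu(\mathcal N')$ is the dual of $\mathcal P(\mathcal N')$, with bilinear pairing $\langle\!\langle\cdot,\cdot\rangle\!\rangle_\mu$ extending $\langle\!\langle f,\varphi\rangle\!\rangle_\mu=\int f\varphi\,d\mu$ ($f\in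 L^2(\mu)$). Every $\Phi\in\mathcal P'_\mu(\mathcal N')$ is uniquely of the form $\Phi=\sum_nQ_n^\mu(\Phi^{(n)})$, $\Phi^{(n)}\in(\mathcal N_{\mathbb C}^{\hat\otimes n})'$, acting by $\langle\!\langle\Phi,\varphi\rangle\!\rangle_\mu=\sum_nn!\langle\Phi^{(n)},\varphi^{(n)}\rangle$. Distributions: $(\mathcal H_{-p})^{-1}_{-q,\mu}$ is the Hilbert space of $\Phi\in\mathcal P'_\mu(\mathcal N')$ with $\|\Phi\|^2_{-p,-q,\mu}=\sum_n2^{-qn}|\Phi^{(n)}|_{-p}^2<\infty$; $(\mathcal N)^{-1}_\mu=\bigcup_{p,q\in\mathbb N}(\mathcal H_{-p})^{-1}_{-q,\mu}$ with the inductive limit topology. The space $(\mathcal H_{-p})^{-1}_{-q,\mu}$ is the dual of the completion of $\mathcal P(\mathcal N')$ in the norm $\|\varphi\|^2_{p,q,\mu}=\sum_n(n!)^22^{nq}|\varphi^{(n)}|_p^2$. $S_\mu$-transform: for $\Phi\in(\mathcal H_{-p})^{-1}_{-q,\mu}$ and $\theta\in\mathcal H_{p,\mathbb C}$ with $2^q|\theta|_p^2<1$, $S_\mu\Phi(\theta)=\langle\!\langle\Phi,e_\mu(\theta;\cdot)\rangle\!\rangle_\mu=\sum_n\langle\Phi^{(n)},\theta^{\otimes n}\rangle$. $\mathrm{Hol}_0(\mathcal N_{\mathbb C})$ is the algebra of germs at $0$ of functions holomorphic in a neighborhood of $0\in\mathcal N_{\mathbb C}$ (functions agreeing on a neighborhood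 of $0$ are identified), with the inductive limit topology given by the norms $\mathrm n_{p,l,\infty}(G)=\sup_{|\theta|_p\le2^{-l}}|G(\theta)|$, $p,l\in\mathbb N$. *)

theory Defs
  imports "HOL-Probability.Probability"
begin

text \<open>
  The vector space operations are passed explicitly, because they are needed for subspaces of
  function spaces and for a space of germs.
\<close>

definition abs_convex ::
  "('v \<Rightarrow> 'v \<Rightarrow> 'v) \<Rightarrow> (complex \<Rightarrow> 'v \<Rightarrow> 'v) \<Rightarrow> 'v set \<Rightarrow> bool" where
  "abs_convex add scl U \<longleftrightarrow>
     (\<forall>u\<in>U. \<forall>v\<in>U. \<forall>a b. cmod a + cmod b \<le> 1 \<longrightarrow> add (scl a u) (scl b v) \<in> U)"

text \<open>
  The finest locally convex topology on \<open>V\<close> for which the linear maps from a family of locally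
  convex spaces into \<open>V\<close> are continuous, where the images of these maps span \<open>V\<close>; \<open>nb i\<close> is
  the image in \<open>V\<close> of a base of zero neighbourhoods of the \<open>i\<close>-th space. A base of zero
  neighbourhoods of \<open>V\<close> consists of the absolutely convex sets that contain a member of
  \<open>nb i\<close> for every \<open>i\<close>. Locally convex inductive limits and locally convex direct sums are
  instances.
\<close>

definition final_lc_topology ::
  "'v set \<Rightarrow> ('v \<Rightarrow> 'v \<Rightarrow> 'v) \<Rightarrow> (complex \<Rightarrow> 'v \<Rightarrow> 'v) \<Rightarrow> ('i \<Rightarrow> 'v set set) \<Rightarrow> 'v topology" where
  "final_lc_topology V add scl nb = topology (\<lambda>W. W \<subseteq> V \<and>
     (\<forall>w\<in>W. \<exists>U\<subseteq>V. abs_convex add scl U \<and> (\<forall>i. \<exists>B\<in>nb i. B \<subseteq> U) \<and> (\<forall>u\<in>U. add w u \<in> W)))"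

lemma openin_final_lc_topology:
  assumes base: "\<And>i A B. A \<in> nb i \<Longrightarrow> B \<in> nb i \<Longrightarrow> \<exists>C\<in>nb i. C \<subseteq> A \<inter> B"
  shows "openin (final_lc_topology V add scl nb) W \<longleftrightarrow> W \<subseteq> V \<and>
     (\<forall>w\<in>W. \<exists>U\<subseteq>V. abs_convex add scl U \<and> (\<forall>i. \<exists>B\<in>nb i. B \<subseteq> U) \<and> (\<forall>u\<in>U. add w u \<in> W))"
proof -
  define P where "P w U W \<longleftrightarrow> U \<subseteq> V \<and> abs_convex add scl U \<and> (\<forall>i. \<exists>B\<in>nb i. B \<subseteq> U) \<and>
    (\<forall>u\<in>U. add w u \<in> W)" for w U W
  have ist: "istopology (\<lambda>W. W \<subseteq> V \<and> (\<forall>w\<in>W. \<exists>U. P w U W))"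
    unfolding istopology_def
  proof (intro conjI allI impI ballI)
    fix S T w
    assume S: "S \<subseteq> V \<and> (\<forall>w\<in>S. \<exists>U. P w U S)" and T: "T \<subseteq> V \<and> (\<forall>w\<in>T. \<exists>U. P w U T)"
      and w: "w \<in> S \<inter> T"
    obtain U1 U2 where U: "P w U1 S" "P w U2 T" using S T w by blast
    have "\<exists>B\<in>nb i. B \<subseteq> U1 \<inter> U2" for i
    proof -
      obtain A B where "A \<in> nb i" "A \<subseteq> U1" "B \<in> nb i" "B \<subseteq> U2" using U unfolding P_def by meson
      then show ?thesis using base[of A i B] by blast
    qed
    then have "P w (U1 \<inter> U2) (S \<inter> T)" using U unfolding P_def abs_convex_def by blast
    then show "\<exists>U. P w U (S \<inter> T)" ..
  next
    fix \<K> w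
    assume *: "\<forall>K\<in>\<K>. K \<subseteq> V \<and> (\<forall>w\<in>K. \<exists>U. P w U K)" and "w \<in> \<Union>\<K>"
    then obtain K U where "K \<in> \<K>" "P w U K" by blast
    then show "\<exists>U. P w U (\<Union>\<K>)" unfolding P_def by blast
  qed blast+
  have "final_lc_topology V add scl nb = topology (\<lambda>W. W \<subseteq> V \<and> (\<forall>w\<in>W. \<exists>U. P w U W))"
    unfolding final_lc_topology_def P_def by simp
  then show ?thesis using ist by (simp add: topology_inverse' P_def)
qed

definition fadd :: "('x \<Rightarrow> complex) \<Rightarrow> ('x \<Rightarrow> complex) \<Rightarrow> 'x \<Rightarrow> complex" where
  "fadd f g = (\<lambda>x. f x + g x)"

definition fscl :: "complex \<Rightarrow> ('x \<Rightarrow> complex) \<Rightarrow> 'x \<Rightarrow> complex" where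
  "fscl c f = (\<lambda>x. c * f x)"

definition norm_of :: "('h \<Rightarrow> 'h \<Rightarrow> real) \<Rightarrow> 'h \<Rightarrow> real" where
  "norm_of ip x = sqrt (ip x x)"

definition hilbert_on :: "'h::real_vector set \<Rightarrow> ('h \<Rightarrow> 'h \<Rightarrow> real) \<Rightarrow> bool" where
  "hilbert_on S ip \<longleftrightarrow> subspace S \<and>
     (\<forall>x\<in>S. \<forall>y\<in>S. ip x y = ip y x) \<and>
     (\<forall>x\<in>S. \<forall>y\<in>S. \<forall>z\<in>S. \<forall>a b. ip (a *\<^sub>R x + b *\<^sub>R y) z = a * ip x z + b * ip y z) \<and>
     (\<forall>x\<in>S. x \<noteq> 0 \<longrightarrow> ip x x > 0) \<and>
     (\<forall>X. (\<forall>n::nat. X n \<in> S) \<and>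
          (\<forall>\<epsilon>>0. \<exists>M. \<forall>m\<ge>M. \<forall>n\<ge>M. norm_of ip (X m - X n) < \<epsilon>) \<longrightarrow>
          (\<exists>x\<in>S. (\<lambda>n. norm_of ip (X n - x)) \<longlonglongrightarrow> 0))"

definition orthonormal_on :: "'h set \<Rightarrow> ('h \<Rightarrow> 'h \<Rightarrow> real) \<Rightarrow> 'h set \<Rightarrow> bool" where
  "orthonormal_on S ip E \<longleftrightarrow> E \<subseteq> S \<and> (\<forall>e\<in>E. \<forall>f\<in>E. ip e f = (if e = f then 1 else 0))"

definition orthonormal_basis_on ::
  "'h::real_vector set \<Rightarrow> ('h \<Rightarrow> 'h \<Rightarrow> real) \<Rightarrow> 'h set \<Rightarrow> bool" where
  "orthonormal_basis_on S ip E \<longleftrightarrow>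
     orthonormal_on S ip E \<and> (\<forall>x\<in>S. (\<forall>e\<in>E. ip e x = 0) \<longrightarrow> x = 0)"

text \<open>
  The type \<open>'h\<close> is the real separable Hilbert space \<open>H\<close>, and \<open>Hp p\<close> with inner product
  \<open>ip p\<close> is \<open>H_p\<close>. Separability of their intersection follows from the last assumption.
\<close>

locale nuclear_triple =
  fixes Hp :: "nat \<Rightarrow> 'h::{real_inner, complete_space, second_countable_topology} set"
    and ip :: "nat \<Rightarrow> 'h \<Rightarrow> 'h \<Rightarrow> real"
  assumes hilbert: "hilbert_on (Hp p) (ip p)"
    and norm_le: "x \<in> Hp p \<Longrightarrow> norm x \<le> norm_of (ip p) x"
    and Hp_antimono: "p < q \<Longrightarrow> Hp q \<subseteq> Hp p"
    and norm_mono: "p < q \<Longrightarrow> x \<in> Hp q \<Longrightarrow> norm_of (ip p) x \<le> norm_of (ip q) x"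
    and dense: "closure (\<Inter>p. Hp p) = UNIV"
    and hilbert_schmidt: "\<exists>p'>p. \<exists>E. orthonormal_basis_on (Hp p') (ip p') E \<and>
           (\<lambda>e. (norm_of (ip p) e)\<^sup>2) summable_on E"
begin

definition N :: "'h set" where
  "N = (\<Inter>p. Hp p)"

text \<open>
  The dual \<open>N'\<close>. Functionals on \<open>N\<close> are represented by functions vanishing off \<open>N\<close>; the same
  convention is used for all functions on subsets below. The space \<open>H_{-p}\<close> consists of the
  functionals that are bounded with respect to the norm of \<open>H_p\<close>.
\<close>

definition N' :: "('h \<Rightarrow> real) set" where
  "N' = {x. (\<forall>\<xi>. \<xi> \<notin> N \<longrightarrow> x \<xi> = 0) \<and>
            (\<forall>\<xi>\<in>N. \<forall>\<eta>\<in>N. \<forall>a b. x (a *\<^sub>R \<xi> + b *\<^sub>R \<eta>) = a * x \<xi> + b * x \<eta>) \<and>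
            (\<exists>p C. \<forall>\<xi>\<in>N. \<bar>x \<xi>\<bar> \<le> C * norm_of (ip p) \<xi>)}"

definition riesz :: "nat \<Rightarrow> 'h \<Rightarrow> 'h \<Rightarrow> real" where
  "riesz p u = (\<lambda>\<xi>. if \<xi> \<in> N then ip p u \<xi> else 0)"

text \<open>The complexification \<open>N_C\<close>: the pair \<open>(\<xi>, \<eta>)\<close> stands for \<open>\<xi> + i \<eta>\<close>.\<close>

definition NC :: "('h \<times> 'h) set" where
  "NC = N \<times> N"

definition cscale :: "complex \<Rightarrow> 'h \<times> 'h \<Rightarrow> 'h \<times> 'h" where
  "cscale c \<theta> = (Re c *\<^sub>R fst \<theta> - Im c *\<^sub>R snd \<theta>, Re c *\<^sub>R snd \<theta> + Im c *\<^sub>R fst \<theta>)"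

definition cnorm :: "nat \<Rightarrow> 'h \<times> 'h \<Rightarrow> real" where
  "cnorm p \<theta> = sqrt ((norm_of (ip p) (fst \<theta>))\<^sup>2 + (norm_of (ip p) (snd \<theta>))\<^sup>2)"

definition pairing :: "('h \<Rightarrow> real) \<Rightarrow> 'h \<times> 'h \<Rightarrow> complex" where
  "pairing x \<theta> = Complex (x (fst \<theta>)) (x (snd \<theta>))"

text \<open>Open sets of the projective limit topology; the balls form a base since the norms increase with \<open>p\<close>.\<close>

definition open_NC :: "('h \<times> 'h) set \<Rightarrow> bool" where
  "open_NC U \<longleftrightarrow> U \<subseteq> NC \<and>
     (\<forall>\<theta>\<in>U. \<exists>p. \<exists>\<epsilon>>0. \<forall>\<eta>\<in>NC. cnorm p (\<eta> - \<theta>) < \<epsilon> \<longrightarrow> \<eta> \<in> U)"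

definition holomorphic_NC :: "('h \<times> 'h \<Rightarrow> complex) \<Rightarrow> ('h \<times> 'h) set \<Rightarrow> bool" where
  "holomorphic_NC G U \<longleftrightarrow>
     (\<forall>\<theta>\<in>U. \<forall>\<eta>\<in>NC. (\<lambda>z. G (\<theta> + cscale z \<eta>)) analytic_on {0}) \<and>
     (\<forall>\<theta>\<in>U. \<exists>V C. open_NC V \<and> \<theta> \<in> V \<and> V \<subseteq> U \<and> (\<forall>\<eta>\<in>V. cmod (G \<eta>) \<le> C))"

text \<open>
  Hilbert tensor powers are realised as spaces of Hilbert--Schmidt functionals (as in Kadison
  and Ringrose): the \<open>n\<close>-th complexified symmetric tensor power of \<open>H_p\<close> is the space of
  symmetric real-multilinear functionals \<open>t\<close> on \<open>n\<close>-tuples from \<open>H_{-p}\<close> with complex values,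
  the elementary tensor of \<open>\<xi>\<^sub>1, \<dots>, \<xi>\<^sub>n\<close> being the functional
  \<open>(x\<^sub>1, \<dots>, x\<^sub>n) \<mapsto> x\<^sub>1 \<xi>\<^sub>1 \<cdots> x\<^sub>n \<xi>\<^sub>n\<close>, for which the sum of the squares
  \<open>|t (x\<^sub>1, \<dots>, x\<^sub>n)|\<^sup>2\<close> over the tuples from an orthonormal basis of \<open>H_{-p}\<close> is finite; the
  norm is the root of this sum. As \<open>N'\<close> is the union of the \<open>H_{-p}\<close>, the elements of the
  projective limit are the functionals on tuples from \<open>N'\<close>.
\<close>

definition sym_form :: "nat \<Rightarrow> (('h \<Rightarrow> real) list \<Rightarrow> complex) \<Rightarrow> bool" where
  "sym_form n t \<longleftrightarrow>
     (\<forall>xs. \<not> (length xs = n \<and> set xs \<subseteq> N') \<longrightarrow> t xs = 0) \<and>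
     (\<forall>xs i x y a b. length xs = n \<and> set xs \<subseteq> N' \<and> i < n \<and> x \<in> N' \<and> y \<in> N' \<longrightarrow>
        t (xs[i := (\<lambda>\<xi>. a * x \<xi> + b * y \<xi>)]) =
          of_real a * t (xs[i := x]) + of_real b * t (xs[i := y])) \<and>
     (\<forall>xs ys. mset xs = mset ys \<longrightarrow> t xs = t ys)"

text \<open>
  The squared Hilbert--Schmidt norm. The Riesz map of \<open>H_p\<close> carries orthonormal systems of
  \<open>H_p\<close> to orthonormal systems of \<open>H_{-p}\<close>, and the supremum over the finite ones is the sum
  over an orthonormal basis. Unlike the latter, it is infinite for unbounded functionals.
\<close>

definition tnorm_sq :: "nat \<Rightarrow> nat \<Rightarrow> (('h \<Rightarrow> real) list \<Rightarrow> complex) \<Rightarrow> ennreal" where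
  "tnorm_sq p n t = (SUP E\<in>{E. finite E \<and> orthonormal_on (Hp p) (ip p) E}.
     \<Sum>es | set es \<subseteq> E \<and> length es = n. ennreal ((cmod (t (map (riesz p) es)))\<^sup>2))"

definition tnorm :: "nat \<Rightarrow> nat \<Rightarrow> (('h \<Rightarrow> real) list \<Rightarrow> complex) \<Rightarrow> real" where
  "tnorm p n t = sqrt (enn2real (tnorm_sq p n t))"

definition NC_tensor :: "nat \<Rightarrow> (('h \<Rightarrow> real) list \<Rightarrow> complex) set" where
  "NC_tensor n = {t. sym_form n t \<and> (\<forall>p. tnorm_sq p n t < \<infinity>)}"

definition tensor_power :: "nat \<Rightarrow> 'h \<times> 'h \<Rightarrow> ('h \<Rightarrow> real) list \<Rightarrow> complex" where
  "tensor_power n \<theta> = (\<lambda>xs. if length xs = n \<and> set xs \<subseteq> N'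
     then (\<Prod>x\<leftarrow>xs. pairing x \<theta>) else 0)"

text \<open>The norm of the symmetric tensor power of \<open>H_{-p}\<close>, as the dual norm.\<close>

definition dual_norm ::
  "nat \<Rightarrow> nat \<Rightarrow> ((('h \<Rightarrow> real) list \<Rightarrow> complex) \<Rightarrow> complex) \<Rightarrow> ennreal" where
  "dual_norm p n L = (SUP t\<in>{t\<in>NC_tensor n. tnorm p n t \<le> 1}. ennreal (cmod (L t)))"

definition NC_tensor_dual :: "nat \<Rightarrow> ((('h \<Rightarrow> real) list \<Rightarrow> complex) \<Rightarrow> complex) set" where
  "NC_tensor_dual n = {L. (\<forall>t. t \<notin> NC_tensor n \<longrightarrow> L t = 0) \<and>
     (\<forall>s\<in>NC_tensor n. \<forall>t\<in>NC_tensor n. \<forall>a b.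
        L (fadd (fscl a s) (fscl b t)) = a * L s + b * L t) \<and>
     (\<exists>p. dual_norm p n L < \<infinity>)}"

text \<open>The function \<open>x \<mapsto> \<langle>x\<^sup>\<otimes>\<^sup>n, t\<rangle>\<close>.\<close>

definition monomial :: "nat \<Rightarrow> (('h \<Rightarrow> real) list \<Rightarrow> complex) \<Rightarrow> ('h \<Rightarrow> real) \<Rightarrow> complex" where
  "monomial n t = (\<lambda>x. if x \<in> N' then t (replicate n x) else 0)"

definition polys :: "(('h \<Rightarrow> real) \<Rightarrow> complex) set" where
  "polys = {\<phi>. \<exists>m t. (\<forall>n\<le>m. t n \<in> NC_tensor n) \<and> \<phi> = (\<lambda>x. \<Sum>n\<le>m. monomial n (t n) x)}"

definition polys_topology :: "(('h \<Rightarrow> real) \<Rightarrow> complex) topology" where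
  "polys_topology = final_lc_topology polys fadd fscl
     (\<lambda>n. {monomial n ` {t \<in> NC_tensor n. tnorm p n t < \<epsilon>} | p \<epsilon>. \<epsilon> > 0})"

definition cylinder_algebra :: "('h \<Rightarrow> real) measure" where
  "cylinder_algebra = sigma N' {{x \<in> N'. x \<xi> \<in> B} | \<xi> B. \<xi> \<in> N \<and> B \<in> sets borel}"

definition laplace :: "('h \<Rightarrow> real) measure \<Rightarrow> 'h \<times> 'h \<Rightarrow> complex" where
  "laplace \<mu> \<theta> = (\<integral>x. exp (pairing x \<theta>) \<partial>\<mu>)"

definition M_a :: "('h \<Rightarrow> real) measure set" where
  "M_a = {\<mu>. sets \<mu> = sets cylinder_algebra \<and>
     (\<exists>U. open_NC U \<and> 0 \<in> U \<and> (\<forall>\<theta>\<in>U. integrable \<mu> (\<lambda>x. exp (pairing x \<theta>))) \<and>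
          holomorphic_NC (laplace \<mu>) U)}"

definition nondegenerate :: "('h \<Rightarrow> real) measure \<Rightarrow> bool" where
  "nondegenerate \<mu> \<longleftrightarrow> (\<forall>\<phi>\<in>polys. (AE x in \<mu>. \<phi> x = 0) \<longrightarrow> (\<forall>x\<in>N'. \<phi> x = 0))"

definition e_mu :: "('h \<Rightarrow> real) measure \<Rightarrow> 'h \<times> 'h \<Rightarrow> ('h \<Rightarrow> real) \<Rightarrow> complex" where
  "e_mu \<mu> \<theta> x = exp (pairing x \<theta>) / laplace \<mu> \<theta>"

definition appell ::
  "('h \<Rightarrow> real) measure \<Rightarrow> ('h \<Rightarrow> real) \<Rightarrow> nat \<Rightarrow> (('h \<Rightarrow> real) list \<Rightarrow> complex) \<Rightarrow> complex" where
  "appell \<mu> x = (THE P. (\<forall>n. P n \<in> NC_tensor_dual n) \<and>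
     (\<exists>U. open_NC U \<and> 0 \<in> U \<and>
        (\<forall>\<theta>\<in>U. (\<lambda>n. P n (tensor_power n \<theta>) / fact n) sums e_mu \<mu> \<theta> x)))"

definition appell_poly :: "('h \<Rightarrow> real) measure \<Rightarrow> nat \<Rightarrow>
    (('h \<Rightarrow> real) list \<Rightarrow> complex) \<Rightarrow> ('h \<Rightarrow> real) \<Rightarrow> complex" where
  "appell_poly \<mu> n t = (\<lambda>x. if x \<in> N' then appell \<mu> x n t else 0)"

definition polys_dual :: "((('h \<Rightarrow> real) \<Rightarrow> complex) \<Rightarrow> complex) set" where
  "polys_dual = {\<Phi>. (\<forall>\<phi>. \<phi> \<notin> polys \<longrightarrow> \<Phi> \<phi> = 0) \<and>
     (\<forall>\<phi>\<in>polys. \<forall>\<psi>\<in>polys. \<forall>a b. \<Phi> (fadd (fscl a \<phi>) (fscl b \<psi>)) = a * \<Phi> \<phi> + b * \<Phi> \<psi>) \<and>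
     continuous_map polys_topology euclidean \<Phi>}"

text \<open>The kernels \<open>\<Phi>\<^sup>(\<^sup>n\<^sup>)\<close> in the expansion of \<open>\<Phi>\<close> with respect to the system \<open>Q\<^sub>n\<close>.\<close>

definition kernels :: "('h \<Rightarrow> real) measure \<Rightarrow> ((('h \<Rightarrow> real) \<Rightarrow> complex) \<Rightarrow> complex) \<Rightarrow>
    nat \<Rightarrow> (('h \<Rightarrow> real) list \<Rightarrow> complex) \<Rightarrow> complex" where
  "kernels \<mu> \<Phi> = (THE K. (\<forall>n. K n \<in> NC_tensor_dual n) \<and>
     (\<forall>m t. (\<forall>n\<le>m. t n \<in> NC_tensor n) \<longrightarrow>
        \<Phi> (\<lambda>x. \<Sum>n\<le>m. appell_poly \<mu> n (t n) x) = (\<Sum>n\<le>m. fact n * K n (t n))))"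

definition dist_norm_sq :: "('h \<Rightarrow> real) measure \<Rightarrow> nat \<Rightarrow> nat \<Rightarrow>
    ((('h \<Rightarrow> real) \<Rightarrow> complex) \<Rightarrow> complex) \<Rightarrow> ennreal" where
  "dist_norm_sq \<mu> p q \<Phi> = (\<Sum>n. ennreal (1 / 2 ^ (q * n)) * (dual_norm p n (kernels \<mu> \<Phi> n))\<^sup>2)"

definition dist_step :: "('h \<Rightarrow> real) measure \<Rightarrow> nat \<Rightarrow> nat \<Rightarrow>
    ((('h \<Rightarrow> real) \<Rightarrow> complex) \<Rightarrow> complex) set" where
  "dist_step \<mu> p q = {\<Phi> \<in> polys_dual. dist_norm_sq \<mu> p q \<Phi> < \<infinity>}"

definition distributions ::
  "('h \<Rightarrow> real) measure \<Rightarrow> ((('h \<Rightarrow> real) \<Rightarrow> complex) \<Rightarrow> complex) set" where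
  "distributions \<mu> = (\<Union>p q. dist_step \<mu> p q)"

definition dist_topology ::
  "('h \<Rightarrow> real) measure \<Rightarrow> ((('h \<Rightarrow> real) \<Rightarrow> complex) \<Rightarrow> complex) topology" where
  "dist_topology \<mu> = final_lc_topology (distributions \<mu>) fadd fscl
     (\<lambda>(p, q). {{\<Phi> \<in> dist_step \<mu> p q. dist_norm_sq \<mu> p q \<Phi> < ennreal (\<epsilon>\<^sup>2)} | \<epsilon>. \<epsilon> > 0})"

definition germ :: "('h \<times> 'h \<Rightarrow> complex) \<Rightarrow> ('h \<times> 'h \<Rightarrow> complex) set" where
  "germ G = {F. \<exists>U. open_NC U \<and> 0 \<in> U \<and> (\<forall>\<theta>\<in>U. F \<theta> = G \<theta>)}"

definition Hol0 :: "('h \<times> 'h \<Rightarrow> complex) set set" where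
  "Hol0 = {germ G | G. \<exists>U. open_NC U \<and> 0 \<in> U \<and> holomorphic_NC G U}"

definition germ_add ::
  "('h \<times> 'h \<Rightarrow> complex) set \<Rightarrow> ('h \<times> 'h \<Rightarrow> complex) set \<Rightarrow> ('h \<times> 'h \<Rightarrow> complex) set" where
  "germ_add g h = (\<Union>F\<in>g. \<Union>G\<in>h. germ (fadd F G))"

definition germ_scl ::
  "complex \<Rightarrow> ('h \<times> 'h \<Rightarrow> complex) set \<Rightarrow> ('h \<times> 'h \<Rightarrow> complex) set" where
  "germ_scl c g = (\<Union>F\<in>g. germ (fscl c F))"

text \<open>
  The norm of a germ on the ball of radius \<open>2\<^sup>-\<^sup>l\<close>: all representatives that are holomorphic
  near this ball agree on it; the value is infinite if there is none.
\<close>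

definition germ_norm :: "nat \<Rightarrow> nat \<Rightarrow> ('h \<times> 'h \<Rightarrow> complex) set \<Rightarrow> ennreal" where
  "germ_norm p l g =
     (INF G\<in>{G \<in> g. \<exists>U. open_NC U \<and> {\<theta> \<in> NC. cnorm p \<theta> \<le> 1 / 2 ^ l} \<subseteq> U \<and> holomorphic_NC G U}.
        SUP \<theta>\<in>{\<theta> \<in> NC. cnorm p \<theta> \<le> 1 / 2 ^ l}. ennreal (cmod (G \<theta>)))"

definition Hol0_topology :: "('h \<times> 'h \<Rightarrow> complex) set topology" where
  "Hol0_topology = final_lc_topology Hol0 germ_add germ_scl
     (\<lambda>(p, l). {{g \<in> Hol0. germ_norm p l g < ennreal \<epsilon>} | \<epsilon>. \<epsilon> > 0})"

definition S_transform :: "('h \<Rightarrow> real) measure \<Rightarrow>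
    ((('h \<Rightarrow> real) \<Rightarrow> complex) \<Rightarrow> complex) \<Rightarrow> 'h \<times> 'h \<Rightarrow> complex" where
  "S_transform \<mu> \<Phi> \<theta> = (\<Sum>n. kernels \<mu> \<Phi> n (tensor_power n \<theta>))"

end

end

theory Submission
  imports Defs "HOL-Complex_Analysis.Complex_Analysis"
begin

text \<open>
  The transform sends a distribution with kernels \<open>K n\<close> to the power series
  \<open>\<theta> \<mapsto> \<Sum>n. K n (\<theta>\<^sup>\<otimes>\<^sup>n)\<close>, so everything rests on the correspondence between germs of holomorphic
  functions and sequences of kernels whose dual norms grow at most geometrically.

  A Gateaux holomorphic function bounded on a ball of \<open>H_p\<close> has homogeneous Taylor coefficients
  which are entire with polynomial growth along complex lines. By Cauchy's estimate a difference
  operator lowers this growth order by one, hence the \<open>n\<close>-fold differences of the \<open>n\<close>-th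
  coefficient are its polarised form, with norm at most \<open>(2 e)\<^sup>n\<close> times the norm of the coefficient.
  The Hilbert--Schmidt embedding turns the polarised form into a functional that is bounded with
  respect to the Hilbert--Schmidt norm on the span of the tensor powers, and this span is dense.
  This gives both existence and uniqueness of the kernels, with estimates that depend on the ball
  only; together with the geometric series they give the continuity in both directions.

  Applied to the inverse Laplace transform, the correspondence produces the Appell kernels at 0;
  those at \<open>x\<close> follow by contraction. As the Appell system is triangular over the monomials, a
  functional on the polynomials can be prescribed by its kernels arbitrarily.
\<close>

section \<open>Sums over lists and symmetric functions\<close>

text \<open>\<open>N\<close> need not be dense in \<open>H_p\<close>, so orthonormal systems of
  \<open>H_p\<close> cannot be taken inside \<open>N\<close> outright; this obstacle shapes the
  density proof for the tensor powers. For the kernels, Cauchy's estimate controls the polarised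
  form on unit vectors only, whereas the dual norm asks for square summability over an orthonormal
  system. A bounded form becomes square summable after a Hilbert-Schmidt embedding of
  \<open>H_q\<close> into \<open>H_p\<close>, at the price of a factor \<open>sqrt K\<close> per
  slot. The factor \<open>2 e\<close> per slot has two sources: an \<open>n\<close>-fold difference
  has \<open>2 ^ n\<close> terms, and its arguments have norm up to \<open>n\<close>, where
  \<open>n ^ n / n! \<le> e ^ n\<close>. All these losses have the form \<open>const ^ n\<close>;
  the weights \<open>2 ^ (- q n)\<close> absorb them once \<open>q\<close> is enlarged. Appell
  polynomials and kernels are introduced by unique description, so a uniqueness result has to stand
  behind every computation with them. Sums over \<open>Lst E n\<close> are sums over the product
  basis of an \<open>n\<close>-th tensor power.\<close>

definition Lst :: "'a set \<Rightarrow> nat \<Rightarrow> 'a list set" where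
  "Lst E n = {es. set es \<subseteq> E \<and> length es = n}"

lemma Lst_0 [simp]: "Lst E 0 = {[]}"
  by (auto simp: Lst_def)

lemma Cons_in_Lst [simp]: "e # es \<in> Lst E (Suc n) \<longleftrightarrow> e \<in> E \<and> es \<in> Lst E n"
  by (auto simp: Lst_def)

lemma replicate_in_Lst [simp]: "x \<in> E \<Longrightarrow> replicate n x \<in> Lst E n"
  by (auto simp: Lst_def)

lemma Lst_mono: "E \<subseteq> F \<Longrightarrow> Lst E n \<subseteq> Lst F n"
  by (auto simp: Lst_def)

lemma Lst_Suc: "Lst E (Suc n) = (\<lambda>(e, es). e # es) ` (E \<times> Lst E n)"
  by (auto simp: Lst_def length_Suc_conv image_iff)

lemma finite_Lst [simp]: "finite E \<Longrightarrow> finite (Lst E n)"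
  unfolding Lst_def by (rule finite_lists_length_eq)

lemma sum_Lst_Suc:
  "finite E \<Longrightarrow> sum f (Lst E (Suc n)) = (\<Sum>e\<in>E. \<Sum>es\<in>Lst E n. f (e # es))"
  unfolding Lst_Suc
  by (subst sum.reindex) (auto simp: inj_on_def sum.cartesian_product intro!: sum.cong)

lemma sum_Lst_add:
  "finite E \<Longrightarrow> sum f (Lst E (k + m)) = (\<Sum>xs\<in>Lst E k. \<Sum>ys\<in>Lst E m. f (xs @ ys))"
  by (induction k arbitrary: f) (simp_all add: sum_Lst_Suc)

lemma sum_Lst_prod:
  fixes g :: "'a \<Rightarrow> 'b::comm_semiring_1"
  assumes "finite E"
  shows "(\<Sum>es\<in>Lst E n. \<Prod>e\<leftarrow>es. g e) = (\<Sum>e\<in>E. g e) ^ n"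
  by (induction n) (simp_all add: sum_Lst_Suc assms sum_distrib_right flip: sum_distrib_left)

lemma prod_sum_Lst:
  fixes g :: "'x \<Rightarrow> 'a \<Rightarrow> 'b::comm_semiring_1"
  assumes "finite E"
  shows "(\<Prod>x\<leftarrow>xs. \<Sum>e\<in>E. g x e) = (\<Sum>es\<in>Lst E (length xs). \<Prod>(x, e)\<leftarrow>zip xs es. g x e)"
  by (induction xs) (simp_all add: sum_Lst_Suc assms sum_product)

section \<open>Polynomial interpolation and symmetric functions\<close>

lemma exists_interpolating_poly:
  fixes c :: "complex \<Rightarrow> complex"
  assumes "finite X"
  obtains q where "\<And>x. x \<in> X \<Longrightarrow> poly q x = c x"
proof -
  have "\<exists>q. \<forall>x\<in>X. poly q x = c x"
    using assms
  proof (induction X rule: finite_induct)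
    case (insert y X)
    then obtain q where q: "\<forall>x\<in>X. poly q x = c x" by blast
    \<comment> \<open>\<open>w\<close> vanishes exactly on \<open>X\<close>, so adding a multiple of
      it repairs the value at \<open>y\<close> and leaves the values on \<open>X\<close>
      alone.\<close>
    define w where "w = (\<Prod>x\<in>X. [:-x, 1:])"
    have w0: "poly w x = 0 \<longleftrightarrow> x \<in> X" for x
      using insert.hyps by (auto simp: w_def poly_prod)
    define r where "r = q + smult ((c y - poly q y) / poly w y) w"
    have "\<forall>x\<in>insert y X. poly r x = c x"
      using q w0 insert.hyps by (auto simp: r_def)
    then show ?case by blast
  qed simp
  then show ?thesis using that by blast
qed

text \<open>Assigning distinct primes to the elements of \<open>F\<close>, a list is determined up to order by the
  product of its primes, so a symmetric function is a polynomial in this product; the powers of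
  the product are the product functions required.\<close>

lemma symmetric_function_span:
  fixes c :: "'a list \<Rightarrow> complex"
  assumes F: "finite F" and c: "\<And>fs gs. mset fs = mset gs \<Longrightarrow> c fs = c gs"
  obtains D :: nat and a :: "nat \<Rightarrow> complex" and z :: "nat \<Rightarrow> 'a \<Rightarrow> real"
  where "\<And>fs. fs \<in> Lst F n \<Longrightarrow> c fs = (\<Sum>j\<le>D. a j * of_real (\<Prod>f\<leftarrow>fs. z j f))"
proof -
  obtain P where P: "P \<subseteq> {p::nat. prime p}" "finite P" "card P = card F"
    using infinite_arbitrarily_large[OF primes_infinite] by metis
  then obtain pr :: "'a \<Rightarrow> nat" where "bij_betw pr F P"
    using F finite_same_card_bij by metis
  then have pr: "inj_on pr F" "pr ` F \<subseteq> {p. prime p}"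
    using P(1) by (auto simp: bij_betw_def)
  define X where "X fs = (\<Prod>f\<leftarrow>fs. pr f)" for fs
  have X: "mset fs = mset gs" if "X fs = X gs" "set fs \<subseteq> F" "set gs \<subseteq> F" for fs gs
  proof -
    have *: "prime_factorization (X hs) = image_mset pr (mset hs)" if "set hs \<subseteq> F" for hs
    proof -
      have "X hs = prod_mset (image_mset pr (mset hs))"
        by (simp add: X_def prod_mset_prod_list flip: mset_map)
      then show ?thesis
        using prime_factorization_prod_mset_primes[of "image_mset pr (mset hs)"] pr(2) that by auto
    qed
    have "image_mset pr (mset fs) = image_mset pr (mset gs)" using * that by metis
    then have "image_mset (the_inv_into F pr) (image_mset pr (mset fs)) =
        image_mset (the_inv_into F pr) (image_mset pr (mset gs))" by simp
    moreover have "image_mset (the_inv_into F pr) (image_mset pr (mset hs)) = mset hs" if "set hs \<subseteq> F" for hs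
      unfolding image_mset.compositionality o_def
      by (rule trans[OF image_mset_cong multiset.map_ident]) (use that pr(1) in \<open>auto simp: the_inv_into_f_f\<close>)
    ultimately show ?thesis using that by metis
  qed
  define Y where "Y = (\<lambda>fs. complex_of_nat (X fs)) ` Lst F n"
  have "finite Y" unfolding Y_def using F by simp
  \<comment> \<open>The product determines its list up to order, so by the symmetry of
    \<open>c\<close> the choice made here does not affect the value.\<close>
  define d where "d = (\<lambda>y::complex. c (SOME fs. fs \<in> Lst F n \<and> of_nat (X fs) = y))"
  obtain q where q: "\<And>y. y \<in> Y \<Longrightarrow> poly q y = d y"
    using exists_interpolating_poly[OF \<open>finite Y\<close>, of d] by metis
  have "c fs = (\<Sum>j\<le>degree q. coeff q j * of_real (\<Prod>f\<leftarrow>fs. real (pr f) ^ j))"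
    if fs: "fs \<in> Lst F n" for fs
  proof -
    define gs where "gs = (SOME gs. gs \<in> Lst F n \<and> complex_of_nat (X gs) = of_nat (X fs))"
    have "gs \<in> Lst F n \<and> complex_of_nat (X gs) = of_nat (X fs)"
      unfolding gs_def by (rule someI[of _ fs]) (simp add: fs)
    then have "mset gs = mset fs"
      using X[of gs fs] fs by (auto simp: Lst_def)
    then have "c fs = d (of_nat (X fs))"
      using c unfolding d_def gs_def by metis
    also have "\<dots> = poly q (of_nat (X fs))"
      using q fs unfolding Y_def by auto
    also have "\<dots> = (\<Sum>j\<le>degree q. coeff q j * of_nat (X fs) ^ j)"
      by (simp add: poly_altdef)
    also have "\<dots> = (\<Sum>j\<le>degree q. coeff q j * of_real (\<Prod>f\<leftarrow>fs. real (pr f) ^ j))"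
    proof (intro sum.cong refl arg_cong2[where f="(*)"])
      fix j
      show "complex_of_nat (X fs) ^ j = of_real (\<Prod>f\<leftarrow>fs. real (pr f) ^ j)"
        unfolding X_def by (induction fs) (simp_all add: power_mult_distrib)
    qed
    finally show ?thesis .
  qed
  then show ?thesis by (rule that)
qed

section \<open>Hilbert spaces given by an inner product on a subspace\<close>

text \<open>The inner product lives on a subspace of the type and varies with \<open>p\<close>, so
  the type classes for inner product spaces do not apply; their theory is developed relative to a
  carrier.\<close>

locale hilbert_carrier =
  fixes S :: "'h::real_vector set" and ip :: "'h \<Rightarrow> 'h \<Rightarrow> real"
  assumes hilbert: "hilbert_on S ip"
begin

abbreviation nrm :: "'h \<Rightarrow> real" where "nrm \<equiv> norm_of ip"

lemma S: "subspace S"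
  using hilbert by (simp add: hilbert_on_def)

lemma S_intros [simp, intro]:
  "0 \<in> S" "x \<in> S \<Longrightarrow> y \<in> S \<Longrightarrow> x + y \<in> S" "x \<in> S \<Longrightarrow> y \<in> S \<Longrightarrow> x - y \<in> S"
  "x \<in> S \<Longrightarrow> a *\<^sub>R x \<in> S" "x \<in> S \<Longrightarrow> - x \<in> S" "(\<And>i. i \<in> I \<Longrightarrow> f i \<in> S) \<Longrightarrow> sum f I \<in> S"
  using S by (simp_all add: subspace_0 subspace_add subspace_diff subspace_scale subspace_neg subspace_sum)

lemma ip_sym: "x \<in> S \<Longrightarrow> y \<in> S \<Longrightarrow> ip x y = ip y x"
  using hilbert unfolding hilbert_on_def by (elim conjE) simp

lemma ip_lin: "x \<in> S \<Longrightarrow> y \<in> S \<Longrightarrow> z \<in> S \<Longrightarrow> ip (a *\<^sub>R x + b *\<^sub>R y) z = a * ip x z + b * ip y z"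
  using hilbert unfolding hilbert_on_def by (elim conjE) simp

lemma ip_add_left [simp]: "x \<in> S \<Longrightarrow> y \<in> S \<Longrightarrow> z \<in> S \<Longrightarrow> ip (x + y) z = ip x z + ip y z"
  using ip_lin[of x y z 1 1] by simp

lemma ip_scale_left [simp]: "x \<in> S \<Longrightarrow> z \<in> S \<Longrightarrow> ip (a *\<^sub>R x) z = a * ip x z"
  using ip_lin[of x x z a 0] by simp

lemma ip_add_right [simp]: "x \<in> S \<Longrightarrow> y \<in> S \<Longrightarrow> z \<in> S \<Longrightarrow> ip z (x + y) = ip z x + ip z y"
  using ip_sym[of z "x + y"] ip_sym[of z] by simp

lemma ip_scale_right [simp]: "x \<in> S \<Longrightarrow> z \<in> S \<Longrightarrow> ip z (a *\<^sub>R x) = a * ip z x"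
  using ip_sym[of z "a *\<^sub>R x"] ip_sym[of z] by simp

lemma ip_zero [simp]: "x \<in> S \<Longrightarrow> ip 0 x = 0" "x \<in> S \<Longrightarrow> ip x 0 = 0"
  using ip_scale_left[of x x 0] ip_scale_right[of x x 0] by simp_all

lemma ip_minus [simp]: "x \<in> S \<Longrightarrow> y \<in> S \<Longrightarrow> ip (- x) y = - ip x y" "x \<in> S \<Longrightarrow> y \<in> S \<Longrightarrow> ip x (- y) = - ip x y"
  using ip_scale_left[of x y "-1"] ip_scale_right[of y x "-1"] by simp_all

lemma ip_diff [simp]: "x \<in> S \<Longrightarrow> y \<in> S \<Longrightarrow> z \<in> S \<Longrightarrow> ip (x - y) z = ip x z - ip y z"
  "x \<in> S \<Longrightarrow> y \<in> S \<Longrightarrow> z \<in> S \<Longrightarrow> ip z (x - y) = ip z x - ip z y"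
  using ip_add_left[of x "- y" z] ip_add_right[of x "- y" z] by simp_all

lemma ip_sum_left: "(\<And>i. i \<in> I \<Longrightarrow> f i \<in> S) \<Longrightarrow> z \<in> S \<Longrightarrow> ip (sum f I) z = (\<Sum>i\<in>I. ip (f i) z)"
  by (induction I rule: infinite_finite_induct) auto

lemma ip_sum_right: "(\<And>i. i \<in> I \<Longrightarrow> f i \<in> S) \<Longrightarrow> z \<in> S \<Longrightarrow> ip z (sum f I) = (\<Sum>i\<in>I. ip z (f i))"
  by (induction I rule: infinite_finite_induct) auto

lemma ip_pos: "x \<in> S \<Longrightarrow> x \<noteq> 0 \<Longrightarrow> ip x x > 0"
  using hilbert unfolding hilbert_on_def by (elim conjE) simp

lemma ip_nonneg [simp]: "x \<in> S \<Longrightarrow> ip x x \<ge> 0"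
  using ip_pos[of x] by (cases "x = 0") auto

lemma nrm_nonneg [simp]: "x \<in> S \<Longrightarrow> nrm x \<ge> 0"
  by (simp add: norm_of_def)

lemma nrm_sq: "x \<in> S \<Longrightarrow> (nrm x)\<^sup>2 = ip x x"
  by (simp add: norm_of_def)

lemma nrm_zero [simp]: "nrm 0 = 0"
  by (simp add: norm_of_def)

lemma nrm_eq_0 [simp]: "x \<in> S \<Longrightarrow> nrm x = 0 \<longleftrightarrow> x = 0"
  using ip_pos[of x] by (cases "x = 0") (auto simp: norm_of_def)

lemma nrm_scale [simp]: "x \<in> S \<Longrightarrow> nrm (a *\<^sub>R x) = \<bar>a\<bar> * nrm x"
  by (simp add: norm_of_def real_sqrt_mult flip: mult.assoc)

lemma nrm_minus_commute: "x \<in> S \<Longrightarrow> y \<in> S \<Longrightarrow> nrm (x - y) = nrm (y - x)"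
  using nrm_scale[of "x - y" "-1"] by simp

lemma Cauchy_Schwarz_sq:
  assumes "x \<in> S" "y \<in> S"
  shows "(ip x y)\<^sup>2 \<le> ip x x * ip y y"
proof (cases "y = 0")
  case False
  define a where "a = ip x y / ip y y"
  have pos: "ip y y > 0" using False assms ip_pos by blast
  have "0 \<le> ip (x - a *\<^sub>R y) (x - a *\<^sub>R y)" using assms by (intro ip_nonneg) auto
  also have "\<dots> = ip x x - 2 * a * ip x y + a\<^sup>2 * ip y y"
    using assms ip_sym[of y x] by (simp add: algebra_simps power2_eq_square)
  also have "\<dots> = ip x x - (ip x y)\<^sup>2 / ip y y"
    using pos by (simp add: a_def field_simps power2_eq_square)
  finally show ?thesis using pos by (simp add: field_simps)
qed (use assms in simp)

lemma Cauchy_Schwarz: "x \<in> S \<Longrightarrow> y \<in> S \<Longrightarrow> \<bar>ip x y\<bar> \<le> nrm x * nrm y"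
  using real_sqrt_le_mono[OF Cauchy_Schwarz_sq[of x y]] by (simp add: norm_of_def real_sqrt_mult)

lemma nrm_triangle:
  assumes "x \<in> S" "y \<in> S"
  shows "nrm (x + y) \<le> nrm x + nrm y"
proof (rule power2_le_imp_le)
  have "(nrm (x + y))\<^sup>2 = (nrm x)\<^sup>2 + 2 * ip x y + (nrm y)\<^sup>2"
    using assms ip_sym[of x y] by (simp add: nrm_sq)
  also have "\<dots> \<le> (nrm x + nrm y)\<^sup>2"
    using Cauchy_Schwarz[OF assms] by (simp add: power2_sum)
  finally show "(nrm (x + y))\<^sup>2 \<le> (nrm x + nrm y)\<^sup>2" .
qed (use assms in simp)

section \<open>Finite orthonormal systems and orthogonal projections\<close>

definition ons :: "'h set \<Rightarrow> bool" where
  "ons E \<longleftrightarrow> finite E \<and> orthonormal_on S ip E"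

lemma onsD: "ons E \<Longrightarrow> e \<in> E \<Longrightarrow> e \<in> S" "ons E \<Longrightarrow> e \<in> E \<Longrightarrow> f \<in> E \<Longrightarrow> ip e f = (if e = f then 1 else 0)"
  unfolding ons_def orthonormal_on_def by auto

lemma ons_finite: "ons E \<Longrightarrow> finite E"
  by (simp add: ons_def)

lemma ons_sub: "ons E \<Longrightarrow> E \<subseteq> S"
  by (simp add: ons_def orthonormal_on_def)

lemma ons_empty [simp]: "ons {}"
  by (simp add: ons_def orthonormal_on_def)

definition proj :: "'h set \<Rightarrow> 'h \<Rightarrow> 'h" where
  "proj E x = (\<Sum>e\<in>E. ip e x *\<^sub>R e)"

lemma proj_in: "ons E \<Longrightarrow> proj E x \<in> S"
  unfolding proj_def by (auto dest: onsD(1))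

lemma proj_span: "proj E x \<in> span E"
  unfolding proj_def by (auto intro: span_sum span_scale span_base)

lemma ip_comb:
  assumes E: "ons E" and e: "e \<in> E"
  shows "ip e (\<Sum>f\<in>E. c f *\<^sub>R f) = c e"
proof -
  have "ip e (\<Sum>f\<in>E. c f *\<^sub>R f) = (\<Sum>f\<in>E. c f * ip e f)"
    using onsD(1)[OF E] e by (subst ip_sum_right) (auto intro!: sum.cong)
  also have "\<dots> = (\<Sum>f\<in>E. if f = e then c e else 0)"
    by (intro sum.cong) (use E e onsD(2) in auto)
  finally show ?thesis using ons_finite[OF E] e by simp
qed

lemma ip_proj: "ons E \<Longrightarrow> e \<in> E \<Longrightarrow> ip e (proj E x) = ip e x"
  unfolding proj_def by (rule ip_comb)

lemma nrm_comb:
  assumes E: "ons E"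
  shows "ip (\<Sum>f\<in>E. c f *\<^sub>R f) (\<Sum>f\<in>E. c f *\<^sub>R f) = (\<Sum>f\<in>E. (c f)\<^sup>2)"
proof -
  have "(\<Sum>f\<in>E. c f *\<^sub>R f) \<in> S" using E by (auto dest: onsD(1))
  then have "ip (\<Sum>f\<in>E. c f *\<^sub>R f) (\<Sum>f\<in>E. c f *\<^sub>R f) = (\<Sum>e\<in>E. c e * ip e (\<Sum>f\<in>E. c f *\<^sub>R f))"
    using onsD(1)[OF E] by (subst ip_sum_left) (auto intro!: sum.cong)
  also have "\<dots> = (\<Sum>f\<in>E. (c f)\<^sup>2)"
    by (intro sum.cong) (use E ip_comb in \<open>auto simp: power2_eq_square\<close>)
  finally show ?thesis .
qed

lemma span_proj:
  assumes E: "ons E" and x: "x \<in> span E"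
  shows "x = proj E x"
proof -
  obtain c where c: "x = (\<Sum>f\<in>E. c f *\<^sub>R f)"
    using x ons_finite[OF E] span_finite[of E] by auto
  show ?thesis
    unfolding proj_def using ip_comb[OF E] c by (auto intro!: sum.cong)
qed

lemma span_in: "E \<subseteq> S \<Longrightarrow> span E \<subseteq> S"
  by (simp add: S span_minimal)

lemma Parseval_finite:
  assumes E: "ons E" and x: "x \<in> span E"
  shows "ip x x = (\<Sum>e\<in>E. (ip e x)\<^sup>2)"
  using nrm_comb[OF E, of "\<lambda>e. ip e x"] span_proj[OF E x] by (simp add: proj_def)

lemma pythagoras_proj:
  assumes E: "ons E" and x: "x \<in> S"
  shows "ip (x - proj E x) (x - proj E x) = ip x x - (\<Sum>e\<in>E. (ip e x)\<^sup>2)"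
proof -
  have P: "proj E x \<in> S" using E by (rule proj_in)
  have a: "ip x (proj E x) = (\<Sum>e\<in>E. (ip e x)\<^sup>2)"
    unfolding proj_def
    by (subst ip_sum_right) (use E x ip_sym in \<open>auto dest: onsD(1) simp: power2_eq_square intro!: sum.cong\<close>)
  have b: "ip (proj E x) (proj E x) = (\<Sum>e\<in>E. (ip e x)\<^sup>2)"
    unfolding proj_def by (rule nrm_comb[OF E])
  show ?thesis using a b P x ip_sym[of x "proj E x"] by simp
qed

lemma Bessel:
  assumes E: "ons E" and x: "x \<in> S"
  shows "(\<Sum>e\<in>E. (ip e x)\<^sup>2) \<le> ip x x"
proof -
  have "0 \<le> ip (x - proj E x) (x - proj E x)" using proj_in[OF E] x by (intro ip_nonneg) auto
  then show ?thesis using pythagoras_proj[OF E x] by simp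
qed

text \<open>Subtracting a vector of \<open>span E\<close> does not change the residual
  \<open>x - proj E x\<close>, so Pythagoras applied to \<open>x - y\<close> bounds it.\<close>

lemma proj_best:
  assumes E: "ons E" and x: "x \<in> S" and y: "y \<in> span E"
  shows "nrm (x - proj E x) \<le> nrm (x - y)"
proof -
  have yS: "y \<in> S" using y E span_in[OF ons_sub[OF E]] by auto
  have "ip (x - y) (x - y) - (\<Sum>e\<in>E. (ip e (x - y))\<^sup>2) =
        ip ((x - y) - proj E (x - y)) ((x - y) - proj E (x - y))"
    using pythagoras_proj[OF E, of "x - y"] x yS by simp
  also have "proj E (x - y) = proj E x - proj E y"
    unfolding proj_def sum_subtractf[symmetric]
    by (intro sum.cong refl) (use E x yS in \<open>auto dest!: onsD(1) simp: scaleR_diff_left\<close>)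
  also have "(x - y) - (proj E x - proj E y) = x - proj E x"
    using span_proj[OF E y] by simp
  finally have "ip (x - proj E x) (x - proj E x) \<le> ip (x - y) (x - y)"
    using sum_nonneg[of E "\<lambda>e. (ip e (x - y))\<^sup>2"] by simp
  then show ?thesis by (simp add: norm_of_def)
qed

text \<open>The given system \<open>E\<close> is kept, so that sums over different systems can be
  compared in a common extension. The inclusion in \<open>span (E \<union> X)\<close> keeps the new
  system inside any subspace that contains the data, for instance inside \<open>N\<close>.\<close>

lemma Gram_Schmidt:
  assumes "finite X" "X \<subseteq> S" and E: "ons E"
  obtains F where "ons F" "E \<subseteq> F" "X \<subseteq> span F" "F \<subseteq> span (E \<union> X)"
proof -
  have "\<exists>F. ons F \<and> E \<subseteq> F \<and> X \<subseteq> span F \<and> F \<subseteq> span (E \<union> X)"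
    using assms(1,2)
  proof (induction X rule: finite_induct)
    case empty
    then show ?case using E span_superset by auto
  next
    case (insert x X)
    then obtain F where F: "ons F" "E \<subseteq> F" "X \<subseteq> span F" "F \<subseteq> span (E \<union> X)" by auto
    have xS: "x \<in> S" using insert by auto
    have mono: "span (E \<union> X) \<subseteq> span (E \<union> insert x X)" by (intro span_mono) auto
    define r where "r = x - proj F x"
    have rS: "r \<in> S" using xS proj_in[OF F(1)] by (simp add: r_def)
    show ?case
    proof (cases "r = 0")
      case True
      then have "x \<in> span F" using proj_span[of F x] by (simp add: r_def)
      then show ?thesis using F mono by blast
    next
      case False
      define e where "e = (1 / nrm r) *\<^sub>R r"
      have n0: "nrm r \<noteq> 0" using False rS by simp
      have eS: "e \<in> S" using rS by (simp add: e_def)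
      have orth: "ip f e = 0" if "f \<in> F" for f
        using that F(1) ip_proj[OF F(1) that] xS rS proj_in[OF F(1), of x] onsD(1)[OF F(1) that]
        by (simp add: e_def r_def)
      have "ip r r = nrm r * nrm r" using nrm_sq[OF rS] by (simp add: power2_eq_square)
      then have ee: "ip e e = 1" using rS n0 by (simp add: e_def)
      have "ons (insert e F)"
      proof -
        have "ip a b = (if a = b then 1 else 0)" if "a \<in> insert e F" "b \<in> insert e F" for a b
        proof (cases "a = e"; cases "b = e")
          assume "a = e" "b \<noteq> e"
          then show ?thesis using that orth[of b] ip_sym[of e b] eS onsD(1)[OF F(1)] by auto
        next
          assume "a \<noteq> e" "b = e"
          then show ?thesis using that orth[of a] by auto
        next
          assume "a \<noteq> e" "b \<noteq> e"
          then show ?thesis using that onsD(2)[OF F(1), of a b] by auto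
        qed (use ee in auto)
        then show ?thesis
          using ons_finite[OF F(1)] ons_sub[OF F(1)] eS unfolding ons_def orthonormal_on_def by simp
      qed
      moreover have "x \<in> span (insert e F)"
      proof -
        have "nrm r *\<^sub>R e + proj F x \<in> span (insert e F)"
          using proj_span[of F x] span_mono[of F "insert e F"]
          by (intro span_add span_scale) (auto intro: span_base)
        then show ?thesis using n0 by (simp add: e_def r_def)
      qed
      moreover have "e \<in> span (E \<union> insert x X)"
      proof -
        have "proj F x \<in> span (E \<union> insert x X)"
          using proj_span[of F x] F(4) mono by (metis span_minimal subspace_span subset_trans subsetD)
        moreover have "x \<in> span (E \<union> insert x X)" by (auto intro: span_base)
        ultimately show ?thesis unfolding e_def r_def by (intro span_scale span_diff)
      qed
      moreover have "X \<subseteq> span (insert e F)" using F(3) span_mono[of F "insert e F"] by auto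
      ultimately have "ons (insert e F) \<and> E \<subseteq> insert e F \<and> insert x X \<subseteq> span (insert e F) \<and>
          insert e F \<subseteq> span (E \<union> insert x X)"
        using F(2,4) mono by auto
      then show ?thesis by blast
    qed
  qed
  then show ?thesis using that by blast
qed

section \<open>Completeness, representation of functionals, total systems\<close>

lemma complete:
  assumes "\<And>n::nat. X n \<in> S" "\<And>\<epsilon>. \<epsilon> > 0 \<Longrightarrow> \<exists>M. \<forall>m\<ge>M. \<forall>n\<ge>M. nrm (X m - X n) < \<epsilon>"
  obtains x where "x \<in> S" "(\<lambda>n. nrm (X n - x)) \<longlonglongrightarrow> 0"
proof -
  have "\<forall>X. (\<forall>n::nat. X n \<in> S) \<and> (\<forall>\<epsilon>>0. \<exists>M. \<forall>m\<ge>M. \<forall>n\<ge>M. nrm (X m - X n) < \<epsilon>) \<longrightarrow>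
      (\<exists>x\<in>S. (\<lambda>n. nrm (X n - x)) \<longlonglongrightarrow> 0)"
    using hilbert unfolding hilbert_on_def by (elim conjE)
  from this[rule_format, of X] assms that show ?thesis by metis
qed

lemma tendsto_ip:
  assumes "\<And>n. X n \<in> S" "x \<in> S" "y \<in> S" "(\<lambda>n. nrm (X n - x)) \<longlonglongrightarrow> 0"
  shows "(\<lambda>n. ip (X n) y) \<longlonglongrightarrow> ip x y"
proof -
  have "(\<lambda>n. nrm (X n - x) * nrm y) \<longlonglongrightarrow> 0"
    using tendsto_mult_left_zero[OF assms(4)] by simp
  moreover have "norm (ip (X n) y - ip x y) \<le> nrm (X n - x) * nrm y" for n
    using Cauchy_Schwarz[of "X n - x" y] assms by simp
  ultimately have "(\<lambda>n. ip (X n) y - ip x y) \<longlonglongrightarrow> 0"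
    by (metis (no_types, lifting) Lim_null_comparison eventually_sequentiallyI)
  then show ?thesis by (simp add: LIM_zero_iff)
qed

text \<open>The representing vector is the limit of a sequence minimising \<open>\<parallel>g\<parallel>\<^sup>2 - 2 \<phi> g\<close> over \<open>M\<close>; the
  parallelogram law makes such a sequence Cauchy.\<close>

lemma Riesz_on_subspace:
  assumes M: "subspace M" "M \<subseteq> S"
    and lin: "\<And>x y a b. x \<in> M \<Longrightarrow> y \<in> M \<Longrightarrow> \<phi> (a *\<^sub>R x + b *\<^sub>R y) = a * \<phi> x + b * \<phi> y"
    and bd: "\<And>x. x \<in> M \<Longrightarrow> \<bar>\<phi> x\<bar> \<le> C * nrm x"
  obtains g X where "g \<in> S" "\<And>n::nat. X n \<in> M" "(\<lambda>n. nrm (X n - g)) \<longlonglongrightarrow> 0"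
    "\<And>x. x \<in> M \<Longrightarrow> ip g x = \<phi> x"
proof -
  define J where "J g = ip g g - 2 * \<phi> g" for g
  have MS: "x \<in> S" if "x \<in> M" for x using M that by blast
  \<comment> \<open>Completing the square: \<open>J g + C\<^sup>2\<close> dominates the square of
    \<open>nrm g - C\<close>.\<close>
  have lb: "J g \<ge> - C\<^sup>2" if "g \<in> M" for g
  proof -
    have "\<phi> g \<le> C * nrm g" using bd[OF that] by linarith
    then have "J g + C\<^sup>2 \<ge> (nrm g - C)\<^sup>2"
      using nrm_sq[OF MS[OF that]] by (simp add: J_def power2_diff algebra_simps)
    then show ?thesis using zero_le_power2[of "nrm g - C"] by linarith
  qed
  define d where "d = Inf (J ` M)"
  have bdd: "bdd_below (J ` M)" using lb by (intro bdd_belowI[of _ "- C\<^sup>2"]) auto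
  have ne: "J ` M \<noteq> {}" using subspace_0[OF M(1)] by auto
  have d: "d \<le> J g" if "g \<in> M" for g
    unfolding d_def using bdd that by (auto intro: cInf_lower)
  have "\<exists>g\<in>M. J g < d + 1 / Suc n" for n
    using cInf_lessD[OF ne, of "d + 1 / Suc n"] unfolding d_def by auto
  then obtain X where X: "\<And>n. X n \<in> M" "\<And>n. J (X n) < d + 1 / Suc n" by metis
  have par: "(nrm (X m - X n))\<^sup>2 \<le> 2 / Suc m + 2 / Suc n" for m n
  proof -
    let ?h = "(1/2) *\<^sub>R X m + (1/2) *\<^sub>R X n"
    have "?h \<in> M" using X M(1) by (simp add: subspace_add subspace_scale)
    then have "d \<le> J ?h" by (rule d)
    \<comment> \<open>The parallelogram law; the terms with \<open>\<phi>\<close> cancel because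
      \<open>\<phi>\<close> is linear.\<close>
    moreover have "(nrm (X m - X n))\<^sup>2 = 2 * J (X m) + 2 * J (X n) - 4 * J ?h"
      using MS[OF X(1)] ip_sym[of "X m" "X n"] lin[OF X(1)[of m] X(1)[of n], of "1/2" "1/2"]
      by (simp add: J_def nrm_sq algebra_simps)
    ultimately show ?thesis using X(2)[of m] X(2)[of n] by simp
  qed
  have "\<exists>M. \<forall>m\<ge>M. \<forall>n\<ge>M. nrm (X m - X n) < \<epsilon>" if \<epsilon>: "\<epsilon> > 0" for \<epsilon>
  proof -
    obtain K where K: "1 / Suc K < \<epsilon>\<^sup>2 / 4"
      using \<epsilon> reals_Archimedean[of "\<epsilon>\<^sup>2 / 4"] unfolding inverse_eq_divide
      by (metis divide_pos_pos zero_less_numeral zero_less_power)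
    have "nrm (X m - X n) < \<epsilon>" if mn: "m \<ge> K" "n \<ge> K" for m n
    proof -
      have "1 / Suc m \<le> 1 / Suc K" "1 / Suc n \<le> 1 / Suc K" using mn by (auto simp: field_simps)
      then have "(nrm (X m - X n))\<^sup>2 < \<epsilon>\<^sup>2" using par[of m n] K by simp
      then show ?thesis using \<open>\<epsilon> > 0\<close> by (simp add: power2_less_imp_less)
    qed
    then show ?thesis by blast
  qed
  then obtain g where g: "g \<in> S" "(\<lambda>n. nrm (X n - g)) \<longlonglongrightarrow> 0"
    using complete[of X] MS[OF X(1)] by blast
  have "ip g x = \<phi> x" if x: "x \<in> M" for x
  proof -
    have est: "(ip (X n) x - \<phi> x)\<^sup>2 \<le> ip x x * (1 / Suc n)" for n
    proof (cases "x = 0")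
      case True
      then show ?thesis using bd[OF x] MS[OF X(1)] by simp
    next
      case False
      define b where "b = ip (X n) x - \<phi> x"
      have pos: "ip x x > 0" using False x MS ip_pos by blast
      \<comment> \<open>This \<open>s\<close> minimises the quadratic polynomial
        \<open>J (X n + s *\<^sub>R x)\<close> in \<open>s\<close>.\<close>
      define s where "s = - b / ip x x"
      have "X n + s *\<^sub>R x \<in> M" using X x M(1) by (simp add: subspace_add subspace_scale)
      then have "d \<le> J (X n + s *\<^sub>R x)" by (rule d)
      also have "\<dots> = J (X n) + 2 * s * b + s\<^sup>2 * ip x x"
        using MS[OF X(1)] MS[OF x] ip_sym[of "X n" x] lin[OF X(1)[of n] x, of 1 s]
        by (simp add: J_def b_def algebra_simps power2_eq_square)
      also have "\<dots> = J (X n) - b\<^sup>2 / ip x x"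
        using pos by (simp add: s_def field_simps power2_eq_square)
      finally have "b\<^sup>2 / ip x x < 1 / Suc n" using X(2)[of n] by linarith
      then show ?thesis using pos unfolding b_def by (simp add: field_simps)
    qed
    have "(\<lambda>n. (ip (X n) x - \<phi> x)\<^sup>2) \<longlonglongrightarrow> (ip g x - \<phi> x)\<^sup>2"
      using tendsto_ip[OF _ g(1) MS[OF x] g(2)] MS[OF X(1)] by (intro tendsto_intros) auto
    moreover have "(\<lambda>n. ip x x * (1 / Suc n)) \<longlonglongrightarrow> ip x x * 0"
        by (intro tendsto_intros LIMSEQ_inverse_real_of_nat[unfolded inverse_eq_divide])
    ultimately have "(ip g x - \<phi> x)\<^sup>2 \<le> 0"
      using LIMSEQ_le[of _ _ _ "ip x x * 0"] est by fastforce
    then show ?thesis by simp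
  qed
  then show ?thesis using that g X(1) by blast
qed

text \<open>Parseval's identity up to \<open>\<epsilon>\<close>. The Riesz vector of
  \<open>ip g\<close> on \<open>span E\<close> is a limit of elements of the span and differs from
  \<open>g\<close> by a vector orthogonal to \<open>E\<close>, which totality forces to be 0. So
  \<open>g\<close> itself is such a limit, and projections are best approximations.\<close>

lemma total_ons_approx:
  assumes E: "orthonormal_basis_on S ip E" and g: "g \<in> S" and \<epsilon>: "\<epsilon> > 0"
  obtains A where "finite A" "A \<subseteq> E" "ip g g \<le> (\<Sum>e\<in>A. (ip e g)\<^sup>2) + \<epsilon>"
proof -
  have ES: "E \<subseteq> S" using E by (simp add: orthonormal_basis_on_def orthonormal_on_def)
  obtain h X where h: "h \<in> S" "\<And>n::nat. X n \<in> span E" "(\<lambda>n. nrm (X n - h)) \<longlonglongrightarrow> 0"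
      "\<And>x. x \<in> span E \<Longrightarrow> ip h x = ip g x"
  proof (rule Riesz_on_subspace[of "span E" "ip g" "nrm g"])
    fix x y a b assume "x \<in> span E" "y \<in> span E"
    then show "ip g (a *\<^sub>R x + b *\<^sub>R y) = a * ip g x + b * ip g y"
      using g span_in[OF ES] by (simp add: subset_iff)
  qed (use span_in[OF ES] g Cauchy_Schwarz[OF g] in auto)
  have "ip e (g - h) = 0" if "e \<in> E" for e
    using that h(1) h(4)[OF span_base[OF that]] g ES ip_sym[of e g] ip_sym[of e h] by (simp add: subset_iff)
  then have "g - h = 0"
    using E g h(1) unfolding orthonormal_basis_on_def by blast
  then have gh: "h = g" by simp
  have "sqrt \<epsilon> > 0" using \<epsilon> by simp
  then have "\<forall>\<^sub>F n in sequentially. nrm (X n - g) < sqrt \<epsilon>"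
    using h(3) gh order_tendstoD(2) by fastforce
  then obtain n where n: "nrm (X n - g) < sqrt \<epsilon>"
    by (auto simp: eventually_sequentially)
  obtain A r where A: "finite A" "A \<subseteq> E" "X n = (\<Sum>a\<in>A. r a *\<^sub>R a)"
    using h(2)[of n] unfolding span_explicit by auto
  then have XA: "X n \<in> span A" by (auto intro: span_sum span_scale span_base)
  have onsA: "ons A" using E A(1,2) unfolding ons_def orthonormal_basis_on_def orthonormal_on_def by (meson subset_iff)
  have XS: "X n \<in> S" using h(2) span_in[OF ES] by auto
  have "nrm (g - proj A g) \<le> nrm (g - X n)" by (rule proj_best[OF onsA g XA])
  also have "\<dots> < sqrt \<epsilon>" using n nrm_minus_commute[OF g XS] by simp
  finally have "(nrm (g - proj A g))\<^sup>2 \<le> (sqrt \<epsilon>)\<^sup>2"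
    using g proj_in[OF onsA] by (intro power_mono) auto
  then have "ip (g - proj A g) (g - proj A g) \<le> \<epsilon>"
    using g proj_in[OF onsA] \<epsilon> by (simp add: nrm_sq)
  then show ?thesis using that[OF A(1,2)] pythagoras_proj[OF onsA g] by simp
qed

end

section \<open>Multilinear forms on lists\<close>

text \<open>The parameters \<open>X\<close>, \<open>scl\<close> and \<open>em\<close> let one notion
  serve both real-multilinear forms on \<open>H_p\<close> and complex-multilinear forms on
  \<open>NC\<close>; \<open>em\<close> embeds the scalars into the complex numbers. The recursion on
  the head matches induction over lists.\<close>

fun mlin :: "'x::ab_group_add set \<Rightarrow> ('s \<Rightarrow> 'x \<Rightarrow> 'x) \<Rightarrow> ('s \<Rightarrow> complex) \<Rightarrow> nat \<Rightarrow> ('x list \<Rightarrow> complex) \<Rightarrow> bool" where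
  "mlin X scl em 0 T \<longleftrightarrow> True"
| "mlin X scl em (Suc n) T \<longleftrightarrow>
     (\<forall>xs\<in>Lst X n. \<forall>x\<in>X. \<forall>y\<in>X. T ((x + y) # xs) = T (x # xs) + T (y # xs)) \<and>
     (\<forall>xs\<in>Lst X n. \<forall>x\<in>X. \<forall>a. T (scl a x # xs) = em a * T (x # xs)) \<and>
     (\<forall>x\<in>X. mlin X scl em n (\<lambda>xs. T (x # xs)))"

lemma mlin_sum_head:
  assumes T: "mlin X scl em (Suc n) T" and xs: "xs \<in> Lst X n"
    and X: "0 \<in> X" "\<And>x y. x \<in> X \<Longrightarrow> y \<in> X \<Longrightarrow> x + y \<in> X" "\<And>a x. x \<in> X \<Longrightarrow> scl a x \<in> X"
    and v: "\<And>i. i \<in> I \<Longrightarrow> v i \<in> X" and I: "finite I"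
  shows "T ((\<Sum>i\<in>I. scl (z i) (v i)) # xs) = (\<Sum>i\<in>I. em (z i) * T (v i # xs))"
proof -
  have add: "T ((x + y) # xs) = T (x # xs) + T (y # xs)" if "x \<in> X" "y \<in> X" for x y
    using T xs that by simp
  have "T ((\<Sum>i\<in>I. scl (z i) (v i)) # xs) = (\<Sum>i\<in>I. em (z i) * T (v i # xs)) \<and>
      (\<Sum>i\<in>I. scl (z i) (v i)) \<in> X"
    using I v
  proof (induction I rule: finite_induct)
    case empty
    \<comment> \<open>Additivity at \<open>0 + 0\<close> makes the form vanish at a zero
      head.\<close>
    then show ?case using add[OF X(1) X(1)] X(1) by simp
  next
    case (insert i I)
    then show ?case using add[of "scl (z i) (v i)" "\<Sum>i\<in>I. scl (z i) (v i)"] T xs X by simp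
  qed
  then show ?thesis ..
qed

lemma sum_scl_closed:
  assumes "finite I" "0 \<in> X" "\<And>x y. x \<in> X \<Longrightarrow> y \<in> X \<Longrightarrow> x + y \<in> X" "\<And>i. i \<in> I \<Longrightarrow> u i \<in> X"
  shows "sum u I \<in> X"
  using assms(1,4) by (induction I rule: finite_induct) (auto simp: assms(2,3))

text \<open>Each slot is expanded separately. Since the indices are ordered lists, no multinomial
  coefficients and no symmetry of \<open>T\<close> enter.\<close>

lemma mlin_diag:
  assumes X: "0 \<in> X" "\<And>x y. x \<in> X \<Longrightarrow> y \<in> X \<Longrightarrow> x + y \<in> X" "\<And>a x. x \<in> X \<Longrightarrow> scl a x \<in> X"
    and v: "\<And>i. i \<in> I \<Longrightarrow> v i \<in> X" and I: "finite I" and T: "mlin X scl em n T"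
  shows "T (replicate n (\<Sum>i\<in>I. scl (z i) (v i))) =
    (\<Sum>is\<in>Lst I n. (\<Prod>i\<leftarrow>is. em (z i)) * T (map v is))"
  using T
proof (induction n arbitrary: T)
  case (Suc n)
  let ?s = "\<Sum>i\<in>I. scl (z i) (v i)"
  have s: "?s \<in> X" by (rule sum_scl_closed[OF I X(1,2)]) (auto intro: X v)
  have "T (?s # replicate n ?s) = (\<Sum>i\<in>I. em (z i) * T (v i # replicate n ?s))"
    by (rule mlin_sum_head[OF Suc.prems _ X v I]) (use s in auto)
  also have "\<dots> = (\<Sum>i\<in>I. em (z i) * (\<Sum>is\<in>Lst I n. (\<Prod>i\<leftarrow>is. em (z i)) * T (v i # map v is)))"
    by (intro sum.cong refl arg_cong2[where f="(*)"] Suc.IH) (use Suc.prems v in auto)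
  also have "\<dots> = (\<Sum>is\<in>Lst I (Suc n). (\<Prod>i\<leftarrow>is. em (z i)) * T (map v is))"
    by (simp add: sum_Lst_Suc I sum_distrib_left mult.assoc)
  finally show ?case by simp
qed simp

context hilbert_carrier
begin

abbreviation "rmlin \<equiv> mlin S scaleR complex_of_real"

lemma rmlin_head_expand:
  assumes T: "rmlin (Suc n) T" and xs: "xs \<in> Lst S n" and F: "ons F" and g: "g \<in> span F"
  shows "T (g # xs) = (\<Sum>f\<in>F. of_real (ip f g) * T (f # xs))"
proof -
  have "T (g # xs) = T ((\<Sum>f\<in>F. ip f g *\<^sub>R f) # xs)"
    using span_proj[OF F g] by (simp add: proj_def)
  also have "\<dots> = (\<Sum>f\<in>F. of_real (ip f g) * T (f # xs))"
    by (rule mlin_sum_head[OF T xs]) (use onsD(1)[OF F] ons_finite[OF F] in auto)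
  finally show ?thesis .
qed

text \<open>A real functional on \<open>span F\<close> is the inner product with a vector whose squared norm is the
  sum of the squares of its values on \<open>F\<close>.\<close>

lemma sum_sq_linear_le:
  assumes F: "ons F" and g: "\<And>i. i \<in> I \<Longrightarrow> g i \<in> span F"
    and bess: "\<And>h. h \<in> span F \<Longrightarrow> (\<Sum>i\<in>I. (ip (g i) h)\<^sup>2) \<le> B * ip h h"
    and w: "\<And>i. i \<in> I \<Longrightarrow> w i = (\<Sum>f\<in>F. of_real (ip f (g i)) * c f)"
  shows "(\<Sum>i\<in>I. (cmod (w i))\<^sup>2) \<le> B * (\<Sum>f\<in>F. (cmod (c f))\<^sup>2)"
proof -
  \<comment> \<open>The inner product is real, so real and imaginary parts of \<open>c\<close> are
    estimated separately, each as the coordinates of a vector \<open>h\<close>.\<close>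
  have real: "(\<Sum>i\<in>I. (\<Sum>f\<in>F. ip f (g i) * r f)\<^sup>2) \<le> B * (\<Sum>f\<in>F. (r f)\<^sup>2)" for r :: "'h \<Rightarrow> real"
  proof -
    define h where "h = (\<Sum>f\<in>F. r f *\<^sub>R f)"
    have h: "h \<in> span F" unfolding h_def by (auto intro: span_sum span_scale span_base)
    have "(\<Sum>f\<in>F. ip f (g i) * r f) = ip (g i) h" if "i \<in> I" for i
    proof -
      have gS: "g i \<in> S" using g[OF that] span_in[OF ons_sub[OF F]] by auto
      show ?thesis unfolding h_def
        by (subst ip_sum_right) (use onsD(1)[OF F] gS ip_sym[of "g i"] in \<open>auto intro!: sum.cong\<close>)
    qed
    then have "(\<Sum>i\<in>I. (\<Sum>f\<in>F. ip f (g i) * r f)\<^sup>2) = (\<Sum>i\<in>I. (ip (g i) h)\<^sup>2)" by simp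
    also have "\<dots> \<le> B * ip h h" by (rule bess[OF h])
    also have "ip h h = (\<Sum>f\<in>F. (r f)\<^sup>2)" unfolding h_def by (rule nrm_comb[OF F])
    finally show ?thesis .
  qed
  have "(\<Sum>i\<in>I. (cmod (w i))\<^sup>2) =
     (\<Sum>i\<in>I. (\<Sum>f\<in>F. ip f (g i) * Re (c f))\<^sup>2) + (\<Sum>i\<in>I. (\<Sum>f\<in>F. ip f (g i) * Im (c f))\<^sup>2)"
    unfolding sum.distrib[symmetric] by (intro sum.cong refl) (simp add: cmod_power2 w)
  also have "\<dots> \<le> B * (\<Sum>f\<in>F. (Re (c f))\<^sup>2) + B * (\<Sum>f\<in>F. (Im (c f))\<^sup>2)"
    using real[of "\<lambda>f. Re (c f)"] real[of "\<lambda>f. Im (c f)"] by linarith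
  also have "\<dots> = B * (\<Sum>f\<in>F. (cmod (c f))\<^sup>2)"
    by (simp add: cmod_power2 sum.distrib distrib_left)
  finally show ?thesis .
qed

text \<open>A Bessel inequality with constant \<open>B\<close> passes to the \<open>n\<close>-th
  tensor power with constant \<open>B ^ n\<close>: the slots are replaced one at a time. The family
  \<open>g\<close> need not be orthonormal, which is how the lemma is applied to images and
  approximations of orthonormal systems.\<close>

lemma sum_Lst_sq_le:
  assumes F: "ons F" and g: "\<And>i. i \<in> I \<Longrightarrow> g i \<in> span F" and I: "finite I" and B: "B \<ge> 0"
    and bess: "\<And>h. h \<in> span F \<Longrightarrow> (\<Sum>i\<in>I. (ip (g i) h)\<^sup>2) \<le> B * ip h h"
    and T: "rmlin n T"
  shows "(\<Sum>is\<in>Lst I n. (cmod (T (map g is)))\<^sup>2) \<le> B ^ n * (\<Sum>fs\<in>Lst F n. (cmod (T fs))\<^sup>2)"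
  using T
proof (induction n arbitrary: T)
  case (Suc n)
  have gS: "g i \<in> S" if "i \<in> I" for i using g[OF that] span_in[OF ons_sub[OF F]] by auto
  note fin = ons_finite[OF F]
  have "(\<Sum>is\<in>Lst I (Suc n). (cmod (T (map g is)))\<^sup>2) =
      (\<Sum>i\<in>I. \<Sum>is\<in>Lst I n. (cmod (T (g i # map g is)))\<^sup>2)"
    by (simp add: sum_Lst_Suc I)
  also have "\<dots> \<le> (\<Sum>i\<in>I. B ^ n * (\<Sum>fs\<in>Lst F n. (cmod (T (g i # fs)))\<^sup>2))"
    by (intro sum_mono Suc.IH) (use Suc.prems gS in auto)
  also have "\<dots> = B ^ n * (\<Sum>fs\<in>Lst F n. \<Sum>i\<in>I. (cmod (T (g i # fs)))\<^sup>2)"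
    by (subst sum.swap) (simp add: sum_distrib_left)
  also have "\<dots> \<le> B ^ n * (\<Sum>fs\<in>Lst F n. B * (\<Sum>f\<in>F. (cmod (T (f # fs)))\<^sup>2))"
  proof (intro mult_left_mono sum_mono)
    fix fs assume "fs \<in> Lst F n"
    then have "fs \<in> Lst S n" using Lst_mono[OF ons_sub[OF F]] by auto
    then show "(\<Sum>i\<in>I. (cmod (T (g i # fs)))\<^sup>2) \<le> B * (\<Sum>f\<in>F. (cmod (T (f # fs)))\<^sup>2)"
      by (intro sum_sq_linear_le[OF F g bess] rmlin_head_expand[OF Suc.prems _ F] g) auto
  qed (use B in simp)
  also have "\<dots> = B ^ Suc n * (\<Sum>fs\<in>Lst F (Suc n). (cmod (T fs))\<^sup>2)"
    by (subst sum_Lst_Suc[OF fin], subst sum.swap) (simp add: sum_distrib_left mult.assoc mult.left_commute)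
  finally show ?case .
qed simp

text \<open>Contraction with an elementary tensor: each frozen argument costs its norm, by
  Cauchy-Schwarz in that slot.\<close>

lemma sum_Lst_sq_prefix_le:
  assumes F: "ons F" and T: "rmlin (length gs + n) T" and gs: "set gs \<subseteq> span F"
  shows "(\<Sum>fs\<in>Lst F n. (cmod (T (gs @ fs)))\<^sup>2) \<le>
    (\<Prod>g\<leftarrow>gs. nrm g)\<^sup>2 * (\<Sum>fs\<in>Lst F (length gs + n). (cmod (T fs))\<^sup>2)"
  using T gs
proof (induction gs arbitrary: T)
  case (Cons g gs)
  note fin = ons_finite[OF F]
  have gF: "g \<in> span F" using Cons by simp
  have gS: "g \<in> S" using gF span_in[OF ons_sub[OF F]] by auto
  have "(\<Sum>fs\<in>Lst F n. (cmod (T ((g # gs) @ fs)))\<^sup>2) \<le>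
    (\<Prod>g\<leftarrow>gs. nrm g)\<^sup>2 * (\<Sum>fs\<in>Lst F (length gs + n). (cmod (T (g # fs)))\<^sup>2)"
    using Cons.IH[of "\<lambda>xs. T (g # xs)"] Cons.prems gS by simp
  also have "\<dots> \<le> (\<Prod>g\<leftarrow>gs. nrm g)\<^sup>2 *
      (\<Sum>fs\<in>Lst F (length gs + n). (nrm g)\<^sup>2 * (\<Sum>f\<in>F. (cmod (T (f # fs)))\<^sup>2))"
  proof (intro mult_left_mono sum_mono)
    fix fs assume "fs \<in> Lst F (length gs + n)"
    then have fs: "fs \<in> Lst S (length gs + n)" using Lst_mono[OF ons_sub[OF F]] by auto
    \<comment> \<open>A single vector is a one-element family whose Bessel constant is its squared
      norm.\<close>
    have "(\<Sum>i\<in>{()}. (cmod (T (g # fs)))\<^sup>2) \<le> (nrm g)\<^sup>2 * (\<Sum>f\<in>F. (cmod (T (f # fs)))\<^sup>2)"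
    proof (rule sum_sq_linear_le[OF F, where g="\<lambda>_. g"])
      fix h assume "h \<in> span F"
      then have "h \<in> S" using span_in[OF ons_sub[OF F]] by auto
      then show "(\<Sum>i\<in>{()}. (ip g h)\<^sup>2) \<le> (nrm g)\<^sup>2 * ip h h"
        using Cauchy_Schwarz_sq[OF gS] by (simp add: nrm_sq gS)
    next
      show "T (g # fs) = (\<Sum>f\<in>F. of_real (ip f g) * T (f # fs))"
        using rmlin_head_expand[OF _ fs F gF, of T] Cons.prems by simp
    qed (use gF in auto)
    then show "(cmod (T (g # fs)))\<^sup>2 \<le> (nrm g)\<^sup>2 * (\<Sum>f\<in>F. (cmod (T (f # fs)))\<^sup>2)" by simp
  qed simp
  also have "\<dots> = (\<Prod>g\<leftarrow>g # gs. nrm g)\<^sup>2 * (\<Sum>fs\<in>Lst F (Suc (length gs + n)). (cmod (T fs))\<^sup>2)"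
    by (subst sum_Lst_Suc[OF fin], subst sum.swap)
      (simp add: sum_distrib_left power_mult_distrib mult.assoc mult.left_commute)
  finally show ?case by simp
qed simp

text \<open>Joint continuity of a bounded form by telescoping: the head is changed first, with an
  error proportional to its distance from the limit, and then the tail.\<close>

lemma rmlin_tendsto:
  assumes T: "rmlin n T" and bd: "\<And>xs. xs \<in> Lst S n \<Longrightarrow> cmod (T xs) \<le> C * (\<Prod>x\<leftarrow>xs. nrm x)"
    and g: "\<And>e k. e \<in> set es \<Longrightarrow> g e (k::nat) \<in> S" "\<And>e. e \<in> set es \<Longrightarrow> l e \<in> S"
      "\<And>e. e \<in> set es \<Longrightarrow> (\<lambda>k. nrm (g e k - l e)) \<longlonglongrightarrow> 0"
    and len: "length es = n"
  shows "(\<lambda>k. T (map (\<lambda>e. g e k) es)) \<longlonglongrightarrow> T (map l es)"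
  using T bd g len
proof (induction es arbitrary: n T C)
  case (Cons e es)
  then obtain m where n: "n = Suc m" "length es = m" by auto
  note T = Cons.prems(1)[unfolded n(1)] and bd = Cons.prems(2)[unfolded n(1)]
  have le: "l e \<in> S" and ge: "g e k \<in> S" for k using Cons.prems by auto
  have inL: "map (\<lambda>e. g e k) es \<in> Lst S m" for k
    using Cons.prems n by (auto simp: Lst_def)
  have nb: "(\<lambda>k. nrm (g f k)) \<longlonglongrightarrow> nrm (l f)" if f: "f \<in> set (e # es)" for f
  proof -
    have "\<bar>nrm (g f k) - nrm (l f)\<bar> \<le> nrm (g f k - l f)" for k
      using nrm_triangle[of "g f k - l f" "l f"] nrm_triangle[of "l f - g f k" "g f k"]
        nrm_minus_commute[of "g f k" "l f"] Cons.prems(3,4)[OF f] by auto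
    then have "(\<lambda>k. nrm (g f k) - nrm (l f)) \<longlonglongrightarrow> 0"
      by (intro Lim_null_comparison[OF _ Cons.prems(5)[OF f]]) auto
    then show ?thesis by (simp add: LIM_zero_iff)
  qed
  have pb: "(\<lambda>k. \<Prod>f\<leftarrow>es. nrm (g f k)) \<longlonglongrightarrow> (\<Prod>f\<leftarrow>es. nrm (l f))"
  proof -
    have "(\<lambda>k. \<Prod>f\<leftarrow>fs. nrm (g f k)) \<longlonglongrightarrow> (\<Prod>f\<leftarrow>fs. nrm (l f))" if "set fs \<subseteq> set es" for fs
      using that nb by (induction fs) (auto intro!: tendsto_mult)
    then show ?thesis by simp
  qed
  have "(\<lambda>k. T ((g e k - l e) # map (\<lambda>e. g e k) es)) \<longlonglongrightarrow> 0"
  proof (rule Lim_null_comparison)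
    show "\<forall>\<^sub>F k in sequentially. norm (T ((g e k - l e) # map (\<lambda>e. g e k) es)) \<le>
        C * (nrm (g e k - l e) * (\<Prod>f\<leftarrow>es. nrm (g f k)))"
    proof (intro always_eventually allI)
      fix k
      have "(g e k - l e) # map (\<lambda>e. g e k) es \<in> Lst S (Suc m)"
        using ge le inL by simp
      from bd[OF this] show "norm (T ((g e k - l e) # map (\<lambda>e. g e k) es)) \<le>
        C * (nrm (g e k - l e) * (\<Prod>f\<leftarrow>es. nrm (g f k)))" by (simp add: o_def)
    qed
    have "(\<lambda>k. C * (nrm (g e k - l e) * (\<Prod>f\<leftarrow>es. nrm (g f k)))) \<longlonglongrightarrow>
        C * (0 * (\<Prod>f\<leftarrow>es. nrm (l f)))"
      by (intro tendsto_intros pb Cons.prems) simp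
    then show "(\<lambda>k. C * (nrm (g e k - l e) * (\<Prod>f\<leftarrow>es. nrm (g f k)))) \<longlonglongrightarrow> 0" by simp
  qed
  moreover have "(\<lambda>k. T (l e # map (\<lambda>e. g e k) es)) \<longlonglongrightarrow> T (l e # map l es)"
  proof (rule Cons.IH[of m "\<lambda>xs. T (l e # xs)" "C * nrm (l e)"])
    fix xs assume "xs \<in> Lst S m"
    then show "cmod (T (l e # xs)) \<le> C * nrm (l e) * (\<Prod>x\<leftarrow>xs. nrm x)"
      using bd[of "l e # xs"] le by (simp add: mult.assoc)
  qed (use T le Cons.prems n in auto)
  ultimately have "(\<lambda>k. T ((g e k - l e) # map (\<lambda>e. g e k) es) + T (l e # map (\<lambda>e. g e k) es)) \<longlonglongrightarrow>
      0 + T (l e # map l es)" by (rule tendsto_add)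
  moreover have "T ((g e k - l e) # map (\<lambda>e. g e k) es) + T (l e # map (\<lambda>e. g e k) es) =
      T (g e k # map (\<lambda>e. g e k) es)" for k
  proof -
    have "T ((g e k - l e + l e) # map (\<lambda>e. g e k) es) =
        T ((g e k - l e) # map (\<lambda>e. g e k) es) + T (l e # map (\<lambda>e. g e k) es)"
      using T inL[of k] ge[of k] le S_intros(3)[OF ge[of k] le] unfolding mlin.simps by blast
    then show ?thesis by simp
  qed
  ultimately show ?case by simp
qed simp

end

section \<open>Tensor norms\<close>

lemma (in hilbert_carrier) ons_basis:
  assumes "finite X" "X \<subseteq> S"
  obtains F where "ons F" "X \<subseteq> span F" "F \<subseteq> span X"
  using Gram_Schmidt[OF assms ons_empty] by (metis Un_empty_left)

context nuclear_triple
begin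

sublocale Hs: hilbert_carrier "Hp p" "ip p" for p
  by unfold_locales (rule hilbert)

abbreviation nm :: "nat \<Rightarrow> 'h \<Rightarrow> real" where "nm p \<equiv> norm_of (ip p)"

section \<open>The scale of Hilbert spaces, \<open>N\<close> and the dual \<open>N'\<close>\<close>

lemma Hp_mono: "p \<le> q \<Longrightarrow> Hp q \<subseteq> Hp p"
  using Hp_antimono[of p q] by (cases "p = q") auto

lemma nm_mono: "p \<le> q \<Longrightarrow> x \<in> Hp q \<Longrightarrow> nm p x \<le> nm q x"
  using norm_mono[of p q x] by (cases "p = q") auto

lemma N_Hp: "x \<in> N \<Longrightarrow> x \<in> Hp p"
  by (simp add: N_def)

lemma N_sub: "N \<subseteq> Hp p"
  by (auto simp: N_def)

lemma subspace_N: "subspace N"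
  unfolding N_def using Hs.S by (auto simp: subspace_def)

lemma N_intros [simp, intro]:
  "0 \<in> N" "x \<in> N \<Longrightarrow> y \<in> N \<Longrightarrow> x + y \<in> N" "x \<in> N \<Longrightarrow> y \<in> N \<Longrightarrow> x - y \<in> N"
  "x \<in> N \<Longrightarrow> a *\<^sub>R x \<in> N" "x \<in> N \<Longrightarrow> - x \<in> N" "(\<And>i. i \<in> I \<Longrightarrow> f i \<in> N) \<Longrightarrow> sum f I \<in> N"
  using subspace_N by (simp_all add: subspace_0 subspace_add subspace_diff subspace_scale subspace_neg subspace_sum)

lemma riesz_N: "\<xi> \<in> N \<Longrightarrow> riesz p u \<xi> = ip p u \<xi>"
  by (simp add: riesz_def)

lemma riesz_in_N' [simp]:
  assumes "u \<in> Hp p"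
  shows "riesz p u \<in> N'"
proof -
  have "riesz p u (a *\<^sub>R \<xi> + b *\<^sub>R \<eta>) = a * riesz p u \<xi> + b * riesz p u \<eta>" if "\<xi> \<in> N" "\<eta> \<in> N" for \<xi> \<eta> a b
    using that assms by (simp add: riesz_def N_Hp)
  moreover have "\<forall>\<xi>\<in>N. \<bar>riesz p u \<xi>\<bar> \<le> nm p u * nm p \<xi>"
    using assms Hs.Cauchy_Schwarz N_Hp by (simp add: riesz_def)
  ultimately show ?thesis
    unfolding N'_def by (auto simp: riesz_def)
qed

lemma riesz_lin:
  "u \<in> Hp p \<Longrightarrow> v \<in> Hp p \<Longrightarrow> riesz p (a *\<^sub>R u + b *\<^sub>R v) = (\<lambda>\<xi>. a * riesz p u \<xi> + b * riesz p v \<xi>)"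
  by (auto simp: riesz_def fun_eq_iff N_Hp)

lemma N'_lin: "x \<in> N' \<Longrightarrow> \<xi> \<in> N \<Longrightarrow> \<eta> \<in> N \<Longrightarrow> x (a *\<^sub>R \<xi> + b *\<^sub>R \<eta>) = a * x \<xi> + b * x \<eta>"
  unfolding N'_def by blast

lemma N'_add: "x \<in> N' \<Longrightarrow> \<xi> \<in> N \<Longrightarrow> \<eta> \<in> N \<Longrightarrow> x (\<xi> + \<eta>) = x \<xi> + x \<eta>"
  using N'_lin[of x \<xi> \<eta> 1 1] by simp

lemma N'_scale: "x \<in> N' \<Longrightarrow> \<xi> \<in> N \<Longrightarrow> x (a *\<^sub>R \<xi>) = a * x \<xi>"
  using N'_lin[of x \<xi> \<xi> a 0] by simp

lemma N'_zero: "x \<in> N' \<Longrightarrow> x 0 = 0"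
  using N'_scale[of x 0 0] by simp

text \<open>A bound by one norm is a bound by all larger ones, so every \<open>q\<close> beyond some
  \<open>p\<close> works. This is what allows finitely many functionals to be represented in one
  common space.\<close>

lemma N'_riesz:
  assumes "x \<in> N'"
  obtains p where "\<And>q. p \<le> q \<Longrightarrow> \<exists>g\<in>Hp q. x = riesz q g"
proof -
  obtain p C where C: "\<And>\<xi>. \<xi> \<in> N \<Longrightarrow> \<bar>x \<xi>\<bar> \<le> C * nm p \<xi>"
    using assms unfolding N'_def by blast
  have "\<exists>g\<in>Hp q. x = riesz q g" if pq: "p \<le> q" for q
  proof -
    obtain g X where g: "g \<in> Hp q" "\<And>\<xi>. \<xi> \<in> N \<Longrightarrow> ip q g \<xi> = x \<xi>"
    proof (rule Hs.Riesz_on_subspace[OF subspace_N N_sub, where \<phi>=x and C="\<bar>C\<bar>" and p=q])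
      fix \<xi> assume \<xi>: "\<xi> \<in> N"
      have "\<bar>x \<xi>\<bar> \<le> C * nm p \<xi>" by (rule C[OF \<xi>])
      also have "\<dots> \<le> \<bar>C\<bar> * nm p \<xi>" using \<xi> N_Hp by (intro mult_right_mono) auto
      also have "\<dots> \<le> \<bar>C\<bar> * nm q \<xi>" using nm_mono[OF pq N_Hp[OF \<xi>]] by (intro mult_left_mono) auto
      finally show "\<bar>x \<xi>\<bar> \<le> \<bar>C\<bar> * nm q \<xi>" .
    qed (use N'_lin[OF assms] in auto)
    moreover have "x = riesz q g"
      using g(2) assms by (auto simp: fun_eq_iff riesz_def N'_def)
    ultimately show ?thesis by blast
  qed
  then show ?thesis by (rule that)
qed

lemma N'_list_riesz:
  assumes "set xs \<subseteq> N'"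
  obtains p where "\<And>q. p \<le> q \<Longrightarrow> \<exists>gs. set gs \<subseteq> Hp q \<and> length gs = length xs \<and> xs = map (riesz q) gs"
proof -
  have "\<exists>p. \<forall>q\<ge>p. \<exists>gs. set gs \<subseteq> Hp q \<and> length gs = length xs \<and> xs = map (riesz q) gs"
    using assms
  proof (induction xs)
    case (Cons x xs)
    then obtain p where p: "\<forall>q\<ge>p. \<exists>gs. set gs \<subseteq> Hp q \<and> length gs = length xs \<and> xs = map (riesz q) gs" by auto
    obtain p' where p': "\<And>q. p' \<le> q \<Longrightarrow> \<exists>g\<in>Hp q. x = riesz q g" using N'_riesz[of x] Cons by auto
    have "\<exists>gs. set gs \<subseteq> Hp q \<and> length gs = length (x # xs) \<and> x # xs = map (riesz q) gs" if q: "q \<ge> max p p'" for q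
    proof -
      obtain gs where gs: "set gs \<subseteq> Hp q" "length gs = length xs" "xs = map (riesz q) gs" using p q by auto
      obtain g where g: "g \<in> Hp q" "x = riesz q g" using p' q by auto
      show ?thesis by (rule exI[of _ "g # gs"]) (use gs g in auto)
    qed
    then show ?case by blast
  qed simp
  then show ?thesis using that by blast
qed

lemma sym_formD_off: "sym_form n t \<Longrightarrow> \<not> (length xs = n \<and> set xs \<subseteq> N') \<Longrightarrow> t xs = 0"
  unfolding sym_form_def by blast

lemma sym_formD_lin:
  "sym_form n t \<Longrightarrow> length xs = n \<Longrightarrow> set xs \<subseteq> N' \<Longrightarrow> i < n \<Longrightarrow> x \<in> N' \<Longrightarrow> y \<in> N' \<Longrightarrow>
    t (xs[i := (\<lambda>\<xi>. a * x \<xi> + b * y \<xi>)]) = of_real a * t (xs[i := x]) + of_real b * t (xs[i := y])"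
  unfolding sym_form_def by blast

lemma sym_formD_sym: "sym_form n t \<Longrightarrow> mset xs = mset ys \<Longrightarrow> t xs = t ys"
  unfolding sym_form_def by blast

lemma sym_form_lin_at:
  assumes t: "sym_form n t" and "length ps + Suc (length xs) = n" "set ps \<subseteq> N'" "set xs \<subseteq> N'" "x \<in> N'" "y \<in> N'"
  shows "t (ps @ (\<lambda>\<xi>. a * x \<xi> + b * y \<xi>) # xs) = of_real a * t (ps @ x # xs) + of_real b * t (ps @ y # xs)"
  using sym_formD_lin[OF t, of "ps @ x # xs" "length ps" x y a b] assms by simp

text \<open>Linearity at an arbitrary position is turned into recursion on the head; the prefix
  \<open>ps\<close> collects the slots that are already fixed.\<close>

lemma rmlin_sym_form:
  assumes t: "sym_form n t"
  shows "length ps + k = n \<Longrightarrow> set ps \<subseteq> N' \<Longrightarrow> Hs.rmlin p k (\<lambda>es. t (ps @ map (riesz p) es))"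
proof (induction k arbitrary: ps)
  case (Suc k)
  have eq: "t (ps @ riesz p (a *\<^sub>R x + b *\<^sub>R y) # map (riesz p) xs) =
      of_real a * t (ps @ riesz p x # map (riesz p) xs) + of_real b * t (ps @ riesz p y # map (riesz p) xs)"
    if "xs \<in> Lst (Hp p) k" "x \<in> Hp p" "y \<in> Hp p" for xs x y a b
    unfolding riesz_lin[OF that(2,3)]
    by (rule sym_form_lin_at[OF t]) (use that Suc.prems in \<open>auto simp: Lst_def\<close>)
  have "Hs.rmlin p k (\<lambda>es. t (ps @ map (riesz p) (x # es)))" if "x \<in> Hp p" for x
    using Suc.IH[of "ps @ [riesz p x]"] Suc.prems that by simp
  then show ?case
    using eq[of _ _ _ 1 1] eq[of _ _ _ _ 0] by simp
qed simp

lemma rmlin_sym_form0: "sym_form n t \<Longrightarrow> Hs.rmlin p n (\<lambda>es. t (map (riesz p) es))"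
  using rmlin_sym_form[of n t "[]" n p] by simp

text \<open>The finite section of the squared Hilbert-Schmidt norm along \<open>E\<close>; its
  supremum over all \<open>E\<close> is \<open>tnorm_sq\<close>.\<close>

definition tsum :: "nat \<Rightarrow> 'h set \<Rightarrow> nat \<Rightarrow> (('h \<Rightarrow> real) list \<Rightarrow> complex) \<Rightarrow> real" where
  "tsum p E n t = (\<Sum>es\<in>Lst E n. (cmod (t (map (riesz p) es)))\<^sup>2)"

lemma tsum_nonneg [simp]: "tsum p E n t \<ge> 0"
  by (simp add: tsum_def sum_nonneg)

lemma tnorm_sq_alt: "tnorm_sq p n t = (SUP E\<in>{E. Hs.ons p E}. ennreal (tsum p E n t))"
  unfolding tnorm_sq_def tsum_def Hs.ons_def Lst_def by (simp add: sum_ennreal)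

text \<open>By Bessel's inequality an orthonormal system inside \<open>span F\<close> has Bessel
  constant 1 there, so finite sections grow with the span.\<close>

lemma tsum_mono_span:
  assumes t: "sym_form n t" and E: "Hs.ons p E" and F: "Hs.ons p F" and EF: "E \<subseteq> span F"
  shows "tsum p E n t \<le> tsum p F n t"
proof -
  have "(\<Sum>es\<in>Lst E n. (cmod (t (map (riesz p) (map (\<lambda>e. e) es))))\<^sup>2) \<le>
      1 ^ n * (\<Sum>fs\<in>Lst F n. (cmod (t (map (riesz p) fs)))\<^sup>2)"
  proof (rule Hs.sum_Lst_sq_le[OF F])
    fix h assume "h \<in> span F"
    then have "h \<in> Hp p" using Hs.span_in[OF Hs.ons_sub[OF F]] by auto
    then show "(\<Sum>i\<in>E. (ip p i h)\<^sup>2) \<le> 1 * ip p h h" using Hs.Bessel[OF E] by simp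
  qed (use EF Hs.ons_finite[OF E] rmlin_sym_form0[OF t] in auto)
  then show ?thesis by (simp add: tsum_def)
qed

text \<open>The functionals \<open>ip p e\<close> are represented in \<open>H_q\<close> by vectors
  \<open>g e\<close> with \<open>riesz q (g e) = riesz p e\<close>. These are not orthonormal in
  \<open>H_q\<close>, but they satisfy Bessel's inequality with constant 1 because the norm of
  \<open>H_q\<close> dominates that of \<open>H_p\<close>.\<close>

lemma tnorm_sq_mono:
  assumes t: "sym_form n t" and pq: "p \<le> q"
  shows "tnorm_sq p n t \<le> tnorm_sq q n t"
  unfolding tnorm_sq_alt[of p]
proof (rule SUP_least, simp)
  fix E assume E: "Hs.ons p E"
  have "\<exists>g\<in>Hp q. \<forall>h\<in>Hp q. ip q g h = ip p e h" if e: "e \<in> E" for e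
  proof -
    have eH: "e \<in> Hp p" using Hs.onsD(1)[OF E e] .
    obtain g X where "g \<in> Hp q" "\<And>h. h \<in> Hp q \<Longrightarrow> ip q g h = ip p e h"
    proof (rule Hs.Riesz_on_subspace[OF Hs.S order_refl, where \<phi>="ip p e" and C="nm p e" and p=q])
      fix x y a b assume "x \<in> Hp q" "y \<in> Hp q"
      then show "ip p e (a *\<^sub>R x + b *\<^sub>R y) = a * ip p e x + b * ip p e y"
        using eH Hp_mono[OF pq] by (simp add: subset_iff)
    next
      fix x assume x: "x \<in> Hp q"
      have "\<bar>ip p e x\<bar> \<le> nm p e * nm p x" using Hs.Cauchy_Schwarz[OF eH] x Hp_mono[OF pq] by auto
      also have "\<dots> \<le> nm p e * nm q x" using eH nm_mono[OF pq x] by (intro mult_left_mono) auto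
      finally show "\<bar>ip p e x\<bar> \<le> nm p e * nm q x" .
    qed auto
    then show ?thesis by blast
  qed
  then obtain g where g: "\<And>e. e \<in> E \<Longrightarrow> g e \<in> Hp q" "\<And>e h. e \<in> E \<Longrightarrow> h \<in> Hp q \<Longrightarrow> ip q (g e) h = ip p e h"
    by metis
  have rz: "riesz q (g e) = riesz p e" if "e \<in> E" for e
    using g(2)[OF that] N_Hp by (auto simp: riesz_def fun_eq_iff)
  obtain F where F: "Hs.ons q F" "g ` E \<subseteq> span F"
    by (rule Hs.ons_basis[of "g ` E" q]) (use g(1) Hs.ons_finite[OF E] in auto)
  have "(\<Sum>es\<in>Lst E n. (cmod (t (map (riesz q) (map g es))))\<^sup>2) \<le>
      1 ^ n * (\<Sum>fs\<in>Lst F n. (cmod (t (map (riesz q) fs)))\<^sup>2)"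
  proof (rule Hs.sum_Lst_sq_le[OF F(1)])
    fix h assume "h \<in> span F"
    then have h: "h \<in> Hp q" using Hs.span_in[OF Hs.ons_sub[OF F(1)]] by auto
    have "(\<Sum>i\<in>E. (ip q (g i) h)\<^sup>2) = (\<Sum>i\<in>E. (ip p i h)\<^sup>2)" using g(2) h by simp
    also have "\<dots> \<le> ip p h h" using Hs.Bessel[OF E] h Hp_mono[OF pq] by auto
    also have "\<dots> \<le> ip q h h"
      using power_mono[OF nm_mono[OF pq h], of 2] h Hp_mono[OF pq] by (auto simp: Hs.nrm_sq subset_iff)
    finally show "(\<Sum>i\<in>E. (ip q (g i) h)\<^sup>2) \<le> 1 * ip q h h" by simp
  qed (use F Hs.ons_finite[OF E] rmlin_sym_form0[OF t] in auto)
  moreover have "map (riesz q) (map g es) = map (riesz p) es" if "es \<in> Lst E n" for es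
    using that rz by (auto simp: Lst_def)
  ultimately have "tsum p E n t \<le> tsum q F n t" by (simp add: tsum_def del: map_map)
  then have "ennreal (tsum p E n t) \<le> ennreal (tsum q F n t)" by (rule ennreal_leI)
  also have "\<dots> \<le> tnorm_sq q n t" unfolding tnorm_sq_alt using F(1) by (intro SUP_upper) auto
  finally show "ennreal (tsum p E n t) \<le> tnorm_sq q n t" .
qed

lemma tnorm_nonneg [simp]: "tnorm p n t \<ge> 0"
  by (simp add: tnorm_def)

lemma tnorm_sq_leI:
  assumes "\<And>E. Hs.ons p E \<Longrightarrow> tsum p E n t \<le> B"
  shows "tnorm_sq p n t \<le> ennreal B"
  unfolding tnorm_sq_alt by (rule SUP_least) (use assms in \<open>auto intro: ennreal_leI\<close>)

lemma tnorm_leI: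
  assumes "\<And>E. Hs.ons p E \<Longrightarrow> tsum p E n t \<le> B\<^sup>2" "B \<ge> 0"
  shows "tnorm p n t \<le> B"
proof -
  have "enn2real (tnorm_sq p n t) \<le> B\<^sup>2"
    using tnorm_sq_leI[OF assms(1)] by (simp add: enn2real_leI)
  then show ?thesis unfolding tnorm_def using assms(2) real_le_lsqrt by blast
qed

lemma tnorm_sq_eq: "tnorm_sq p n t < \<infinity> \<Longrightarrow> tnorm_sq p n t = ennreal ((tnorm p n t)\<^sup>2)"
  by (simp add: tnorm_def)

lemma tsum_le_tnorm:
  assumes "tnorm_sq p n t < \<infinity>" "Hs.ons p E"
  shows "tsum p E n t \<le> (tnorm p n t)\<^sup>2"
proof -
  have "ennreal (tsum p E n t) \<le> tnorm_sq p n t"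
    unfolding tnorm_sq_alt using assms(2) by (intro SUP_upper) auto
  then show ?thesis using tnorm_sq_eq[OF assms(1)] by simp
qed

lemma tnorm_approx:
  assumes "tnorm_sq p n t < \<infinity>" "\<epsilon> > 0"
  obtains E where "Hs.ons p E" "(tnorm p n t)\<^sup>2 \<le> tsum p E n t + \<epsilon>"
proof (cases "(tnorm p n t)\<^sup>2 \<le> \<epsilon>")
  case True
  then show ?thesis using that[of "{}"] tsum_nonneg[of p "{}" n t] Hs.ons_empty by simp
next
  case False
  have "ennreal ((tnorm p n t)\<^sup>2 - \<epsilon>) < tnorm_sq p n t"
    unfolding tnorm_sq_eq[OF assms(1)] using assms(2) False by (intro ennreal_lessI) auto
  then obtain E where "Hs.ons p E" "ennreal ((tnorm p n t)\<^sup>2 - \<epsilon>) < ennreal (tsum p E n t)"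
    unfolding tnorm_sq_alt less_SUP_iff by auto
  then show ?thesis using that[of E] False by (simp add: ennreal_less_iff)
qed

lemma NC_tensorD: "t \<in> NC_tensor n \<Longrightarrow> sym_form n t" "t \<in> NC_tensor n \<Longrightarrow> tnorm_sq p n t < \<infinity>"
  by (auto simp: NC_tensor_def)

lemma tnorm_mono: "t \<in> NC_tensor n \<Longrightarrow> p \<le> q \<Longrightarrow> tnorm p n t \<le> tnorm q n t"
  unfolding tnorm_def using tnorm_sq_mono[of n t p q] NC_tensorD(2)[of t n q] NC_tensorD(1)
  by (intro real_sqrt_le_mono enn2real_mono) auto

lemma sym_form_lc:
  assumes "sym_form n s" "sym_form n t"
  shows "sym_form n (fadd (fscl a s) (fscl b t))"
  unfolding sym_form_def
proof (intro conjI allI impI)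
  fix xs assume "\<not> (length xs = n \<and> set xs \<subseteq> N')"
  then show "fadd (fscl a s) (fscl b t) xs = 0"
    using sym_formD_off[OF assms(1)] sym_formD_off[OF assms(2)] by (simp add: fadd_def fscl_def)
next
  fix xs i x y c d assume *: "length xs = n \<and> set xs \<subseteq> N' \<and> i < n \<and> x \<in> N' \<and> y \<in> N'"
  have "s (xs[i := \<lambda>\<xi>. c * x \<xi> + d * y \<xi>]) = of_real c * s (xs[i := x]) + of_real d * s (xs[i := y])"
    "t (xs[i := \<lambda>\<xi>. c * x \<xi> + d * y \<xi>]) = of_real c * t (xs[i := x]) + of_real d * t (xs[i := y])"
    using sym_formD_lin[OF assms(1)] sym_formD_lin[OF assms(2)] * by blast+
  then show "fadd (fscl a s) (fscl b t) (xs[i := \<lambda>\<xi>. c * x \<xi> + d * y \<xi>]) =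
     of_real c * fadd (fscl a s) (fscl b t) (xs[i := x]) + of_real d * fadd (fscl a s) (fscl b t) (xs[i := y])"
    unfolding fadd_def fscl_def by (simp only:) (simp add: distrib_left mult.left_commute)
next
  fix xs ys :: "('h \<Rightarrow> real) list" assume "mset xs = mset ys"
  then show "fadd (fscl a s) (fscl b t) xs = fadd (fscl a s) (fscl b t) ys"
    using sym_formD_sym[OF assms(1), of xs ys] sym_formD_sym[OF assms(2), of xs ys] by (simp add: fadd_def fscl_def)
qed

lemma tsum_L2: "sqrt (tsum p E n t) = L2_set (\<lambda>es. cmod (t (map (riesz p) es))) (Lst E n)"
  by (simp add: tsum_def L2_set_def)

lemma tsum_lc:
  assumes s: "tnorm_sq p n s < \<infinity>" and t: "tnorm_sq p n t < \<infinity>" and E: "Hs.ons p E"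
  shows "tsum p E n (fadd (fscl a s) (fscl b t)) \<le> (cmod a * tnorm p n s + cmod b * tnorm p n t)\<^sup>2"
proof -
  have "sqrt (tsum p E n (fadd (fscl a s) (fscl b t))) \<le>
      L2_set (\<lambda>es. cmod a * cmod (s (map (riesz p) es)) + cmod b * cmod (t (map (riesz p) es))) (Lst E n)"
    unfolding tsum_L2 by (intro L2_set_mono) (auto simp: fadd_def fscl_def norm_mult intro: norm_triangle_le)
  also have "\<dots> \<le> L2_set (\<lambda>es. cmod a * cmod (s (map (riesz p) es))) (Lst E n) +
      L2_set (\<lambda>es. cmod b * cmod (t (map (riesz p) es))) (Lst E n)"
    by (rule L2_set_triangle_ineq)
  also have "\<dots> = cmod a * sqrt (tsum p E n s) + cmod b * sqrt (tsum p E n t)"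
    by (simp add: tsum_L2 L2_set_right_distrib)
  also have "\<dots> \<le> cmod a * tnorm p n s + cmod b * tnorm p n t"
    using tsum_le_tnorm[OF s E] tsum_le_tnorm[OF t E]
    by (intro add_mono mult_left_mono real_le_lsqrt) auto
  finally show ?thesis by (simp add: sqrt_le_D)
qed

lemma NC_tensor_lc:
  assumes "s \<in> NC_tensor n" "t \<in> NC_tensor n"
  shows "fadd (fscl a s) (fscl b t) \<in> NC_tensor n"
proof -
  have "tnorm_sq p n (fadd (fscl a s) (fscl b t)) < \<infinity>" for p
  proof -
    have "tnorm_sq p n (fadd (fscl a s) (fscl b t)) \<le> ennreal ((cmod a * tnorm p n s + cmod b * tnorm p n t)\<^sup>2)"
      using tsum_lc[OF NC_tensorD(2)[OF assms(1)] NC_tensorD(2)[OF assms(2)]] by (rule tnorm_sq_leI)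
    then show ?thesis by (simp add: order_le_less_trans)
  qed
  then show ?thesis using sym_form_lc assms by (auto simp: NC_tensor_def)
qed

lemma tnorm_lc:
  assumes "s \<in> NC_tensor n" "t \<in> NC_tensor n"
  shows "tnorm p n (fadd (fscl a s) (fscl b t)) \<le> cmod a * tnorm p n s + cmod b * tnorm p n t"
  using tsum_lc[OF NC_tensorD(2)[OF assms(1)] NC_tensorD(2)[OF assms(2)]] by (rule tnorm_leI) auto

lemma zero_NC_tensor [simp]: "(\<lambda>_. 0) \<in> NC_tensor n"
proof -
  have "tnorm_sq p n (\<lambda>_. 0) \<le> ennreal 0" for p
    by (rule tnorm_sq_leI) (simp add: tsum_def)
  then show ?thesis by (simp add: NC_tensor_def sym_form_def)
qed

lemma fscl_1 [simp]: "fscl 1 f = f" and fscl_0 [simp]: "fscl 0 f = (\<lambda>_. 0)"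
  and fadd_0 [simp]: "fadd f (\<lambda>_. 0) = f" "fadd (\<lambda>_. 0) f = f"
  by (simp_all add: fscl_def fadd_def)

lemma NC_tensor_add: "s \<in> NC_tensor n \<Longrightarrow> t \<in> NC_tensor n \<Longrightarrow> fadd s t \<in> NC_tensor n"
  using NC_tensor_lc[of s n t 1 1] by simp

lemma NC_tensor_scl: "t \<in> NC_tensor n \<Longrightarrow> fscl a t \<in> NC_tensor n"
  using NC_tensor_lc[of t n t a 0] by simp

lemma tnorm_scl_le: "t \<in> NC_tensor n \<Longrightarrow> tnorm p n (fscl a t) \<le> cmod a * tnorm p n t"
  using tnorm_lc[of t n t p a 0] by simp

lemma prod_list_mset: "mset xs = mset ys \<Longrightarrow> (\<Prod>x\<leftarrow>xs. f x) = (\<Prod>x\<leftarrow>ys. f x :: complex)"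
  by (metis mset_map prod_mset_prod_list)

lemma mset_eq_set_length: "mset xs = mset ys \<Longrightarrow> length xs = length ys \<and> set xs = set ys"
  by (metis mset_eq_length mset_eq_setD)

lemma N'_lc: "x \<in> N' \<Longrightarrow> y \<in> N' \<Longrightarrow> (\<lambda>\<xi>. a * x \<xi> + b * y \<xi>) \<in> N'"
proof -
  assume x: "x \<in> N'" and y: "y \<in> N'"
  obtain p where p: "\<And>q. p \<le> q \<Longrightarrow> \<exists>g\<in>Hp q. x = riesz q g" using N'_riesz[OF x] by blast
  obtain p' where p': "\<And>q. p' \<le> q \<Longrightarrow> \<exists>g\<in>Hp q. y = riesz q g" using N'_riesz[OF y] by blast
  obtain g h where "g \<in> Hp (max p p')" "x = riesz (max p p') g" "h \<in> Hp (max p p')" "y = riesz (max p p') h"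
    using p[of "max p p'"] p'[of "max p p'"] by auto
  then show ?thesis using riesz_lin[of g "max p p'" h a b] by (metis riesz_in_N' Hs.S_intros(2,4))
qed

lemma pairing_lc: "pairing (\<lambda>\<xi>. a * x \<xi> + b * y \<xi>) \<theta> = of_real a * pairing x \<theta> + of_real b * pairing y \<theta>"
  by (simp add: pairing_def complex_eq_iff)

lemma sym_form_tensor_power: "sym_form n (tensor_power n \<theta>)"
  unfolding sym_form_def
proof (intro conjI allI impI)
  fix xs assume "\<not> (length xs = n \<and> set xs \<subseteq> N')"
  then show "tensor_power n \<theta> xs = 0" by (auto simp: tensor_power_def)
next
  fix xs i x y a b assume *: "length xs = n \<and> set xs \<subseteq> N' \<and> i < n \<and> x \<in> N' \<and> y \<in> N'"
  have "tensor_power n \<theta> (xs[i := w]) =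
      (\<Prod>x\<leftarrow>take i xs. pairing x \<theta>) * (pairing w \<theta> * (\<Prod>x\<leftarrow>drop (Suc i) xs. pairing x \<theta>))" if "w \<in> N'" for w
  proof -
    have "set (xs[i := w]) \<subseteq> N'" using * that set_update_subset_insert[of xs i w] by auto
    moreover have "(\<Prod>x\<leftarrow>xs[i := w]. pairing x \<theta>) =
        (\<Prod>x\<leftarrow>take i xs. pairing x \<theta>) * (pairing w \<theta> * (\<Prod>x\<leftarrow>drop (Suc i) xs. pairing x \<theta>))"
      using * by (subst upd_conv_take_nth_drop) auto
    ultimately show ?thesis using * by (simp add: tensor_power_def)
  qed
  then show "tensor_power n \<theta> (xs[i := \<lambda>\<xi>. a * x \<xi> + b * y \<xi>]) =
      of_real a * tensor_power n \<theta> (xs[i := x]) + of_real b * tensor_power n \<theta> (xs[i := y])"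
    using * N'_lc by (simp add: pairing_lc algebra_simps)
next
  fix xs ys :: "('h \<Rightarrow> real) list" assume "mset xs = mset ys"
  then show "tensor_power n \<theta> xs = tensor_power n \<theta> ys"
    using mset_eq_set_length prod_list_mset[of xs ys] unfolding tensor_power_def by metis
qed

lemma cnorm_nonneg [simp]: "cnorm p \<theta> \<ge> 0"
  by (simp add: cnorm_def)

text \<open>On an elementary tensor the sum over lists factors into an \<open>n\<close>-th power;
  Bessel's inequality for the real and the imaginary part bounds the base.\<close>

lemma tsum_tensor_power:
  assumes \<theta>: "\<theta> \<in> NC" and E: "Hs.ons p E"
  shows "tsum p E n (tensor_power n \<theta>) \<le> (cnorm p \<theta> ^ n)\<^sup>2"
proof -
  obtain \<xi> \<eta> where \<theta>': "\<theta> = (\<xi>, \<eta>)" "\<xi> \<in> N" "\<eta> \<in> N" using \<theta> by (auto simp: NC_def)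
  have "(cmod (tensor_power n \<theta> (map (riesz p) es)))\<^sup>2 = (\<Prod>e\<leftarrow>es. (ip p e \<xi>)\<^sup>2 + (ip p e \<eta>)\<^sup>2)"
    if "es \<in> Lst E n" for es
  proof -
    have "set (map (riesz p) es) \<subseteq> N'" using that Hs.onsD(1)[OF E] by (auto simp: Lst_def)
    then have "tensor_power n \<theta> (map (riesz p) es) = (\<Prod>e\<leftarrow>es. pairing (riesz p e) \<theta>)"
      using that by (simp add: tensor_power_def Lst_def o_def)
    also have "(cmod \<dots>)\<^sup>2 = (\<Prod>e\<leftarrow>es. (ip p e \<xi>)\<^sup>2 + (ip p e \<eta>)\<^sup>2)"
      by (induction es) (simp_all add: norm_mult power_mult_distrib cmod_power2 pairing_def \<theta>' riesz_N)
    finally show ?thesis .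
  qed
  then have "tsum p E n (tensor_power n \<theta>) = (\<Sum>es\<in>Lst E n. \<Prod>e\<leftarrow>es. (ip p e \<xi>)\<^sup>2 + (ip p e \<eta>)\<^sup>2)"
    by (simp add: tsum_def)
  also have "\<dots> = (\<Sum>e\<in>E. (ip p e \<xi>)\<^sup>2 + (ip p e \<eta>)\<^sup>2) ^ n"
    by (rule sum_Lst_prod[OF Hs.ons_finite[OF E]])
  also have "\<dots> \<le> (ip p \<xi> \<xi> + ip p \<eta> \<eta>) ^ n"
    using Hs.Bessel[OF E N_Hp] \<theta>' by (intro power_mono sum_nonneg) (auto simp: sum.distrib add_mono)
  also have "ip p \<xi> \<xi> + ip p \<eta> \<eta> = (cnorm p \<theta>)\<^sup>2"
    using \<theta>' by (simp add: cnorm_def Hs.nrm_sq N_Hp)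
  finally show ?thesis by (simp flip: power_mult add: mult.commute)
qed

lemma tensor_power_NC [simp]: "\<theta> \<in> NC \<Longrightarrow> tensor_power n \<theta> \<in> NC_tensor n"
proof -
  assume \<theta>: "\<theta> \<in> NC"
  have "tnorm_sq p n (tensor_power n \<theta>) \<le> ennreal ((cnorm p \<theta> ^ n)\<^sup>2)" for p
    by (rule tnorm_sq_leI[OF tsum_tensor_power[OF \<theta>]])
  then have "tnorm_sq p n (tensor_power n \<theta>) < \<infinity>" for p
    by (metis ennreal_less_top infinity_ennreal_def order_le_less_trans)
  then show ?thesis by (simp add: NC_tensor_def sym_form_tensor_power)
qed

lemma tnorm_tensor_power: "\<theta> \<in> NC \<Longrightarrow> tnorm p n (tensor_power n \<theta>) \<le> cnorm p \<theta> ^ n"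
  by (rule tnorm_leI[OF tsum_tensor_power]) auto

section \<open>Density of the tensor powers\<close>

text \<open>The locale provides one basis \<open>E0\<close> with finite sum, while estimates need a
  bound for every orthonormal system \<open>E\<close> of \<open>H_p'\<close>. The squared norms are
  expanded in an orthonormal basis \<open>F\<close> of the span of \<open>E\<close> in
  \<open>H_p\<close>, the sums are exchanged, and for each \<open>f\<close> in \<open>F\<close>
  Bessel for \<open>E\<close> and Parseval for \<open>E0\<close> are applied to the same
  vector.\<close>

lemma hilbert_schmidt_const:
  obtains p' K where "p < p'" "K \<ge> 0" "\<And>E. Hs.ons p' E \<Longrightarrow> (\<Sum>e\<in>E. (nm p e)\<^sup>2) \<le> K"
proof -
  obtain p' E0 where p': "p < p'" and E0: "orthonormal_basis_on (Hp p') (ip p') E0"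
    and sm: "(\<lambda>e. (nm p e)\<^sup>2) summable_on E0"
    using hilbert_schmidt by blast
  define K where "K = (\<Sum>\<^sub>\<infinity>e\<in>E0. (nm p e)\<^sup>2)"
  have K0: "K \<ge> 0" unfolding K_def by (intro infsum_nonneg) auto
  have sub: "x \<in> Hp p" if "x \<in> Hp p'" for x using Hp_mono[of p p'] p' that by auto
  have E0H: "E0 \<subseteq> Hp p'" using E0 by (simp add: orthonormal_basis_on_def orthonormal_on_def)
  have "(\<Sum>e\<in>E. (nm p e)\<^sup>2) \<le> K" if E: "Hs.ons p' E" for E
  proof (rule field_le_epsilon)
    fix \<epsilon>0 :: real assume \<epsilon>0: "\<epsilon>0 > 0"
    have EH: "E \<subseteq> Hp p" using Hs.ons_sub[OF E] sub by auto
    obtain F where F: "Hs.ons p F" "E \<subseteq> span F" by (rule Hs.ons_basis[OF Hs.ons_finite[OF E] EH])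
    \<comment> \<open>The total error is shared among the elements of \<open>F\<close>.\<close>
    define \<epsilon> where "\<epsilon> = \<epsilon>0 / (1 + card F)"
    have \<epsilon>: "\<epsilon> > 0" using \<epsilon>0 by (simp add: \<epsilon>_def field_simps)
    have FH: "f \<in> Hp p" if "f \<in> F" for f using Hs.onsD(1)[OF F(1) that] .
    have "\<exists>A. finite A \<and> A \<subseteq> E0 \<and> (\<Sum>e\<in>E. (ip p f e)\<^sup>2) \<le> (\<Sum>e\<in>A. (ip p f e)\<^sup>2) + \<epsilon>" if f: "f \<in> F" for f
    proof -
      \<comment> \<open>\<open>g\<close> is the image of \<open>f\<close> under the adjoint of the
        embedding of \<open>H_p'\<close> into \<open>H_p\<close>.\<close>
      obtain g X where g: "g \<in> Hp p'" "\<And>h. h \<in> Hp p' \<Longrightarrow> ip p' g h = ip p f h"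
      proof (rule Hs.Riesz_on_subspace[OF Hs.S order_refl, where \<phi>="ip p f" and C="nm p f" and p=p'])
        fix x y a b assume "x \<in> Hp p'" "y \<in> Hp p'"
        then show "ip p f (a *\<^sub>R x + b *\<^sub>R y) = a * ip p f x + b * ip p f y"
          using FH[OF f] sub by simp
      next
        fix x assume x: "x \<in> Hp p'"
        have "\<bar>ip p f x\<bar> \<le> nm p f * nm p x" using Hs.Cauchy_Schwarz[OF FH[OF f] sub[OF x]] .
        also have "\<dots> \<le> nm p f * nm p' x" using FH[OF f] nm_mono[of p p' x] p' x by (intro mult_left_mono) auto
        finally show "\<bar>ip p f x\<bar> \<le> nm p f * nm p' x" .
      qed auto
      obtain A where A: "finite A" "A \<subseteq> E0" "ip p' g g \<le> (\<Sum>e\<in>A. (ip p' e g)\<^sup>2) + \<epsilon>"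
        using Hs.total_ons_approx[OF E0 g(1) \<epsilon>] by metis
      have c: "ip p' e g = ip p f e" if "e \<in> Hp p'" for e
        using g that Hs.ip_sym[OF that g(1)] by simp
      have "(\<Sum>e\<in>E. (ip p f e)\<^sup>2) = (\<Sum>e\<in>E. (ip p' e g)\<^sup>2)"
        by (intro sum.cong refl) (use c Hs.ons_sub[OF E] in auto)
      also have "\<dots> \<le> ip p' g g" by (rule Hs.Bessel[OF E g(1)])
      also have "\<dots> \<le> (\<Sum>e\<in>A. (ip p' e g)\<^sup>2) + \<epsilon>" by (rule A(3))
      also have "(\<Sum>e\<in>A. (ip p' e g)\<^sup>2) = (\<Sum>e\<in>A. (ip p f e)\<^sup>2)"
        by (intro sum.cong refl) (use c A(2) E0H in auto)
      finally show ?thesis using A(1,2) by blast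
    qed
    then obtain A where A: "\<And>f. f \<in> F \<Longrightarrow> finite (A f)" "\<And>f. f \<in> F \<Longrightarrow> A f \<subseteq> E0"
        "\<And>f. f \<in> F \<Longrightarrow> (\<Sum>e\<in>E. (ip p f e)\<^sup>2) \<le> (\<Sum>e\<in>A f. (ip p f e)\<^sup>2) + \<epsilon>" by metis
    define B where "B = (\<Union>f\<in>F. A f)"
    have B: "finite B" "B \<subseteq> E0" using A Hs.ons_finite[OF F(1)] by (auto simp: B_def)
    have BH: "e \<in> Hp p" if "e \<in> B" for e using B E0H sub that by auto
    have "(\<Sum>e\<in>E. (nm p e)\<^sup>2) = (\<Sum>e\<in>E. \<Sum>f\<in>F. (ip p f e)\<^sup>2)"
      by (intro sum.cong refl) (use EH F Hs.Parseval_finite[OF F(1)] in \<open>auto simp: Hs.nrm_sq subset_iff\<close>)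
    also have "\<dots> = (\<Sum>f\<in>F. \<Sum>e\<in>E. (ip p f e)\<^sup>2)" by (rule sum.swap)
    also have "\<dots> \<le> (\<Sum>f\<in>F. (\<Sum>e\<in>B. (ip p f e)\<^sup>2) + \<epsilon>)"
    proof (rule sum_mono)
      fix f assume f: "f \<in> F"
      have "(\<Sum>e\<in>A f. (ip p f e)\<^sup>2) \<le> (\<Sum>e\<in>B. (ip p f e)\<^sup>2)"
        using B f by (intro sum_mono2) (auto simp: B_def)
      then show "(\<Sum>e\<in>E. (ip p f e)\<^sup>2) \<le> (\<Sum>e\<in>B. (ip p f e)\<^sup>2) + \<epsilon>" using A(3)[OF f] by linarith
    qed
    also have "\<dots> = (\<Sum>e\<in>B. \<Sum>f\<in>F. (ip p f e)\<^sup>2) + card F * \<epsilon>"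
      by (subst sum.swap) (simp add: sum.distrib)
    also have "(\<Sum>e\<in>B. \<Sum>f\<in>F. (ip p f e)\<^sup>2) \<le> (\<Sum>e\<in>B. (nm p e)\<^sup>2)"
      by (rule sum_mono) (use Hs.Bessel[OF F(1)] BH in \<open>auto simp: Hs.nrm_sq\<close>)
    also have "(\<Sum>e\<in>B. (nm p e)\<^sup>2) \<le> K"
      unfolding K_def using B by (intro finite_sum_le_infsum[OF sm]) auto
    also have "card F * \<epsilon> \<le> \<epsilon>0" using \<epsilon>0 by (simp add: \<epsilon>_def field_simps)
    finally show "(\<Sum>e\<in>E. (nm p e)\<^sup>2) \<le> K + \<epsilon>0" by simp
  qed
  then show ?thesis using that p' K0 by blast
qed

text \<open>The prefix estimate with all arguments frozen, in an orthonormal basis of their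
  span.\<close>

lemma tensor_bound:
  assumes t: "sym_form n t" "tnorm_sq p n t < \<infinity>" and xs: "xs \<in> Lst (Hp p) n"
  shows "cmod (t (map (riesz p) xs)) \<le> tnorm p n t * (\<Prod>x\<leftarrow>xs. nm p x)"
proof -
  have fin: "finite (set xs)" "set xs \<subseteq> Hp p" "length xs = n" using xs by (auto simp: Lst_def)
  obtain F where F: "Hs.ons p F" "set xs \<subseteq> span F" by (rule Hs.ons_basis[OF fin(1,2)])
  have "(cmod (t (map (riesz p) xs)))\<^sup>2 \<le> (\<Prod>x\<leftarrow>xs. nm p x)\<^sup>2 * tsum p F n t"
    using Hs.sum_Lst_sq_prefix_le[OF F(1), of xs 0 "\<lambda>es. t (map (riesz p) es)"]
      rmlin_sym_form0[OF t(1), of p] F(2) fin(3) by (simp add: tsum_def)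
  also have "\<dots> \<le> (\<Prod>x\<leftarrow>xs. nm p x)\<^sup>2 * (tnorm p n t)\<^sup>2"
    by (intro mult_left_mono tsum_le_tnorm[OF t(2) F(1)]) auto
  finally have "(cmod (t (map (riesz p) xs)))\<^sup>2 \<le> (tnorm p n t * (\<Prod>x\<leftarrow>xs. nm p x))\<^sup>2"
    by (simp add: power_mult_distrib mult.commute)
  moreover have "(\<Prod>x\<leftarrow>xs. nm p x) \<ge> 0"
    using fin(2) by (induction xs) auto
  ultimately show ?thesis by (intro power2_le_imp_le[of "cmod _"]) auto
qed

text \<open>Since \<open>N\<close> need not be dense in \<open>H_p\<close>, a system in \<open>H_p\<close> is replaced by vectors of \<open>N\<close>
  approximating its projection to the closure of \<open>N\<close>; these satisfy Bessel's inequality up to a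
  factor tending to 1.\<close>

lemma tsum_N_approx:
  assumes t: "sym_form n t" "tnorm_sq p n t < \<infinity>" and E: "Hs.ons p E" and \<epsilon>: "\<epsilon> > 0"
  obtains F where "Hs.ons p F" "F \<subseteq> N" "tsum p E n t \<le> tsum p F n t + \<epsilon>"
proof -
  have EH: "e \<in> Hp p" if "e \<in> E" for e using Hs.onsD(1)[OF E that] .
  \<comment> \<open>\<open>l\<close> is the projection of \<open>e\<close> to the closure of
    \<open>N\<close>. Both induce the same functional on \<open>N\<close>, so \<open>t\<close>
    cannot tell them apart.\<close>
  have "\<exists>l X. l \<in> Hp p \<and> (\<forall>k::nat. X k \<in> N) \<and> (\<lambda>k. nm p (X k - l)) \<longlonglongrightarrow> 0 \<and> (\<forall>\<xi>\<in>N. ip p l \<xi> = ip p e \<xi>)"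
    if e: "e \<in> E" for e
  proof -
    obtain l X where "l \<in> Hp p" "\<And>k::nat. X k \<in> N" "(\<lambda>k. nm p (X k - l)) \<longlonglongrightarrow> 0"
        "\<And>\<xi>. \<xi> \<in> N \<Longrightarrow> ip p l \<xi> = ip p e \<xi>"
    proof (rule Hs.Riesz_on_subspace[OF subspace_N N_sub, where \<phi>="ip p e" and C="nm p e" and p=p])
      fix x y a b assume "x \<in> N" "y \<in> N"
      then show "ip p e (a *\<^sub>R x + b *\<^sub>R y) = a * ip p e x + b * ip p e y"
        using EH[OF e] N_Hp by simp
    qed (use Hs.Cauchy_Schwarz[OF EH[OF e]] N_Hp in auto)
    then show ?thesis by blast
  qed
  then obtain l X where l: "\<And>e. e \<in> E \<Longrightarrow> l e \<in> Hp p" and X: "\<And>e k. e \<in> E \<Longrightarrow> X e (k::nat) \<in> N"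
    and lim: "\<And>e. e \<in> E \<Longrightarrow> (\<lambda>k. nm p (X e k - l e)) \<longlonglongrightarrow> 0"
    and ipl: "\<And>e \<xi>. e \<in> E \<Longrightarrow> \<xi> \<in> N \<Longrightarrow> ip p (l e) \<xi> = ip p e \<xi>" by metis
  have rz: "riesz p (l e) = riesz p e" if "e \<in> E" for e
    using ipl[OF that] by (auto simp: riesz_def fun_eq_iff)
  define \<delta> where "\<delta> k = (\<Sum>e\<in>E. nm p (X e k - l e))" for k
  have \<delta>0: "\<delta> k \<ge> 0" for k
    unfolding \<delta>_def by (intro sum_nonneg Hs.nrm_nonneg) (use X l N_Hp in auto)
  have \<delta>: "\<delta> \<longlonglongrightarrow> 0" unfolding \<delta>_def using lim by (intro tendsto_null_sum) auto
  have "\<exists>F. Hs.ons p F \<and> F \<subseteq> N \<and> (\<lambda>e. X e k) ` E \<subseteq> span F" for k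
  proof -
    obtain F where "Hs.ons p F" "(\<lambda>e. X e k) ` E \<subseteq> span F" "F \<subseteq> span ((\<lambda>e. X e k) ` E)"
      by (rule Hs.ons_basis[of "(\<lambda>e. X e k) ` E" p]) (use X N_Hp Hs.ons_finite[OF E] in auto)
    moreover have "span ((\<lambda>e. X e k) ` E) \<subseteq> N" using X by (intro span_minimal subspace_N) auto
    ultimately show ?thesis by blast
  qed
  then obtain F where F: "\<And>k. Hs.ons p (F k)" "\<And>k. F k \<subseteq> N" "\<And>k. (\<lambda>e. X e k) ` E \<subseteq> span (F k)" by metis
  define a where "a k = (\<Sum>es\<in>Lst E n. (cmod (t (map (riesz p) (map (\<lambda>e. X e k) es))))\<^sup>2)" for k
  \<comment> \<open>Against vectors of \<open>N\<close> the limits \<open>l e\<close> act like the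
    orthonormal \<open>e\<close>; the deviations of \<open>X e k\<close> from them contribute at
    most \<open>\<delta> k\<close> in operator norm.\<close>
  have bess: "(\<Sum>e\<in>E. (ip p (X e k) h)\<^sup>2) \<le> (1 + \<delta> k)\<^sup>2 * ip p h h" if h: "h \<in> span (F k)" for h k
  proof -
    have hN: "h \<in> N" using h F(2) span_minimal[OF F(2) subspace_N] by blast
    note hH = N_Hp[OF hN]
    have "L2_set (\<lambda>e. ip p (X e k) h) E = L2_set (\<lambda>e. ip p e h + ip p (X e k - l e) h) E"
      by (intro L2_set_cong refl) (use ipl[OF _ hN] X l hH N_Hp in auto)
    also have "\<dots> \<le> L2_set (\<lambda>e. ip p e h) E + L2_set (\<lambda>e. ip p (X e k - l e) h) E"
      by (rule L2_set_triangle_ineq)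
    also have "L2_set (\<lambda>e. ip p e h) E \<le> nm p h"
      unfolding L2_set_def norm_of_def using Hs.Bessel[OF E hH] by simp
    also have "L2_set (\<lambda>e. ip p (X e k - l e) h) E \<le> (\<Sum>e\<in>E. \<bar>ip p (X e k - l e) h\<bar>)"
      by (rule L2_set_le_sum_abs)
    also have "\<dots> \<le> (\<Sum>e\<in>E. nm p (X e k - l e) * nm p h)"
      by (intro sum_mono Hs.Cauchy_Schwarz) (use X l hH N_Hp in auto)
    also have "\<dots> = \<delta> k * nm p h" by (simp add: \<delta>_def sum_distrib_right)
    finally have "(L2_set (\<lambda>e. ip p (X e k) h) E)\<^sup>2 \<le> ((1 + \<delta> k) * nm p h)\<^sup>2"
      by (intro power_mono) (auto simp: algebra_simps L2_set_nonneg)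
    then show ?thesis using hH by (simp add: L2_set_def power_mult_distrib Hs.nrm_sq sum_nonneg)
  qed
  have le: "a k \<le> ((1 + \<delta> k)\<^sup>2) ^ n * tsum p (F k) n t" for k
    unfolding a_def tsum_def
    by (rule Hs.sum_Lst_sq_le[OF F(1)]) (use F(3) Hs.ons_finite[OF E] rmlin_sym_form0[OF t(1)] bess in auto)
  define M where "M = (tnorm p n t)\<^sup>2"
  \<comment> \<open>The factor in front of the finite section is traded for an additive error, since
    all finite sections are bounded by \<open>M\<close>.\<close>
  have le2: "a k - (((1 + \<delta> k)\<^sup>2) ^ n - 1) * M \<le> tsum p (F k) n t" for k
  proof -
    have "((1 + \<delta> k)\<^sup>2) ^ n \<ge> 1" using \<delta>0[of k] by (simp add: one_le_power)
    then have "(((1 + \<delta> k)\<^sup>2) ^ n - 1) * tsum p (F k) n t \<le> (((1 + \<delta> k)\<^sup>2) ^ n - 1) * M"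
      unfolding M_def by (intro mult_left_mono tsum_le_tnorm[OF t(2) F(1)]) auto
    then show ?thesis using le[of k] by (simp add: algebra_simps)
  qed
  have "a \<longlonglongrightarrow> (\<Sum>es\<in>Lst E n. (cmod (t (map (riesz p) (map l es))))\<^sup>2)"
    unfolding a_def
  proof (intro tendsto_sum tendsto_power tendsto_norm)
    fix es assume es: "es \<in> Lst E n"
    then have es': "\<And>e. e \<in> set es \<Longrightarrow> e \<in> E" "length es = n" by (auto simp: Lst_def)
    show "(\<lambda>k. t (map (riesz p) (map (\<lambda>e. X e k) es))) \<longlonglongrightarrow> t (map (riesz p) (map l es))"
      by (rule Hs.rmlin_tendsto[OF rmlin_sym_form0[OF t(1)] tensor_bound[OF t], where g=X])
        (use es' X l lim N_Hp in auto)
  qed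
  moreover have "(\<Sum>es\<in>Lst E n. (cmod (t (map (riesz p) (map l es))))\<^sup>2) = tsum p E n t"
    unfolding tsum_def
  proof (intro sum.cong refl)
    fix es assume "es \<in> Lst E n"
    then have "map (riesz p) (map l es) = map (riesz p) es" using rz by (auto simp: Lst_def)
    then show "(cmod (t (map (riesz p) (map l es))))\<^sup>2 = (cmod (t (map (riesz p) es)))\<^sup>2" by (simp only:)
  qed
  ultimately have "a \<longlonglongrightarrow> tsum p E n t" by simp
  then have "(\<lambda>k. a k - (((1 + \<delta> k)\<^sup>2) ^ n - 1) * M) \<longlonglongrightarrow> tsum p E n t - (((1 + 0)\<^sup>2) ^ n - 1) * M"
    by (intro tendsto_intros \<delta>)
  then have "(\<lambda>k. a k - (((1 + \<delta> k)\<^sup>2) ^ n - 1) * M) \<longlonglongrightarrow> tsum p E n t" by simp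
  then have "\<forall>\<^sub>F k in sequentially. a k - (((1 + \<delta> k)\<^sup>2) ^ n - 1) * M > tsum p E n t - \<epsilon>"
    using \<epsilon> by (intro order_tendstoD(1)) auto
  then obtain k where k: "a k - (((1 + \<delta> k)\<^sup>2) ^ n - 1) * M > tsum p E n t - \<epsilon>"
    by (auto simp: eventually_sequentially)
  then have "tsum p E n t \<le> tsum p (F k) n t + \<epsilon>" using le2[of k] by linarith
  then show ?thesis by (rule that[OF F(1) F(2)])
qed

text \<open>Linear combinations are kept as coefficient lists, so that a functional can be
  prescribed on formal combinations before it is known to respect the relations among tensor
  powers.\<close>

definition tspan :: "nat \<Rightarrow> (complex \<times> ('h \<times> 'h)) list \<Rightarrow> ('h \<Rightarrow> real) list \<Rightarrow> complex" where
  "tspan n cs = (\<lambda>xs. \<Sum>(c, \<theta>)\<leftarrow>cs. c * tensor_power n \<theta> xs)"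

lemma tspan_simps:
  "tspan n [] = (\<lambda>_. 0)" "tspan n ((c, \<theta>) # cs) = fadd (fscl c (tensor_power n \<theta>)) (tspan n cs)"
  by (auto simp: tspan_def fadd_def fscl_def)

lemma tspan_append: "tspan n (cs @ ds) = fadd (tspan n cs) (tspan n ds)"
  by (simp add: tspan_def fadd_def)

lemma tspan_NC: "snd ` set cs \<subseteq> NC \<Longrightarrow> tspan n cs \<in> NC_tensor n"
proof (induction cs)
  case (Cons c cs)
  then show ?case by (cases c) (auto simp: tspan_simps NC_tensor_add NC_tensor_scl)
qed (simp add: tspan_simps)

text \<open>Polarisation: the \<open>n\<close>-th tensor power of a combination of \<open>F\<close>
  with weights \<open>z j\<close> has the coefficient \<open>\<Prod>f\<leftarrow>fs. z j f\<close>
  at the list \<open>fs\<close>, and every symmetric coefficient function is a combination of such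
  products.\<close>

lemma finite_rank_tspan:
  assumes F: "finite F" "F \<subseteq> N" and c: "\<And>fs gs. mset fs = mset gs \<Longrightarrow> c fs = c gs"
  obtains cs where "snd ` set cs \<subseteq> NC"
    "\<And>xs. length xs = n \<Longrightarrow> set xs \<subseteq> N' \<Longrightarrow>
       tspan n cs xs = (\<Sum>fs\<in>Lst F n. c fs * of_real (\<Prod>(x, f)\<leftarrow>zip xs fs. x f))"
proof -
  have "\<exists>D a z. \<forall>fs\<in>Lst F n. c fs = (\<Sum>j\<le>(D::nat). a j * of_real (\<Prod>f\<leftarrow>fs. z j f))"
    by (rule symmetric_function_span[of F c n, OF F(1) c]) blast+
  then obtain D :: nat and a z where
    az: "\<And>fs. fs \<in> Lst F n \<Longrightarrow> c fs = (\<Sum>j\<le>D. a j * of_real (\<Prod>f\<leftarrow>fs. z j f))" by blast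
  define \<theta> where "\<theta> j = (\<Sum>f\<in>F. z j f *\<^sub>R f, 0::'h)" for j
  define cs where "cs = map (\<lambda>j. (a j, \<theta> j)) [0..<Suc D]"
  have \<theta>: "\<theta> j \<in> NC" for j unfolding \<theta>_def NC_def using F by auto
  have "tspan n cs xs = (\<Sum>fs\<in>Lst F n. c fs * of_real (\<Prod>(x, f)\<leftarrow>zip xs fs. x f))"
    if xs: "length xs = n" "set xs \<subseteq> N'" for xs
  proof -
    have pr: "pairing x (\<theta> j) = of_real (\<Sum>f\<in>F. z j f * x f)" if "x \<in> N'" for x j
    proof -
      have "x (\<Sum>f\<in>F. z j f *\<^sub>R f) = (\<Sum>f\<in>F. z j f * x f)"
        using F
      proof (induction F rule: finite_induct)
        case (insert f F)
        then have "(\<Sum>f\<in>F. z j f *\<^sub>R f) \<in> N" by auto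
        then show ?case using insert by (simp add: N'_add N'_scale \<open>x \<in> N'\<close>)
      qed (use N'_zero[OF \<open>x \<in> N'\<close>] in simp)
      then show ?thesis using N'_zero[OF that] by (simp add: pairing_def \<theta>_def complex_eq_iff)
    qed
    have tp: "tensor_power n (\<theta> j) xs =
        (\<Sum>fs\<in>Lst F n. of_real (\<Prod>f\<leftarrow>fs. z j f) * of_real (\<Prod>(x, f)\<leftarrow>zip xs fs. x f))" for j
    proof -
      have "tensor_power n (\<theta> j) xs = (\<Prod>x\<leftarrow>xs. pairing x (\<theta> j))"
        using xs by (simp add: tensor_power_def)
      also have "map (\<lambda>x. pairing x (\<theta> j)) xs = map (\<lambda>x. of_real (\<Sum>f\<in>F. z j f * x f)) xs"
        using pr xs by (intro map_cong) auto
      also have "prod_list \<dots> = of_real (\<Prod>x\<leftarrow>xs. \<Sum>f\<in>F. z j f * x f)"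
        by (induction xs) auto
      also have "(\<Prod>x\<leftarrow>xs. \<Sum>f\<in>F. z j f * x f) = (\<Sum>fs\<in>Lst F n. \<Prod>(x, f)\<leftarrow>zip xs fs. z j f * x f)"
        using prod_sum_Lst[OF F(1), of "\<lambda>x f. z j f * x f" xs] xs by simp
      also have "\<dots> = (\<Sum>fs\<in>Lst F n. (\<Prod>f\<leftarrow>fs. z j f) * (\<Prod>(x, f)\<leftarrow>zip xs fs. x f))"
      proof (intro sum.cong refl)
        fix fs assume "fs \<in> Lst F n"
        then have "length xs = length fs" using xs by (simp add: Lst_def)
        then show "(\<Prod>(x, f)\<leftarrow>zip xs fs. z j f * x f) = (\<Prod>f\<leftarrow>fs. z j f) * (\<Prod>(x, f)\<leftarrow>zip xs fs. x f)"
          by (induction xs fs rule: list_induct2) auto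
      qed
      finally show ?thesis by simp
    qed
    have "tspan n cs xs = (\<Sum>j\<leftarrow>[0..<Suc D]. a j * tensor_power n (\<theta> j) xs)"
      by (simp add: tspan_def cs_def o_def)
    also have "\<dots> = (\<Sum>j\<le>D. a j * tensor_power n (\<theta> j) xs)"
      unfolding interv_sum_list_conv_sum_set_nat by (intro sum.cong) auto
    also have "\<dots> = (\<Sum>fs\<in>Lst F n. (\<Sum>j\<le>D. a j * of_real (\<Prod>f\<leftarrow>fs. z j f)) * of_real (\<Prod>(x, f)\<leftarrow>zip xs fs. x f))"
      unfolding tp sum_distrib_left sum_distrib_right by (subst sum.swap) (simp add: mult.assoc)
    also have "\<dots> = (\<Sum>fs\<in>Lst F n. c fs * of_real (\<Prod>(x, f)\<leftarrow>zip xs fs. x f))"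
      using az by simp
    finally show ?thesis .
  qed
  moreover have "snd ` set cs \<subseteq> NC" using \<theta> by (auto simp: cs_def)
  ultimately show ?thesis using that by blast
qed

text \<open>The approximant is the finite section of \<open>t\<close> along a system
  \<open>F\<close> in \<open>N\<close>. One half of \<open>\<epsilon>\<^sup>2\<close> pays for a
  finite system almost exhausting the norm, the other half for moving this system into
  \<open>N\<close>; by orthogonality the squared error is what the section misses.\<close>

lemma tspan_dense:
  assumes t: "t \<in> NC_tensor n" and \<epsilon>: "\<epsilon> > 0"
  obtains cs where "snd ` set cs \<subseteq> NC" "tnorm p n (fadd t (fscl (-1) (tspan n cs))) \<le> \<epsilon>"
proof -
  note sf = NC_tensorD(1)[OF t] and fin = NC_tensorD(2)[OF t]
  have e2: "\<epsilon>\<^sup>2 / 2 > 0" using \<epsilon> by simp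
  obtain E where E: "Hs.ons p E" "(tnorm p n t)\<^sup>2 \<le> tsum p E n t + \<epsilon>\<^sup>2 / 2"
    using tnorm_approx[OF fin e2] by metis
  obtain F where F: "Hs.ons p F" "F \<subseteq> N" "tsum p E n t \<le> tsum p F n t + \<epsilon>\<^sup>2 / 2"
    using tsum_N_approx[OF sf fin E(1) e2] by metis
  have sym: "t (map (riesz p) fs) = t (map (riesz p) gs)" if "mset fs = mset gs" for fs gs
    using sym_formD_sym[OF sf] that by (metis mset_map)
  have "\<exists>cs. snd ` set cs \<subseteq> NC \<and> (\<forall>xs. length xs = n \<longrightarrow> set xs \<subseteq> N' \<longrightarrow>
       tspan n cs xs = (\<Sum>fs\<in>Lst F n. t (map (riesz p) fs) * of_real (\<Prod>(x, f)\<leftarrow>zip xs fs. x f)))"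
    by (rule finite_rank_tspan[OF Hs.ons_finite[OF F(1)] F(2), of "\<lambda>fs. t (map (riesz p) fs)" n, OF sym]) blast+
  then obtain cs where cs: "snd ` set cs \<subseteq> NC"
    "\<And>xs. length xs = n \<Longrightarrow> set xs \<subseteq> N' \<Longrightarrow>
       tspan n cs xs = (\<Sum>fs\<in>Lst F n. t (map (riesz p) fs) * of_real (\<Prod>(x, f)\<leftarrow>zip xs fs. x f))"
    by blast
  let ?r = "fadd t (fscl (-1) (tspan n cs))"
  have rNC: "?r \<in> NC_tensor n"
    by (intro NC_tensor_add NC_tensor_scl tspan_NC t cs(1))
  have "tnorm p n ?r \<le> \<epsilon>"
  proof (rule tnorm_leI)
    fix E' assume E': "Hs.ons p E'"
    \<comment> \<open>The error has to be measured on an arbitrary \<open>E'\<close>; extending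
      \<open>F\<close> to a system whose span contains \<open>E'\<close> makes both visible in one
      basis.\<close>
    obtain F' where F': "Hs.ons p F'" "F \<subseteq> F'" "E' \<subseteq> span F'"
      using Hs.Gram_Schmidt[OF Hs.ons_finite[OF E'] Hs.ons_sub[OF E'] F(1)] by metis
    \<comment> \<open>Evaluating on basis vectors gives Kronecker deltas, so the section agrees with
      \<open>t\<close> on lists from \<open>F\<close> and vanishes on the others.\<close>
    have val: "tspan n cs (map (riesz p) fs) = (if fs \<in> Lst F n then t (map (riesz p) fs) else 0)"
      if fs: "fs \<in> Lst F' n" for fs
    proof -
      have fsH: "set fs \<subseteq> Hp p" and len: "length fs = n"
        using fs Hs.ons_sub[OF F'(1)] by (auto simp: Lst_def)
      have "(\<Prod>(x, g)\<leftarrow>zip (map (riesz p) fs) gs. x g) = (if fs = gs then 1 else 0)" if "gs \<in> Lst F n" for gs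
      proof -
        have "length fs = length gs" "set fs \<subseteq> F'" "set gs \<subseteq> F" using that fs by (auto simp: Lst_def)
        then show ?thesis
        proof (induction fs gs rule: list_induct2)
          case (Cons f fs g gs)
          then have "riesz p f g = (if f = g then 1 else 0)"
            using Hs.onsD(2)[OF F'(1), of f g] F'(2) F(2) by (auto simp: riesz_def)
          then show ?case using Cons by auto
        qed simp
      qed
      then have "tspan n cs (map (riesz p) fs) = (\<Sum>gs\<in>Lst F n. if fs = gs then t (map (riesz p) gs) else 0)"
        using fsH len by (subst cs(2)) (auto intro!: sum.cong)
      also have "\<dots> = (if fs \<in> Lst F n then t (map (riesz p) fs) else 0)"
        using Hs.ons_finite[OF F(1)] by simp
      finally show ?thesis .
    qed
    have sub: "Lst F n \<subseteq> Lst F' n" by (rule Lst_mono[OF F'(2)])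
    have "tsum p E' n ?r \<le> tsum p F' n ?r"
      by (rule tsum_mono_span[OF NC_tensorD(1)[OF rNC] E' F'(1,3)])
    also have "\<dots> = (\<Sum>fs\<in>Lst F' n. if fs \<in> Lst F n then 0 else (cmod (t (map (riesz p) fs)))\<^sup>2)"
      unfolding tsum_def by (intro sum.cong refl) (auto simp: val fadd_def fscl_def)
    also have "\<dots> = (\<Sum>fs\<in>Lst F' n - Lst F n. (cmod (t (map (riesz p) fs)))\<^sup>2)"
      by (rule sum.mono_neutral_cong_right) (use Hs.ons_finite[OF F'(1)] in auto)
    also have "\<dots> = tsum p F' n t - tsum p F n t"
      unfolding tsum_def using sub Hs.ons_finite[OF F'(1)] by (intro sum_diff) auto
    also have "\<dots> \<le> (tnorm p n t)\<^sup>2 - tsum p F n t"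
      using tsum_le_tnorm[OF fin F'(1)] by simp
    also have "\<dots> \<le> \<epsilon>\<^sup>2" using E(2) F(3) by simp
    finally show "tsum p E' n ?r \<le> \<epsilon>\<^sup>2" .
  qed (use \<epsilon> in simp)
  then show ?thesis using that cs(1) by blast
qed

section \<open>Functionals on tensors\<close>

lemma dualD:
  assumes "L \<in> NC_tensor_dual n"
  shows "t \<notin> NC_tensor n \<Longrightarrow> L t = 0"
    "s \<in> NC_tensor n \<Longrightarrow> t \<in> NC_tensor n \<Longrightarrow> L (fadd (fscl a s) (fscl b t)) = a * L s + b * L t"
    "\<exists>p. dual_norm p n L < \<infinity>"
  using assms unfolding NC_tensor_dual_def by blast+

lemma dual_add: "L \<in> NC_tensor_dual n \<Longrightarrow> s \<in> NC_tensor n \<Longrightarrow> t \<in> NC_tensor n \<Longrightarrow> L (fadd s t) = L s + L t"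
  using dualD(2)[of L n s t 1 1] by simp

lemma dual_scl: "L \<in> NC_tensor_dual n \<Longrightarrow> t \<in> NC_tensor n \<Longrightarrow> L (fscl a t) = a * L t"
  using dualD(2)[of L n t t a 0] by simp

lemma dual_zero: "L \<in> NC_tensor_dual n \<Longrightarrow> L (\<lambda>_. 0) = 0"
  using dual_scl[of L n "\<lambda>_. 0" 0] by simp

lemma dual_norm_leI:
  assumes "\<And>t. t \<in> NC_tensor n \<Longrightarrow> cmod (L t) \<le> C * tnorm p n t" "C \<ge> 0"
  shows "dual_norm p n L \<le> ennreal C"
  unfolding dual_norm_def
proof (rule SUP_least)
  fix t assume "t \<in> {t \<in> NC_tensor n. tnorm p n t \<le> 1}"
  then have "cmod (L t) \<le> C * tnorm p n t" "tnorm p n t \<le> 1" using assms by auto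
  then have "cmod (L t) \<le> C" using assms(2) mult_left_le[of "tnorm p n t" C] by linarith
  then show "ennreal (cmod (L t)) \<le> ennreal C" by (rule ennreal_leI)
qed

text \<open>Rescaling is done with numbers \<open>r\<close> above the norm instead of the norm
  itself, which covers the case of norm 0; letting \<open>r\<close> decrease gives the
  bound.\<close>

lemma dual_norm_bound:
  assumes L: "L \<in> NC_tensor_dual n" and C: "dual_norm p n L \<le> ennreal C" "C \<ge> 0" and t: "t \<in> NC_tensor n"
  shows "cmod (L t) \<le> C * tnorm p n t"
proof -
  have unit: "cmod (L s) \<le> C" if "s \<in> NC_tensor n" "tnorm p n s \<le> 1" for s
  proof -
    have "ennreal (cmod (L s)) \<le> dual_norm p n L"
      unfolding dual_norm_def using that by (intro SUP_upper) auto
    then show ?thesis using C by (metis ennreal_le_iff order_trans)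
  qed
  have sc: "cmod (L t) \<le> C * r" if r: "r > 0" "tnorm p n t \<le> r" for r
  proof -
    let ?s = "fscl (of_real (1 / r)) t"
    have "tnorm p n ?s \<le> 1"
    proof -
      have "tnorm p n ?s \<le> cmod (of_real (1 / r)) * tnorm p n t" by (rule tnorm_scl_le[OF t])
      also have "\<dots> \<le> 1" using r by (simp add: norm_divide field_simps)
      finally show ?thesis .
    qed
    then have "cmod (L ?s) \<le> C" using unit NC_tensor_scl[OF t] by blast
    then show ?thesis using r by (simp add: dual_scl[OF L t] norm_mult norm_divide field_simps)
  qed
  show ?thesis
  proof (rule field_le_epsilon)
    fix e :: real assume e: "e > 0"
    have "cmod (L t) \<le> C * (tnorm p n t + e / (C + 1))"
      using e C by (intro sc) (auto simp: add_nonneg_pos)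
    also have "\<dots> \<le> C * tnorm p n t + e"
      using C e by (simp add: field_simps)
    finally show "cmod (L t) \<le> C * tnorm p n t + e" .
  qed
qed

lemma dual_bound:
  assumes "L \<in> NC_tensor_dual n"
  obtains p C where "C \<ge> 0" "\<And>q t. p \<le> q \<Longrightarrow> t \<in> NC_tensor n \<Longrightarrow> cmod (L t) \<le> C * tnorm q n t"
proof -
  obtain p where p: "dual_norm p n L < \<infinity>" using dualD(3)[OF assms] by blast
  define C where "C = enn2real (dual_norm p n L)"
  have C: "dual_norm p n L \<le> ennreal C" "C \<ge> 0" using p by (auto simp: C_def)
  have "cmod (L t) \<le> C * tnorm q n t" if "p \<le> q" "t \<in> NC_tensor n" for q t
    using dual_norm_bound[OF assms C that(2)] tnorm_mono[OF that(2,1)] C(2)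
    by (meson mult_left_mono order_trans)
  then show ?thesis using that C(2) by blast
qed

lemma NC_tensor_dualI:
  assumes "\<And>t. t \<notin> NC_tensor n \<Longrightarrow> L t = 0"
    "\<And>s t a b. s \<in> NC_tensor n \<Longrightarrow> t \<in> NC_tensor n \<Longrightarrow> L (fadd (fscl a s) (fscl b t)) = a * L s + b * L t"
    "\<And>t. t \<in> NC_tensor n \<Longrightarrow> cmod (L t) \<le> C * tnorm p n t" "C \<ge> 0"
  shows "L \<in> NC_tensor_dual n"
proof -
  have "dual_norm p n L < \<infinity>" using dual_norm_leI[OF assms(3,4)] by (simp add: order_le_less_trans)
  then show ?thesis using assms(1,2) unfolding NC_tensor_dual_def by blast
qed

lemma dual_lc:
  assumes K: "K \<in> NC_tensor_dual n" and L: "L \<in> NC_tensor_dual n"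
  shows "(\<lambda>t. a * K t + b * L t) \<in> NC_tensor_dual n"
proof -
  obtain p C where p: "C \<ge> 0" "\<And>q t. p \<le> q \<Longrightarrow> t \<in> NC_tensor n \<Longrightarrow> cmod (K t) \<le> C * tnorm q n t"
    using dual_bound[OF K] by metis
  obtain p' C' where p': "C' \<ge> 0" "\<And>q t. p' \<le> q \<Longrightarrow> t \<in> NC_tensor n \<Longrightarrow> cmod (L t) \<le> C' * tnorm q n t"
    using dual_bound[OF L] by metis
  let ?q = "max p p'"
  show ?thesis
  proof (rule NC_tensor_dualI[where C="cmod a * C + cmod b * C'" and p="?q"])
    fix t assume t: "t \<in> NC_tensor n"
    have "cmod (a * K t + b * L t) \<le> cmod a * cmod (K t) + cmod b * cmod (L t)"
      using norm_triangle_ineq[of "a * K t" "b * L t"] by (simp add: norm_mult)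
    also have "\<dots> \<le> cmod a * (C * tnorm ?q n t) + cmod b * (C' * tnorm ?q n t)"
      using t by (intro add_mono mult_left_mono p p') auto
    finally show "cmod (a * K t + b * L t) \<le> (cmod a * C + cmod b * C') * tnorm ?q n t"
      by (simp add: algebra_simps)
  qed (use p p' in \<open>auto simp: dualD[OF K] dualD[OF L] algebra_simps\<close>)
qed

lemma dual_tspan:
  assumes L: "L \<in> NC_tensor_dual n" and "snd ` set cs \<subseteq> NC"
  shows "L (tspan n cs) = (\<Sum>(c, \<theta>)\<leftarrow>cs. c * L (tensor_power n \<theta>))"
  using assms(2)
proof (induction cs)
  case (Cons c cs)
  then show ?case
    by (cases c) (auto simp: tspan_simps dual_add[OF L] dual_scl[OF L] tspan_NC NC_tensor_scl)
qed (simp add: tspan_simps dual_zero[OF L])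

text \<open>The difference is bounded by some \<open>tnorm p n\<close>, and for this norm the span
  of the tensor powers is dense.\<close>

lemma dual_eqI:
  assumes K: "K \<in> NC_tensor_dual n" and L: "L \<in> NC_tensor_dual n"
    and eq: "\<And>\<theta>. \<theta> \<in> NC \<Longrightarrow> K (tensor_power n \<theta>) = L (tensor_power n \<theta>)"
  shows "K = L"
proof
  fix t
  define M where "M = (\<lambda>t. 1 * K t + (-1) * L t)"
  have M: "M \<in> NC_tensor_dual n" unfolding M_def by (rule dual_lc[OF K L])
  obtain p C where C: "C \<ge> 0" "\<And>t. t \<in> NC_tensor n \<Longrightarrow> cmod (M t) \<le> C * tnorm p n t"
    using dual_bound[OF M] by (metis order_refl)
  show "K t = L t"
  proof (cases "t \<in> NC_tensor n")
    case True
    have "cmod (M t) \<le> 0"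
    proof (rule field_le_epsilon)
      fix e :: real assume e: "e > 0"
      obtain cs where cs: "snd ` set cs \<subseteq> NC" "tnorm p n (fadd t (fscl (-1) (tspan n cs))) \<le> e / (C + 1)"
        using tspan_dense[OF True, of "e / (C + 1)" p] e C(1) by (auto simp: add_nonneg_pos)
      have "M (tspan n cs) = (\<Sum>(c, \<theta>)\<leftarrow>cs. c * M (tensor_power n \<theta>))" by (rule dual_tspan[OF M cs(1)])
      also have "\<dots> = 0" using cs(1) by (induction cs) (auto simp: M_def eq)
      finally have "M t = M (fadd t (fscl (-1) (tspan n cs)))"
        using dual_add[OF M True NC_tensor_scl[OF tspan_NC[OF cs(1)]]] dual_scl[OF M tspan_NC[OF cs(1)]] by simp
      then have "cmod (M t) \<le> C * (e / (C + 1))"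
        using C(2)[of "fadd t (fscl (-1) (tspan n cs))"] cs(2) C(1)
          NC_tensor_add[OF True NC_tensor_scl[OF tspan_NC[OF cs(1)]]]
        by (metis mult_left_mono order_trans)
      also have "\<dots> \<le> 0 + e" using C e by (simp add: field_simps)
      finally show "cmod (M t) \<le> 0 + e" .
    qed
    then show ?thesis by (simp add: M_def)
  qed (simp add: dualD(1)[OF K] dualD(1)[OF L])
qed

text \<open>The hypothesis \<open>bd\<close> does two things: applied to a difference of lists it
  shows that the prescribed value depends on the tensor only, and it provides the continuity needed
  for extension to the closure.\<close>

lemma dual_extend:
  assumes bd: "\<And>cs. snd ` set cs \<subseteq> NC \<Longrightarrow> cmod (\<Sum>(c, \<theta>)\<leftarrow>cs. c * F \<theta>) \<le> C * tnorm p n (tspan n cs)" and C: "C \<ge> 0"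
  obtains L where "L \<in> NC_tensor_dual n" "\<And>\<theta>. \<theta> \<in> NC \<Longrightarrow> L (tensor_power n \<theta>) = F \<theta>"
    "dual_norm p n L \<le> ennreal C"
proof -
  define val where "val cs = (\<Sum>(c, \<theta>)\<leftarrow>cs. c * F \<theta>)" for cs
  define sub where "sub t cs = fadd t (fscl (-1) (tspan n cs))" for t cs
  define neg where "neg cs = map (\<lambda>(c, \<theta>). (- c, \<theta>)) cs" for cs :: "(complex \<times> ('h \<times> 'h)) list"
  have neg: "val (neg cs) = - val cs" "tspan n (neg cs) = fscl (-1) (tspan n cs)" "snd ` set (neg cs) = snd ` set cs" for cs
  proof -
    show "val (neg cs) = - val cs"
      unfolding val_def neg_def by (induction cs) auto
    show "tspan n (neg cs) = fscl (-1) (tspan n cs)"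
      unfolding tspan_def neg_def fscl_def fun_eq_iff by (induction cs) auto
    show "snd ` set (neg cs) = snd ` set cs" unfolding neg_def by force
  qed
  have sub_NC: "sub t cs \<in> NC_tensor n" if "t \<in> NC_tensor n" "snd ` set cs \<subseteq> NC" for t cs
    unfolding sub_def using that by (intro NC_tensor_add NC_tensor_scl tspan_NC)
  have diff: "cmod (val cs - val ds) \<le> C * (tnorm p n (sub t cs) + tnorm p n (sub t ds))"
    if t: "t \<in> NC_tensor n" and cs: "snd ` set cs \<subseteq> NC" and ds: "snd ` set ds \<subseteq> NC" for t cs ds
  proof -
    have "cmod (val (cs @ neg ds)) \<le> C * tnorm p n (tspan n (cs @ neg ds))"
      unfolding val_def by (rule bd) (use cs ds neg(3)[of ds] in \<open>simp add: image_Un\<close>)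
    also have "val (cs @ neg ds) = val cs - val ds" using neg(1)[of ds] by (simp add: val_def)
    also have "tspan n (cs @ neg ds) = fadd (fscl 1 (sub t ds)) (fscl (-1) (sub t cs))"
      unfolding tspan_append neg(2) by (auto simp: sub_def fadd_def fscl_def)
    also have "tnorm p n \<dots> \<le> tnorm p n (sub t cs) + tnorm p n (sub t ds)"
      using tnorm_lc[OF sub_NC[OF t ds] sub_NC[OF t cs], of p 1 "-1"] by simp
    finally show ?thesis using C by (simp add: mult_left_mono)
  qed
  \<comment> \<open>The extended value is pinned down by closeness to the values of all formal
    combinations at once, so that linearity can be checked with any convenient approximants.\<close>
  have "\<exists>v. \<forall>cs. snd ` set cs \<subseteq> NC \<longrightarrow> cmod (v - val cs) \<le> C * tnorm p n (sub t cs)" if t: "t \<in> NC_tensor n" for t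
  proof -
    have "\<exists>cs. snd ` set cs \<subseteq> NC \<and> tnorm p n (sub t cs) \<le> 1 / Suc k" for k
      using tspan_dense[OF t, of "1 / Suc k" p] unfolding sub_def by (metis divide_pos_pos of_nat_0_less_iff zero_less_Suc zero_less_one)
    then obtain cs where cs: "\<And>k. snd ` set (cs k) \<subseteq> NC" "\<And>k. tnorm p n (sub t (cs k)) \<le> 1 / Suc k" by metis
    have lim0: "(\<lambda>k. tnorm p n (sub t (cs k))) \<longlonglongrightarrow> 0"
      by (rule Lim_null_comparison[OF _ LIMSEQ_inverse_real_of_nat])
        (use cs(2) in \<open>auto simp: inverse_eq_divide\<close>)
    have "Cauchy (\<lambda>k. val (cs k))"
    proof (rule metric_CauchyI)
      fix e :: real assume e: "e > 0"
      have "(\<lambda>k. C * tnorm p n (sub t (cs k))) \<longlonglongrightarrow> C * 0" by (intro tendsto_intros lim0)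
      then have "\<forall>\<^sub>F k in sequentially. C * tnorm p n (sub t (cs k)) < e / 2"
        using e by (intro order_tendstoD(2)) auto
      then obtain k0 where k0: "\<And>k. k \<ge> k0 \<Longrightarrow> C * tnorm p n (sub t (cs k)) < e / 2"
        by (auto simp: eventually_sequentially)
      have "dist (val (cs k)) (val (cs j)) < e" if "k \<ge> k0" "j \<ge> k0" for k j
        using diff[OF t cs(1) cs(1), of k j] k0[OF that(1)] k0[OF that(2)]
        by (simp add: dist_norm algebra_simps)
      then show "\<exists>M. \<forall>m\<ge>M. \<forall>n\<ge>M. dist (val (cs m)) (val (cs n)) < e" by blast
    qed
    then obtain v where v: "(\<lambda>k. val (cs k)) \<longlonglongrightarrow> v"
      using Cauchy_convergent_iff convergent_def by blast
    have "cmod (v - val ds) \<le> C * tnorm p n (sub t ds)" if ds: "snd ` set ds \<subseteq> NC" for ds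
    proof -
      have "(\<lambda>k. C * (tnorm p n (sub t (cs k)) + tnorm p n (sub t ds))) \<longlonglongrightarrow> C * (0 + tnorm p n (sub t ds))"
        by (intro tendsto_intros lim0)
      moreover have "(\<lambda>k. cmod (val (cs k) - val ds)) \<longlonglongrightarrow> cmod (v - val ds)" by (intro tendsto_intros v)
      ultimately show ?thesis
        using LIMSEQ_le[of "\<lambda>k. cmod (val (cs k) - val ds)"] diff[OF t cs(1) ds] by fastforce
    qed
    then show ?thesis by blast
  qed
  then obtain V where V: "\<And>t cs. t \<in> NC_tensor n \<Longrightarrow> snd ` set cs \<subseteq> NC \<Longrightarrow> cmod (V t - val cs) \<le> C * tnorm p n (sub t cs)"
    by metis
  define L where "L t = (if t \<in> NC_tensor n then V t else 0)" for t
  have bound: "cmod (L t) \<le> C * tnorm p n t" if "t \<in> NC_tensor n" for t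
    using V[OF that, of "[]"] that by (simp add: L_def val_def sub_def tspan_simps fscl_def)
  have lin: "L (fadd (fscl a s) (fscl b t)) = a * L s + b * L t"
    if s: "s \<in> NC_tensor n" and t: "t \<in> NC_tensor n" for s t a b
  proof -
    let ?u = "fadd (fscl a s) (fscl b t)"
    have u: "?u \<in> NC_tensor n" by (rule NC_tensor_lc[OF s t])
    have "cmod (V ?u - (a * V s + b * V t)) \<le> 0"
    proof (rule field_le_epsilon)
      fix e :: real assume e: "e > 0"
      \<comment> \<open>The approximation errors enter at most
        \<open>2 * (cmod a + cmod b) * C\<close> times; the added ones keep \<open>A\<close>
        positive.\<close>
      define A where "A = 2 * (cmod a + cmod b + 1) * (C + 1)"
      have A: "A > 0" unfolding A_def using C by (intro mult_pos_pos) (auto intro: add_nonneg_pos)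
      define d where "d = e / A"
      have d: "d > 0" using e A by (simp add: d_def)
      obtain cs where cs: "snd ` set cs \<subseteq> NC" "tnorm p n (sub s cs) \<le> d"
        using tspan_dense[OF s d] unfolding sub_def by metis
      obtain ds where ds: "snd ` set ds \<subseteq> NC" "tnorm p n (sub t ds) \<le> d"
        using tspan_dense[OF t d] unfolding sub_def by metis
      define es where "es = map (\<lambda>(c, \<theta>). (a * c, \<theta>)) cs @ map (\<lambda>(c, \<theta>). (b * c, \<theta>)) ds"
      have es: "snd ` set es \<subseteq> NC" using cs(1) ds(1) unfolding es_def by force
      have vm: "val (map (\<lambda>(c, \<theta>). (a * c, \<theta>)) cs) = a * val cs" for a cs
        unfolding val_def by (induction cs) (auto simp: algebra_simps)
      have tm: "tspan n (map (\<lambda>(c, \<theta>). (a * c, \<theta>)) cs) = fscl a (tspan n cs)" for a cs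
        unfolding tspan_def fscl_def fun_eq_iff by (induction cs) (auto simp: algebra_simps)
      have ve: "val es = a * val cs + b * val ds"
        using vm[of a cs] vm[of b ds] by (simp add: es_def val_def)
      have "sub ?u es = fadd (fscl a (sub s cs)) (fscl b (sub t ds))"
        unfolding sub_def es_def tspan_append tm by (auto simp: fadd_def fscl_def algebra_simps)
      then have "tnorm p n (sub ?u es) \<le> cmod a * tnorm p n (sub s cs) + cmod b * tnorm p n (sub t ds)"
        using tnorm_lc[OF sub_NC[OF s cs(1)] sub_NC[OF t ds(1)]] by simp
      also have "\<dots> \<le> cmod a * d + cmod b * d" using cs(2) ds(2) by (intro add_mono mult_left_mono) auto
      finally have 1: "cmod (V ?u - val es) \<le> C * (cmod a * d + cmod b * d)"
        using V[OF u es] C by (meson mult_left_mono order_trans)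
      have 2: "cmod (V s - val cs) \<le> C * d" "cmod (V t - val ds) \<le> C * d"
        using V[OF s cs(1)] V[OF t ds(1)] cs(2) ds(2) C by (meson mult_left_mono order_trans)+
      have "V ?u - (a * V s + b * V t) = (V ?u - val es) - (a * (V s - val cs) + b * (V t - val ds))"
        by (simp add: ve algebra_simps)
      also have "cmod \<dots> \<le> cmod (V ?u - val es) + (cmod a * cmod (V s - val cs) + cmod b * cmod (V t - val ds))"
        by (metis (no_types, lifting) add_left_mono norm_mult norm_triangle_ineq norm_triangle_ineq4 order_trans)
      also have "\<dots> \<le> C * (cmod a * d + cmod b * d) + (cmod a * (C * d) + cmod b * (C * d))"
        by (intro add_mono mult_left_mono 1 2) auto
      also have "\<dots> = 2 * (cmod a + cmod b) * C * d" by (simp add: algebra_simps)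
      also have "\<dots> \<le> A * d"
        unfolding A_def using C d by (intro mult_right_mono mult_mono) auto
      also have "\<dots> = 0 + e" using A by (simp add: d_def)
      finally show "cmod (V ?u - (a * V s + b * V t)) \<le> 0 + e" .
    qed
    then show ?thesis using u s t by (simp add: L_def)
  qed
  have "L \<in> NC_tensor_dual n"
    by (rule NC_tensor_dualI[OF _ lin bound C]) (auto simp: L_def)
  moreover have "L (tensor_power n \<theta>) = F \<theta>" if \<theta>: "\<theta> \<in> NC" for \<theta>
  proof -
    have "sub (tensor_power n \<theta>) [(1, \<theta>)] = (\<lambda>_. 0)"
      by (simp add: sub_def tspan_simps fadd_def fscl_def)
    moreover have "tnorm p n (\<lambda>_. 0) \<le> 0" by (rule tnorm_leI) (auto simp: tsum_def)
    ultimately have "C * tnorm p n (sub (tensor_power n \<theta>) [(1, \<theta>)]) \<le> 0"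
      using C by (simp add: mult_nonneg_nonpos)
    moreover have "cmod (V (tensor_power n \<theta>) - val [(1, \<theta>)]) \<le> C * tnorm p n (sub (tensor_power n \<theta>) [(1, \<theta>)])"
      using \<theta> by (intro V) auto
    ultimately have "cmod (V (tensor_power n \<theta>) - val [(1, \<theta>)]) \<le> 0" by linarith
    then show ?thesis using \<theta> by (simp add: L_def val_def)
  qed
  moreover have "dual_norm p n L \<le> ennreal C" by (rule dual_norm_leI[OF bound C])
  ultimately show ?thesis using that by blast
qed

section \<open>Polynomials and Taylor coefficients on the complexification\<close>

lemma NC_intros [simp, intro]:
  "0 \<in> NC" "x \<in> NC \<Longrightarrow> y \<in> NC \<Longrightarrow> x + y \<in> NC" "x \<in> NC \<Longrightarrow> y \<in> NC \<Longrightarrow> x - y \<in> NC"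
  "x \<in> NC \<Longrightarrow> cscale c x \<in> NC"
  by (auto simp: NC_def cscale_def zero_prod_def)

lemma cscale_simps [simp]:
  "cscale 1 x = x" "cscale 0 x = 0" "cscale c 0 = 0" "cscale a (cscale b x) = cscale (a * b) x"
  by (auto simp: cscale_def zero_prod_def prod_eq_iff algebra_simps)

lemma cscale_add: "cscale (a + b) x = cscale a x + cscale b x" "cscale a (x + y) = cscale a x + cscale a y"
  by (auto simp: cscale_def prod_eq_iff algebra_simps)

lemma NC_fst_snd: "x \<in> NC \<Longrightarrow> fst x \<in> N" "x \<in> NC \<Longrightarrow> snd x \<in> N"
  by (auto simp: NC_def)

lemma cnorm_sq: "x \<in> NC \<Longrightarrow> (cnorm p x)\<^sup>2 = ip p (fst x) (fst x) + ip p (snd x) (snd x)"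
  using NC_fst_snd[of x] by (simp add: cnorm_def Hs.nrm_sq N_Hp)

lemma cnorm_cscale:
  assumes x: "x \<in> NC"
  shows "cnorm p (cscale c x) = cmod c * cnorm p x"
proof (rule power2_eq_imp_eq)
  note H = NC_fst_snd[OF x, THEN N_Hp]
  have "(cnorm p (cscale c x))\<^sup>2 = ((Re c)\<^sup>2 + (Im c)\<^sup>2) * (ip p (fst x) (fst x) + ip p (snd x) (snd x))"
    unfolding cnorm_sq[OF NC_intros(4)[OF x]]
    using H[of p] Hs.ip_sym[OF H(1)[of p] H(2)[of p]] by (simp add: cscale_def algebra_simps power2_eq_square)
  also have "\<dots> = (cmod c * cnorm p x)\<^sup>2"
    by (simp add: power_mult_distrib cnorm_sq[OF x] cmod_power2)
  finally show "(cnorm p (cscale c x))\<^sup>2 = (cmod c * cnorm p x)\<^sup>2" .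
qed auto

lemma cnorm_triangle:
  assumes x: "x \<in> NC" and y: "y \<in> NC"
  shows "cnorm p (x + y) \<le> cnorm p x + cnorm p y"
proof -
  note H = NC_fst_snd[OF x, THEN N_Hp] NC_fst_snd[OF y, THEN N_Hp]
  have "cnorm p (x + y) \<le> sqrt ((nm p (fst x) + nm p (fst y))\<^sup>2 + (nm p (snd x) + nm p (snd y))\<^sup>2)"
    unfolding cnorm_def using Hs.nrm_triangle H by (intro real_sqrt_le_mono add_mono power_mono) auto
  also have "\<dots> \<le> cnorm p x + cnorm p y"
    unfolding cnorm_def by (rule real_sqrt_sum_squares_triangle_ineq)
  finally show ?thesis .
qed

lemma cnorm_eq_0: "x \<in> NC \<Longrightarrow> cnorm p x = 0 \<longleftrightarrow> x = 0"
  using NC_fst_snd[of x, THEN N_Hp] by (auto simp: cnorm_def prod_eq_iff sum_power2_eq_zero_iff)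

lemma cnorm_0 [simp]: "cnorm p 0 = 0"
  using cnorm_eq_0[of 0] by simp

lemma cnorm_mono: "p \<le> q \<Longrightarrow> x \<in> NC \<Longrightarrow> cnorm p x \<le> cnorm q x"
  unfolding cnorm_def using NC_fst_snd[of x, THEN N_Hp] nm_mono
  by (intro real_sqrt_le_mono add_mono power_mono) auto

text \<open>A stand-in for polynomials of degree at most \<open>n\<close>, described by growth only.
  Cauchy's estimate and Liouville's theorem work on complex lines, so no joint continuity is
  demanded.\<close>

definition Pol :: "nat \<Rightarrow> nat \<Rightarrow> ('h \<times> 'h \<Rightarrow> complex) \<Rightarrow> bool" where
  "Pol p n F \<longleftrightarrow> (\<forall>x\<in>NC. \<forall>y\<in>NC. (\<lambda>z. F (x + cscale z y)) holomorphic_on UNIV) \<and>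
     (\<exists>C\<ge>0. \<forall>x\<in>NC. cmod (F x) \<le> C * (1 + cnorm p x) ^ n)"

definition Dl :: "'h \<times> 'h \<Rightarrow> ('h \<times> 'h \<Rightarrow> complex) \<Rightarrow> 'h \<times> 'h \<Rightarrow> complex" where
  "Dl h F = (\<lambda>x. F (x + h) - F x)"

lemma Dl_apply: "Dl h F x = F (x + h) - F x"
  by (simp add: Dl_def)

fun dif :: "('h \<times> 'h) list \<Rightarrow> ('h \<times> 'h \<Rightarrow> complex) \<Rightarrow> 'h \<times> 'h \<Rightarrow> complex" where
  "dif [] F = F"
| "dif (h # hs) F = Dl h (dif hs F)"

lemma Pol_hol: "Pol p n F \<Longrightarrow> x \<in> NC \<Longrightarrow> y \<in> NC \<Longrightarrow> (\<lambda>z. F (x + cscale z y)) holomorphic_on UNIV"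
  by (auto simp: Pol_def)

text \<open>Cauchy's estimate on discs of radius \<open>1 + |x|\<close> shows that a difference lowers the growth
  order by one.\<close>

lemma Pol_Dl:
  assumes F: "Pol p (Suc n) F" and h: "h \<in> NC"
  shows "Pol p n (Dl h F)"
proof -
  obtain C where C: "C \<ge> 0" "\<And>x. x \<in> NC \<Longrightarrow> cmod (F x) \<le> C * (1 + cnorm p x) ^ Suc n"
    using F unfolding Pol_def by blast
  have "(\<lambda>z. Dl h F (x + cscale z y)) holomorphic_on UNIV" if "x \<in> NC" "y \<in> NC" for x y
  proof -
    have "(\<lambda>z. F ((x + h) + cscale z y) - F (x + cscale z y)) holomorphic_on UNIV"
      using that h by (intro holomorphic_intros Pol_hol[OF F]) auto
    then show ?thesis by (simp add: Dl_def add_ac)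
  qed
  moreover have "cmod (Dl h F x) \<le> C * (1 + 2 * cnorm p h) ^ Suc n * (1 + cnorm p x) ^ n" if x: "x \<in> NC" for x
  proof -
    define g where "g z = F (x + cscale z h)" for z
    define R where "R = 1 + cnorm p x"
    have R: "R \<ge> 1" by (simp add: R_def)
    \<comment> \<open>On the disc of radius \<open>1 + R\<close>, with \<open>R \<ge> 1\<close>, the
      quantity \<open>1 + cnorm p (x + cscale u h)\<close> is at most
      \<open>R * (1 + 2 * cnorm p h)\<close>.\<close>
    define B where "B = C * (R * (1 + 2 * cnorm p h)) ^ Suc n"
    have hol: "g holomorphic_on UNIV" unfolding g_def by (rule Pol_hol[OF F x h])
    have gb: "cmod (g u) \<le> B" if u: "cmod u \<le> 1 + R" for u
    proof -
      have xu: "x + cscale u h \<in> NC" using x h by auto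
      have "cnorm p (x + cscale u h) \<le> cnorm p x + cmod u * cnorm p h"
        using cnorm_triangle[OF x NC_intros(4)[OF h]] cnorm_cscale[OF h] by metis
      also have "\<dots> \<le> cnorm p x + 2 * R * cnorm p h"
        using u R by (intro add_left_mono mult_right_mono) auto
      finally have "1 + cnorm p (x + cscale u h) \<le> R * (1 + 2 * cnorm p h)"
        by (simp add: R_def algebra_simps)
      then have "(1 + cnorm p (x + cscale u h)) ^ Suc n \<le> (R * (1 + 2 * cnorm p h)) ^ Suc n"
        by (intro power_mono) auto
      then show ?thesis
        unfolding g_def B_def using C(2)[OF xu] C(1) by (meson mult_left_mono order_trans)
    qed
    have gd: "cmod (deriv g w) \<le> B / R" if w: "cmod w \<le> 1" for w
    proof -
      have "norm ((deriv ^^ 1) g w) \<le> fact 1 * B / R ^ 1"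
      proof (rule Cauchy_inequality)
        fix u assume "cmod (w - u) = R"
        then have "cmod u \<le> 1 + R" using w norm_triangle_ineq3[of u w] by (simp add: norm_minus_commute)
        then show "cmod (g u) \<le> B" by (rule gb)
      qed (use hol R in \<open>auto intro: holomorphic_on_subset holomorphic_on_imp_continuous_on\<close>)
      then show ?thesis by simp
    qed
    have "cmod (g 1 - g 0) \<le> B / R * cmod (1 - 0)"
    proof (rule field_differentiable_bound[where S="cball 0 1" and f'="deriv g"])
      fix z :: complex assume "z \<in> cball 0 1"
      show "(g has_field_derivative deriv g z) (at z within cball 0 1)"
        using hol by (meson UNIV_I holomorphic_derivI open_UNIV has_field_derivative_at_within)
    qed (use gd in auto)
    also have "B / R * cmod (1 - 0) = C * (1 + 2 * cnorm p h) ^ Suc n * R ^ n"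
      unfolding B_def power_mult_distrib using R by simp
    finally show ?thesis by (simp add: g_def Dl_def R_def)
  qed
  moreover have "C * (1 + 2 * cnorm p h) ^ Suc n \<ge> 0" using C by simp
  ultimately show ?thesis unfolding Pol_def by blast
qed

lemma Pol_0_const:
  assumes F: "Pol p 0 F" and x: "x \<in> NC"
  shows "F x = F 0"
proof -
  obtain C where C: "\<And>x. x \<in> NC \<Longrightarrow> cmod (F x) \<le> C" using F unfolding Pol_def by auto
  have "(\<lambda>z. F (0 + cscale z x)) constant_on UNIV"
  proof (rule Liouville_theorem[OF Pol_hol[OF F _ x]])
    show "bounded (range (\<lambda>z. F (0 + cscale z x)))"
      by (intro boundedI[of _ C], elim rangeE, simp only:, intro C) (use x in simp)
  qed auto
  then obtain c where "\<And>z. F (0 + cscale z x) = c" unfolding constant_on_def by auto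
  from this[of 0] this[of 1] show ?thesis by simp
qed

lemma Pol_dif: "Pol p (length hs + n) F \<Longrightarrow> set hs \<subseteq> NC \<Longrightarrow> Pol p n (dif hs F)"
proof (induction hs arbitrary: n)
  case (Cons h hs)
  then have "Pol p (Suc n) (dif hs F)" using Cons.IH[of "Suc n"] by simp
  then show ?case using Pol_Dl Cons.prems by simp
qed simp

lemma Dl_commute: "Dl a (Dl b F) = Dl b (Dl a F)"
  by (auto simp: Dl_def fun_eq_iff add_ac)

lemma dif_Dl: "dif hs (Dl h F) = Dl h (dif hs F)"
  by (induction hs) (simp_all add: Dl_commute[of h])

text \<open>By additivity all derivatives equal the one at 0, so the function is affine, and it
  vanishes at 0.\<close>

lemma additive_entire_linear:
  fixes a :: "complex \<Rightarrow> complex"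
  assumes hol: "a holomorphic_on UNIV" and add: "\<And>z w. a (z + w) = a z + a w"
  shows "a z = z * a 1"
proof -
  have d0: "(a has_field_derivative deriv a 0) (at 0)"
    using hol by (meson UNIV_I holomorphic_derivI open_UNIV)
  have d: "(a has_field_derivative deriv a 0) (at z)" for z
  proof -
    have "((\<lambda>w. a (w - z) + a z) has_field_derivative deriv a 0 * 1 + 0) (at z)"
      by (rule DERIV_add[OF DERIV_chain'[where f="\<lambda>w. w - z" and g=a]]) (use d0 in \<open>auto intro!: derivative_eq_intros\<close>)
    moreover have "(\<lambda>w. a (w - z) + a z) = a"
    proof
      show "a (w - z) + a z = a w" for w using add[of "w - z" z] by simp
    qed
    ultimately show ?thesis by simp
  qed
  have "((\<lambda>w. a w - deriv a 0 * w) has_field_derivative 0) (at z)" for z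
    using d[of z] by (auto intro!: derivative_eq_intros)
  then obtain c where c: "\<And>z. a z - deriv a 0 * z = c"
    using has_field_derivative_zero_constant[of UNIV "\<lambda>w. a w - deriv a 0 * w"] by auto
  have "a 0 = 0" using add[of 0 0] by simp
  then have "c = 0" using c[of 0] by simp
  then have "a z = deriv a 0 * z" "a 1 = deriv a 0" using c[of z] c[of 1] by auto
  then show ?thesis by (metis mult.commute)
qed

text \<open>Differences of a function of order 1 have order 0 and are constant, which is additivity.
  Complex homogeneity then comes from holomorphy along lines.\<close>

lemma Pol_1_affine:
  assumes G: "Pol p 1 G"
  shows "x \<in> NC \<Longrightarrow> y \<in> NC \<Longrightarrow> G (x + y) - G 0 = (G x - G 0) + (G y - G 0)"
    "x \<in> NC \<Longrightarrow> G (cscale c x) - G 0 = c * (G x - G 0)"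
proof -
  show add: "G (x + y) - G 0 = (G x - G 0) + (G y - G 0)" if "x \<in> NC" "y \<in> NC" for x y
  proof -
    have "Dl y G x = Dl y G 0" by (rule Pol_0_const[OF Pol_Dl]) (use G that in simp_all)
    then have "G (x + y) = G x + (G y - G 0)" by (simp add: Dl_def algebra_simps)
    then show ?thesis by simp
  qed
  assume x: "x \<in> NC"
  define a where "a z = G (0 + cscale z x) - G 0" for z
  have "a c = c * a 1"
  proof (rule additive_entire_linear)
    show "a holomorphic_on UNIV" unfolding a_def
      using Pol_hol[OF G _ x, of 0] by (intro holomorphic_intros) auto
    show "a (z + w) = a z + a w" for z w
      using add[of "cscale z x" "cscale w x"] x by (simp add: a_def cscale_add)
  qed
  then show "G (cscale c x) - G 0 = c * (G x - G 0)" by (simp add: a_def)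
qed

abbreviation "cmlin \<equiv> mlin NC cscale (\<lambda>z. z)"

text \<open>After all other differences have been taken, a function of order 1 remains, and its
  increment from 0 is linear. Since differences commute, the head can be moved innermost for the
  induction.\<close>

lemma cmlin_dif: "Pol p n F \<Longrightarrow> cmlin n (\<lambda>hs. dif hs F 0)"
proof (induction n arbitrary: F)
  case (Suc n)
  have G: "Pol p 1 (dif hs F)" if "hs \<in> Lst NC n" for hs
    using Pol_dif[of p hs 1 F] Suc.prems that by (auto simp: Lst_def)
  have "cmlin n (\<lambda>hs. dif (h # hs) F 0)" if "h \<in> NC" for h
    using Suc.IH[OF Pol_Dl[OF Suc.prems that]] by (simp add: dif_Dl)
  then show ?case
    using Pol_1_affine[OF G] by (simp add: Dl_apply)
qed simp

text \<open>The difference is a signed sum of \<open>2 ^ length hs\<close> values of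
  \<open>F\<close>, at points whose norm is at most \<open>cnorm p x\<close> plus the norms of the
  steps.\<close>

lemma dif_bound:
  assumes F: "\<And>x. x \<in> NC \<Longrightarrow> cmod (F x) \<le> C * cnorm p x ^ n" and C: "C \<ge> 0"
  shows "x \<in> NC \<Longrightarrow> set hs \<subseteq> NC \<Longrightarrow> cmod (dif hs F x) \<le> 2 ^ length hs * C * (cnorm p x + (\<Sum>h\<leftarrow>hs. cnorm p h)) ^ n"
proof (induction hs arbitrary: x)
  case (Cons h hs)
  have h: "h \<in> NC" and hs: "set hs \<subseteq> NC" using Cons.prems by auto
  let ?s = "\<Sum>h\<leftarrow>hs. cnorm p h"
  have s0: "?s \<ge> 0" by (induction hs) auto
  have "cmod (dif (h # hs) F x) \<le> cmod (dif hs F (x + h)) + cmod (dif hs F x)"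
    by (simp add: Dl_apply norm_triangle_ineq4)
  also have "\<dots> \<le> 2 ^ length hs * C * (cnorm p (x + h) + ?s) ^ n + 2 ^ length hs * C * (cnorm p x + ?s) ^ n"
    using Cons.IH[of "x + h"] Cons.IH[of x] Cons.prems h hs by (intro add_mono) auto
  also have "\<dots> \<le> 2 ^ length hs * C * (cnorm p x + cnorm p h + ?s) ^ n + 2 ^ length hs * C * (cnorm p x + cnorm p h + ?s) ^ n"
    using C s0 cnorm_triangle[OF Cons.prems(1) h, of p] by (intro add_mono mult_left_mono power_mono) auto
  finally show ?case by (simp add: add_ac mult_ac)
qed (use F in simp)

text \<open>Each argument is normalised in turn by homogeneity; at a zero head the form
  vanishes.\<close>

lemma cmlin_bound:
  assumes "cmlin n T" "\<And>hs. hs \<in> Lst NC n \<Longrightarrow> (\<forall>h\<in>set hs. cnorm p h \<le> 1) \<Longrightarrow> cmod (T hs) \<le> B"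
    and "hs \<in> Lst NC n"
  shows "cmod (T hs) \<le> B * (\<Prod>h\<leftarrow>hs. cnorm p h)"
  using assms
proof (induction n arbitrary: T hs B)
  case (Suc n)
  then obtain h gs where hs: "hs = h # gs" "h \<in> NC" "gs \<in> Lst NC n"
    unfolding Lst_Suc by auto
  show ?case
  proof (cases "h = 0")
    case True
    have "T ((0 + 0) # gs) = T (0 # gs) + T (0 # gs)"
      using Suc.prems(1) hs(3) unfolding mlin.simps by blast
    then show ?thesis using True hs by simp
  next
    case False
    define r where "r = cnorm p h"
    have r: "r > 0" using False cnorm_eq_0[OF hs(2), of p] cnorm_nonneg[of p h] unfolding r_def by linarith
    define k where "k = cscale (of_real (1 / r)) h"
    have k: "k \<in> NC" "cnorm p k \<le> 1" using r hs(2) by (auto simp: k_def cnorm_cscale norm_divide r_def)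
    have "cmod (T (k # gs)) \<le> B * (\<Prod>h\<leftarrow>gs. cnorm p h)"
    proof (rule Suc.IH[of "\<lambda>gs. T (k # gs)"])
      fix gs assume "gs \<in> Lst NC n" "\<forall>h\<in>set gs. cnorm p h \<le> 1"
      then show "cmod (T (k # gs)) \<le> B" using Suc.prems(2)[of "k # gs"] k by simp
    qed (use Suc.prems(1) k hs(3) in auto)
    moreover have "T (k # gs) = of_real (1 / r) * T (h # gs)"
      unfolding k_def using Suc.prems(1) hs(2,3) unfolding mlin.simps by blast
    ultimately show ?thesis using r hs(1) by (simp add: norm_mult norm_divide r_def field_simps)
  qed
qed simp

section \<open>Iterated differences of powers and the diagonal of the polarised form\<close>

fun dd :: "nat \<Rightarrow> (complex \<Rightarrow> complex) \<Rightarrow> complex \<Rightarrow> complex" where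
  "dd 0 g = g"
| "dd (Suc m) g = dd m (\<lambda>z. g (z + 1) - g z)"

lemma dd_sum: "dd m (\<lambda>z. \<Sum>j\<in>J. c j * g j z) z = (\<Sum>j\<in>J. c j * dd m (g j) z)"
  by (induction m arbitrary: g) (simp_all add: sum_subtractf[symmetric] right_diff_distrib[symmetric])

text \<open>By the binomial theorem one difference turns the \<open>k\<close>-th power into lower
  powers, the leading one with coefficient \<open>k\<close>.\<close>

lemma dd_power: "(k < m \<longrightarrow> dd m (\<lambda>z. z ^ k) z = 0) \<and> dd m (\<lambda>z. z ^ m) z = fact m"
proof (induction m arbitrary: k)
  case (Suc m)
  have eq: "dd (Suc m) (\<lambda>z. z ^ k) z = (\<Sum>j<k. of_nat (k choose j) * dd m (\<lambda>z. z ^ j) z)" for k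
  proof -
    have "(z + 1) ^ k - z ^ k = (\<Sum>j<k. of_nat (k choose j) * z ^ j)" for z :: complex
      using binomial_ring[of z 1 k] by (simp add: lessThan_Suc_atMost[symmetric])
    then show ?thesis by (simp add: dd_sum)
  qed
  have "dd (Suc m) (\<lambda>z. z ^ k) z = 0" if "k < Suc m"
    unfolding eq by (rule sum.neutral) (use Suc.IH that in auto)
  moreover have "dd (Suc m) (\<lambda>z. z ^ Suc m) z = fact (Suc m)"
  proof -
    have "(\<Sum>j<m. of_nat (Suc m choose j) * dd m (\<lambda>z. z ^ j) z) = 0"
      by (rule sum.neutral) (use Suc.IH in auto)
    then show ?thesis unfolding eq using Suc.IH[of 0] by simp
  qed
  ultimately show ?case by blast
qed simp

lemma dif_replicate: "dif (replicate m h) F (cscale z h) = dd m (\<lambda>z. F (cscale z h)) z"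
proof (induction m arbitrary: F)
  case (Suc m)
  have "dif (replicate (Suc m) h) F = dif (replicate m h) (Dl h F)" by (simp add: dif_Dl)
  then have "dif (replicate (Suc m) h) F (cscale z h) = dd m (\<lambda>z. Dl h F (cscale z h)) z"
    by (simp only: Suc.IH)
  also have "(\<lambda>z. Dl h F (cscale z h)) = (\<lambda>z. F (cscale (z + 1) h) - F (cscale z h))"
    by (simp add: Dl_def cscale_add)
  finally show ?case by simp
qed simp

text \<open>Along the line through \<open>h\<close> the function is a multiple of the
  \<open>n\<close>-th power, whose \<open>n\<close>-th difference is \<open>fact n\<close>. Hence
  dividing by \<open>fact n\<close> polarises a homogeneous function.\<close>

lemma dif_diag:
  assumes "\<And>z. F (cscale z h) = z ^ n * F h"
  shows "dif (replicate n h) F 0 = fact n * F h"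
proof -
  have "dif (replicate n h) F (cscale 0 h) = dd n (\<lambda>z. \<Sum>j\<in>{0::nat}. F h * z ^ n) 0"
    unfolding dif_replicate by (simp add: assms mult.commute)
  also have "\<dots> = fact n * F h" unfolding dd_sum using dd_power[of 0 n 0] by simp
  finally show ?thesis by simp
qed

section \<open>Taylor coefficients of functions bounded and Gateaux holomorphic on a ball\<close>

definition bounded_hol :: "nat \<Rightarrow> real \<Rightarrow> real \<Rightarrow> ('h \<times> 'h \<Rightarrow> complex) \<Rightarrow> bool" where
  "bounded_hol p r M G \<longleftrightarrow> r > 0 \<and> (\<forall>\<theta>\<in>NC. cnorm p \<theta> \<le> r \<longrightarrow> cmod (G \<theta>) \<le> M \<and>
     (\<forall>\<eta>\<in>NC. (\<lambda>z. G (\<theta> + cscale z \<eta>)) analytic_on {0}))"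

definition tcoeff :: "('h \<times> 'h \<Rightarrow> complex) \<Rightarrow> nat \<Rightarrow> 'h \<times> 'h \<Rightarrow> complex" where
  "tcoeff G n \<theta> = (deriv ^^ n) (\<lambda>z. G (cscale z \<theta>)) 0 / fact n"

lemma bounded_hol_analytic:
  assumes G: "bounded_hol p r M G" and "x \<in> NC" "y \<in> NC" "cnorm p (x + cscale z y) \<le> r"
  shows "(\<lambda>z. G (x + cscale z y)) analytic_on {z}"
proof -
  have "(\<lambda>w. G ((x + cscale z y) + cscale w y)) analytic_on {0}"
    using assms unfolding bounded_hol_def by auto
  then have "(\<lambda>w. G ((x + cscale z y) + cscale w y)) \<circ> (\<lambda>u. u - z) analytic_on {z}"
    by (intro analytic_on_compose) (auto intro!: analytic_intros)
  moreover have "(\<lambda>w. G ((x + cscale z y) + cscale w y)) \<circ> (\<lambda>u. u - z) = (\<lambda>z. G (x + cscale z y))"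
  proof
    fix u
    have "cscale u y = cscale z y + cscale (u - z) y" using cscale_add(1)[of z "u - z" y] by simp
    then show "((\<lambda>w. G ((x + cscale z y) + cscale w y)) \<circ> (\<lambda>u. u - z)) u = G (x + cscale u y)"
      by (simp add: add.assoc)
  qed
  ultimately show ?thesis by simp
qed

lemma bounded_hol_line:
  assumes G: "bounded_hol p r M G" and \<theta>: "\<theta> \<in> NC" and \<rho>: "\<rho> * cnorm p \<theta> \<le> r"
  shows "(\<lambda>z. G (cscale z \<theta>)) holomorphic_on cball 0 \<rho>"
proof -
  have "(\<lambda>z. G (0 + cscale z \<theta>)) analytic_on {z}" if "z \<in> cball 0 \<rho>" for z
  proof (rule bounded_hol_analytic[OF G _ \<theta>])
    have "cmod z * cnorm p \<theta> \<le> \<rho> * cnorm p \<theta>" using that by (intro mult_right_mono) auto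
    then show "cnorm p (0 + cscale z \<theta>) \<le> r" using \<rho> by (simp add: cnorm_cscale[OF \<theta>])
  qed auto
  then have "(\<lambda>z. G (cscale z \<theta>)) analytic_on cball 0 \<rho>"
    by (subst analytic_on_analytic_at) simp
  then show ?thesis by (rule analytic_imp_holomorphic)
qed

lemma tcoeff_bound_aux:
  assumes G: "bounded_hol p r M G" and \<theta>: "\<theta> \<in> NC" and \<rho>: "\<rho> > 0" "\<rho> * cnorm p \<theta> \<le> r"
  shows "cmod (tcoeff G n \<theta>) \<le> M / \<rho> ^ n"
proof -
  have "cmod ((deriv ^^ n) (\<lambda>z. G (cscale z \<theta>)) 0) \<le> fact n * M / \<rho> ^ n"
  proof (rule Cauchy_inequality)
    fix z assume "cmod (0 - z) = \<rho>"
    then have "cnorm p (cscale z \<theta>) \<le> r" using \<rho> \<theta> by (simp add: cnorm_cscale)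
    then show "cmod (G (cscale z \<theta>)) \<le> M" using G \<theta> unfolding bounded_hol_def by auto
  qed (use bounded_hol_line[OF G \<theta> \<rho>(2)] \<rho> in \<open>auto intro: holomorphic_on_subset holomorphic_on_imp_continuous_on\<close>)
  then show ?thesis by (simp add: tcoeff_def norm_divide field_simps)
qed

lemma bounded_hol_M: "bounded_hol p r M G \<Longrightarrow> M \<ge> 0"
  unfolding bounded_hol_def using norm_ge_zero[of "G 0"]
  by (metis NC_intros(1) cnorm_0 less_imp_le order_trans)

lemma tcoeff_bound:
  assumes G: "bounded_hol p r M G" and \<theta>: "\<theta> \<in> NC"
  shows "cmod (tcoeff G n \<theta>) \<le> M / r ^ n * cnorm p \<theta> ^ n"
proof -
  have r: "r > 0" using G by (simp add: bounded_hol_def)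
  show ?thesis
  proof (cases "cnorm p \<theta> = 0")
    case False
    then have pos: "cnorm p \<theta> > 0" using cnorm_nonneg[of p \<theta>] by linarith
    then show ?thesis
      using tcoeff_bound_aux[OF G \<theta>, of "r / cnorm p \<theta>" n] r by (simp add: power_divide)
  next
    \<comment> \<open>Here \<open>\<theta> = 0\<close>, so any radius is admissible; for positive
      order the function on the line is constant and the coefficient vanishes.\<close>
    case True
    show ?thesis
    proof (cases n)
      case 0
      then show ?thesis using tcoeff_bound_aux[OF G \<theta>, of 1 n] True r by simp
    next
      case (Suc m)
      have "\<theta> = 0" using True \<theta> cnorm_eq_0 by blast
      then have "tcoeff G n \<theta> = 0" by (simp add: tcoeff_def Suc higher_deriv_const)
      then show ?thesis using True Suc by simp
    qed
  qed
qed

lemma tcoeff_homog: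
  assumes G: "bounded_hol p r M G" and \<theta>: "\<theta> \<in> NC"
  shows "tcoeff G n (cscale w \<theta>) = w ^ n * tcoeff G n \<theta>"
proof -
  define \<rho> where "\<rho> = r / (cnorm p \<theta> + 1)"
  have r: "r > 0" using G by (simp add: bounded_hol_def)
  have pos: "cnorm p \<theta> + 1 > 0" using cnorm_nonneg[of p \<theta>] by linarith
  have \<rho>: "\<rho> > 0" "\<rho> * cnorm p \<theta> \<le> r" using r pos by (auto simp: \<rho>_def field_simps)
  have "(deriv ^^ n) (\<lambda>z. (\<lambda>z. G (cscale z \<theta>)) (w * z)) 0 = w ^ n * (deriv ^^ n) (\<lambda>z. G (cscale z \<theta>)) (w * 0)"
  proof (rule higher_deriv_compose_linear[where S="ball 0 (\<rho> / (cmod w + 1))" and T="ball 0 \<rho>"])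
    show "(\<lambda>z. G (cscale z \<theta>)) holomorphic_on ball 0 \<rho>"
      using bounded_hol_line[OF G \<theta> \<rho>(2)] by (rule holomorphic_on_subset) auto
    fix z :: complex assume "z \<in> ball 0 (\<rho> / (cmod w + 1))"
    then have "cmod z < \<rho> / (cmod w + 1)" by simp
    then have "(cmod w + 1) * cmod z < \<rho>" by (simp add: pos_less_divide_eq add_nonneg_pos mult.commute)
    then have "cmod w * cmod z + cmod z < \<rho>" by (simp add: algebra_simps)
    then show "w * z \<in> ball 0 \<rho>" using norm_ge_zero[of z] by (simp add: norm_mult del: norm_ge_zero)
  qed (use \<rho> in \<open>auto simp: add_nonneg_pos\<close>)
  then show ?thesis by (simp add: tcoeff_def mult.commute)
qed

text \<open>The power series of \<open>G\<close> along the line through \<open>\<theta>\<close>,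
  evaluated at 1. The strict inequality leaves room for a disc of radius larger than 1.\<close>

lemma tcoeff_sums:
  assumes G: "bounded_hol p r M G" and \<theta>: "\<theta> \<in> NC" "cnorm p \<theta> < r"
  shows "(\<lambda>n. tcoeff G n \<theta>) sums G \<theta>"
proof -
  have "\<exists>\<rho>>1. \<rho> * cnorm p \<theta> \<le> r"
  proof (cases "cnorm p \<theta> = 0")
    case True
    then show ?thesis using G by (intro exI[of _ 2]) (simp add: bounded_hol_def)
  next
    case False
    then have "cnorm p \<theta> > 0" using cnorm_nonneg[of p \<theta>] by linarith
    then show ?thesis using \<theta>(2) by (intro exI[of _ "r / cnorm p \<theta>"]) simp
  qed
  then obtain \<rho> where \<rho>: "\<rho> > 1" "\<rho> * cnorm p \<theta> \<le> r" by blast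
  have "(\<lambda>z. G (cscale z \<theta>)) holomorphic_on ball 0 \<rho>"
    using bounded_hol_line[OF G \<theta>(1) \<rho>(2)] by (rule holomorphic_on_subset) auto
  from holomorphic_power_series[OF this, of 1] \<rho>(1) show ?thesis by (simp add: tcoeff_def)
qed

text \<open>The coefficient of order \<open>n\<close> is the locally uniform limit of the holomorphic functions
  \<open>(G (w \<theta>) - \<Sum>k<n. w\<^sup>k tcoeff G k \<theta>) / w\<^sup>n\<close> as \<open>w\<close> tends to 0, so no joint continuity is needed.\<close>

lemma tcoeff_hol_line:
  assumes G: "bounded_hol p r M G" and x: "x \<in> NC" and y: "y \<in> NC"
  shows "(\<lambda>z. tcoeff G n (x + cscale z y)) holomorphic_on UNIV"
proof (induction n rule: less_induct)
  case (less n)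
  have r: "r > 0" using G by (simp add: bounded_hol_def)
  have M: "M \<ge> 0" by (rule bounded_hol_M[OF G])
  have "(\<lambda>z. tcoeff G n (x + cscale z y)) holomorphic_on ball 0 R" if R: "R > 0" for R
  proof -
    define c where "c = cnorm p x + R * cnorm p y + 1"
    have c: "c \<ge> 1" using R by (simp add: c_def)
    have in_NC: "x + cscale z y \<in> NC" for z using x y by auto
    have cb: "cnorm p (x + cscale z y) \<le> c" if "z \<in> ball 0 R" for z
    proof -
      have "cnorm p (x + cscale z y) \<le> cnorm p x + cmod z * cnorm p y"
        using cnorm_triangle[OF x NC_intros(4)[OF y], of p z] cnorm_cscale[OF y, of p z] by simp
      also have "cmod z * cnorm p y \<le> R * cnorm p y" using that by (intro mult_right_mono) auto
      finally show ?thesis by (simp add: c_def)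
    qed
    \<comment> \<open>Since \<open>c\<close> bounds the norm of \<open>x + cscale z y\<close> for
      all \<open>z\<close> in the disc, scaling by \<open>w j\<close> brings these points into the
      ball of radius \<open>r / 2\<close>, where the Taylor series has ratio at most 1/2.\<close>
    define w where "w j = r / (2 * c) * (1 / Suc j)" for j
    have w: "w j > 0" "w j * c \<le> r / 2" for j
    proof -
      show "w j > 0" using r c by (simp add: w_def)
      have "w j * c = r / 2 * (1 / Suc j)" using c by (simp add: w_def)
      also have "\<dots> \<le> r / 2" using r by (simp add: field_simps)
      finally show "w j * c \<le> r / 2" .
    qed
    define H where "H j z = (G (cscale (w j) (x + cscale z y)) - (\<Sum>k<n. tcoeff G k (x + cscale z y) * w j ^ k)) / w j ^ n" for j z
    have small: "cnorm p (cscale (w j) (x + cscale z y)) \<le> r / 2" if "z \<in> ball 0 R" for j z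
    proof -
      have "w j * cnorm p (x + cscale z y) \<le> w j * c" using cb[OF that] w(1)[of j] by (intro mult_left_mono) auto
      also have "\<dots> \<le> r / 2" by (rule w(2))
      finally show ?thesis using w(1)[of j] by (simp add: cnorm_cscale[OF in_NC])
    qed
    have holH: "H j holomorphic_on ball 0 R" for j
    proof -
      have "(\<lambda>z. G (cscale (w j) x + cscale z (cscale (w j) y))) analytic_on {z}" if "z \<in> ball 0 R" for z
      proof (rule bounded_hol_analytic[OF G])
        show "cnorm p (cscale (w j) x + cscale z (cscale (w j) y)) \<le> r"
          using small[OF that, of j] r by (simp add: cscale_add mult.commute)
      qed (use x y in auto)
      then have "(\<lambda>z. G (cscale (w j) x + cscale z (cscale (w j) y))) analytic_on ball 0 R"
        by (subst analytic_on_analytic_at) simp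
      then have "(\<lambda>z. G (cscale (w j) (x + cscale z y))) holomorphic_on ball 0 R"
        by (auto dest!: analytic_imp_holomorphic simp: cscale_add mult.commute)
      moreover have "(\<lambda>z. tcoeff G k (x + cscale z y)) holomorphic_on ball 0 R" if "k < n" for k
        using less[OF that] by (rule holomorphic_on_subset) auto
      ultimately show ?thesis
        unfolding H_def using w(1)[of j] by (intro holomorphic_intros) auto
    qed
    \<comment> \<open>\<open>H j\<close> is the coefficient of order \<open>n\<close> plus the
      Taylor tail divided by \<open>w j ^ n\<close>; the tail is of order
      \<open>w j ^ Suc n\<close>, uniformly in \<open>z\<close>.\<close>
    have est: "cmod (H j z - tcoeff G n (x + cscale z y)) \<le> 2 * M * (c / r) ^ Suc n * w j" if z: "z \<in> ball 0 R" for j z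
    proof -
      let ?\<theta> = "x + cscale z y"
      define q where "q = w j * c / r"
      have q: "q \<ge> 0" "q \<le> 1/2" using w[of j] c r by (auto simp: q_def field_simps)
      have tb: "cmod (tcoeff G k ?\<theta> * w j ^ k) \<le> M * q ^ k" for k
      proof -
        have "cmod (tcoeff G k ?\<theta>) \<le> M / r ^ k * cnorm p ?\<theta> ^ k" by (rule tcoeff_bound[OF G in_NC])
        also have "\<dots> \<le> M / r ^ k * c ^ k" using cb[OF z] M r by (intro mult_left_mono power_mono) auto
        finally have "cmod (tcoeff G k ?\<theta>) * w j ^ k \<le> M / r ^ k * c ^ k * w j ^ k"
          using w(1)[of j] by (intro mult_right_mono) auto
        then show ?thesis using w(1)[of j] by (simp add: norm_mult norm_power q_def power_divide power_mult_distrib mult_ac)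
      qed
      have "(\<lambda>k. tcoeff G k (cscale (w j) ?\<theta>)) sums G (cscale (w j) ?\<theta>)"
        using small[OF z, of j] r in_NC by (intro tcoeff_sums[OF G]) auto
      then have "(\<lambda>k. tcoeff G k ?\<theta> * w j ^ k) sums G (cscale (w j) ?\<theta>)"
        by (simp add: tcoeff_homog[OF G in_NC] mult.commute)
      from sums_split_initial_segment[OF this, of "Suc n"]
      have ss: "(\<lambda>k. tcoeff G (k + Suc n) ?\<theta> * w j ^ (k + Suc n)) sums
         (G (cscale (w j) ?\<theta>) - (\<Sum>k<Suc n. tcoeff G k ?\<theta> * w j ^ k))" by simp
      have gs: "(\<lambda>k. M * q ^ Suc n * q ^ k) sums (M * q ^ Suc n * (1 / (1 - q)))"
        using q by (intro sums_mult geometric_sums) auto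
      have "cmod (G (cscale (w j) ?\<theta>) - (\<Sum>k<Suc n. tcoeff G k ?\<theta> * w j ^ k)) \<le> M * q ^ Suc n * (1 / (1 - q))"
      proof -
        have "cmod (\<Sum>k. tcoeff G (k + Suc n) ?\<theta> * w j ^ (k + Suc n)) \<le> (\<Sum>k. M * q ^ Suc n * q ^ k)"
        proof (rule norm_suminf_le)
          fix k
          have "M * q ^ (k + Suc n) = M * q ^ Suc n * q ^ k" by (simp only: power_add mult_ac)
          then show "cmod (tcoeff G (k + Suc n) ?\<theta> * w j ^ (k + Suc n)) \<le> M * q ^ Suc n * q ^ k"
            using tb[of "k + Suc n"] by (simp only:)
        qed (rule sums_summable[OF gs])
        then show ?thesis using sums_unique[OF ss] sums_unique[OF gs] by simp
      qed
      also have "\<dots> \<le> M * q ^ Suc n * 2"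
        using q M by (intro mult_left_mono) (auto simp: field_simps)
      finally have e: "cmod (G (cscale (w j) ?\<theta>) - (\<Sum>k<Suc n. tcoeff G k ?\<theta> * w j ^ k)) \<le> 2 * M * q ^ Suc n" by simp
      have "H j z - tcoeff G n ?\<theta> = (G (cscale (w j) ?\<theta>) - (\<Sum>k<Suc n. tcoeff G k ?\<theta> * w j ^ k)) / w j ^ n"
        using w(1)[of j] by (simp add: H_def field_simps)
      then have "cmod (H j z - tcoeff G n ?\<theta>) \<le> 2 * M * q ^ Suc n / w j ^ n"
        using e w(1)[of j] by (simp add: norm_divide norm_power divide_right_mono)
      also have "\<dots> = 2 * M * (c / r) ^ Suc n * w j"
        using w(1)[of j] by (simp add: q_def power_divide power_mult_distrib field_simps)
      finally show ?thesis .
    qed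
    have unif: "uniform_limit (ball 0 R) H (\<lambda>z. tcoeff G n (x + cscale z y)) sequentially"
      unfolding uniform_limit_iff
    proof (intro allI impI)
      fix e :: real assume e: "e > 0"
      have "w \<longlonglongrightarrow> r / (2 * c) * 0"
        unfolding w_def by (intro tendsto_intros LIMSEQ_inverse_real_of_nat[unfolded inverse_eq_divide])
      then have "(\<lambda>j. 2 * M * (c / r) ^ Suc n * w j) \<longlonglongrightarrow> 2 * M * (c / r) ^ Suc n * (r / (2 * c) * 0)"
        by (intro tendsto_mult tendsto_const)
      then have "\<forall>\<^sub>F j in sequentially. 2 * M * (c / r) ^ Suc n * w j < e"
        using e by (intro order_tendstoD(2)) auto
      then show "\<forall>\<^sub>F j in sequentially. \<forall>z\<in>ball 0 R. dist (H j z) (tcoeff G n (x + cscale z y)) < e"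
      proof eventually_elim
        case (elim j)
        show ?case
        proof
          fix z :: complex assume "z \<in> ball 0 R"
          from order_le_less_trans[OF est[OF this] elim]
          show "dist (H j z) (tcoeff G n (x + cscale z y)) < e" by (simp add: dist_norm)
        qed
      qed
    qed
    show ?thesis
    proof (rule holomorphic_uniform_sequence[OF open_ball holH])
      fix z :: complex assume "z \<in> ball 0 R"
      then obtain d where "d > 0" "cball z d \<subseteq> ball 0 R" by (meson open_ball open_contains_cball)
      then show "\<exists>d>0. cball z d \<subseteq> ball 0 R \<and> uniform_limit (cball z d) H (\<lambda>z. tcoeff G n (x + cscale z y)) sequentially"
        using uniform_limit_on_subset[OF unif] by blast
    qed
  qed
  then have "(\<lambda>z. tcoeff G n (x + cscale z y)) field_differentiable at z" for z
    using holomorphic_on_imp_differentiable_at[of _ "ball 0 (cmod z + 1)" z] by (simp add: add_nonneg_pos)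
  then show ?case by (simp add: holomorphic_on_def field_differentiable_at_within)
qed

lemma Pol_tcoeff:
  assumes G: "bounded_hol p r M G"
  shows "Pol p n (tcoeff G n)"
proof -
  have C: "M / r ^ n \<ge> 0" using bounded_hol_M[OF G] G by (simp add: bounded_hol_def)
  have "cmod (tcoeff G n x) \<le> M / r ^ n * (1 + cnorm p x) ^ n" if "x \<in> NC" for x
  proof -
    have "M / r ^ n * cnorm p x ^ n \<le> M / r ^ n * (1 + cnorm p x) ^ n"
      using C by (intro mult_left_mono power_mono) auto
    then show ?thesis using tcoeff_bound[OF G that, of n] by linarith
  qed
  then show ?thesis unfolding Pol_def using tcoeff_hol_line[OF G] C by blast
qed

section \<open>The kernel theorem\<close>

text \<open>\<open>real n ^ n / fact n\<close> is a single term of the exponential series at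
  \<open>n\<close>.\<close>

lemma power_n_le_fact_exp: "real n ^ n \<le> fact n * exp 1 ^ n"
proof -
  have "real n ^ n / fact n \<le> exp (real n)"
  proof -
    have s: "(\<lambda>k. real n ^ k /\<^sub>R fact k) sums exp (real n)" by (rule exp_converges)
    have "sum (\<lambda>k. real n ^ k /\<^sub>R fact k) {n} \<le> exp (real n)"
      unfolding sums_unique[OF s] by (intro sum_le_suminf sums_summable[OF s]) auto
    then show ?thesis by (simp add: field_simps)
  qed
  also have "exp (real n) = exp 1 ^ n" by (simp add: exp_of_nat_mult[symmetric])
  finally show ?thesis by (simp add: field_simps)
qed

lemma NC_expand:
  assumes E: "Hs.ons p E" "E \<subseteq> N" and \<theta>: "\<theta> \<in> NC" "fst \<theta> \<in> span E" "snd \<theta> \<in> span E"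
  shows "\<theta> = (\<Sum>e\<in>E. cscale (pairing (riesz p e) \<theta>) (e, 0))"
proof -
  have "fst \<theta> = (\<Sum>e\<in>E. ip p e (fst \<theta>) *\<^sub>R e)" "snd \<theta> = (\<Sum>e\<in>E. ip p e (snd \<theta>) *\<^sub>R e)"
    using Hs.span_proj[OF E(1) \<theta>(2)] Hs.span_proj[OF E(1) \<theta>(3)] by (simp_all add: Hs.proj_def)
  moreover have "(\<Sum>e\<in>E. cscale (pairing (riesz p e) \<theta>) (e, 0)) =
      (\<Sum>e\<in>E. (ip p e (fst \<theta>) *\<^sub>R e, ip p e (snd \<theta>) *\<^sub>R e))"
    using NC_fst_snd[OF \<theta>(1)] by (intro sum.cong) (auto simp: cscale_def pairing_def riesz_N)
  ultimately show ?thesis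
    by (simp add: prod_eq_iff fst_sum snd_sum)
qed

text \<open>In an orthonormal basis of the finite-dimensional span of the vectors involved, the
  functional is the pairing with the matrix of the polarised form, whose Hilbert--Schmidt norm is
  controlled by the Hilbert--Schmidt embedding.\<close>

lemma homogeneous_tspan_bound:
  assumes F: "Pol p n F" and hom: "\<And>z x. x \<in> NC \<Longrightarrow> F (cscale z x) = z ^ n * F x"
    and bd: "\<And>x. x \<in> NC \<Longrightarrow> cmod (F x) \<le> C * cnorm p x ^ n" and C: "C \<ge> 0"
    and K: "K \<ge> 0" "\<And>E. Hs.ons q E \<Longrightarrow> (\<Sum>e\<in>E. (nm p e)\<^sup>2) \<le> K"
    and cs: "snd ` set cs \<subseteq> NC"
  shows "cmod (\<Sum>(c, \<theta>)\<leftarrow>cs. c * F \<theta>) \<le> C * (2 * exp 1 * sqrt K) ^ n * tnorm q n (tspan n cs)"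
proof -
  define A where "A hs = dif hs F 0 / fact n" for hs
  have A: "cmlin n A"
  proof -
    have "cmlin n (\<lambda>hs. T hs / c)" if "cmlin n T" for c T n
      using that by (induction n arbitrary: T) (simp_all add: add_divide_distrib)
    then show ?thesis unfolding A_def using cmlin_dif[OF F] by blast
  qed
  \<comment> \<open>\<open>2 ^ n\<close> counts the terms of the difference,
    \<open>exp 1 ^ n\<close> comes from arguments of total norm at most \<open>n\<close> divided by
    \<open>fact n\<close>.\<close>
  define B where "B = C * (2 * exp 1) ^ n"
  have Ab: "cmod (A hs) \<le> B * (\<Prod>h\<leftarrow>hs. cnorm p h)" if "hs \<in> Lst NC n" for hs
  proof (rule cmlin_bound[OF A _ that])
    fix hs assume hs: "hs \<in> Lst NC n" "\<forall>h\<in>set hs. cnorm p h \<le> 1"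
    then have len: "length hs = n" "set hs \<subseteq> NC" by (auto simp: Lst_def)
    have "(\<Sum>h\<leftarrow>hs. cnorm p h) \<le> (\<Sum>h\<leftarrow>hs. 1)" using hs(2) by (intro sum_list_mono) auto
    then have s: "(\<Sum>h\<leftarrow>hs. cnorm p h) \<le> real n" using len by (simp add: sum_list_triv)
    have s0: "(\<Sum>h\<leftarrow>hs. cnorm p h) \<ge> 0" by (rule sum_list_nonneg) auto
    have "cmod (dif hs F 0) \<le> 2 ^ n * C * (cnorm p 0 + (\<Sum>h\<leftarrow>hs. cnorm p h)) ^ n"
      using dif_bound[OF bd C NC_intros(1) len(2)] len(1) by simp
    also have "\<dots> \<le> 2 ^ n * C * real n ^ n"
      using s s0 C by (intro mult_left_mono power_mono) auto
    also have "\<dots> \<le> 2 ^ n * C * (fact n * exp 1 ^ n)"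
      using C by (intro mult_left_mono power_n_le_fact_exp) auto
    finally show "cmod (A hs) \<le> B"
      by (simp add: A_def B_def norm_divide power_mult_distrib field_simps)
  qed
  \<comment> \<open>All real and imaginary parts that occur; an orthonormal basis of their span in
    \<open>H_q\<close> consists of vectors of \<open>N\<close>.\<close>
  define X where "X = fst ` snd ` set cs \<union> snd ` snd ` set cs"
  have XN: "X \<subseteq> N" unfolding X_def using cs NC_fst_snd by auto
  obtain E where E: "Hs.ons q E" "X \<subseteq> span E" "E \<subseteq> span X"
  proof (rule Hs.ons_basis[of X q])
    show "finite X" by (simp add: X_def)
    show "X \<subseteq> Hp q" using XN N_sub by blast
  qed
  have EN: "E \<subseteq> N" using E(3) span_minimal[OF XN subspace_N] by blast
  note fin = Hs.ons_finite[OF E(1)]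
  define a where "a es = A (map (\<lambda>e. (e, 0)) es)" for es
  have diag: "F \<theta> = (\<Sum>es\<in>Lst E n. a es * tensor_power n \<theta> (map (riesz q) es))" if \<theta>: "\<theta> \<in> snd ` set cs" for \<theta>
  proof -
    have \<theta>NC: "\<theta> \<in> NC" using cs \<theta> by auto
    have "fst \<theta> \<in> span E" "snd \<theta> \<in> span E" using E(2) \<theta> unfolding X_def by blast+
    note ex = NC_expand[OF E(1) EN \<theta>NC this]
    have "F \<theta> = A (replicate n \<theta>)"
      using dif_diag[of F \<theta> n] hom[OF \<theta>NC] by (simp add: A_def)
    also have "\<dots> = A (replicate n (\<Sum>e\<in>E. cscale (pairing (riesz q e) \<theta>) (e, 0)))"
      using ex by simp
    also have "\<dots> = (\<Sum>es\<in>Lst E n. (\<Prod>e\<leftarrow>es. pairing (riesz q e) \<theta>) * A (map (\<lambda>e. (e, 0)) es))"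
      by (rule mlin_diag[OF _ _ _ _ fin A]) (use EN in \<open>auto simp: NC_def cscale_def zero_prod_def\<close>)
    also have "\<dots> = (\<Sum>es\<in>Lst E n. a es * tensor_power n \<theta> (map (riesz q) es))"
    proof (intro sum.cong refl)
      fix es assume es: "es \<in> Lst E n"
      then have "set (map (riesz q) es) \<subseteq> N'" using Hs.onsD(1)[OF E(1)] by (auto simp: Lst_def)
      then show "(\<Prod>e\<leftarrow>es. pairing (riesz q e) \<theta>) * A (map (\<lambda>e. (e, 0)) es) = a es * tensor_power n \<theta> (map (riesz q) es)"
        using es by (simp add: a_def tensor_power_def Lst_def o_def)
    qed
    finally show ?thesis .
  qed
  \<comment> \<open>The basis \<open>E\<close> is attached to \<open>cs\<close>, so the induction
    runs over lists \<open>ds\<close> contained in it.\<close>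
  have "(\<Sum>(c, \<theta>)\<leftarrow>ds. c * F \<theta>) = (\<Sum>es\<in>Lst E n. a es * tspan n ds (map (riesz q) es))" if "set ds \<subseteq> set cs" for ds
    using that
  proof (induction ds)
    case (Cons d ds)
    obtain c \<theta> where d: "d = (c, \<theta>)" by (cases d)
    have "\<theta> \<in> snd ` set cs" using Cons.prems d by force
    from diag[OF this] show ?case
      using Cons by (simp add: d tspan_simps fadd_def fscl_def distrib_left sum.distrib sum_distrib_left mult_ac)
  qed (simp add: tspan_simps)
  from this[of cs] have "cmod (\<Sum>(c, \<theta>)\<leftarrow>cs. c * F \<theta>) = cmod (\<Sum>es\<in>Lst E n. a es * tspan n cs (map (riesz q) es))"
    by simp
  also have "\<dots> \<le> (\<Sum>es\<in>Lst E n. \<bar>cmod (a es)\<bar> * \<bar>cmod (tspan n cs (map (riesz q) es))\<bar>)"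
    using norm_sum[of "\<lambda>es. a es * tspan n cs (map (riesz q) es)" "Lst E n"] by (simp add: norm_mult)
  \<comment> \<open>Cauchy-Schwarz: the first factor is a finite section of the polarised form, to
    be bounded by the embedding, the second one a finite section of the norm of
    \<open>tspan n cs\<close>.\<close>
  also have "\<dots> \<le> L2_set (\<lambda>es. cmod (a es)) (Lst E n) * L2_set (\<lambda>es. cmod (tspan n cs (map (riesz q) es))) (Lst E n)"
    by (rule L2_set_mult_ineq)
  also have "\<dots> \<le> (B * sqrt K ^ n) * tnorm q n (tspan n cs)"
  proof (rule mult_mono)
    have "(\<Sum>es\<in>Lst E n. (cmod (a es))\<^sup>2) \<le> (\<Sum>es\<in>Lst E n. B\<^sup>2 * (\<Prod>e\<leftarrow>es. (nm p e)\<^sup>2))"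
    proof (rule sum_mono)
      fix es assume es: "es \<in> Lst E n"
      have "map (\<lambda>e. (e, 0)) es \<in> Lst NC n" using es EN by (auto simp: Lst_def NC_def)
      from Ab[OF this] have "cmod (a es) \<le> B * (\<Prod>e\<leftarrow>es. cnorm p (e, 0))" by (simp add: a_def o_def)
      also have "map (\<lambda>e. cnorm p (e, 0)) es = map (nm p) es"
        using es EN N_Hp by (intro map_cong refl) (auto simp: Lst_def cnorm_def subset_iff)
      finally have "(cmod (a es))\<^sup>2 \<le> (B * (\<Prod>e\<leftarrow>es. nm p e))\<^sup>2" by (intro power_mono) auto
      also have "\<dots> = B\<^sup>2 * (\<Prod>e\<leftarrow>es. (nm p e)\<^sup>2)"
      proof -
        have "(\<Prod>e\<leftarrow>es. nm p e)\<^sup>2 = (\<Prod>e\<leftarrow>es. (nm p e)\<^sup>2)" for es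
          by (induction es) (simp_all add: power_mult_distrib)
        then show ?thesis by (simp add: power_mult_distrib)
      qed
      finally show "(cmod (a es))\<^sup>2 \<le> B\<^sup>2 * (\<Prod>e\<leftarrow>es. (nm p e)\<^sup>2)" .
    qed
    also have "\<dots> = B\<^sup>2 * (\<Sum>e\<in>E. (nm p e)\<^sup>2) ^ n"
      by (simp add: sum_Lst_prod[OF fin] flip: sum_distrib_left)
    also have "\<dots> \<le> B\<^sup>2 * K ^ n"
      by (intro mult_left_mono power_mono K(2) E(1) sum_nonneg) auto
    also have "\<dots> = (B * sqrt K ^ n)\<^sup>2"
      using K(1) by (simp add: power_mult_distrib flip: power_mult) (simp add: power_mult mult.commute[of n])
    finally show "L2_set (\<lambda>es. cmod (a es)) (Lst E n) \<le> B * sqrt K ^ n"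
      unfolding L2_set_def using C K by (intro real_le_lsqrt) (auto simp: B_def)
    have "L2_set (\<lambda>es. cmod (tspan n cs (map (riesz q) es))) (Lst E n) = sqrt (tsum q E n (tspan n cs))"
      by (simp add: tsum_L2)
    also have "\<dots> \<le> tnorm q n (tspan n cs)"
      using tsum_le_tnorm[OF NC_tensorD(2)[OF tspan_NC[OF cs]] E(1)] by (intro real_le_lsqrt) auto
    finally show "L2_set (\<lambda>es. cmod (tspan n cs (map (riesz q) es))) (Lst E n) \<le> tnorm q n (tspan n cs)" .
  qed (use C K in \<open>auto simp: B_def L2_set_nonneg\<close>)
  also have "B * sqrt K ^ n = C * (2 * exp 1 * sqrt K) ^ n"
    by (simp add: B_def power_mult_distrib mult.assoc)
  finally show ?thesis .
qed

text \<open>\<open>q\<close> and \<open>\<kappa>\<close> are fixed before \<open>r\<close>,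
  \<open>M\<close> and \<open>G\<close>. Continuity of the inverse transform rests on this
  uniformity.\<close>

lemma Taylor_kernels:
  obtains q \<kappa> where "p < q" "\<kappa> > 0"
    "\<And>r M G. bounded_hol p r M G \<Longrightarrow> \<exists>L. (\<forall>n. L n \<in> NC_tensor_dual n \<and>
        dual_norm q n (L n) \<le> ennreal (M * (\<kappa> / r) ^ n) \<and>
        (\<forall>\<theta>\<in>NC. L n (tensor_power n \<theta>) = tcoeff G n \<theta>))"
proof -
  obtain q K where q: "p < q" "K \<ge> 0" "\<And>E. Hs.ons q E \<Longrightarrow> (\<Sum>e\<in>E. (nm p e)\<^sup>2) \<le> K"
    using hilbert_schmidt_const[of p] by metis
  \<comment> \<open>Enlarging \<open>K\<close> by 1 makes \<open>\<kappa>\<close> positive even if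
    \<open>K\<close> is 0.\<close>
  have K1: "K + 1 \<ge> 0" "\<And>E. Hs.ons q E \<Longrightarrow> (\<Sum>e\<in>E. (nm p e)\<^sup>2) \<le> K + 1"
    subgoal using q(2) by simp
    subgoal for E using q(3)[of E] by linarith
    done
  define \<kappa> where "\<kappa> = 2 * exp 1 * sqrt (K + 1)"
  have \<kappa>: "\<kappa> > 0" using q(2) by (simp add: \<kappa>_def)
  have "\<exists>L. (\<forall>n. L n \<in> NC_tensor_dual n \<and> dual_norm q n (L n) \<le> ennreal (M * (\<kappa> / r) ^ n) \<and>
        (\<forall>\<theta>\<in>NC. L n (tensor_power n \<theta>) = tcoeff G n \<theta>))" if G: "bounded_hol p r M G" for r M G
  proof -
    have r: "r > 0" using G by (simp add: bounded_hol_def)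
    have M: "M \<ge> 0" by (rule bounded_hol_M[OF G])
    have "\<exists>L. L \<in> NC_tensor_dual n \<and> dual_norm q n L \<le> ennreal (M * (\<kappa> / r) ^ n) \<and>
        (\<forall>\<theta>\<in>NC. L (tensor_power n \<theta>) = tcoeff G n \<theta>)" for n
    proof -
      have Cn: "M / r ^ n \<ge> 0" using M r by simp
      have C': "M / r ^ n * \<kappa> ^ n \<ge> 0" using M r \<kappa> by simp
      have "cmod (\<Sum>(c, \<theta>)\<leftarrow>cs. c * tcoeff G n \<theta>) \<le> M / r ^ n * \<kappa> ^ n * tnorm q n (tspan n cs)"
        if "snd ` set cs \<subseteq> NC" for cs
        unfolding \<kappa>_def
        by (rule homogeneous_tspan_bound[OF Pol_tcoeff[OF G] tcoeff_homog[OF G] tcoeff_bound[OF G] Cn K1 that])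
      from dual_extend[OF this C'] obtain L where "L \<in> NC_tensor_dual n" "\<And>\<theta>. \<theta> \<in> NC \<Longrightarrow> L (tensor_power n \<theta>) = tcoeff G n \<theta>"
        "dual_norm q n L \<le> ennreal (M / r ^ n * \<kappa> ^ n)" by metis
      then show ?thesis by (intro exI[of _ L]) (simp add: power_divide)
    qed
    then show ?thesis by metis
  qed
  then show ?thesis using that q(1) \<kappa> by blast
qed

section \<open>Contraction of tensors\<close>

text \<open>\<open>L\<close> is applied to the last \<open>m\<close> slots. This is the transpose of
  the product with the functional \<open>L\<close>, needed because the Appell kernels at
  \<open>x\<close> are products of powers of \<open>x\<close> with the kernels at 0.\<close>

definition contr :: "nat \<Rightarrow> nat \<Rightarrow> ((('h \<Rightarrow> real) list \<Rightarrow> complex) \<Rightarrow> complex) \<Rightarrow>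
    (('h \<Rightarrow> real) list \<Rightarrow> complex) \<Rightarrow> ('h \<Rightarrow> real) list \<Rightarrow> complex" where
  "contr k m L t = (\<lambda>xs. if length xs = k \<and> set xs \<subseteq> N' then L (\<lambda>ys. t (xs @ ys)) else 0)"

lemma sym_form_slice:
  assumes t: "sym_form (k + m) t" and xs: "length xs = k" "set xs \<subseteq> N'"
  shows "sym_form m (\<lambda>ys. t (xs @ ys))"
  unfolding sym_form_def
proof (intro conjI allI impI)
  fix ys assume "\<not> (length ys = m \<and> set ys \<subseteq> N')"
  then show "t (xs @ ys) = 0" using xs by (intro sym_formD_off[OF t]) auto
next
  fix ys i x y a b assume "length ys = m \<and> set ys \<subseteq> N' \<and> i < m \<and> x \<in> N' \<and> y \<in> N'"
  then show "t (xs @ ys[i := \<lambda>\<xi>. a * x \<xi> + b * y \<xi>]) =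
      of_real a * t (xs @ ys[i := x]) + of_real b * t (xs @ ys[i := y])"
    using sym_formD_lin[OF t, of "xs @ ys" "k + i" x y a b] xs by (simp add: list_update_append)
next
  fix ys zs :: "('h \<Rightarrow> real) list" assume "mset ys = mset zs"
  then show "t (xs @ ys) = t (xs @ zs)" by (intro sym_formD_sym[OF t]) simp
qed

lemma slice_NC:
  assumes t: "t \<in> NC_tensor (k + m)" and xs: "length xs = k" "set xs \<subseteq> N'"
  shows "(\<lambda>ys. t (xs @ ys)) \<in> NC_tensor m"
proof -
  note sf = sym_form_slice[OF NC_tensorD(1)[OF t] xs]
  obtain p0 where p0: "\<And>q. p0 \<le> q \<Longrightarrow> \<exists>gs. set gs \<subseteq> Hp q \<and> length gs = length xs \<and> xs = map (riesz q) gs"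
    using N'_list_riesz[OF xs(2)] by metis
  have "tnorm_sq p m (\<lambda>ys. t (xs @ ys)) < \<infinity>" for p
  proof -
    define q where "q = max p p0"
    obtain gs where gs: "set gs \<subseteq> Hp q" "length gs = length xs" "xs = map (riesz q) gs"
      using p0[of q] by (auto simp: q_def)
    have "tnorm_sq q m (\<lambda>ys. t (xs @ ys)) \<le> ennreal ((\<Prod>g\<leftarrow>gs. nm q g)\<^sup>2 * (tnorm q (k + m) t)\<^sup>2)"
    proof (rule tnorm_sq_leI)
      fix E assume E: "Hs.ons q E"
      obtain F where F: "Hs.ons q F" "E \<subseteq> F" "set gs \<subseteq> span F"
        using Hs.Gram_Schmidt[OF _ gs(1) E] by (metis List.finite_set)
      have "tsum q E m (\<lambda>ys. t (xs @ ys)) \<le> tsum q F m (\<lambda>ys. t (xs @ ys))"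
        using F(2) span_superset[of F] by (intro tsum_mono_span[OF sf E F(1)]) auto
      also have "\<dots> \<le> (\<Prod>g\<leftarrow>gs. nm q g)\<^sup>2 * tsum q F (k + m) t"
      proof -
        have len: "length gs = k" using gs(2) xs(1) by simp
        have "(\<Sum>fs\<in>Lst F m. (cmod (t (map (riesz q) (gs @ fs))))\<^sup>2) \<le>
            (\<Prod>g\<leftarrow>gs. nm q g)\<^sup>2 * (\<Sum>fs\<in>Lst F (length gs + m). (cmod (t (map (riesz q) fs)))\<^sup>2)"
          by (rule Hs.sum_Lst_sq_prefix_le[OF F(1) _ F(3)])
            (unfold len, rule rmlin_sym_form0[OF NC_tensorD(1)[OF t]])
        then show ?thesis unfolding tsum_def len gs(3) map_append .
      qed
      also have "\<dots> \<le> (\<Prod>g\<leftarrow>gs. nm q g)\<^sup>2 * (tnorm q (k + m) t)\<^sup>2"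
        by (intro mult_left_mono tsum_le_tnorm[OF NC_tensorD(2)[OF t] F(1)]) auto
      finally show "tsum q E m (\<lambda>ys. t (xs @ ys)) \<le> (\<Prod>g\<leftarrow>gs. nm q g)\<^sup>2 * (tnorm q (k + m) t)\<^sup>2" .
    qed
    then have "tnorm_sq q m (\<lambda>ys. t (xs @ ys)) < \<infinity>" by (simp add: order_le_less_trans)
    moreover have "tnorm_sq p m (\<lambda>ys. t (xs @ ys)) \<le> tnorm_sq q m (\<lambda>ys. t (xs @ ys))"
      by (rule tnorm_sq_mono[OF sf]) (simp add: q_def)
    ultimately show ?thesis by (rule order_le_less_trans[rotated])
  qed
  then show ?thesis using sf by (simp add: NC_tensor_def)
qed

text \<open>Fubini for the Hilbert-Schmidt norm. Each slice norm is a supremum over its own systems,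
  so nearly optimal systems are chosen for the finitely many slices and merged into one system
  \<open>G\<close> containing \<open>E\<close>.\<close>

lemma sum_tnorm_slices:
  assumes t: "t \<in> NC_tensor (k + m)" and E: "Hs.ons q E"
  shows "(\<Sum>es\<in>Lst E k. (tnorm q m (\<lambda>ys. t (map (riesz q) es @ ys)))\<^sup>2) \<le> (tnorm q (k + m) t)\<^sup>2"
proof (rule field_le_epsilon)
  fix e :: real assume e: "e > 0"
  \<comment> \<open>The error is shared among the lists; the added 1 avoids a division by 0.\<close>
  define d where "d = e / (card (Lst E k) + 1)"
  have d: "d > 0" using e by (simp add: d_def add_nonneg_pos)
  let ?t = "\<lambda>es ys. t (map (riesz q) es @ ys)"
  have sl: "?t es \<in> NC_tensor m" if "es \<in> Lst E k" for es
    using that Hs.onsD(1)[OF E] by (intro slice_NC[OF t]) (auto simp: Lst_def)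
  have "\<exists>F. Hs.ons q F \<and> (tnorm q m (?t es))\<^sup>2 \<le> tsum q F m (?t es) + d" if "es \<in> Lst E k" for es
    using tnorm_approx[OF NC_tensorD(2)[OF sl[OF that]] d] by metis
  then obtain F where F: "\<And>es. es \<in> Lst E k \<Longrightarrow> Hs.ons q (F es)"
    "\<And>es. es \<in> Lst E k \<Longrightarrow> (tnorm q m (?t es))\<^sup>2 \<le> tsum q (F es) m (?t es) + d" by metis
  note finE = Hs.ons_finite[OF E]
  have X: "finite (\<Union>es\<in>Lst E k. F es)" "(\<Union>es\<in>Lst E k. F es) \<subseteq> Hp q"
    using F(1) Hs.ons_finite Hs.ons_sub finE by (auto, blast)
  obtain G where G: "Hs.ons q G" "E \<subseteq> G" "(\<Union>es\<in>Lst E k. F es) \<subseteq> span G"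
    using Hs.Gram_Schmidt[OF X E] by metis
  note finG = Hs.ons_finite[OF G(1)]
  have "(\<Sum>es\<in>Lst E k. (tnorm q m (?t es))\<^sup>2) \<le> (\<Sum>es\<in>Lst E k. tsum q G m (?t es) + d)"
  proof (rule sum_mono)
    fix es assume es: "es \<in> Lst E k"
    have "tsum q (F es) m (?t es) \<le> tsum q G m (?t es)"
      by (rule tsum_mono_span[OF NC_tensorD(1)[OF sl[OF es]] F(1)[OF es] G(1)]) (use G(3) es in blast)
    then show "(tnorm q m (?t es))\<^sup>2 \<le> tsum q G m (?t es) + d" using F(2)[OF es] by linarith
  qed
  also have "\<dots> = (\<Sum>es\<in>Lst E k. tsum q G m (?t es)) + card (Lst E k) * d" by (simp add: sum.distrib)
  also have "(\<Sum>es\<in>Lst E k. tsum q G m (?t es)) \<le> (\<Sum>es\<in>Lst G k. tsum q G m (?t es))"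
    using Lst_mono[OF G(2)] finG by (intro sum_mono2) auto
  also have "\<dots> = tsum q G (k + m) t"
    by (simp add: tsum_def sum_Lst_add[OF finG])
  also have "\<dots> \<le> (tnorm q (k + m) t)\<^sup>2" by (rule tsum_le_tnorm[OF NC_tensorD(2)[OF t] G(1)])
  also have "card (Lst E k) * d \<le> e" using e by (simp add: d_def field_simps add_nonneg_pos)
  finally show "(\<Sum>es\<in>Lst E k. (tnorm q m (?t es))\<^sup>2) \<le> (tnorm q (k + m) t)\<^sup>2 + e" by simp
qed

lemma fadd_fscl_slice: "(\<lambda>ys. fadd (fscl a s) (fscl b t) (xs @ ys)) = fadd (fscl a (\<lambda>ys. s (xs @ ys))) (fscl b (\<lambda>ys. t (xs @ ys)))"
  by (simp add: fadd_def fscl_def)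

lemma contr_lc:
  assumes L: "L \<in> NC_tensor_dual m" and s: "s \<in> NC_tensor (k + m)" and t: "t \<in> NC_tensor (k + m)"
  shows "contr k m L (fadd (fscl a s) (fscl b t)) = fadd (fscl a (contr k m L s)) (fscl b (contr k m L t))"
  unfolding contr_def fadd_fscl_slice
  using dualD(2)[OF L slice_NC[OF s] slice_NC[OF t]] by (auto simp: fadd_def fscl_def)

lemma sym_form_contr:
  assumes L: "L \<in> NC_tensor_dual m" and t: "t \<in> NC_tensor (k + m)"
  shows "sym_form k (contr k m L t)"
  unfolding sym_form_def
proof (intro conjI allI impI)
  fix xs assume "\<not> (length xs = k \<and> set xs \<subseteq> N')"
  then show "contr k m L t xs = 0" by (auto simp: contr_def)
next
  fix xs i x y a b assume *: "length xs = k \<and> set xs \<subseteq> N' \<and> i < k \<and> x \<in> N' \<and> y \<in> N'"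
  have sub: "set (xs[i := w]) \<subseteq> N'" if "w \<in> N'" for w
    using * that set_update_subset_insert[of xs i w] by auto
  let ?w = "\<lambda>\<xi>. a * x \<xi> + b * y \<xi>"
  have w: "?w \<in> N'" using * by (intro N'_lc) auto
  have "(\<lambda>ys. t (xs[i := ?w] @ ys)) =
      fadd (fscl (of_real a) (\<lambda>ys. t (xs[i := x] @ ys))) (fscl (of_real b) (\<lambda>ys. t (xs[i := y] @ ys)))"
  proof
    fix ys
    show "t (xs[i := ?w] @ ys) = fadd (fscl (of_real a) (\<lambda>ys. t (xs[i := x] @ ys))) (fscl (of_real b) (\<lambda>ys. t (xs[i := y] @ ys))) ys"
    proof (cases "length ys = m \<and> set ys \<subseteq> N'")
      case True
      then show ?thesis
        using sym_formD_lin[OF NC_tensorD(1)[OF t], of "xs @ ys" i x y a b] *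
        by (simp add: fadd_def fscl_def list_update_append)
    next
      case False
      then have "t (zs @ ys) = 0" if "length zs = k" for zs
        using that by (intro sym_formD_off[OF NC_tensorD(1)[OF t]]) auto
      then show ?thesis using * by (simp add: fadd_def fscl_def)
    qed
  qed
  then show "contr k m L t (xs[i := ?w]) = of_real a * contr k m L t (xs[i := x]) + of_real b * contr k m L t (xs[i := y])"
    using * sub w dualD(2)[OF L slice_NC[OF t, of "xs[i := x]"] slice_NC[OF t, of "xs[i := y]"]]
    by (simp add: contr_def)
next
  fix xs ys :: "('h \<Rightarrow> real) list" assume m: "mset xs = mset ys"
  then have "(\<lambda>zs. t (xs @ zs)) = (\<lambda>zs. t (ys @ zs))"
    by (intro ext sym_formD_sym[OF NC_tensorD(1)[OF t]]) simp
  then show "contr k m L t xs = contr k m L t ys"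
    using mset_eq_set_length[OF m] by (simp add: contr_def)
qed

lemma tsum_contr:
  assumes L: "L \<in> NC_tensor_dual m" and t: "t \<in> NC_tensor (k + m)"
    and C: "\<And>t. t \<in> NC_tensor m \<Longrightarrow> cmod (L t) \<le> C * tnorm q m t" "C \<ge> 0" and E: "Hs.ons q E"
  shows "tsum q E k (contr k m L t) \<le> (C * tnorm q (k + m) t)\<^sup>2"
proof -
  have "tsum q E k (contr k m L t) \<le> (\<Sum>es\<in>Lst E k. C\<^sup>2 * (tnorm q m (\<lambda>ys. t (map (riesz q) es @ ys)))\<^sup>2)"
    unfolding tsum_def
  proof (rule sum_mono)
    fix es assume "es \<in> Lst E k"
    then have *: "length (map (riesz q) es) = k" "set (map (riesz q) es) \<subseteq> N'"
      using Hs.onsD(1)[OF E] by (auto simp: Lst_def)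
    then have "cmod (contr k m L t (map (riesz q) es)) \<le> C * tnorm q m (\<lambda>ys. t (map (riesz q) es @ ys))"
      using C(1)[OF slice_NC[OF t *]] by (simp add: contr_def)
    then have "(cmod (contr k m L t (map (riesz q) es)))\<^sup>2 \<le> (C * tnorm q m (\<lambda>ys. t (map (riesz q) es @ ys)))\<^sup>2"
      by (intro power_mono) auto
    then show "(cmod (contr k m L t (map (riesz q) es)))\<^sup>2 \<le> C\<^sup>2 * (tnorm q m (\<lambda>ys. t (map (riesz q) es @ ys)))\<^sup>2"
      by (simp add: power_mult_distrib)
  qed
  also have "\<dots> \<le> C\<^sup>2 * (tnorm q (k + m) t)\<^sup>2"
    unfolding sum_distrib_left[symmetric] by (intro mult_left_mono sum_tnorm_slices[OF t E]) auto
  finally show ?thesis by (simp add: power_mult_distrib)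
qed

lemma contr_NC:
  assumes L: "L \<in> NC_tensor_dual m" and t: "t \<in> NC_tensor (k + m)"
  shows "contr k m L t \<in> NC_tensor k"
proof -
  obtain p C where p: "C \<ge> 0" "\<And>q t. p \<le> q \<Longrightarrow> t \<in> NC_tensor m \<Longrightarrow> cmod (L t) \<le> C * tnorm q m t"
    using dual_bound[OF L] by metis
  have "tnorm_sq r k (contr k m L t) < \<infinity>" for r
  proof -
    let ?q = "max p r"
    have "tnorm_sq ?q k (contr k m L t) \<le> ennreal ((C * tnorm ?q (k + m) t)\<^sup>2)"
      by (intro tnorm_sq_leI tsum_contr[OF L t p(2) p(1)]) auto
    then have "tnorm_sq ?q k (contr k m L t) < \<infinity>" by (simp add: order_le_less_trans)
    then show ?thesis
      using tnorm_sq_mono[OF sym_form_contr[OF L t], of r ?q] by (simp add: order_le_less_trans)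
  qed
  then show ?thesis using sym_form_contr[OF L t] by (simp add: NC_tensor_def)
qed

lemma contr_bound:
  assumes L: "L \<in> NC_tensor_dual m"
  obtains p C where "C \<ge> 0" "\<And>q t. p \<le> q \<Longrightarrow> t \<in> NC_tensor (k + m) \<Longrightarrow> tnorm q k (contr k m L t) \<le> C * tnorm q (k + m) t"
proof -
  obtain p C where p: "C \<ge> 0" "\<And>q t. p \<le> q \<Longrightarrow> t \<in> NC_tensor m \<Longrightarrow> cmod (L t) \<le> C * tnorm q m t"
    using dual_bound[OF L] by metis
  have "tnorm q k (contr k m L t) \<le> C * tnorm q (k + m) t" if "p \<le> q" "t \<in> NC_tensor (k + m)" for q t
    using p by (intro tnorm_leI tsum_contr[OF L that(2) p(2)[OF that(1)] p(1)]) auto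
  then show ?thesis using that p(1) by blast
qed

text \<open>On tensor powers the contraction factors; these factors become the terms of a Cauchy
  product.\<close>

lemma contr_tensor_power:
  assumes "L \<in> NC_tensor_dual m" "\<theta> \<in> NC" "x \<in> N'"
  shows "contr k m L (tensor_power (k + m) \<theta>) (replicate k x) = pairing x \<theta> ^ k * L (tensor_power m \<theta>)"
proof -
  have "(\<lambda>ys. tensor_power (k + m) \<theta> (replicate k x @ ys)) = fscl (pairing x \<theta> ^ k) (tensor_power m \<theta>)"
  proof
    fix ys
    have "set (replicate k x) \<subseteq> N'" using assms(3) by (auto simp: set_replicate_conv_if)
    then show "tensor_power (k + m) \<theta> (replicate k x @ ys) = fscl (pairing x \<theta> ^ k) (tensor_power m \<theta>) ys"
      by (simp add: tensor_power_def fscl_def prod_list_replicate)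
  qed
  then show ?thesis
    using assms dual_scl[OF assms(1) tensor_power_NC[OF assms(2)]] by (auto simp: contr_def)
qed

end

section \<open>The Appell system\<close>

lemma power_series_zero_unique:
  fixes c :: "nat \<Rightarrow> complex"
  assumes "\<delta> > 0" and s: "\<And>z. cmod z < \<delta> \<Longrightarrow> (\<lambda>n. c n * z ^ n) sums 0"
  shows "c n = 0"
proof (cases "n = 0")
  case True
  have "(\<lambda>n. c n * 0 ^ n) sums c 0" by (rule powser_sums_zero)
  moreover have "(\<lambda>n. c n * 0 ^ n) sums 0" by (rule s) (use \<open>\<delta> > 0\<close> in simp)
  ultimately have "c 0 = 0" by (rule sums_unique2)
  then show ?thesis using True by simp
next
  case False
  show ?thesis
  proof (rule ccontr)
    assume "c n \<noteq> 0"
    show False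
    proof (rule powser_0_nonzero[of \<delta> 0 c "\<lambda>_. 0" n])
      fix e :: real assume "e > 0" and e: "\<And>z::complex. z \<in> cball 0 e - {0} \<Longrightarrow> (0::complex) \<noteq> 0"
      then have "of_real e \<in> cball (0::complex) e - {0}" by auto
      from e[OF this] show False by simp
    qed (use False assms \<open>c n \<noteq> 0\<close> in auto)
  qed
qed

lemma mlin_scale_diag:
  assumes "mlin X scl em n T" "x \<in> X" "\<And>a x. x \<in> X \<Longrightarrow> scl a x \<in> X"
  shows "T (replicate n (scl a x)) = em a ^ n * T (replicate n x)"
  using assms(1)
proof (induction n arbitrary: T)
  case (Suc n)
  have "T (scl a x # replicate n (scl a x)) = em a * T (x # replicate n (scl a x))"
    using Suc.prems assms(2,3) by simp
  also have "\<dots> = em a * (em a ^ n * T (x # replicate n x))"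
    using Suc.IH[of "\<lambda>xs. T (x # xs)"] Suc.prems assms(2) by simp
  finally show ?case by simp
qed simp

context nuclear_triple
begin

section \<open>Zero neighbourhoods, restriction to complex lines, uniqueness of kernels\<close>

lemma open_NC_ball: "open_NC {\<theta> \<in> NC. cnorm p \<theta> < r}"
  unfolding open_NC_def
proof (intro conjI ballI)
  fix \<theta> assume "\<theta> \<in> {\<theta> \<in> NC. cnorm p \<theta> < r}"
  then have \<theta>: "\<theta> \<in> NC" "cnorm p \<theta> < r" by auto
  have "\<eta> \<in> {\<theta> \<in> NC. cnorm p \<theta> < r}" if "\<eta> \<in> NC" "cnorm p (\<eta> - \<theta>) < r - cnorm p \<theta>" for \<eta>
    using cnorm_triangle[of "\<eta> - \<theta>" \<theta> p] that \<theta> by auto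
  then show "\<exists>q. \<exists>\<epsilon>>0. \<forall>\<eta>\<in>NC. cnorm q (\<eta> - \<theta>) < \<epsilon> \<longrightarrow> \<eta> \<in> {\<theta> \<in> NC. cnorm p \<theta> < r}"
    using \<theta>(2) by (intro exI[of _ p] exI[of _ "r - cnorm p \<theta>"]) auto
qed auto

lemma open_NC_0_ball:
  assumes "open_NC U" "0 \<in> U"
  obtains p r where "r > 0" "{\<theta> \<in> NC. cnorm p \<theta> < r} \<subseteq> U"
  using assms unfolding open_NC_def by fastforce

lemma open_NC_Int:
  assumes "open_NC U" "open_NC V"
  shows "open_NC (U \<inter> V)"
  unfolding open_NC_def
proof (intro conjI ballI)
  show "U \<inter> V \<subseteq> NC" using assms by (auto simp: open_NC_def)
  fix \<theta> assume \<theta>: "\<theta> \<in> U \<inter> V"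
  have "\<exists>p. \<exists>\<epsilon>>0. \<forall>\<eta>\<in>NC. cnorm p (\<eta> - \<theta>) < \<epsilon> \<longrightarrow> \<eta> \<in> U" "\<exists>p. \<exists>\<epsilon>>0. \<forall>\<eta>\<in>NC. cnorm p (\<eta> - \<theta>) < \<epsilon> \<longrightarrow> \<eta> \<in> V"
    using assms \<theta> unfolding open_NC_def by blast+
  then obtain p e q d where p: "e > 0" "\<forall>\<eta>\<in>NC. cnorm p (\<eta> - \<theta>) < e \<longrightarrow> \<eta> \<in> U"
    and q: "d > 0" "\<forall>\<eta>\<in>NC. cnorm q (\<eta> - \<theta>) < d \<longrightarrow> \<eta> \<in> V" by blast
  have \<theta>NC: "\<theta> \<in> NC" using assms \<theta> by (auto simp: open_NC_def)
  have "\<forall>\<eta>\<in>NC. cnorm (max p q) (\<eta> - \<theta>) < min e d \<longrightarrow> \<eta> \<in> U \<inter> V"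
  proof (intro ballI impI)
    fix \<eta> assume \<eta>: "\<eta> \<in> NC" "cnorm (max p q) (\<eta> - \<theta>) < min e d"
    have "cnorm p (\<eta> - \<theta>) \<le> cnorm (max p q) (\<eta> - \<theta>)" "cnorm q (\<eta> - \<theta>) \<le> cnorm (max p q) (\<eta> - \<theta>)"
      using \<eta>(1) \<theta>NC by (auto intro!: cnorm_mono)
    then have "cnorm p (\<eta> - \<theta>) < e" "cnorm q (\<eta> - \<theta>) < d" using \<eta>(2) by linarith+
    then show "\<eta> \<in> U \<inter> V" using p q \<eta>(1) by blast
  qed
  moreover have "min e d > 0" using p q by simp
  ultimately show "\<exists>p. \<exists>\<epsilon>>0. \<forall>\<eta>\<in>NC. cnorm p (\<eta> - \<theta>) < \<epsilon> \<longrightarrow> \<eta> \<in> U \<inter> V" by blast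
qed

lemma holomorphic_NC_bounded_hol:
  assumes "open_NC U" "0 \<in> U" "holomorphic_NC G U"
  obtains p r M where "bounded_hol p r M G"
proof -
  obtain V C where V: "open_NC V" "0 \<in> V" "V \<subseteq> U" "\<forall>\<eta>\<in>V. cmod (G \<eta>) \<le> C"
    using assms unfolding holomorphic_NC_def by blast
  obtain p r where r: "r > 0" "{\<theta> \<in> NC. cnorm p \<theta> < r} \<subseteq> V" using open_NC_0_ball[OF V(1,2)] by metis
  \<comment> \<open>Halving the radius places a closed ball inside the open one.\<close>
  have "bounded_hol p (r / 2) C G"
    unfolding bounded_hol_def
  proof (intro conjI ballI impI)
    fix \<theta> assume \<theta>: "\<theta> \<in> NC" "cnorm p \<theta> \<le> r / 2"
    then have "\<theta> \<in> V" using r by auto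
    then show "cmod (G \<theta>) \<le> C" using V(4) by blast
    show "(\<lambda>z. G (\<theta> + cscale z \<eta>)) analytic_on {0}" if "\<eta> \<in> NC" for \<eta>
      using assms(3) \<open>\<theta> \<in> V\<close> V(3) that unfolding holomorphic_NC_def by blast
  qed (use r in simp)
  then show ?thesis by (rule that)
qed

lemma tensor_power_cscale: "tensor_power n (cscale z \<theta>) xs = z ^ n * tensor_power n \<theta> xs" if "\<theta> \<in> NC"
proof (cases "length xs = n \<and> set xs \<subseteq> N'")
  case True
  have "pairing x (cscale z \<theta>) = z * pairing x \<theta>" if "x \<in> N'" for x
    using NC_fst_snd[OF \<open>\<theta> \<in> NC\<close>] N'_lin[OF that, of "fst \<theta>" "snd \<theta>" "Re z" "- Im z"]
      N'_lin[OF that, of "snd \<theta>" "fst \<theta>" "Re z" "Im z"]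
    by (simp add: pairing_def cscale_def complex_eq_iff)
  then have "map (\<lambda>x. pairing x (cscale z \<theta>)) xs = map (\<lambda>x. z * pairing x \<theta>) xs"
    using True by (intro map_cong) auto
  moreover have "(\<Prod>x\<leftarrow>xs. z * pairing x \<theta>) = z ^ length xs * (\<Prod>x\<leftarrow>xs. pairing x \<theta>)"
    by (induction xs) auto
  ultimately have "(\<Prod>x\<leftarrow>xs. pairing x (cscale z \<theta>)) = z ^ length xs * (\<Prod>x\<leftarrow>xs. pairing x \<theta>)"
    by (simp only:)
  then show ?thesis using True by (simp add: tensor_power_def)
qed (auto simp: tensor_power_def)

lemma dual_cscale:
  assumes "L \<in> NC_tensor_dual n" "\<theta> \<in> NC"
  shows "L (tensor_power n (cscale z \<theta>)) = z ^ n * L (tensor_power n \<theta>)"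
proof -
  have "tensor_power n (cscale z \<theta>) = fscl (z ^ n) (tensor_power n \<theta>)"
    using tensor_power_cscale[OF assms(2)] by (auto simp: fscl_def)
  then show ?thesis using dual_scl[OF assms(1) tensor_power_NC[OF assms(2)]] by simp
qed

text \<open>Along a complex line both series are power series in the parameter, so their
  coefficients agree; these are the values on tensor powers, which determine the functionals. The
  weights \<open>c\<close> cover both the factorials of the Appell expansion and the constant 1 of
  the transform.\<close>

lemma kernels_unique:
  assumes K: "\<And>n. K n \<in> NC_tensor_dual n" and L: "\<And>n. L n \<in> NC_tensor_dual n"
    and U: "open_NC U" "0 \<in> U" and c: "\<And>n. c n \<noteq> 0"
    and s: "\<And>\<theta>. \<theta> \<in> U \<Longrightarrow> (\<lambda>n. K n (tensor_power n \<theta>) / c n) sums f \<theta>"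
      "\<And>\<theta>. \<theta> \<in> U \<Longrightarrow> (\<lambda>n. L n (tensor_power n \<theta>) / c n) sums f \<theta>"
  shows "K = L"
proof
  fix n
  obtain p r where r: "r > 0" "{\<theta> \<in> NC. cnorm p \<theta> < r} \<subseteq> U" using open_NC_0_ball[OF U] by metis
  show "K n = L n"
  proof (rule dual_eqI[OF K L])
    fix \<theta> assume \<theta>: "\<theta> \<in> NC"
    define \<delta> where "\<delta> = r / (cnorm p \<theta> + 1)"
    have pos: "cnorm p \<theta> + 1 > 0" using cnorm_nonneg[of p \<theta>] by linarith
    have "(K n (tensor_power n \<theta>) - L n (tensor_power n \<theta>)) / c n = 0"
    proof (rule power_series_zero_unique)
      show "\<delta> > 0" using r pos by (simp add: \<delta>_def)
      fix z assume "cmod z < \<delta>"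
      then have "cmod z * (cnorm p \<theta> + 1) < r" using pos by (simp add: \<delta>_def pos_less_divide_eq)
      then have "cmod z * cnorm p \<theta> < r" by (simp add: distrib_left) (use norm_ge_zero[of z] in linarith)
      then have "cscale z \<theta> \<in> U" using r(2) \<theta> by (auto simp: cnorm_cscale)
      from sums_diff[OF s(1)[OF this] s(2)[OF this]]
      show "(\<lambda>n. (K n (tensor_power n \<theta>) - L n (tensor_power n \<theta>)) / c n * z ^ n) sums 0"
        by (simp add: dual_cscale[OF K \<theta>] dual_cscale[OF L \<theta>] diff_divide_distrib left_diff_distrib right_diff_distrib mult.commute)
    qed
    then show "K n (tensor_power n \<theta>) = L n (tensor_power n \<theta>)" using c[of n] by simp
  qed
qed

text \<open>Continuity separated from linearity and from the convention off
  \<open>NC_tensor n\<close>. Asking for the bound at all \<open>q\<close> beyond some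
  \<open>p\<close> makes sums and compositions with contractions immediate.\<close>

definition tame :: "nat \<Rightarrow> ((('h \<Rightarrow> real) list \<Rightarrow> complex) \<Rightarrow> complex) \<Rightarrow> bool" where
  "tame n f \<longleftrightarrow> (\<exists>p C. C \<ge> 0 \<and> (\<forall>q\<ge>p. \<forall>t\<in>NC_tensor n. cmod (f t) \<le> C * tnorm q n t))"

lemma tame_dual: "L \<in> NC_tensor_dual n \<Longrightarrow> tame n L"
  unfolding tame_def by (metis dual_bound)

lemma tame_mult: "tame n f \<Longrightarrow> tame n (\<lambda>t. c * f t)"
proof -
  assume "tame n f"
  then obtain p C where C: "C \<ge> 0" "\<And>q t. q \<ge> p \<Longrightarrow> t \<in> NC_tensor n \<Longrightarrow> cmod (f t) \<le> C * tnorm q n t"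
    unfolding tame_def by blast
  have "cmod (c * f t) \<le> (cmod c * C) * tnorm q n t" if "q \<ge> p" "t \<in> NC_tensor n" for q t
    using mult_left_mono[OF C(2)[OF that], of "cmod c"] by (simp add: norm_mult mult.assoc)
  then show ?thesis unfolding tame_def using C(1) by (intro exI[of _ p] exI[of _ "cmod c * C"]) auto
qed

lemma tame_add:
  assumes "tame n f" "tame n g"
  shows "tame n (\<lambda>t. f t + g t)"
proof -
  obtain p C where C: "C \<ge> 0" "\<And>q t. q \<ge> p \<Longrightarrow> t \<in> NC_tensor n \<Longrightarrow> cmod (f t) \<le> C * tnorm q n t"
    using assms(1) unfolding tame_def by blast
  obtain p' C' where C': "C' \<ge> 0" "\<And>q t. q \<ge> p' \<Longrightarrow> t \<in> NC_tensor n \<Longrightarrow> cmod (g t) \<le> C' * tnorm q n t"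
    using assms(2) unfolding tame_def by blast
  have "cmod (f t + g t) \<le> (C + C') * tnorm q n t" if "q \<ge> max p p'" "t \<in> NC_tensor n" for q t
    using C(2)[of q t] C'(2)[of q t] that norm_triangle_ineq[of "f t" "g t"] by (simp add: distrib_right)
  then show ?thesis unfolding tame_def using C(1) C'(1) by (intro exI[of _ "max p p'"] exI[of _ "C + C'"]) auto
qed

lemma tame_0: "tame n (\<lambda>_. 0)"
  unfolding tame_def by (intro exI[of _ 0]) auto

lemma tame_sum: "finite I \<Longrightarrow> (\<And>i. i \<in> I \<Longrightarrow> tame n (f i)) \<Longrightarrow> tame n (\<lambda>t. \<Sum>i\<in>I. f i t)"
  by (induction I rule: finite_induct) (auto intro: tame_add tame_0)

lemma tame_cong: "tame n f \<Longrightarrow> (\<And>t. t \<in> NC_tensor n \<Longrightarrow> f t = g t) \<Longrightarrow> tame n g"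
  unfolding tame_def by metis

lemma tame_contr:
  assumes L: "L \<in> NC_tensor_dual m" and f: "tame k f"
  shows "tame (k + m) (\<lambda>t. f (contr k m L t))"
proof -
  obtain p C where C: "C \<ge> 0" "\<And>q t. q \<ge> p \<Longrightarrow> t \<in> NC_tensor k \<Longrightarrow> cmod (f t) \<le> C * tnorm q k t"
    using f unfolding tame_def by blast
  obtain p' C' where C': "C' \<ge> 0"
    "\<And>q t. p' \<le> q \<Longrightarrow> t \<in> NC_tensor (k + m) \<Longrightarrow> tnorm q k (contr k m L t) \<le> C' * tnorm q (k + m) t"
    using contr_bound[OF L] by metis
  have "cmod (f (contr k m L t)) \<le> (C * C') * tnorm q (k + m) t" if q: "q \<ge> max p p'" and t: "t \<in> NC_tensor (k + m)" for q t
  proof -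
    have "cmod (f (contr k m L t)) \<le> C * tnorm q k (contr k m L t)"
      using q by (intro C(2) contr_NC[OF L t]) auto
    also have "\<dots> \<le> C * (C' * tnorm q (k + m) t)" using q t C(1) by (intro mult_left_mono C'(2)) auto
    finally show ?thesis by (simp add: mult.assoc)
  qed
  then show ?thesis unfolding tame_def using C(1) C'(1) by (intro exI[of _ "max p p'"] exI[of _ "C * C'"]) auto
qed

lemma tame_eval:
  assumes "x \<in> N'"
  shows "tame n (\<lambda>t. t (replicate n x))"
proof -
  obtain p where p: "\<And>q. p \<le> q \<Longrightarrow> \<exists>g\<in>Hp q. x = riesz q g" using N'_riesz[OF assms] by metis
  obtain g where g: "g \<in> Hp p" "x = riesz p g" using p by blast
  have "cmod (t (replicate n x)) \<le> nm p g ^ n * tnorm q n t" if "q \<ge> p" "t \<in> NC_tensor n" for q t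
  proof -
    have "cmod (t (map (riesz p) (replicate n g))) \<le> tnorm p n t * (\<Prod>x\<leftarrow>replicate n g. nm p x)"
      by (intro tensor_bound[OF NC_tensorD(1)[OF that(2)] NC_tensorD(2)[OF that(2)]]) (use g in simp)
    also have "\<dots> \<le> tnorm q n t * (\<Prod>x\<leftarrow>replicate n g. nm p x)"
      using tnorm_mono[OF that(2,1)] g by (intro mult_right_mono) (auto simp: prod_list_replicate)
    finally show ?thesis by (simp add: g(2) prod_list_replicate mult.commute)
  qed
  then show ?thesis unfolding tame_def using g(1) by (intro exI[of _ p] exI[of _ "nm p g ^ n"]) auto
qed

lemma dual_tameI:
  assumes "\<And>t. t \<notin> NC_tensor n \<Longrightarrow> L t = 0"
    "\<And>s t a b. s \<in> NC_tensor n \<Longrightarrow> t \<in> NC_tensor n \<Longrightarrow> L (fadd (fscl a s) (fscl b t)) = a * L s + b * L t"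
    "tame n L"
  shows "L \<in> NC_tensor_dual n"
proof -
  obtain p C where "C \<ge> 0" "\<And>t. t \<in> NC_tensor n \<Longrightarrow> cmod (L t) \<le> C * tnorm p n t"
    using assms(3) unfolding tame_def by blast
  then show ?thesis using NC_tensor_dualI[OF assms(1,2), where C=C and p=p] by blast
qed

section \<open>Reciprocals of holomorphic functions near 0\<close>

lemma bounded_hol_near_0:
  assumes G: "bounded_hol p r M G" and \<theta>: "\<theta> \<in> NC" "cnorm p \<theta> \<le> r / 2"
  shows "cmod (G \<theta> - G 0) \<le> 2 * M * cnorm p \<theta> / r"
proof -
  have r: "r > 0" using G by (simp add: bounded_hol_def)
  define q where "q = cnorm p \<theta> / r"
  have q: "0 \<le> q" "q \<le> 1 / 2" using r \<theta>(2) by (auto simp: q_def field_simps)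
  have "(\<lambda>n. tcoeff G n \<theta>) sums G \<theta>" using \<theta> r by (intro tcoeff_sums[OF G]) auto
  from sums_split_initial_segment[OF this, of 1]
  have s: "(\<lambda>n. tcoeff G (Suc n) \<theta>) sums (G \<theta> - G 0)" by (simp add: tcoeff_def)
  have gs: "(\<lambda>n. M * q * q ^ n) sums (M * q * (1 / (1 - q)))" using q by (intro sums_mult geometric_sums) auto
  have "cmod (\<Sum>n. tcoeff G (Suc n) \<theta>) \<le> (\<Sum>n. M * q * q ^ n)"
  proof (rule norm_suminf_le[OF _ sums_summable[OF gs]])
    fix n
    show "cmod (tcoeff G (Suc n) \<theta>) \<le> M * q * q ^ n"
      using tcoeff_bound[OF G \<theta>(1), of "Suc n"] by (simp add: q_def power_divide)
  qed
  then have "cmod (G \<theta> - G 0) \<le> M * q * (1 / (1 - q))" using sums_unique[OF s] sums_unique[OF gs] by simp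
  also have "\<dots> \<le> M * q * 2"
    using q bounded_hol_M[OF G] by (intro mult_left_mono) (auto simp: field_simps)
  finally show ?thesis by (simp add: q_def mult_ac)
qed

text \<open>The radius is chosen so that \<open>G\<close> deviates from \<open>G 0 = 1\<close> by at
  most \<open>2 * M / (4 * (M + 1)) \<le> 1 / 2\<close>; hence the reciprocal is at most 2.\<close>

lemma bounded_hol_inverse:
  assumes G: "bounded_hol p r M G" and G0: "G 0 = 1"
  shows "bounded_hol p (r / (4 * (M + 1))) 2 (\<lambda>\<theta>. 1 / G \<theta>)"
proof -
  have r: "r > 0" using G by (simp add: bounded_hol_def)
  have M: "M \<ge> 0" by (rule bounded_hol_M[OF G])
  let ?r = "r / (4 * (M + 1))"
  have rr: "?r > 0" "?r \<le> r / 2" using r M by (auto simp: field_simps)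
  have low: "cmod (G \<theta>) \<ge> 1 / 2" if \<theta>: "\<theta> \<in> NC" "cnorm p \<theta> \<le> ?r" for \<theta>
  proof -
    have "cmod (G \<theta> - G 0) \<le> 2 * M * cnorm p \<theta> / r"
      by (rule bounded_hol_near_0[OF G \<theta>(1) order_trans[OF \<theta>(2) rr(2)]])
    also have "\<dots> \<le> 2 * M * ?r / r" using \<theta> M r by (intro divide_right_mono mult_left_mono) auto
    also have "2 * M * ?r / r = M / (M + 1) / 2" using r M by (simp add: divide_simps)
    also have "\<dots> \<le> 1 / 2" using M by (simp add: field_simps)
    finally have "cmod (G \<theta> - 1) \<le> 1 / 2" using G0 by simp
    then show ?thesis using norm_triangle_ineq2[of 1 "1 - G \<theta>"] by (simp add: norm_minus_commute)
  qed
  show ?thesis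
    unfolding bounded_hol_def
  proof (intro conjI ballI impI)
    fix \<theta> assume \<theta>: "\<theta> \<in> NC" "cnorm p \<theta> \<le> ?r"
    have l: "cmod (G \<theta>) \<ge> 1 / 2" by (rule low[OF \<theta>])
    then have nz: "G \<theta> \<noteq> 0" by auto
    show "cmod (1 / G \<theta>) \<le> 2" using l nz by (simp add: norm_divide field_simps)
    fix \<eta> assume \<eta>: "\<eta> \<in> NC"
    have "cnorm p \<theta> \<le> r" using \<theta>(2) rr(2) r by linarith
    then have "(\<lambda>z. G (\<theta> + cscale z \<eta>)) analytic_on {0}" using G \<theta>(1) \<eta> unfolding bounded_hol_def by auto
    then show "(\<lambda>z. 1 / G (\<theta> + cscale z \<eta>)) analytic_on {0}"
      using nz by (intro analytic_on_divide) auto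
  qed (use rr in simp)
qed

end

locale appell_setting = nuclear_triple Hp ip
  for Hp :: "nat \<Rightarrow> 'h::{real_inner, complete_space, second_countable_topology} set"
    and ip :: "nat \<Rightarrow> 'h \<Rightarrow> 'h \<Rightarrow> real" +
  fixes \<mu> :: "('h \<Rightarrow> real) measure"
  assumes M_a: "\<mu> \<in> M_a" and prob: "prob_space \<mu>"
begin

section \<open>Appell kernels by contraction with the kernels at 0\<close>

lemma laplace_0: "laplace \<mu> 0 = 1"
proof -
  interpret prob_space \<mu> by (rule prob)
  have "sets \<mu> = sets cylinder_algebra" using M_a by (simp add: M_a_def)
  then have "space \<mu> = space cylinder_algebra" by (rule sets_eq_imp_space_eq)
  also have "\<dots> = N'" unfolding cylinder_algebra_def by (intro space_measure_of) auto
  finally have sp: "space \<mu> = N'" .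
  have "pairing x 0 = 0" if "x \<in> N'" for x
    using N'_zero[OF that] by (simp add: pairing_def complex_eq_iff)
  then have "laplace \<mu> 0 = (\<integral>x. 1 \<partial>\<mu>)"
    unfolding laplace_def by (intro Bochner_Integration.integral_cong refl) (simp add: sp)
  then show ?thesis by (simp add: prob_space)
qed

text \<open>Two by-products are recorded for later use: absolute summability, for the Cauchy product
  with the exponential series, and the value 1 in degree 0, which makes the Appell system triangular
  with identity on the diagonal.\<close>

lemma inverse_laplace_kernels:
  "\<exists>P. (\<forall>n. P n \<in> NC_tensor_dual n) \<and> (\<forall>\<theta>\<in>NC. P 0 (tensor_power 0 \<theta>) = 1) \<and>
     (\<exists>p r. r > 0 \<and> (\<forall>\<theta>\<in>NC. cnorm p \<theta> < r \<longrightarrow> summable (\<lambda>n. cmod (P n (tensor_power n \<theta>) / fact n)) \<and>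
        (\<lambda>n. P n (tensor_power n \<theta>) / fact n) sums (1 / laplace \<mu> \<theta>)))"
proof -
  obtain U where "open_NC U" "0 \<in> U" "holomorphic_NC (laplace \<mu>) U" using M_a by (auto simp: M_a_def)
  then obtain p r M where "bounded_hol p r M (laplace \<mu>)" using holomorphic_NC_bounded_hol by metis
  from bounded_hol_inverse[OF this laplace_0] obtain r where
    G: "bounded_hol p r 2 (\<lambda>\<theta>. 1 / laplace \<mu> \<theta>)" by blast
  let ?G = "\<lambda>\<theta>. 1 / laplace \<mu> \<theta>"
  obtain L where L: "\<And>n. L n \<in> NC_tensor_dual n" "\<And>n \<theta>. \<theta> \<in> NC \<Longrightarrow> L n (tensor_power n \<theta>) = tcoeff ?G n \<theta>"
    using Taylor_kernels[of p] G by metis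
  have r: "r > 0" using G by (simp add: bounded_hol_def)
  \<comment> \<open>The factorial is that of the Appell expansion; the zero summand brings
    \<open>P n\<close> into the form of \<open>dual_lc\<close>.\<close>
  define P where "P n = (\<lambda>t. fact n * L n t + 0 * L n t)" for n
  have "P n \<in> NC_tensor_dual n" for n unfolding P_def by (rule dual_lc[OF L(1) L(1)])
  moreover have PL: "P n (tensor_power n \<theta>) / fact n = tcoeff ?G n \<theta>" if "\<theta> \<in> NC" for n \<theta>
    using L(2)[OF that] by (simp add: P_def)
  moreover have "P 0 (tensor_power 0 \<theta>) = 1" if "\<theta> \<in> NC" for \<theta>
    using PL[OF that, of 0] laplace_0 by (simp add: tcoeff_def)
  moreover have "summable (\<lambda>n. cmod (tcoeff ?G n \<theta>))" if "\<theta> \<in> NC" "cnorm p \<theta> < r" for \<theta>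
  proof (rule summable_comparison_test')
    show "summable (\<lambda>n. 2 * (cnorm p \<theta> / r) ^ n)" using that r by (intro summable_mult summable_geometric) auto
    show "norm (cmod (tcoeff ?G n \<theta>)) \<le> 2 * (cnorm p \<theta> / r) ^ n" for n
      using tcoeff_bound[OF G that(1), of n] by (simp add: power_divide)
  qed
  moreover have "(\<lambda>n. tcoeff ?G n \<theta>) sums ?G \<theta>" if "\<theta> \<in> NC" "cnorm p \<theta> < r" for \<theta>
    by (rule tcoeff_sums[OF G that])
  ultimately show ?thesis
    using r by (intro exI[of _ P] conjI exI[of _ p] exI[of _ r]) (auto simp: PL)
qed

definition P0 :: "nat \<Rightarrow> (('h \<Rightarrow> real) list \<Rightarrow> complex) \<Rightarrow> complex" where
  "P0 = (SOME P. (\<forall>n. P n \<in> NC_tensor_dual n) \<and> (\<forall>\<theta>\<in>NC. P 0 (tensor_power 0 \<theta>) = 1) \<and>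
     (\<exists>p r. r > 0 \<and> (\<forall>\<theta>\<in>NC. cnorm p \<theta> < r \<longrightarrow> summable (\<lambda>n. cmod (P n (tensor_power n \<theta>) / fact n)) \<and>
        (\<lambda>n. P n (tensor_power n \<theta>) / fact n) sums (1 / laplace \<mu> \<theta>))))"

lemma P0: "P0 n \<in> NC_tensor_dual n" "\<theta> \<in> NC \<Longrightarrow> P0 0 (tensor_power 0 \<theta>) = 1"
  "\<exists>p r. r > 0 \<and> (\<forall>\<theta>\<in>NC. cnorm p \<theta> < r \<longrightarrow> summable (\<lambda>n. cmod (P0 n (tensor_power n \<theta>) / fact n)) \<and>
        (\<lambda>n. P0 n (tensor_power n \<theta>) / fact n) sums (1 / laplace \<mu> \<theta>))"
  using someI_ex[OF inverse_laplace_kernels] unfolding P0_def[symmetric] by blast+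

text \<open>Up to the binomial coefficient, the component of degree \<open>k\<close> of the Appell
  polynomial with coefficient \<open>t\<close> of degree \<open>n\<close>.\<close>

definition lower :: "nat \<Rightarrow> nat \<Rightarrow> (('h \<Rightarrow> real) list \<Rightarrow> complex) \<Rightarrow> ('h \<Rightarrow> real) list \<Rightarrow> complex" where
  "lower n k t = contr k (n - k) (P0 (n - k)) t"

lemma lower_NC: "k \<le> n \<Longrightarrow> t \<in> NC_tensor n \<Longrightarrow> lower n k t \<in> NC_tensor k"
  unfolding lower_def using contr_NC[OF P0(1), of t k "n - k"] by simp

lemma lower_lc:
  "k \<le> n \<Longrightarrow> s \<in> NC_tensor n \<Longrightarrow> t \<in> NC_tensor n \<Longrightarrow>
    lower n k (fadd (fscl a s) (fscl b t)) = fadd (fscl a (lower n k s)) (fscl b (lower n k t))"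
  unfolding lower_def using contr_lc[OF P0(1), of s k "n - k" t] by simp

lemma tame_lower: "k \<le> n \<Longrightarrow> tame k f \<Longrightarrow> tame n (\<lambda>t. f (lower n k t))"
  unfolding lower_def using tame_contr[OF P0(1), of k f "n - k"] by simp

text \<open>A tensor of degree 0 is a multiple of the empty tensor power, on which
  \<open>P0 0\<close> is 1.\<close>

lemma lower_self:
  assumes t: "t \<in> NC_tensor n"
  shows "lower n n t = t"
proof
  fix xs
  show "lower n n t xs = t xs"
  proof (cases "length xs = n \<and> set xs \<subseteq> N'")
    case True
    have "(\<lambda>ys. t (xs @ ys)) = fscl (t xs) (tensor_power 0 0)"
    proof
      fix ys
      show "t (xs @ ys) = fscl (t xs) (tensor_power 0 0) ys"
        using sym_formD_off[OF NC_tensorD(1)[OF t], of "xs @ ys"] True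
        by (cases "ys = []") (auto simp: fscl_def tensor_power_def)
    qed
    then show ?thesis
      using True P0(2)[of 0] dual_scl[OF P0(1) tensor_power_NC, of 0 0] by (simp add: lower_def contr_def)
  next
    case False
    then show ?thesis using sym_formD_off[OF NC_tensorD(1)[OF t]] by (auto simp: lower_def contr_def)
  qed
qed

text \<open>The Appell identity: the kernel of degree \<open>n\<close> at \<open>x\<close> is the
  binomial sum of the products of the \<open>k\<close>-th power of \<open>x\<close> with the kernel
  of degree \<open>n - k\<close> at 0, written in terms of contractions.\<close>

definition PA :: "('h \<Rightarrow> real) \<Rightarrow> nat \<Rightarrow> (('h \<Rightarrow> real) list \<Rightarrow> complex) \<Rightarrow> complex" where
  "PA x n t = (if t \<in> NC_tensor n then \<Sum>k\<le>n. of_nat (n choose k) * lower n k t (replicate k x) else 0)"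

lemma PA_dual:
  assumes x: "x \<in> N'"
  shows "PA x n \<in> NC_tensor_dual n"
proof (rule dual_tameI)
  show "PA x n (fadd (fscl a s) (fscl b t)) = a * PA x n s + b * PA x n t"
    if s: "s \<in> NC_tensor n" and t: "t \<in> NC_tensor n" for s t a b
  proof -
    have "PA x n (fadd (fscl a s) (fscl b t)) =
      (\<Sum>k\<le>n. a * (of_nat (n choose k) * lower n k s (replicate k x)) + b * (of_nat (n choose k) * lower n k t (replicate k x)))"
      unfolding PA_def using NC_tensor_lc[OF s t] lower_lc[OF _ s t]
      by (auto intro!: sum.cong simp: fadd_def fscl_def algebra_simps)
    then show ?thesis using s t by (simp add: PA_def sum.distrib sum_distrib_left)
  qed
  have "tame n (\<lambda>t. \<Sum>k\<le>n. of_nat (n choose k) * lower n k t (replicate k x))"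
    by (intro tame_sum tame_mult tame_lower tame_eval[OF x]) auto
  then show "tame n (PA x n)" by (rule tame_cong) (simp add: PA_def)
qed (simp add: PA_def)

text \<open>\<open>e_mu\<close> is the product of \<open>exp (pairing x \<theta>)\<close> and the
  reciprocal Laplace transform; the Cauchy product of their series produces the binomial
  sums.\<close>

lemma PA_sums:
  assumes x: "x \<in> N'"
  shows "\<exists>U. open_NC U \<and> 0 \<in> U \<and> (\<forall>\<theta>\<in>U. (\<lambda>n. PA x n (tensor_power n \<theta>) / fact n) sums e_mu \<mu> \<theta> x)"
proof -
  obtain p r where r0: "r > 0" and r1: "\<forall>\<theta>\<in>NC. cnorm p \<theta> < r \<longrightarrow>
      summable (\<lambda>n. cmod (P0 n (tensor_power n \<theta>) / fact n)) \<and>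
      (\<lambda>n. P0 n (tensor_power n \<theta>) / fact n) sums (1 / laplace \<mu> \<theta>)"
    using P0(3) by (elim exE conjE)
  note r = r0 r1[rule_format, THEN conjunct1] r1[rule_format, THEN conjunct2]
  have "(\<lambda>n. PA x n (tensor_power n \<theta>) / fact n) sums e_mu \<mu> \<theta> x" if \<theta>: "\<theta> \<in> NC" "cnorm p \<theta> < r" for \<theta>
  proof -
    let ?w = "pairing x \<theta>"
    define a where "a k = ?w ^ k / fact k" for k
    define b where "b k = P0 k (tensor_power k \<theta>) / fact k" for k
    have a: "a = (\<lambda>k. ?w ^ k /\<^sub>R fact k)" by (auto simp: a_def scaleR_conv_of_real divide_inverse)
    have "summable (\<lambda>k. norm (a k))" unfolding a by (rule summable_norm_exp)
    moreover have "summable (\<lambda>k. norm (b k))" unfolding b_def using r(2)[OF \<theta>] by simp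
    ultimately have "(\<lambda>n. \<Sum>k\<le>n. a k * b (n - k)) sums ((\<Sum>k. a k) * (\<Sum>k. b k))" by (rule Cauchy_product_sums)
    moreover have "(\<Sum>k. a k) = exp ?w" unfolding a by (simp add: exp_def)
    moreover have "(\<Sum>k. b k) = 1 / laplace \<mu> \<theta>" unfolding b_def using sums_unique[OF r(3)[OF \<theta>]] by simp
    moreover have "(\<Sum>k\<le>n. a k * b (n - k)) = PA x n (tensor_power n \<theta>) / fact n" for n
    proof -
      have "lower n k (tensor_power n \<theta>) (replicate k x) = ?w ^ k * P0 (n - k) (tensor_power (n - k) \<theta>)"
        if "k \<le> n" for k
        using contr_tensor_power[OF P0(1)[of "n - k"] \<theta>(1) x, of k] that by (simp add: lower_def)
      then have "PA x n (tensor_power n \<theta>) / fact n =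
          (\<Sum>k\<le>n. of_nat (n choose k) * (?w ^ k * P0 (n - k) (tensor_power (n - k) \<theta>)) / fact n)"
        using \<theta>(1) by (simp add: PA_def sum_divide_distrib)
      also have "\<dots> = (\<Sum>k\<le>n. a k * b (n - k))"
        by (intro sum.cong refl) (simp add: a_def b_def binomial_fact)
      finally show ?thesis by simp
    qed
    ultimately show ?thesis by (simp add: e_mu_def)
  qed
  then show ?thesis
    using r(1) open_NC_ball[of p r] by (intro exI[of _ "{\<theta> \<in> NC. cnorm p \<theta> < r}"]) auto
qed

text \<open>The unique description is resolved by comparing two expansions on the intersection of
  their neighbourhoods.\<close>

lemma appell_eq:
  assumes x: "x \<in> N'"
  shows "appell \<mu> x = PA x"
  unfolding appell_def
proof (rule the_equality)
  show "(\<forall>n. PA x n \<in> NC_tensor_dual n) \<and>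
     (\<exists>U. open_NC U \<and> 0 \<in> U \<and> (\<forall>\<theta>\<in>U. (\<lambda>n. PA x n (tensor_power n \<theta>) / fact n) sums e_mu \<mu> \<theta> x))"
    using PA_dual[OF x] PA_sums[OF x] by blast
  fix Q assume Q: "(\<forall>n. Q n \<in> NC_tensor_dual n) \<and>
     (\<exists>U. open_NC U \<and> 0 \<in> U \<and> (\<forall>\<theta>\<in>U. (\<lambda>n. Q n (tensor_power n \<theta>) / fact n) sums e_mu \<mu> \<theta> x))"
  then obtain U where U: "open_NC U" "0 \<in> U" "\<And>\<theta>. \<theta> \<in> U \<Longrightarrow> (\<lambda>n. Q n (tensor_power n \<theta>) / fact n) sums e_mu \<mu> \<theta> x" by blast
  obtain V where V: "open_NC V" "0 \<in> V" "\<And>\<theta>. \<theta> \<in> V \<Longrightarrow> (\<lambda>n. PA x n (tensor_power n \<theta>) / fact n) sums e_mu \<mu> \<theta> x"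
    using PA_sums[OF x] by blast
  show "Q = PA x"
  proof (rule kernels_unique[where U="U \<inter> V" and c="fact" and f="\<lambda>\<theta>. e_mu \<mu> \<theta> x"])
    show "open_NC (U \<inter> V)" by (rule open_NC_Int[OF U(1) V(1)])
  qed (use Q PA_dual[OF x] U V in auto)
qed

lemma appell_poly_eq:
  assumes "t \<in> NC_tensor n"
  shows "appell_poly \<mu> n t = (\<lambda>x. \<Sum>k\<le>n. of_nat (n choose k) * monomial k (lower n k t) x)"
  using assms by (auto simp: appell_poly_def appell_eq PA_def monomial_def fun_eq_iff)

end

section \<open>Polynomials and their dual\<close>

lemma topspace_final_lc:
  assumes base: "\<And>i A B. A \<in> nb i \<Longrightarrow> B \<in> nb i \<Longrightarrow> \<exists>C\<in>nb i. C \<subseteq> A \<inter> B"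
    and V: "abs_convex add scl V" "\<And>u v. u \<in> V \<Longrightarrow> v \<in> V \<Longrightarrow> add u v \<in> V" "\<And>i. \<exists>B\<in>nb i. B \<subseteq> V"
  shows "topspace (final_lc_topology V add scl nb) = V"
proof
  have op: "openin (final_lc_topology V add scl nb) W \<longleftrightarrow> W \<subseteq> V \<and>
     (\<forall>w\<in>W. \<exists>U\<subseteq>V. abs_convex add scl U \<and> (\<forall>i. \<exists>B\<in>nb i. B \<subseteq> U) \<and> (\<forall>u\<in>U. add w u \<in> W))" for W
    by (rule openin_final_lc_topology) (rule base)
  have "openin (final_lc_topology V add scl nb) V" unfolding op using V by blast
  then show "V \<subseteq> topspace (final_lc_topology V add scl nb)" by (rule openin_subset)
  have "openin (final_lc_topology V add scl nb) (topspace (final_lc_topology V add scl nb))" by (rule openin_topspace)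
  then show "topspace (final_lc_topology V add scl nb) \<subseteq> V" unfolding op by blast
qed

lemma real_polynomial_zero:
  fixes c :: "nat \<Rightarrow> complex"
  assumes "\<And>a::real. (\<Sum>n\<le>m. c n * of_real a ^ n) = 0" "n \<le> m"
  shows "c n = 0"
proof -
  define q where "q = (\<Sum>n\<le>m. monom (c n) n)"
  have "poly q (of_real a) = 0" for a :: real
    using assms(1)[of a] by (simp add: q_def poly_sum poly_monom)
  then have "range complex_of_real \<subseteq> {z. poly q z = 0}" by auto
  moreover have "infinite (range complex_of_real)"
    by (simp add: finite_image_iff inj_on_def infinite_UNIV_char_0)
  ultimately have "q = 0" using poly_roots_finite[of q] finite_subset by blast
  then have "coeff q n = 0" by simp
  then show ?thesis using assms(2) by (simp add: q_def coeff_sum if_distrib cong: if_cong)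
qed

context nuclear_triple
begin

section \<open>Uniqueness of the coefficients of a polynomial\<close>

lemma NC_tensor_scale_diag:
  assumes t: "t \<in> NC_tensor n" and x: "x \<in> N'"
  shows "(\<lambda>\<xi>. a * x \<xi>) \<in> N'" "t (replicate n (\<lambda>\<xi>. a * x \<xi>)) = of_real a ^ n * t (replicate n x)"
proof -
  obtain p where p: "\<And>q. p \<le> q \<Longrightarrow> \<exists>g\<in>Hp q. x = riesz q g" using N'_riesz[OF x] by metis
  obtain g where g: "g \<in> Hp p" "x = riesz p g" using p by blast
  have eq: "(\<lambda>\<xi>. a * x \<xi>) = riesz p (a *\<^sub>R g)"
    using riesz_lin[OF g(1) g(1), of a 0] g(2) by simp
  show "(\<lambda>\<xi>. a * x \<xi>) \<in> N'" unfolding eq using g(1) by auto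
  have "t (map (riesz p) (replicate n (a *\<^sub>R g))) = of_real a ^ n * t (map (riesz p) (replicate n g))"
    by (rule mlin_scale_diag[OF rmlin_sym_form0[OF NC_tensorD(1)[OF t]] g(1)]) auto
  then show "t (replicate n (\<lambda>\<xi>. a * x \<xi>)) = of_real a ^ n * t (replicate n x)"
    unfolding eq unfolding g(2) map_replicate .
qed

text \<open>Polarisation: the indicator of the orbit of \<open>(0, \<dots>, n - 1)\<close> is a combination of product
  functions, and each product function yields a value of \<open>t\<close> on the diagonal.\<close>

lemma NC_tensor_diag_zero:
  assumes t: "t \<in> NC_tensor n" and z: "\<And>x. x \<in> N' \<Longrightarrow> t (replicate n x) = 0"
  shows "t = (\<lambda>_. 0)"
proof
  fix xs
  note sf = NC_tensorD(1)[OF t]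
  show "t xs = 0"
  proof (cases "length xs = n \<and> set xs \<subseteq> N'")
    case True
    then obtain p where p: "\<And>q. p \<le> q \<Longrightarrow> \<exists>gs. set gs \<subseteq> Hp q \<and> length gs = length xs \<and> xs = map (riesz q) gs"
      using N'_list_riesz[of xs] by metis
    obtain gs where gs: "set gs \<subseteq> Hp p" "length gs = n" "xs = map (riesz p) gs"
      using p[of p] True by auto
    define T where "T es = t (map (riesz p) es)" for es
    define c where "c is = (if mset is = mset [0..<n] then 1 else 0 :: complex)" for "is"
    have "\<exists>D a z. \<forall>is\<in>Lst {..<n} n. c is = (\<Sum>j\<le>(D::nat). a j * of_real (\<Prod>i\<leftarrow>is. z j i))"
      by (rule symmetric_function_span[of "{..<n}" c n]) (auto simp: c_def)
    then obtain D :: nat and a z' where az: "\<And>is. is \<in> Lst {..<n} n \<Longrightarrow> c is = (\<Sum>j\<le>D. a j * of_real (\<Prod>i\<leftarrow>is. z' j i))"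
      by blast
    have gi: "gs ! i \<in> Hp p" if "i < n" for i using gs that nth_mem[of i gs] by auto
    have diag: "(\<Sum>is\<in>Lst {..<n} n. of_real (\<Prod>i\<leftarrow>is. z' j i) * T (map ((!) gs) is)) = 0" for j
    proof -
      let ?g = "\<Sum>i<n. z' j i *\<^sub>R gs ! i"
      have "T (replicate n ?g) = (\<Sum>is\<in>Lst {..<n} n. (\<Prod>i\<leftarrow>is. of_real (z' j i)) * T (map ((!) gs) is))"
        unfolding T_def
        by (rule mlin_diag[OF _ _ _ _ _ rmlin_sym_form0[OF sf]]) (use gi in auto)
      moreover have "T (replicate n ?g) = 0"
        unfolding T_def map_replicate using gi by (intro z riesz_in_N' Hs.S_intros) auto
      moreover have "(\<Prod>i\<leftarrow>is. complex_of_real (z' j i)) = of_real (\<Prod>i\<leftarrow>is. z' j i)" for "is"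
        by (induction "is") auto
      ultimately show ?thesis by simp
    qed
    have "(\<Sum>is\<in>Lst {..<n} n. c is * T (map ((!) gs) is)) =
        (\<Sum>j\<le>D. a j * (\<Sum>is\<in>Lst {..<n} n. of_real (\<Prod>i\<leftarrow>is. z' j i) * T (map ((!) gs) is)))"
      unfolding sum_distrib_left by (subst sum.swap) (simp add: az sum_distrib_right mult.assoc)
    also have "\<dots> = 0" by (simp add: diag)
    also have "(\<Sum>is\<in>Lst {..<n} n. c is * T (map ((!) gs) is)) = (\<Sum>is\<in>Lst {..<n} n. c is * T gs)"
    proof (intro sum.cong refl)
      fix "is"
      show "c is * T (map ((!) gs) is) = c is * T gs"
      proof (cases "mset is = mset [0..<n]")
        case True
        then have "mset (map (riesz p) (map ((!) gs) is)) = mset (map (riesz p) (map ((!) gs) [0..<n]))" by simp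
        also have "map ((!) gs) [0..<n] = gs" using gs(2) map_nth[of gs] by simp
        finally show ?thesis unfolding T_def using sym_formD_sym[OF sf] by metis
      qed (simp add: c_def)
    qed
    also have "\<dots> = (\<Sum>is\<in>Lst {..<n} n. c is) * T gs" by (simp add: sum_distrib_right)
    finally have "(\<Sum>is\<in>Lst {..<n} n. c is) = 0 \<or> T gs = 0" by simp
    \<comment> \<open>The sum counts the rearrangements of \<open>[0..<n]\<close>, among them that
      list itself.\<close>
    moreover have "(\<Sum>is\<in>Lst {..<n} n. c is) \<noteq> 0"
    proof -
      have "(\<Sum>is\<in>Lst {..<n} n. c is) = of_nat (card {is \<in> Lst {..<n} n. mset is = mset [0..<n]})"
        by (simp add: c_def sum.If_cases Int_def conj_commute)
      moreover have "[0..<n] \<in> {is \<in> Lst {..<n} n. mset is = mset [0..<n]}" by (auto simp: Lst_def)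
      moreover have "finite {is \<in> Lst {..<n} n. mset is = mset [0..<n]}" by simp
      ultimately show ?thesis by (metis card_gt_0_iff empty_iff of_nat_0_eq_iff less_not_refl)
    qed
    ultimately show ?thesis by (simp add: T_def gs(3))
  qed (use sym_formD_off[OF sf] in auto)
qed

text \<open>Coefficients beyond \<open>m\<close> are required to vanish, so the sequence
  \<open>t\<close> is determined by \<open>\<phi>\<close> whatever \<open>m\<close> is chosen, and
  representations can be lifted to a common \<open>m\<close>.\<close>

definition rep :: "(('h \<Rightarrow> real) \<Rightarrow> complex) \<Rightarrow> nat \<Rightarrow> (nat \<Rightarrow> ('h \<Rightarrow> real) list \<Rightarrow> complex) \<Rightarrow> bool" where
  "rep \<phi> m t \<longleftrightarrow> (\<forall>n. t n \<in> NC_tensor n) \<and> (\<forall>n>m. t n = (\<lambda>_. 0)) \<and> \<phi> = (\<lambda>x. \<Sum>n\<le>m. monomial n (t n) x)"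

lemma monomial_lc: "monomial n (fadd (fscl a s) (fscl b t)) x = a * monomial n s x + b * monomial n t x"
  by (simp add: monomial_def fadd_def fscl_def)

lemma monomial_zero [simp]: "monomial n (\<lambda>_. 0) x = 0"
  by (simp add: monomial_def)

lemma polys_rep: "\<phi> \<in> polys \<longleftrightarrow> (\<exists>m t. rep \<phi> m t)"
proof
  assume "\<phi> \<in> polys"
  then obtain m t where t: "\<forall>n\<le>m. t n \<in> NC_tensor n" "\<phi> = (\<lambda>x. \<Sum>n\<le>m. monomial n (t n) x)"
    unfolding polys_def by blast
  have "rep \<phi> m (\<lambda>n. if n \<le> m then t n else (\<lambda>_. 0))" using t by (auto simp: rep_def)
  then show "\<exists>m t. rep \<phi> m t" by blast
next
  assume "\<exists>m t. rep \<phi> m t"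
  then show "\<phi> \<in> polys" unfolding rep_def polys_def by blast
qed

lemma rep_mono: "rep \<phi> m t \<Longrightarrow> m \<le> M \<Longrightarrow> rep \<phi> M t"
proof -
  assume r: "rep \<phi> m t" and "m \<le> M"
  then have "(\<Sum>n\<le>M. monomial n (t n) x) = (\<Sum>n\<le>m. monomial n (t n) x)" for x
    by (intro sum.mono_neutral_right) (auto simp: rep_def)
  then show "rep \<phi> M t" using r \<open>m \<le> M\<close> by (simp add: rep_def)
qed

lemma rep_lc:
  assumes "rep \<phi> m s" "rep \<psi> m t"
  shows "rep (fadd (fscl a \<phi>) (fscl b \<psi>)) m (\<lambda>n. fadd (fscl a (s n)) (fscl b (t n)))"
  unfolding rep_def
proof (intro conjI allI impI)
  show "fadd (fscl a (s n)) (fscl b (t n)) \<in> NC_tensor n" for n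
    using assms by (simp add: rep_def NC_tensor_lc)
  show "fadd (fscl a (s n)) (fscl b (t n)) = (\<lambda>_. 0)" if "n > m" for n
    using assms that by (simp add: rep_def fadd_def fscl_def)
  show "fadd (fscl a \<phi>) (fscl b \<psi>) = (\<lambda>x. \<Sum>n\<le>m. monomial n (fadd (fscl a (s n)) (fscl b (t n))) x)"
    using assms unfolding rep_def monomial_lc by (simp add: fadd_def fscl_def sum.distrib sum_distrib_left)
qed

text \<open>Scaling \<open>x\<close> by a real number gives a polynomial in that number, which
  separates the degrees; a tensor that vanishes on the diagonal is zero by polarisation.\<close>

lemma rep_zero:
  assumes "rep (\<lambda>_. 0) m t"
  shows "t n = (\<lambda>_. 0)"
proof (cases "n \<le> m")
  case True
  have t: "t k \<in> NC_tensor k" for k using assms by (simp add: rep_def)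
  have z: "(\<Sum>k\<le>m. monomial k (t k) x) = 0" for x
    using assms unfolding rep_def by (metis (no_types, lifting))
  have "t n (replicate n x) = 0" if x: "x \<in> N'" for x
  proof (rule real_polynomial_zero[OF _ True, where c="\<lambda>n. t n (replicate n x)"])
    fix a :: real
    have "(\<Sum>k\<le>m. t k (replicate k x) * of_real a ^ k) = (\<Sum>k\<le>m. monomial k (t k) (\<lambda>\<xi>. a * x \<xi>))"
      using NC_tensor_scale_diag[OF t x] by (intro sum.cong) (auto simp: monomial_def mult.commute)
    then show "(\<Sum>k\<le>m. t k (replicate k x) * of_real a ^ k) = 0" using z by simp
  qed
  then show ?thesis by (rule NC_tensor_diag_zero[OF t])
next
  case False
  then show ?thesis using assms by (simp add: rep_def)
qed

lemma rep_unique: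
  assumes "rep \<phi> m s" "rep \<phi> m' t"
  shows "s = t"
proof
  fix n
  let ?M = "max m m'"
  have "rep (fadd (fscl 1 \<phi>) (fscl (-1) \<phi>)) ?M (\<lambda>n. fadd (fscl 1 (s n)) (fscl (-1) (t n)))"
    by (intro rep_lc rep_mono[OF assms(1)] rep_mono[OF assms(2)]) auto
  moreover have "fadd (fscl 1 \<phi>) (fscl (-1) \<phi>) = (\<lambda>_. 0)" by (simp add: fadd_def fscl_def)
  ultimately have "rep (\<lambda>_. 0) ?M (\<lambda>n. fadd (fscl 1 (s n)) (fscl (-1) (t n)))" by (simp only:)
  from rep_zero[OF this, of n] have *: "fadd (fscl 1 (s n)) (fscl (-1) (t n)) = (\<lambda>_. 0)" .
  have "s n x = t n x" for x using fun_cong[OF *, of x] by (simp add: fadd_def fscl_def)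
  then show "s n = t n" by auto
qed

lemma rep_monomial: "t \<in> NC_tensor n \<Longrightarrow> rep (monomial n t) n (\<lambda>k. if k = n then t else (\<lambda>_. 0))"
proof -
  assume t: "t \<in> NC_tensor n"
  have "(\<Sum>k\<le>n. monomial k (if k = n then t else (\<lambda>_. 0)) x) = (\<Sum>k\<le>n. if k = n then monomial n t x else 0)" for x
    by (intro sum.cong) auto
  then show ?thesis using t by (auto simp: rep_def)
qed

lemma monomial_polys [simp]: "t \<in> NC_tensor n \<Longrightarrow> monomial n t \<in> polys"
  using rep_monomial polys_rep by blast

lemma polys_lc:
  assumes "\<phi> \<in> polys" "\<psi> \<in> polys"
  shows "fadd (fscl a \<phi>) (fscl b \<psi>) \<in> polys"
proof -
  obtain m s m' t where "rep \<phi> m s" "rep \<psi> m' t" using assms polys_rep by metis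
  then have "rep \<phi> (max m m') s" "rep \<psi> (max m m') t" by (auto intro: rep_mono)
  then show ?thesis using rep_lc polys_rep by blast
qed

lemma zero_polys [simp]: "(\<lambda>_. 0) \<in> polys"
proof -
  have "monomial 0 (\<lambda>_. 0) \<in> polys" by simp
  moreover have "monomial 0 (\<lambda>_. 0) = (\<lambda>_. 0)" by auto
  ultimately show ?thesis by simp
qed

section \<open>Continuous linear functionals on the polynomials\<close>

definition plin :: "((('h \<Rightarrow> real) \<Rightarrow> complex) \<Rightarrow> complex) \<Rightarrow> bool" where
  "plin \<Phi> \<longleftrightarrow> (\<forall>\<phi>\<in>polys. \<forall>\<psi>\<in>polys. \<forall>a b. \<Phi> (fadd (fscl a \<phi>) (fscl b \<psi>)) = a * \<Phi> \<phi> + b * \<Phi> \<psi>)"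

lemma plinD: "plin \<Phi> \<Longrightarrow> \<phi> \<in> polys \<Longrightarrow> \<psi> \<in> polys \<Longrightarrow> \<Phi> (fadd (fscl a \<phi>) (fscl b \<psi>)) = a * \<Phi> \<phi> + b * \<Phi> \<psi>"
  by (simp add: plin_def)

lemma plin_zero: "plin \<Phi> \<Longrightarrow> \<Phi> (\<lambda>_. 0) = 0"
  using plinD[of \<Phi> "\<lambda>_. 0" "\<lambda>_. 0" 0 0] by simp

lemma plin_sum:
  assumes "plin \<Phi>" "finite I" "\<And>i. i \<in> I \<Longrightarrow> \<phi> i \<in> polys"
  shows "(\<lambda>x. \<Sum>i\<in>I. c i * \<phi> i x) \<in> polys \<and> \<Phi> (\<lambda>x. \<Sum>i\<in>I. c i * \<phi> i x) = (\<Sum>i\<in>I. c i * \<Phi> (\<phi> i))"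
  using assms(2,3)
proof (induction I rule: finite_induct)
  case (insert i I)
  have eq: "(\<lambda>x. \<Sum>i\<in>insert i I. c i * \<phi> i x) = fadd (fscl (c i) (\<phi> i)) (fscl 1 (\<lambda>x. \<Sum>i\<in>I. c i * \<phi> i x))"
    using insert.hyps by (simp add: fadd_def fscl_def)
  have i: "\<phi> i \<in> polys" and I: "(\<lambda>x. \<Sum>i\<in>I. c i * \<phi> i x) \<in> polys" using insert by auto
  show ?case
    unfolding eq plinD[OF assms(1) i I] using polys_lc[OF i I, of "c i" 1] insert by simp
qed (simp add: plin_zero[OF assms(1)])

lemma polys_base:
  assumes "A \<in> {monomial n ` {t \<in> NC_tensor n. tnorm p n t < \<epsilon>} | p \<epsilon>. \<epsilon> > 0}"
    "B \<in> {monomial n ` {t \<in> NC_tensor n. tnorm p n t < \<epsilon>} | p \<epsilon>. \<epsilon> > 0}"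
  shows "\<exists>C\<in>{monomial n ` {t \<in> NC_tensor n. tnorm p n t < \<epsilon>} | p \<epsilon>. \<epsilon> > 0}. C \<subseteq> A \<inter> B"
proof -
  obtain p e q d where A: "A = monomial n ` {t \<in> NC_tensor n. tnorm p n t < e}" "e > 0"
    and B: "B = monomial n ` {t \<in> NC_tensor n. tnorm q n t < d}" "d > 0" using assms by blast
  let ?C = "monomial n ` {t \<in> NC_tensor n. tnorm (max p q) n t < min e d}"
  have "tnorm p n t < e \<and> tnorm q n t < d" if "t \<in> NC_tensor n" "tnorm (max p q) n t < min e d" for t
    using tnorm_mono[OF that(1), of p "max p q"] tnorm_mono[OF that(1), of q "max p q"] that(2) by auto
  then have "?C \<subseteq> A \<inter> B" using A B by auto
  moreover have "?C \<in> {monomial n ` {t \<in> NC_tensor n. tnorm p n t < \<epsilon>} | p \<epsilon>. \<epsilon> > 0}"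
    using A(2) B(2) by (intro CollectI exI[of _ "max p q"] exI[of _ "min e d"]) simp
  ultimately show ?thesis by blast
qed

lemma openin_polys:
  "openin polys_topology W \<longleftrightarrow> W \<subseteq> polys \<and>
     (\<forall>w\<in>W. \<exists>U\<subseteq>polys. abs_convex fadd fscl U \<and>
       (\<forall>n. \<exists>B\<in>{monomial n ` {t \<in> NC_tensor n. tnorm p n t < \<epsilon>} | p \<epsilon>. \<epsilon> > 0}. B \<subseteq> U) \<and> (\<forall>u\<in>U. fadd w u \<in> W))"
  unfolding polys_topology_def
  by (rule openin_final_lc_topology[of "\<lambda>n. {monomial n ` {t \<in> NC_tensor n. tnorm p n t < \<epsilon>} | p \<epsilon>. \<epsilon> > 0}", OF polys_base])

lemma topspace_polys: "topspace polys_topology = polys"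
  unfolding polys_topology_def
proof (rule topspace_final_lc)
  show "\<exists>C\<in>{monomial n ` {t \<in> NC_tensor n. tnorm p n t < \<epsilon>} | p \<epsilon>. \<epsilon> > 0}. C \<subseteq> A \<inter> B"
    if "A \<in> {monomial n ` {t \<in> NC_tensor n. tnorm p n t < \<epsilon>} | p \<epsilon>. \<epsilon> > 0}"
    "B \<in> {monomial n ` {t \<in> NC_tensor n. tnorm p n t < \<epsilon>} | p \<epsilon>. \<epsilon> > 0}" for n A B
    using that by (rule polys_base)
  show "abs_convex fadd fscl polys" unfolding abs_convex_def using polys_lc by blast
  show "fadd u v \<in> polys" if "u \<in> polys" "v \<in> polys" for u v using polys_lc[OF that, of 1 1] by simp
  show "\<exists>B\<in>{monomial n ` {t \<in> NC_tensor n. tnorm p n t < \<epsilon>} | p \<epsilon>. \<epsilon> > 0}. B \<subseteq> polys" for n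
  proof (rule bexI)
    show "monomial n ` {t \<in> NC_tensor n. tnorm 0 n t < 1} \<in> {monomial n ` {t \<in> NC_tensor n. tnorm p n t < \<epsilon>} | p \<epsilon>. \<epsilon> > 0}"
      by (intro CollectI exI[of _ 0] exI[of _ "1::real"]) simp
  qed auto
qed

lemma monomial_scl: "monomial n (fscl a t) = fadd (fscl a (monomial n t)) (fscl 0 (monomial n t))"
  by (auto simp: monomial_def fadd_def fscl_def)

text \<open>Continuity at 0 restricts to every summand of the direct sum: the functional is below 1
  on the image of a ball, and homogeneity turns this into a bound by the norm.\<close>

lemma polys_dualD:
  assumes "\<Phi> \<in> polys_dual"
  shows "\<phi> \<notin> polys \<Longrightarrow> \<Phi> \<phi> = 0" "plin \<Phi>" "tame n (\<lambda>t. \<Phi> (monomial n t))"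
proof -
  show "\<phi> \<notin> polys \<Longrightarrow> \<Phi> \<phi> = 0" and lin: "plin \<Phi>"
    using assms by (auto simp: polys_dual_def plin_def)
  have "continuous_map polys_topology euclidean \<Phi>" using assms by (simp add: polys_dual_def)
  then have "openin polys_topology {\<phi> \<in> topspace polys_topology. \<Phi> \<phi> \<in> ball 0 1}"
    by (rule openin_continuous_map_preimage) simp
  then have op: "openin polys_topology {\<phi> \<in> polys. cmod (\<Phi> \<phi>) < 1}" by (simp add: topspace_polys)
  have "(\<lambda>_. 0) \<in> {\<phi> \<in> polys. cmod (\<Phi> \<phi>) < 1}" using plin_zero[OF lin] by simp
  from bspec[OF conjunct2[OF op[unfolded openin_polys]] this] obtain U where U: "\<forall>n. \<exists>B\<in>{monomial n ` {t \<in> NC_tensor n. tnorm p n t < \<epsilon>} | p \<epsilon>. \<epsilon> > 0}. B \<subseteq> U"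
      "\<forall>u\<in>U. fadd (\<lambda>_. 0) u \<in> {\<phi> \<in> polys. cmod (\<Phi> \<phi>) < 1}"
    by (elim exE conjE)
  from spec[OF U(1), of n] obtain B where
    B: "B \<in> {monomial n ` {t \<in> NC_tensor n. tnorm p n t < \<epsilon>} | p \<epsilon>. \<epsilon> > 0}" "B \<subseteq> U"
    by (elim bexE)
  from B(1) obtain p \<epsilon> where "B = monomial n ` {t \<in> NC_tensor n. tnorm p n t < \<epsilon>}" and \<epsilon>: "\<epsilon> > 0"
    by (elim CollectE exE conjE)
  then have p: "\<epsilon> > 0" "monomial n ` {t \<in> NC_tensor n. tnorm p n t < \<epsilon>} \<subseteq> U" using B(2) by auto
  have small: "cmod (\<Phi> (monomial n t)) < 1" if "t \<in> NC_tensor n" "tnorm p n t < \<epsilon>" for t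
    using U(2) p(2) that by auto
  have bd: "cmod (\<Phi> (monomial n t)) \<le> (1 / \<epsilon>) * tnorm p n t" if t: "t \<in> NC_tensor n" for t
  proof (rule field_le_epsilon)
    fix e :: real assume e: "e > 0"
    \<comment> \<open>Slightly more than the norm, so that the rescaled tensor lies strictly inside
      the ball of radius \<open>\<epsilon>\<close> even if the norm is 0.\<close>
    define \<rho> where "\<rho> = tnorm p n t + e * \<epsilon>"
    have \<rho>: "\<rho> > 0" "tnorm p n t < \<rho>" using e p(1) by (auto simp: \<rho>_def add_nonneg_pos)
    let ?c = "of_real (\<epsilon> / \<rho>) :: complex"
    have "tnorm p n (fscl ?c t) \<le> cmod ?c * tnorm p n t" by (rule tnorm_scl_le[OF t])
    also have "\<dots> < \<epsilon>" using \<rho> p(1) by (simp add: norm_divide field_simps)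
    finally have "cmod (\<Phi> (monomial n (fscl ?c t))) < 1" using small NC_tensor_scl[OF t] by blast
    moreover have "\<Phi> (monomial n (fscl ?c t)) = ?c * \<Phi> (monomial n t)"
      unfolding monomial_scl using plinD[OF lin, of "monomial n t" "monomial n t" ?c 0] t by simp
    ultimately have "cmod (?c * \<Phi> (monomial n t)) < 1" by (simp only:)
    then have "\<epsilon> * cmod (\<Phi> (monomial n t)) < \<rho>" using \<rho> p(1) by (simp add: norm_mult norm_divide field_simps)
    then show "cmod (\<Phi> (monomial n t)) \<le> (1 / \<epsilon>) * tnorm p n t + e" using p(1) by (simp add: \<rho>_def field_simps)
  qed
  have "cmod (\<Phi> (monomial n t)) \<le> (1 / \<epsilon>) * tnorm q n t" if "q \<ge> p" "t \<in> NC_tensor n" for q t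
  proof -
    have "(1 / \<epsilon>) * tnorm p n t \<le> (1 / \<epsilon>) * tnorm q n t"
      using tnorm_mono[OF that(2,1)] p(1) by (intro mult_left_mono) auto
    then show ?thesis using bd[OF that(2)] by linarith
  qed
  then show "tame n (\<lambda>t. \<Phi> (monomial n t))"
    unfolding tame_def using p(1) by (intro exI[of _ p] exI[of _ "1 / \<epsilon>"]) auto
qed

text \<open>Converse of the restriction to summands: the set where a linear functional is below
  \<open>e\<close> is absolutely convex, and by tameness it contains a ball of every
  summand.\<close>

lemma polys_dualI:
  assumes off: "\<And>\<phi>. \<phi> \<notin> polys \<Longrightarrow> \<Phi> \<phi> = 0" and lin: "plin \<Phi>" and tm: "\<And>n. tame n (\<lambda>t. \<Phi> (monomial n t))"
  shows "\<Phi> \<in> polys_dual"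
proof -
  have "continuous_map polys_topology euclidean \<Phi>"
    unfolding continuous_map
  proof (intro conjI allI impI)
    fix W :: "complex set" assume W: "openin euclidean W"
    have "openin polys_topology {\<phi> \<in> polys. \<Phi> \<phi> \<in> W}"
      unfolding openin_polys
    proof (intro conjI ballI)
      fix w assume "w \<in> {\<phi> \<in> polys. \<Phi> \<phi> \<in> W}"
      then have w: "w \<in> polys" "\<Phi> w \<in> W" by auto
      obtain e where e: "e > 0" "ball (\<Phi> w) e \<subseteq> W" by (rule openE[of W "\<Phi> w"]) (use W w in auto)
      define U where "U = {u \<in> polys. cmod (\<Phi> u) < e}"
      have "abs_convex fadd fscl U"
        unfolding abs_convex_def
      proof (intro ballI allI impI)
        fix u v a b assume u: "u \<in> U" and v: "v \<in> U" and ab: "cmod a + cmod b \<le> 1"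
        have m: "max (cmod (\<Phi> u)) (cmod (\<Phi> v)) < e" using u v by (simp add: U_def)
        have "cmod (a * \<Phi> u + b * \<Phi> v) \<le> cmod a * cmod (\<Phi> u) + cmod b * cmod (\<Phi> v)"
          by (metis norm_mult norm_triangle_ineq)
        also have "\<dots> \<le> cmod a * max (cmod (\<Phi> u)) (cmod (\<Phi> v)) + cmod b * max (cmod (\<Phi> u)) (cmod (\<Phi> v))"
          by (intro add_mono mult_left_mono) auto
        also have "\<dots> \<le> max (cmod (\<Phi> u)) (cmod (\<Phi> v))"
          using ab mult_right_mono[OF ab, of "max (cmod (\<Phi> u)) (cmod (\<Phi> v))"]
          by (simp add: distrib_right le_max_iff_disj)
        finally show "fadd (fscl a u) (fscl b v) \<in> U"
          using m u v plinD[OF lin] polys_lc unfolding U_def by auto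
      qed
      moreover have "\<exists>B\<in>{monomial n ` {t \<in> NC_tensor n. tnorm p n t < \<epsilon>} | p \<epsilon>. \<epsilon> > 0}. B \<subseteq> U" for n
      proof -
        obtain p C where C: "C \<ge> 0" "\<And>t. t \<in> NC_tensor n \<Longrightarrow> cmod (\<Phi> (monomial n t)) \<le> C * tnorm p n t"
          using tm[of n] unfolding tame_def by blast
        have C1: "C + 1 > 0" using C(1) by simp
        have "cmod (\<Phi> (monomial n t)) < e" if "t \<in> NC_tensor n" "tnorm p n t < e / (C + 1)" for t
        proof -
          have "C * tnorm p n t \<le> (C + 1) * tnorm p n t" by (intro mult_right_mono) auto
          also have "\<dots> < e" using that(2) C1 by (simp add: pos_less_divide_eq mult.commute)
          finally show ?thesis using C(2)[OF that(1)] by simp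
        qed
        then have "monomial n ` {t \<in> NC_tensor n. tnorm p n t < e / (C + 1)} \<subseteq> U" by (auto simp: U_def)
        moreover have "e / (C + 1) > 0" using e(1) C1 by simp
        ultimately show ?thesis by blast
      qed
      moreover have "fadd w u \<in> {\<phi> \<in> polys. \<Phi> \<phi> \<in> W}" if "u \<in> U" for u
      proof -
        have "\<Phi> (fadd w u) = \<Phi> w + \<Phi> u" "fadd w u \<in> polys"
          using plinD[OF lin w(1), of u 1 1] polys_lc[OF w(1), of u 1 1] that by (auto simp: U_def)
        moreover have "\<Phi> w + \<Phi> u \<in> ball (\<Phi> w) e" using that by (simp add: U_def dist_norm)
        ultimately show ?thesis using e(2) by auto
      qed
      moreover have "U \<subseteq> polys" by (auto simp: U_def)
      ultimately show "\<exists>U\<subseteq>polys. abs_convex fadd fscl U \<and>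
        (\<forall>n. \<exists>B\<in>{monomial n ` {t \<in> NC_tensor n. tnorm p n t < \<epsilon>} | p \<epsilon>. \<epsilon> > 0}. B \<subseteq> U) \<and>
        (\<forall>u\<in>U. fadd w u \<in> {\<phi> \<in> polys. \<Phi> \<phi> \<in> W})" by blast
    qed auto
    then show "openin polys_topology {x \<in> topspace polys_topology. \<Phi> x \<in> W}" by (simp add: topspace_polys)
  qed auto
  then show ?thesis using off lin unfolding polys_dual_def plin_def by blast
qed

lemma polys_dual_lc:
  assumes "\<Phi> \<in> polys_dual" "\<Psi> \<in> polys_dual"
  shows "fadd (fscl a \<Phi>) (fscl b \<Psi>) \<in> polys_dual"
proof (rule polys_dualI)
  show "tame n (\<lambda>t. fadd (fscl a \<Phi>) (fscl b \<Psi>) (monomial n t))" for n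
    unfolding fadd_def fscl_def by (intro tame_add tame_mult polys_dualD(3) assms)
  have "fadd (fscl a \<Phi>) (fscl b \<Psi>) (fadd (fscl c \<phi>) (fscl d \<psi>)) =
      c * fadd (fscl a \<Phi>) (fscl b \<Psi>) \<phi> + d * fadd (fscl a \<Phi>) (fscl b \<Psi>) \<psi>"
    if "\<phi> \<in> polys" "\<psi> \<in> polys" for \<phi> \<psi> c d
  proof -
    have "\<Phi> (fadd (fscl c \<phi>) (fscl d \<psi>)) = c * \<Phi> \<phi> + d * \<Phi> \<psi>" "\<Psi> (fadd (fscl c \<phi>) (fscl d \<psi>)) = c * \<Psi> \<phi> + d * \<Psi> \<psi>"
      using plinD[OF polys_dualD(2)] assms that by blast+
    moreover have "fadd (fscl a \<Phi>) (fscl b \<Psi>) \<phi> = a * \<Phi> \<phi> + b * \<Psi> \<phi>" for \<phi> by (simp add: fadd_def fscl_def)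
    ultimately show ?thesis by (simp only:) (simp add: algebra_simps)
  qed
  then show "plin (fadd (fscl a \<Phi>) (fscl b \<Psi>))" unfolding plin_def by blast
qed (simp add: fadd_def fscl_def polys_dualD(1)[OF assms(1)] polys_dualD(1)[OF assms(2)])

text \<open>The functional on the direct sum with components \<open>\<Psi>\<close>. The chosen
  representation is immaterial since coefficients are unique and trailing zeros contribute
  nothing.\<close>

definition poly_functional :: "(nat \<Rightarrow> (('h \<Rightarrow> real) list \<Rightarrow> complex) \<Rightarrow> complex) \<Rightarrow> (('h \<Rightarrow> real) \<Rightarrow> complex) \<Rightarrow> complex" where
  "poly_functional \<Psi> \<phi> = (if \<phi> \<in> polys then let (m, t) = (SOME (m, t). rep \<phi> m t) in \<Sum>n\<le>m. \<Psi> n (t n) else 0)"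

lemma poly_functional_rep:
  assumes \<Psi>: "\<And>n. \<Psi> n \<in> NC_tensor_dual n" and r: "rep \<phi> m t"
  shows "poly_functional \<Psi> \<phi> = (\<Sum>n\<le>m. \<Psi> n (t n))"
proof -
  obtain m' t' where e: "(SOME (m, t). rep \<phi> m t) = (m', t')" by fastforce
  have "case (SOME (m, t). rep \<phi> m t) of (m, t) \<Rightarrow> rep \<phi> m t" by (rule someI[of _ "(m, t)"]) (simp add: r)
  then have r': "rep \<phi> m' t'" unfolding e by simp
  have "t' = t" by (rule rep_unique[OF r' r])
  have z: "(\<Sum>n\<le>max m m'. \<Psi> n (t n)) = (\<Sum>n\<le>k. \<Psi> n (t n))" if "rep \<phi> k t" "k \<le> max m m'" for k
    by (rule sum.mono_neutral_right) (use that dual_zero[OF \<Psi>] in \<open>auto simp: rep_def\<close>)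
  have "poly_functional \<Psi> \<phi> = (\<Sum>n\<le>m'. \<Psi> n (t n))"
    using r polys_rep e \<open>t' = t\<close> unfolding poly_functional_def by auto
  also have "\<dots> = (\<Sum>n\<le>m. \<Psi> n (t n))" using z[of m] z[of m'] r r' \<open>t' = t\<close> by simp
  finally show ?thesis .
qed

lemma poly_functional_monomial:
  assumes "\<And>n. \<Psi> n \<in> NC_tensor_dual n" "t \<in> NC_tensor n"
  shows "poly_functional \<Psi> (monomial n t) = \<Psi> n t"
proof -
  have "poly_functional \<Psi> (monomial n t) = (\<Sum>k\<le>n. \<Psi> k (if k = n then t else (\<lambda>_. 0)))"
    by (rule poly_functional_rep[OF assms(1) rep_monomial[OF assms(2)]])
  also have "\<dots> = (\<Sum>k\<le>n. if k = n then \<Psi> n t else 0)"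
    by (intro sum.cong) (auto simp: dual_zero[OF assms(1)])
  finally show ?thesis by simp
qed

lemma poly_functional_dual:
  assumes \<Psi>: "\<And>n. \<Psi> n \<in> NC_tensor_dual n"
  shows "poly_functional \<Psi> \<in> polys_dual"
proof (rule polys_dualI)
  show "tame n (\<lambda>t. poly_functional \<Psi> (monomial n t))" for n
    by (rule tame_cong[OF tame_dual[OF \<Psi>[of n]]]) (simp add: poly_functional_monomial[OF \<Psi>])
  have "poly_functional \<Psi> (fadd (fscl a \<phi>) (fscl b \<psi>)) = a * poly_functional \<Psi> \<phi> + b * poly_functional \<Psi> \<psi>" if p: "\<phi> \<in> polys" "\<psi> \<in> polys" for \<phi> \<psi> a b
  proof -
    obtain m s m' t where st: "rep \<phi> m s" "rep \<psi> m' t" using p polys_rep by metis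
    let ?M = "max m m'"
    have r: "rep \<phi> ?M s" "rep \<psi> ?M t" using st by (auto intro: rep_mono)
    then have NC: "s n \<in> NC_tensor n" "t n \<in> NC_tensor n" for n by (auto simp: rep_def)
    show ?thesis
      unfolding poly_functional_rep[OF \<Psi> rep_lc[OF r]] poly_functional_rep[OF \<Psi> r(1)] poly_functional_rep[OF \<Psi> r(2)]
      by (simp add: dualD(2)[OF \<Psi> NC] sum.distrib sum_distrib_left)
  qed
  then show "plin (poly_functional \<Psi>)" by (simp add: plin_def)
qed (simp add: poly_functional_def)

end

context appell_setting
begin

section \<open>Kernels with respect to the Appell system\<close>

lemma appell_poly_polys:
  assumes \<Phi>: "plin \<Phi>" and t: "t \<in> NC_tensor n"
  shows "appell_poly \<mu> n t \<in> polys"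
    "\<Phi> (appell_poly \<mu> n t) = (\<Sum>k\<le>n. of_nat (n choose k) * \<Phi> (monomial k (lower n k t)))"
  unfolding appell_poly_eq[OF t]
  using plin_sum[OF \<Phi>, of "{..n}" "\<lambda>k. monomial k (lower n k t)" "\<lambda>k. of_nat (n choose k)"] lower_NC[OF _ t]
  by auto

definition kern :: "((('h \<Rightarrow> real) \<Rightarrow> complex) \<Rightarrow> complex) \<Rightarrow> nat \<Rightarrow> (('h \<Rightarrow> real) list \<Rightarrow> complex) \<Rightarrow> complex" where
  "kern \<Phi> n t = (if t \<in> NC_tensor n then \<Phi> (appell_poly \<mu> n t) / fact n else 0)"

lemma kern_dual:
  assumes \<Phi>: "\<Phi> \<in> polys_dual"
  shows "kern \<Phi> n \<in> NC_tensor_dual n"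
proof (rule dual_tameI)
  note lin = polys_dualD(2)[OF \<Phi>]
  note ap = appell_poly_polys[OF lin]
  show "kern \<Phi> n (fadd (fscl a s) (fscl b t)) = a * kern \<Phi> n s + b * kern \<Phi> n t"
    if s: "s \<in> NC_tensor n" and t: "t \<in> NC_tensor n" for s t a b
  proof -
    have "appell_poly \<mu> n (fadd (fscl a s) (fscl b t)) = fadd (fscl a (appell_poly \<mu> n s)) (fscl b (appell_poly \<mu> n t))"
    proof
      fix x
      have "appell_poly \<mu> n (fadd (fscl a s) (fscl b t)) x =
          (\<Sum>k\<le>n. of_nat (n choose k) * (a * monomial k (lower n k s) x + b * monomial k (lower n k t) x))"
        unfolding appell_poly_eq[OF NC_tensor_lc[OF s t]]
        by (intro sum.cong refl) (simp add: lower_lc[OF _ s t] monomial_lc)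
      also have "\<dots> = fadd (fscl a (appell_poly \<mu> n s)) (fscl b (appell_poly \<mu> n t)) x"
        unfolding appell_poly_eq[OF s] appell_poly_eq[OF t] fadd_def fscl_def
        by (simp add: sum_distrib_left sum.distrib[symmetric] distrib_left mult.left_commute)
      finally show "appell_poly \<mu> n (fadd (fscl a s) (fscl b t)) x =
          fadd (fscl a (appell_poly \<mu> n s)) (fscl b (appell_poly \<mu> n t)) x" .
    qed
    then show ?thesis
      using plinD[OF lin ap(1)[OF s] ap(1)[OF t]] NC_tensor_lc[OF s t] s t by (simp add: kern_def add_divide_distrib)
  qed
  have "tame n (\<lambda>t. (1 / fact n) * (\<Sum>k\<le>n. of_nat (n choose k) * \<Phi> (monomial k (lower n k t))))"
    by (intro tame_mult tame_sum tame_lower[where f="\<lambda>t. \<Phi> (monomial _ t)"] polys_dualD(3)[OF \<Phi>]) auto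
  then show "tame n (kern \<Phi> n)" by (rule tame_cong) (simp add: kern_def ap(2))
qed (simp add: kern_def)

text \<open>Resolves the unique description. Existence extends the values on single Appell
  polynomials by linearity; uniqueness tests with families concentrated in one degree.\<close>

lemma kernels_eqI:
  assumes \<Phi>: "\<Phi> \<in> polys_dual" and K: "\<And>n. K n \<in> NC_tensor_dual n"
    and KA: "\<And>n t. t \<in> NC_tensor n \<Longrightarrow> \<Phi> (appell_poly \<mu> n t) = fact n * K n t"
  shows "kernels \<mu> \<Phi> = K"
  unfolding kernels_def
proof (rule the_equality)
  note lin = polys_dualD(2)[OF \<Phi>]
  note ap = appell_poly_polys[OF lin]
  have sum: "\<Phi> (\<lambda>x. \<Sum>n\<le>m. appell_poly \<mu> n (t n) x) = (\<Sum>n\<le>m. fact n * K n (t n))"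
    if "\<forall>n\<le>m. t n \<in> NC_tensor n" for m t
    using plin_sum[OF lin, of "{..m}" "\<lambda>n. appell_poly \<mu> n (t n)" "\<lambda>_. 1"] that ap(1) KA by simp
  then show "(\<forall>n. K n \<in> NC_tensor_dual n) \<and> (\<forall>m t. (\<forall>n\<le>m. t n \<in> NC_tensor n) \<longrightarrow>
        \<Phi> (\<lambda>x. \<Sum>n\<le>m. appell_poly \<mu> n (t n) x) = (\<Sum>n\<le>m. fact n * K n (t n)))"
    using K by blast
  fix K' assume K': "(\<forall>n. K' n \<in> NC_tensor_dual n) \<and> (\<forall>m t. (\<forall>n\<le>m. t n \<in> NC_tensor n) \<longrightarrow>
        \<Phi> (\<lambda>x. \<Sum>n\<le>m. appell_poly \<mu> n (t n) x) = (\<Sum>n\<le>m. fact n * K' n (t n)))"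
  have "K' m t = K m t" for m t
  proof (cases "t \<in> NC_tensor m")
    case True
    define T where "T n = (if n = m then t else (\<lambda>_. 0))" for n
    have T: "\<forall>n\<le>m. T n \<in> NC_tensor n" using True by (simp add: T_def)
    have one: "(\<Sum>n\<le>m. fact n * L n (T n)) = fact m * L m t" if "\<And>n. L n \<in> NC_tensor_dual n" for L
    proof -
      have "(\<Sum>n\<le>m. fact n * L n (T n)) = (\<Sum>n\<le>m. if n = m then fact m * L m t else 0)"
        by (intro sum.cong) (auto simp: T_def dual_zero[OF that])
      then show ?thesis by simp
    qed
    have "(\<Sum>n\<le>m. fact n * K' n (T n)) = (\<Sum>n\<le>m. fact n * K n (T n))"
      using conjunct2[OF K', rule_format, of m T] T sum[OF T] by simp
    then show ?thesis using one[of K'] one[of K] K conjunct1[OF K'] by simp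
  next
    case False
    then show ?thesis
      using dualD(1)[OF K[of m]] dualD(1)[OF conjunct1[OF K', rule_format, of m]] by simp
  qed
  then show "K' = K" by blast
qed

lemma kernels_kern: "\<Phi> \<in> polys_dual \<Longrightarrow> kernels \<mu> \<Phi> = kern \<Phi>"
  by (rule kernels_eqI) (auto simp: kern_dual kern_def)

lemma kernels_dual: "\<Phi> \<in> polys_dual \<Longrightarrow> kernels \<mu> \<Phi> n \<in> NC_tensor_dual n"
  by (simp add: kernels_kern kern_dual)

lemma kernels_lc:
  assumes "\<Phi> \<in> polys_dual" "\<Psi> \<in> polys_dual"
  shows "kernels \<mu> (fadd (fscl a \<Phi>) (fscl b \<Psi>)) = (\<lambda>n t. a * kernels \<mu> \<Phi> n t + b * kernels \<mu> \<Psi> n t)"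
  unfolding kernels_kern[OF assms(1)] kernels_kern[OF assms(2)] kernels_kern[OF polys_dual_lc[OF assms]]
  by (auto simp: kern_def fadd_def fscl_def fun_eq_iff add_divide_distrib)

text \<open>The Appell polynomial of degree \<open>n\<close> with coefficient \<open>t\<close> is
  the monomial of \<open>t\<close> plus terms of lower degree, so the values on monomials are
  recovered by induction on the degree.\<close>

lemma kernels_inj:
  assumes \<Phi>: "\<Phi> \<in> polys_dual" and \<Psi>: "\<Psi> \<in> polys_dual" and eq: "kernels \<mu> \<Phi> = kernels \<mu> \<Psi>"
  shows "\<Phi> = \<Psi>"
proof -
  have ap: "\<Phi> (appell_poly \<mu> n t) = \<Psi> (appell_poly \<mu> n t)" if "t \<in> NC_tensor n" for n t
    using fun_cong[OF fun_cong[OF eq, of n], of t] that by (simp add: kernels_kern \<Phi> \<Psi> kern_def)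
  have mono: "\<Phi> (monomial n t) = \<Psi> (monomial n t)" if "t \<in> NC_tensor n" for n t
    using that
  proof (induction n arbitrary: t rule: less_induct)
    case (less n)
    have *: "X (appell_poly \<mu> n t) = (\<Sum>k<n. of_nat (n choose k) * X (monomial k (lower n k t))) + X (monomial n t)"
      if "X \<in> polys_dual" for X
      using appell_poly_polys(2)[OF polys_dualD(2)[OF that] less.prems]
      by (simp add: lessThan_Suc_atMost[symmetric] lower_self[OF less.prems])
    have "(\<Sum>k<n. of_nat (n choose k) * \<Phi> (monomial k (lower n k t))) = (\<Sum>k<n. of_nat (n choose k) * \<Psi> (monomial k (lower n k t)))"
      by (intro sum.cong refl arg_cong2[where f="(*)"] less.IH lower_NC less.prems) auto
    then show ?case using *[OF \<Phi>] *[OF \<Psi>] ap[OF less.prems] by simp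
  qed
  show ?thesis
  proof
    fix \<phi>
    show "\<Phi> \<phi> = \<Psi> \<phi>"
    proof (cases "\<phi> \<in> polys")
      case True
      then obtain m t where r: "rep \<phi> m t" using polys_rep by blast
      then have \<phi>: "\<phi> = (\<lambda>x. \<Sum>n\<le>m. 1 * monomial n (t n) x)" and t: "t n \<in> NC_tensor n" for n by (auto simp: rep_def)
      have X: "X \<phi> = (\<Sum>n\<le>m. 1 * X (monomial n (t n)))" if "X \<in> polys_dual" for X
        unfolding \<phi> using plin_sum[OF polys_dualD(2)[OF that], of "{..m}" "\<lambda>n. monomial n (t n)" "\<lambda>_. 1"] t by auto
      show ?thesis unfolding X[OF \<Phi>] X[OF \<Psi>] using mono[OF t] by simp
    qed (simp add: polys_dualD(1)[OF \<Phi>] polys_dualD(1)[OF \<Psi>])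
  qed
qed

text \<open>The triangular system solved for the values on monomials: the prescribed value on the
  Appell polynomial minus the contributions of lower degree.\<close>

fun psi :: "(nat \<Rightarrow> (('h \<Rightarrow> real) list \<Rightarrow> complex) \<Rightarrow> complex) \<Rightarrow> nat \<Rightarrow> (('h \<Rightarrow> real) list \<Rightarrow> complex) \<Rightarrow> complex" where
  "psi K n t = (if t \<in> NC_tensor n then fact n * K n t - (\<Sum>k<n. of_nat (n choose k) * psi K k (lower n k t)) else 0)"

declare psi.simps [simp del]

lemma psi_dual:
  assumes K: "\<And>n. K n \<in> NC_tensor_dual n"
  shows "psi K n \<in> NC_tensor_dual n"
proof (induction n rule: less_induct)
  case (less n)
  show ?case
  proof (rule dual_tameI)
    show "psi K n t = 0" if "t \<notin> NC_tensor n" for t using that by (simp add: psi.simps)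
    show "psi K n (fadd (fscl a s) (fscl b t)) = a * psi K n s + b * psi K n t"
      if s: "s \<in> NC_tensor n" and t: "t \<in> NC_tensor n" for s t a b
    proof -
      have "psi K k (lower n k (fadd (fscl a s) (fscl b t))) = a * psi K k (lower n k s) + b * psi K k (lower n k t)"
        if "k < n" for k
        using lower_lc[of k n, OF _ s t] that dualD(2)[OF less.IH[OF that] lower_NC[of k n, OF _ s] lower_NC[of k n, OF _ t]] by simp
      then have "(\<Sum>k<n. of_nat (n choose k) * psi K k (lower n k (fadd (fscl a s) (fscl b t)))) =
          a * (\<Sum>k<n. of_nat (n choose k) * psi K k (lower n k s)) + b * (\<Sum>k<n. of_nat (n choose k) * psi K k (lower n k t))"
        by (simp add: sum_distrib_left sum.distrib[symmetric] distrib_left mult.left_commute)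
      then show ?thesis
        using s t NC_tensor_lc[OF s t] dualD(2)[OF K s t]
        by (simp add: psi.simps[of K n] algebra_simps)
    qed
    have "tame n (\<lambda>t. fact n * K n t + (-1) * (\<Sum>k<n. of_nat (n choose k) * psi K k (lower n k t)))"
      by (intro tame_add tame_mult tame_sum tame_lower tame_dual K less.IH) auto
    then show "tame n (psi K n)" by (rule tame_cong) (simp add: psi.simps[of K n])
  qed
qed

text \<open>The components \<open>psi K\<close> are continuous in each degree; for a direct sum this
  suffices, so no growth condition on \<open>K\<close> is imposed.\<close>

lemma kernels_surj:
  assumes K: "\<And>n. K n \<in> NC_tensor_dual n"
  obtains \<Phi> where "\<Phi> \<in> polys_dual" "kernels \<mu> \<Phi> = K"
proof -
  note \<psi> = psi_dual[OF K]
  let ?\<Phi> = "poly_functional (psi K)"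
  have \<Phi>: "?\<Phi> \<in> polys_dual" by (rule poly_functional_dual[OF \<psi>])
  have "?\<Phi> (appell_poly \<mu> n t) = fact n * K n t" if t: "t \<in> NC_tensor n" for n t
  proof -
    have "?\<Phi> (appell_poly \<mu> n t) = (\<Sum>k\<le>n. of_nat (n choose k) * psi K k (lower n k t))"
      unfolding appell_poly_polys(2)[OF polys_dualD(2)[OF \<Phi>] t]
      by (intro sum.cong refl arg_cong2[where f="(*)"] poly_functional_monomial[OF \<psi>] lower_NC t) auto
    also have "\<dots> = (\<Sum>k<n. of_nat (n choose k) * psi K k (lower n k t)) + psi K n t"
      by (simp add: lessThan_Suc_atMost[symmetric] lower_self[OF t])
    finally show ?thesis using t by (simp add: psi.simps[of K n t])
  qed
  then have "kernels \<mu> ?\<Phi> = K" by (intro kernels_eqI[OF \<Phi> K])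
  then show ?thesis using that \<Phi> by blast
qed

end

section \<open>The isomorphism\<close>

text \<open>A linear bijection carries absolutely convex sets to such sets in both directions, so
  neighbourhoods can be transported as soon as steps compare: \<open>contS\<close> says that step
  \<open>i\<close> maps continuously into some step \<open>j\<close>, \<open>openS\<close> that the
  inverse maps step \<open>j\<close> continuously into some step \<open>i\<close>.\<close>

lemma homeomorphic_final_lc:
  assumes baseA: "\<And>i A B. A \<in> nbA i \<Longrightarrow> B \<in> nbA i \<Longrightarrow> \<exists>C\<in>nbA i. C \<subseteq> A \<inter> B"
    and baseB: "\<And>i A B. A \<in> nbB i \<Longrightarrow> B \<in> nbB i \<Longrightarrow> \<exists>C\<in>nbB i. C \<subseteq> A \<inter> B"
    and V: "abs_convex addV sclV V" "\<And>u v. u \<in> V \<Longrightarrow> v \<in> V \<Longrightarrow> addV u v \<in> V" "\<And>i. \<exists>B\<in>nbA i. B \<subseteq> V"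
    and W: "abs_convex addW sclW W" "\<And>u v. u \<in> W \<Longrightarrow> v \<in> W \<Longrightarrow> addW u v \<in> W" "\<And>i. \<exists>B\<in>nbB i. B \<subseteq> W"
    and bij: "bij_betw S V W"
    and lin: "\<And>u v a b. u \<in> V \<Longrightarrow> v \<in> V \<Longrightarrow> S (addV (sclV a u) (sclV b v)) = addW (sclW a (S u)) (sclW b (S v))"
    and add: "\<And>u v. u \<in> V \<Longrightarrow> v \<in> V \<Longrightarrow> S (addV u v) = addW (S u) (S v)"
    and contS: "\<And>i. \<exists>j. \<forall>C\<in>nbB j. \<exists>B\<in>nbA i. B \<subseteq> V \<and> S ` B \<subseteq> C"
    and openS: "\<And>j. \<exists>i. \<forall>B\<in>nbA i. \<exists>C\<in>nbB j. C \<subseteq> S ` B"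
  shows "homeomorphic_map (final_lc_topology V addV sclV nbA) (final_lc_topology W addW sclW nbB) S"
proof -
  let ?X = "final_lc_topology V addV sclV nbA" and ?Y = "final_lc_topology W addW sclW nbB"
  have opA: "openin ?X Q \<longleftrightarrow> Q \<subseteq> V \<and>
     (\<forall>w\<in>Q. \<exists>U\<subseteq>V. abs_convex addV sclV U \<and> (\<forall>i. \<exists>B\<in>nbA i. B \<subseteq> U) \<and> (\<forall>u\<in>U. addV w u \<in> Q))" for Q
    by (rule openin_final_lc_topology) (rule baseA)
  have opB: "openin ?Y Q \<longleftrightarrow> Q \<subseteq> W \<and>
     (\<forall>w\<in>Q. \<exists>U\<subseteq>W. abs_convex addW sclW U \<and> (\<forall>i. \<exists>B\<in>nbB i. B \<subseteq> U) \<and> (\<forall>u\<in>U. addW w u \<in> Q))" for Q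
    by (rule openin_final_lc_topology) (rule baseB)
  have tA: "topspace ?X = V" by (rule topspace_final_lc[OF _ V]) (rule baseA)
  have tB: "topspace ?Y = W" by (rule topspace_final_lc[OF _ W]) (rule baseB)
  have SV: "S v \<in> W" if "v \<in> V" for v using bij that by (auto simp: bij_betw_def)
  show ?thesis
  proof (rule bijective_open_imp_homeomorphic_map)
    show "continuous_map ?X ?Y S"
      unfolding continuous_map tA tB
    proof (intro conjI allI impI)
      show "S ` V \<subseteq> W" using SV by auto
      fix Q assume Q: "openin ?Y Q"
      show "openin ?X {v \<in> V. S v \<in> Q}"
        unfolding opA
      proof (intro conjI ballI)
        fix v assume "v \<in> {v \<in> V. S v \<in> Q}"
        then have v: "v \<in> V" "S v \<in> Q" by auto
        obtain U where U: "U \<subseteq> W" "abs_convex addW sclW U" "\<forall>i. \<exists>B\<in>nbB i. B \<subseteq> U" "\<forall>u\<in>U. addW (S v) u \<in> Q"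
          using bspec[OF conjunct2[OF Q[unfolded opB]] v(2)] by (elim exE conjE)
        define U' where "U' = {u \<in> V. S u \<in> U}"
        have "abs_convex addV sclV U'"
          unfolding abs_convex_def
        proof (intro ballI allI impI)
          fix u u' a b assume u: "u \<in> U'" "u' \<in> U'" and ab: "cmod a + cmod b \<le> 1"
          have "addV (sclV a u) (sclV b u') \<in> V" using V(1) u ab unfolding abs_convex_def U'_def by blast
          moreover have "addW (sclW a (S u)) (sclW b (S u')) \<in> U" using U(2) u ab unfolding abs_convex_def U'_def by blast
          ultimately show "addV (sclV a u) (sclV b u') \<in> U'" using lin[of u u' a b] u by (simp add: U'_def)
        qed
        moreover have "\<exists>B\<in>nbA i. B \<subseteq> U'" for i
        proof -
          from contS[of i] obtain j where j: "\<forall>C\<in>nbB j. \<exists>B\<in>nbA i. B \<subseteq> V \<and> S ` B \<subseteq> C" ..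
          from spec[OF U(3), of j] obtain C where C: "C \<in> nbB j" "C \<subseteq> U" ..
          from bspec[OF j C(1)] obtain B where B: "B \<in> nbA i" "B \<subseteq> V \<and> S ` B \<subseteq> C" ..
          then have "B \<subseteq> U'" using C(2) by (auto simp: U'_def)
          then show ?thesis using B(1) by (rule bexI)
        qed
        moreover have "addV v u \<in> {v \<in> V. S v \<in> Q}" if "u \<in> U'" for u
          using that U(4) add v V(2) unfolding U'_def by simp
        moreover have "U' \<subseteq> V" by (auto simp: U'_def)
        ultimately show "\<exists>U\<subseteq>V. abs_convex addV sclV U \<and> (\<forall>i. \<exists>B\<in>nbA i. B \<subseteq> U) \<and> (\<forall>u\<in>U. addV v u \<in> {v \<in> V. S v \<in> Q})"
          by blast
      qed auto
    qed
    show "open_map ?X ?Y S"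
      unfolding open_map_def
    proof (intro allI impI)
      fix Q assume Q: "openin ?X Q"
      have QV: "Q \<subseteq> V" using Q unfolding opA by blast
      show "openin ?Y (S ` Q)"
        unfolding opB
      proof (intro conjI ballI)
        show "S ` Q \<subseteq> W" using QV SV by auto
        fix w assume "w \<in> S ` Q"
        then obtain v where v: "v \<in> Q" "w = S v" by blast
        obtain U where U: "U \<subseteq> V" "abs_convex addV sclV U" "\<forall>i. \<exists>B\<in>nbA i. B \<subseteq> U" "\<forall>u\<in>U. addV v u \<in> Q"
          using bspec[OF conjunct2[OF Q[unfolded opA]] v(1)] by (elim exE conjE)
        have "abs_convex addW sclW (S ` U)"
          unfolding abs_convex_def
        proof (intro ballI allI impI)
          fix s t a b assume "s \<in> S ` U" "t \<in> S ` U" and ab: "cmod a + cmod b \<le> 1"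
          then obtain u u' where u: "u \<in> U" "u' \<in> U" "s = S u" "t = S u'" by blast
          then have "addV (sclV a u) (sclV b u') \<in> U" using U(2) ab unfolding abs_convex_def by blast
          moreover have "S (addV (sclV a u) (sclV b u')) = addW (sclW a s) (sclW b t)"
            unfolding u(3,4) by (rule lin) (use u(1,2) U(1) in auto)
          ultimately show "addW (sclW a s) (sclW b t) \<in> S ` U" by (metis image_eqI)
        qed
        moreover have "\<exists>C\<in>nbB j. C \<subseteq> S ` U" for j
        proof -
          from openS[of j] obtain i where i: "\<forall>B\<in>nbA i. \<exists>C\<in>nbB j. C \<subseteq> S ` B" ..
          from spec[OF U(3), of i] obtain B where B: "B \<in> nbA i" "B \<subseteq> U" ..
          from bspec[OF i B(1)] obtain C where "C \<in> nbB j" "C \<subseteq> S ` B" ..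
          moreover from this have "C \<subseteq> S ` U" using B(2) by blast
          ultimately show ?thesis by (intro bexI)
        qed
        moreover have "addW w u \<in> S ` Q" if u: "u \<in> S ` U" for u
        proof -
          obtain u' where u': "u' \<in> U" "u = S u'" using u by blast
          then have "addW w u = S (addV v u')"
            unfolding v(2) u'(2) by (intro add[symmetric]) (use v(1) QV U(1) in auto)
          then show ?thesis using U(4) u'(1) by blast
        qed
        moreover have "S ` U \<subseteq> W" using U(1) SV by auto
        ultimately show "\<exists>U\<subseteq>W. abs_convex addW sclW U \<and> (\<forall>i. \<exists>B\<in>nbB i. B \<subseteq> U) \<and> (\<forall>u\<in>U. addW w u \<in> S ` Q)"
          by blast
      qed
    qed
    show "S ` topspace ?X = topspace ?Y" "inj_on S (topspace ?X)"
      unfolding tA tB using bij by (auto simp: bij_betw_def)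
  qed
qed

text \<open>Interpolation at \<open>0, ..., n\<close> with coefficients independent of the
  polynomial, so that it can be applied to all evaluations of a tensor simultaneously.\<close>

lemma Lagrange_basis:
  obtains l :: "nat \<Rightarrow> complex poly" where
    "\<And>p z. degree p \<le> n \<Longrightarrow> poly p z = (\<Sum>j\<le>n. poly (l j) z * poly p (of_nat j))"
proof -
  define w where "w j = (\<Prod>i\<in>{..n} - {j}. [:- of_nat i, 1::complex:])" for j
  define l where "l j = smult (1 / poly (w j) (of_nat j)) (w j)" for j
  have deg: "degree (l j) \<le> n" if "j \<le> n" for j
  proof -
    have "degree (w j) \<le> (\<Sum>i\<in>{..n} - {j}. degree [:- of_nat i, 1::complex:])"
      unfolding w_def by (rule order_trans[OF degree_prod_sum_le]) (simp_all add: o_def)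
    also have "\<dots> = n" using that by simp
    finally show ?thesis unfolding l_def by (metis degree_smult_le order_trans)
  qed
  have val: "poly (l j) (of_nat i) = (if i = j then 1 else 0)" if "i \<le> n" "j \<le> n" for i j
    using that by (auto simp: l_def w_def poly_prod)
  have "poly p z = (\<Sum>j\<le>n. poly (l j) z * poly p (of_nat j))" if p: "degree p \<le> n" for p z
  proof -
    define q where "q = (\<Sum>j\<le>n. smult (poly p (of_nat j)) (l j))"
    have "p = q"
    proof (rule poly_eqI_degree[of "of_nat ` {..n}"])
      have c: "card (complex_of_nat ` {..n}) = Suc n" by (simp add: card_image inj_on_def)
      have "degree q \<le> n" unfolding q_def
        by (rule degree_sum_le) (auto intro: order_trans[OF degree_smult_le] deg)
      then show "card (complex_of_nat ` {..n}) > degree p" "card (complex_of_nat ` {..n}) > degree q"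
        using p c by auto
      fix x assume "x \<in> complex_of_nat ` {..n}"
      then obtain i where i: "i \<le> n" "x = of_nat i" by auto
      have "poly q x = (\<Sum>j\<le>n. if j = i then poly p x else 0)"
        unfolding q_def poly_sum using i val by (intro sum.cong) auto
      then show "poly p x = poly q x" using i by simp
    qed
    then have "poly p z = poly q z" by simp
    then show ?thesis by (simp add: q_def poly_sum mult.commute)
  qed
  then show ?thesis by (rule that)
qed

context nuclear_triple
begin

section \<open>Power series of kernels and germs\<close>

lemma dual_norm_antimono:
  assumes "p \<le> q"
  shows "dual_norm q n L \<le> dual_norm p n L"
  unfolding dual_norm_def
proof (rule SUP_subset_mono)
  show "{t \<in> NC_tensor n. tnorm q n t \<le> 1} \<subseteq> {t \<in> NC_tensor n. tnorm p n t \<le> 1}"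
    using tnorm_mono[OF _ assms] by (auto intro: order_trans)
qed auto

text \<open>Expanding the tensor power of \<open>\<theta> + cscale z \<eta>\<close> would call for
  mixed symmetric products. Interpolation writes it instead as a combination of the tensor powers at
  \<open>n + 1\<close> points of the line, with coefficients polynomial in \<open>z\<close>.\<close>

lemma dual_line_holomorphic:
  assumes L: "L \<in> NC_tensor_dual n" and \<theta>: "\<theta> \<in> NC" and \<eta>: "\<eta> \<in> NC"
  shows "(\<lambda>z. L (tensor_power n (\<theta> + cscale z \<eta>))) holomorphic_on A"
proof -
  have "\<exists>l. \<forall>p z. degree p \<le> n \<longrightarrow> poly p z = (\<Sum>j\<le>n. poly (l j) z * poly p (of_nat j :: complex))"
    by (rule Lagrange_basis[of n]) blast
  then obtain l where l: "\<And>p z. degree p \<le> n \<Longrightarrow> poly p z = (\<Sum>j\<le>n. poly (l j) z * poly p (of_nat j :: complex))"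
    by blast
  have pr: "pairing x (\<theta> + cscale z \<eta>) = pairing x \<theta> + z * pairing x \<eta>" if x: "x \<in> N'" for x z
  proof -
    note H = NC_fst_snd[OF \<theta>] NC_fst_snd[OF \<eta>]
    have "x (fst \<theta> + (Re z *\<^sub>R fst \<eta> - Im z *\<^sub>R snd \<eta>)) = x (fst \<theta>) + (Re z * x (fst \<eta>) - Im z * x (snd \<eta>))"
      "x (snd \<theta> + (Re z *\<^sub>R snd \<eta> + Im z *\<^sub>R fst \<eta>)) = x (snd \<theta>) + (Re z * x (snd \<eta>) + Im z * x (fst \<eta>))"
      using H N'_lin[OF x, of "fst \<eta>" "snd \<eta>" "Re z" "- Im z"] N'_lin[OF x, of "snd \<eta>" "fst \<eta>" "Re z" "Im z"]
      by (simp_all add: N'_add[OF x])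
    then show ?thesis by (simp add: pairing_def cscale_def complex_eq_iff)
  qed
  define cs where "cs z = map (\<lambda>j. (poly (l j) z, \<theta> + cscale (of_nat j) \<eta>)) [0..<Suc n]" for z
  have cs: "snd ` set (cs z) \<subseteq> NC" for z using \<theta> \<eta> by (auto simp: cs_def)
  have sum_cs: "(\<Sum>(c, \<zeta>)\<leftarrow>cs z. c * f \<zeta>) = (\<Sum>j\<le>n. poly (l j) z * f (\<theta> + cscale (of_nat j) \<eta>))" for f z
  proof -
    have "(\<Sum>(c, \<zeta>)\<leftarrow>cs z. c * f \<zeta>) = (\<Sum>j\<leftarrow>[0..<Suc n]. poly (l j) z * f (\<theta> + cscale (of_nat j) \<eta>))"
      by (simp add: cs_def o_def)
    also have "\<dots> = (\<Sum>j\<le>n. poly (l j) z * f (\<theta> + cscale (of_nat j) \<eta>))"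
      unfolding interv_sum_list_conv_sum_set_nat by (intro sum.cong) auto
    finally show ?thesis .
  qed
  have tz: "tensor_power n (\<theta> + cscale z \<eta>) = tspan n (cs z)" for z
  proof
    fix xs
    show "tensor_power n (\<theta> + cscale z \<eta>) xs = tspan n (cs z) xs"
    proof (cases "length xs = n \<and> set xs \<subseteq> N'")
      case True
      define q where "q = (\<Prod>x\<leftarrow>xs. [:pairing x \<theta>, pairing x \<eta>:])"
      have "degree q \<le> length xs"
        unfolding q_def
      proof (induction xs)
        case (Cons x xs)
        have "degree [:pairing x \<theta>, pairing x \<eta>:] \<le> 1" by simp
        then show ?case
          using Cons degree_mult_le[of "[:pairing x \<theta>, pairing x \<eta>:]" "\<Prod>x\<leftarrow>xs. [:pairing x \<theta>, pairing x \<eta>:]"]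
          by (simp del: mult_pCons_left)
      qed simp
      then have dq: "degree q \<le> n" using True by simp
      have tp: "tensor_power n (\<theta> + cscale u \<eta>) xs = poly q u" for u
      proof -
        have "tensor_power n (\<theta> + cscale u \<eta>) xs = (\<Prod>x\<leftarrow>xs. pairing x (\<theta> + cscale u \<eta>))"
          using True by (simp add: tensor_power_def)
        also have "map (\<lambda>x. pairing x (\<theta> + cscale u \<eta>)) xs = map (\<lambda>x. poly [:pairing x \<theta>, pairing x \<eta>:] u) xs"
          using True pr by (intro map_cong refl) auto
        also have "prod_list \<dots> = poly q u"
          unfolding q_def by (induction xs) (auto simp: algebra_simps)
        finally show ?thesis .
      qed
      show ?thesis
        unfolding tp l[OF dq, of z] tspan_def sum_cs by (simp add: tp)
    next
      case False
      then have "tensor_power n \<zeta> xs = 0" for \<zeta> by (auto simp: tensor_power_def)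
      then show ?thesis unfolding tspan_def sum_cs by simp
    qed
  qed
  have "L (tensor_power n (\<theta> + cscale z \<eta>)) =
      (\<Sum>j\<le>n. poly (l j) z * L (tensor_power n (\<theta> + cscale (of_nat j) \<eta>)))" for z
  proof -
    have "L (tensor_power n (\<theta> + cscale z \<eta>)) = L (tspan n (cs z))" by (simp only: tz)
    also have "\<dots> = (\<Sum>(c, \<zeta>)\<leftarrow>cs z. c * L (tensor_power n \<zeta>))" by (rule dual_tspan[OF L cs])
    also have "\<dots> = (\<Sum>j\<le>n. poly (l j) z * L (tensor_power n (\<theta> + cscale (of_nat j) \<eta>)))" by (rule sum_cs)
    finally show ?thesis .
  qed
  then have "(\<lambda>z. L (tensor_power n (\<theta> + cscale z \<eta>))) =
      (\<lambda>z. \<Sum>j\<le>n. poly (l j) z * L (tensor_power n (\<theta> + cscale (of_nat j) \<eta>)))" by (rule ext)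
  moreover have "(\<lambda>z. \<Sum>j\<le>n. poly (l j) z * L (tensor_power n (\<theta> + cscale (of_nat j) \<eta>))) holomorphic_on A"
    by (intro holomorphic_intros)
  ultimately show ?thesis by (simp only:)
qed

text \<open>A weighted supremum in place of the square sum of \<open>dist_norm_sq\<close>. It is the
  form in which geometric series apply: the power series converges for norms below
  \<open>1 / R\<close>.\<close>

definition kbound :: "nat \<Rightarrow> real \<Rightarrow> real \<Rightarrow> (nat \<Rightarrow> (('h \<Rightarrow> real) list \<Rightarrow> complex) \<Rightarrow> complex) \<Rightarrow> bool" where
  "kbound p R s K \<longleftrightarrow> R > 0 \<and> s \<ge> 0 \<and> (\<forall>n. K n \<in> NC_tensor_dual n \<and> dual_norm p n (K n) \<le> ennreal (s * R ^ n))"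

lemma kbound_term:
  assumes K: "kbound p R s K" and \<theta>: "\<theta> \<in> NC"
  shows "cmod (K n (tensor_power n \<theta>)) \<le> s * (R * cnorm p \<theta>) ^ n"
proof -
  have C: "s * R ^ n \<ge> 0" using K by (simp add: kbound_def)
  have "cmod (K n (tensor_power n \<theta>)) \<le> s * R ^ n * tnorm p n (tensor_power n \<theta>)"
    using K \<theta> C by (intro dual_norm_bound) (auto simp: kbound_def)
  also have "\<dots> \<le> s * R ^ n * cnorm p \<theta> ^ n"
    using C by (intro mult_left_mono tnorm_tensor_power[OF \<theta>]) auto
  finally show ?thesis by (simp add: power_mult_distrib mult.assoc)
qed

text \<open>The free bound \<open>x\<close> makes the estimate uniform on a ball, as local
  boundedness and the germ norms require.\<close>

lemma kbound_sum:
  assumes K: "kbound p R s K" and \<theta>: "\<theta> \<in> NC" and x: "R * cnorm p \<theta> \<le> x" "x < 1"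
  shows "summable (\<lambda>n. K n (tensor_power n \<theta>))" "cmod (\<Sum>n. K n (tensor_power n \<theta>)) \<le> s / (1 - x)"
proof -
  have R: "R > 0" "s \<ge> 0" using K by (auto simp: kbound_def)
  have x0: "x \<ge> 0" using x R cnorm_nonneg[of p \<theta>] by (meson mult_nonneg_nonneg less_imp_le order_trans)
  have b: "cmod (K n (tensor_power n \<theta>)) \<le> s * x ^ n" for n
  proof -
    have "s * (R * cnorm p \<theta>) ^ n \<le> s * x ^ n" using R x by (intro mult_left_mono power_mono) auto
    then show ?thesis using kbound_term[OF K \<theta>, of n] by linarith
  qed
  have gs: "(\<lambda>n. s * x ^ n) sums (s * (1 / (1 - x)))" using x x0 by (intro sums_mult geometric_sums) auto
  show "summable (\<lambda>n. K n (tensor_power n \<theta>))"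
    by (rule summable_comparison_test'[OF sums_summable[OF gs]]) (rule b)
  have "cmod (\<Sum>n. K n (tensor_power n \<theta>)) \<le> (\<Sum>n. s * x ^ n)"
    by (rule norm_suminf_le[OF b sums_summable[OF gs]])
  then show "cmod (\<Sum>n. K n (tensor_power n \<theta>)) \<le> s / (1 - x)" using sums_unique[OF gs] by simp
qed

lemma kbound_holomorphic:
  assumes K: "kbound p R s K"
  shows "holomorphic_NC (\<lambda>\<theta>. \<Sum>n. K n (tensor_power n \<theta>)) {\<theta> \<in> NC. cnorm p \<theta> < 1 / R}"
  unfolding holomorphic_NC_def
proof (intro conjI ballI)
  have R: "R > 0" "s \<ge> 0" using K by (auto simp: kbound_def)
  fix \<theta> assume "\<theta> \<in> {\<theta> \<in> NC. cnorm p \<theta> < 1 / R}"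
  then have \<theta>: "\<theta> \<in> NC" "cnorm p \<theta> < 1 / R" by auto
  \<comment> \<open>The midpoint: the ball of radius \<open>\<rho>\<close> contains
    \<open>\<theta>\<close> and still has geometric ratio \<open>R * \<rho>\<close> below 1.\<close>
  define \<rho> where "\<rho> = (cnorm p \<theta> + 1 / R) / 2"
  have \<rho>: "cnorm p \<theta> < \<rho>" "\<rho> < 1 / R" using \<theta>(2) by (auto simp: \<rho>_def)
  have x: "R * \<rho> < 1" using \<rho>(2) R by (simp add: field_simps)
  have "\<forall>\<eta>\<in>{\<theta> \<in> NC. cnorm p \<theta> < \<rho>}. cmod (\<Sum>n. K n (tensor_power n \<eta>)) \<le> s / (1 - R * \<rho>)"
    using R by (intro ballI kbound_sum(2)[OF K _ _ x]) auto
  moreover have "{\<theta> \<in> NC. cnorm p \<theta> < \<rho>} \<subseteq> {\<theta> \<in> NC. cnorm p \<theta> < 1 / R}" using \<rho> by auto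
  ultimately show "\<exists>V C. open_NC V \<and> \<theta> \<in> V \<and> V \<subseteq> {\<theta> \<in> NC. cnorm p \<theta> < 1 / R} \<and>
      (\<forall>\<eta>\<in>V. cmod (\<Sum>n. K n (tensor_power n \<eta>)) \<le> C)"
    using open_NC_ball[of p \<rho>] \<theta>(1) \<rho>(1) by (intro exI[of _ "{\<theta> \<in> NC. cnorm p \<theta> < \<rho>}"] exI[of _ "s / (1 - R * \<rho>)"]) auto
  fix \<eta> assume \<eta>: "\<eta> \<in> NC"
  \<comment> \<open>For parameters below \<open>\<delta>\<close> the line through
    \<open>\<theta>\<close> stays in the ball of radius \<open>\<rho>\<close>, where the Weierstrass
    test applies.\<close>
  define \<delta> where "\<delta> = (\<rho> - cnorm p \<theta>) / (cnorm p \<eta> + 1)"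
  have pos: "cnorm p \<eta> + 1 > 0" using cnorm_nonneg[of p \<eta>] by linarith
  have \<delta>: "\<delta> > 0" using \<rho>(1) pos by (simp add: \<delta>_def)
  have small: "cnorm p (\<theta> + cscale z \<eta>) \<le> \<rho>" if "z \<in> ball 0 \<delta>" for z
  proof -
    have "cmod z * (cnorm p \<eta> + 1) < \<rho> - cnorm p \<theta>"
      using that pos by (simp add: \<delta>_def pos_less_divide_eq)
    then have "cmod z * cnorm p \<eta> + cmod z < \<rho> - cnorm p \<theta>" by (simp add: distrib_left)
    then have "cmod z * cnorm p \<eta> < \<rho> - cnorm p \<theta>" using norm_ge_zero[of z] by linarith
    then show ?thesis
      using cnorm_triangle[OF \<theta>(1) NC_intros(4)[OF \<eta>], of p z] cnorm_cscale[OF \<eta>, of p z] by simp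
  qed
  have unif: "uniform_limit (ball 0 \<delta>) (\<lambda>m z. \<Sum>n<m. K n (tensor_power n (\<theta> + cscale z \<eta>)))
      (\<lambda>z. \<Sum>n. K n (tensor_power n (\<theta> + cscale z \<eta>))) sequentially"
  proof (rule Weierstrass_m_test)
    fix n and z :: complex assume z: "z \<in> ball 0 \<delta>"
    have "cmod (K n (tensor_power n (\<theta> + cscale z \<eta>))) \<le> s * (R * cnorm p (\<theta> + cscale z \<eta>)) ^ n"
      using \<theta> \<eta> by (intro kbound_term[OF K]) auto
    also have "\<dots> \<le> s * (R * \<rho>) ^ n"
      using small[OF z] R by (intro mult_left_mono power_mono) auto
    finally show "norm (K n (tensor_power n (\<theta> + cscale z \<eta>))) \<le> s * (R * \<rho>) ^ n" .
  next
    have "R * \<rho> \<ge> 0" using R \<rho>(1) cnorm_nonneg[of p \<theta>] by (intro mult_nonneg_nonneg) linarith+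
    then show "summable (\<lambda>n. s * (R * \<rho>) ^ n)" using x by (intro summable_mult summable_geometric) auto
  qed
  have "(\<lambda>z. \<Sum>n. K n (tensor_power n (\<theta> + cscale z \<eta>))) holomorphic_on ball 0 \<delta>"
  proof (rule holomorphic_uniform_sequence[OF open_ball])
    show "(\<lambda>z. \<Sum>n<m. K n (tensor_power n (\<theta> + cscale z \<eta>))) holomorphic_on ball 0 \<delta>" for m
      using K \<theta>(1) \<eta> by (intro holomorphic_on_sum dual_line_holomorphic) (auto simp: kbound_def)
    fix z :: complex assume "z \<in> ball 0 \<delta>"
    then obtain d where "d > 0" "cball z d \<subseteq> ball 0 \<delta>" by (meson open_ball open_contains_cball)
    then show "\<exists>d>0. cball z d \<subseteq> ball 0 \<delta> \<and> uniform_limit (cball z d) (\<lambda>m z. \<Sum>n<m. K n (tensor_power n (\<theta> + cscale z \<eta>)))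
      (\<lambda>z. \<Sum>n. K n (tensor_power n (\<theta> + cscale z \<eta>))) sequentially"
      using uniform_limit_on_subset[OF unif] by blast
  qed
  then show "(\<lambda>z. \<Sum>n. K n (tensor_power n (\<theta> + cscale z \<eta>))) analytic_on {0}"
    using \<delta> by (meson analytic_at open_ball centre_in_ball)
qed

lemma kbound_lc:
  assumes K: "kbound p R s K" and L: "kbound q R' s' L"
  shows "kbound (max p q) (max R R') (cmod a * s + cmod b * s') (\<lambda>n t. a * K n t + b * L n t)"
proof -
  have R: "R > 0" "s \<ge> 0" "R' > 0" "s' \<ge> 0" using K L by (auto simp: kbound_def)
  let ?p = "max p q" and ?R = "max R R'"
  have Kd: "K n \<in> NC_tensor_dual n" and Ld: "L n \<in> NC_tensor_dual n" for n using K L by (auto simp: kbound_def)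
  have Kb: "dual_norm ?p n (K n) \<le> ennreal (s * ?R ^ n)" for n
  proof -
    have "dual_norm ?p n (K n) \<le> dual_norm p n (K n)" by (rule dual_norm_antimono) simp
    also have "\<dots> \<le> ennreal (s * R ^ n)" using K by (simp add: kbound_def)
    also have "\<dots> \<le> ennreal (s * ?R ^ n)" using R by (intro ennreal_leI mult_left_mono power_mono) auto
    finally show ?thesis .
  qed
  have Lb: "dual_norm ?p n (L n) \<le> ennreal (s' * ?R ^ n)" for n
  proof -
    have "dual_norm ?p n (L n) \<le> dual_norm q n (L n)" by (rule dual_norm_antimono) simp
    also have "\<dots> \<le> ennreal (s' * R' ^ n)" using L by (simp add: kbound_def)
    also have "\<dots> \<le> ennreal (s' * ?R ^ n)" using R by (intro ennreal_leI mult_left_mono power_mono) auto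
    finally show ?thesis .
  qed
  have "dual_norm ?p n (\<lambda>t. a * K n t + b * L n t) \<le> ennreal ((cmod a * s + cmod b * s') * ?R ^ n)" for n
  proof (rule dual_norm_leI)
    fix t assume t: "t \<in> NC_tensor n"
    have "cmod (a * K n t + b * L n t) \<le> cmod a * cmod (K n t) + cmod b * cmod (L n t)"
      using norm_triangle_ineq[of "a * K n t" "b * L n t"] by (simp add: norm_mult)
    also have "\<dots> \<le> cmod a * (s * ?R ^ n * tnorm ?p n t) + cmod b * (s' * ?R ^ n * tnorm ?p n t)"
      using R by (intro add_mono mult_left_mono dual_norm_bound[OF Kd Kb _ t] dual_norm_bound[OF Ld Lb _ t]) auto
    finally show "cmod (a * K n t + b * L n t) \<le> (cmod a * s + cmod b * s') * ?R ^ n * tnorm ?p n t"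
      by (simp add: algebra_simps)
  qed (use R in simp)
  then show ?thesis using R dual_lc[OF Kd Ld] by (simp add: kbound_def less_max_iff_disj)
qed

lemma germ_self [simp]: "G \<in> germ G"
  unfolding germ_def using open_NC_ball[of 0 1] by (auto intro!: exI[of _ "{\<theta> \<in> NC. cnorm 0 \<theta> < 1}"])

lemma germ_eqI:
  assumes U: "open_NC U" "0 \<in> U" "\<And>\<theta>. \<theta> \<in> U \<Longrightarrow> F \<theta> = G \<theta>"
  shows "germ F = germ G"
proof -
  have "germ F \<subseteq> germ G" if U: "open_NC U" "0 \<in> U" "\<And>\<theta>. \<theta> \<in> U \<Longrightarrow> F \<theta> = G \<theta>" for F G :: "'h \<times> 'h \<Rightarrow> complex" and U
  proof
    fix H assume "H \<in> germ F"
    then obtain V where V: "open_NC V" "0 \<in> V" "\<forall>\<theta>\<in>V. H \<theta> = F \<theta>" by (auto simp: germ_def)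
    have "open_NC (U \<inter> V) \<and> 0 \<in> U \<inter> V \<and> (\<forall>\<theta>\<in>U \<inter> V. H \<theta> = G \<theta>)"
      using open_NC_Int[OF U(1) V(1)] U V by auto
    then show "H \<in> germ G" unfolding germ_def by blast
  qed
  from this[of U F G] this[of U G F] show ?thesis using U by auto
qed

lemma germ_memD:
  assumes "F \<in> germ G"
  obtains U where "open_NC U" "0 \<in> U" "\<And>\<theta>. \<theta> \<in> U \<Longrightarrow> F \<theta> = G \<theta>"
  using assms unfolding germ_def by blast

lemma germ_mem_eq: "F \<in> germ G \<Longrightarrow> germ F = germ G"
  by (metis germ_memD germ_eqI)

text \<open>All representatives give the same germ, so the union in \<open>germ_add\<close> is a
  union of equal sets.\<close>

lemma germ_add_germ: "germ_add (germ F) (germ G) = germ (fadd F G)"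
proof -
  have "germ (fadd F' G') = germ (fadd F G)" if F': "F' \<in> germ F" and G': "G' \<in> germ G" for F' G'
  proof -
    obtain U where U: "open_NC U" "0 \<in> U" "\<And>\<theta>. \<theta> \<in> U \<Longrightarrow> F' \<theta> = F \<theta>" using germ_memD[OF F'] by metis
    obtain V where V: "open_NC V" "0 \<in> V" "\<And>\<theta>. \<theta> \<in> V \<Longrightarrow> G' \<theta> = G \<theta>" using germ_memD[OF G'] by metis
    show ?thesis
      by (rule germ_eqI[OF open_NC_Int[OF U(1) V(1)]]) (use U V in \<open>auto simp: fadd_def\<close>)
  qed
  then show ?thesis unfolding germ_add_def using germ_self by blast
qed

lemma germ_scl_germ: "germ_scl c (germ F) = germ (fscl c F)"
proof -
  have "germ (fscl c F') = germ (fscl c F)" if F': "F' \<in> germ F" for F'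
  proof -
    obtain U where U: "open_NC U" "0 \<in> U" "\<And>\<theta>. \<theta> \<in> U \<Longrightarrow> F' \<theta> = F \<theta>" using germ_memD[OF F'] by metis
    show ?thesis by (rule germ_eqI[OF U(1,2)]) (use U in \<open>auto simp: fscl_def\<close>)
  qed
  then show ?thesis unfolding germ_scl_def using germ_self by blast
qed

lemma two_power_ge:
  fixes R :: real
  obtains q where "2 * R\<^sup>2 \<le> 2 ^ q"
  using real_arch_pow[of 2 "2 * R\<^sup>2"] by (metis less_imp_le one_less_numeral_iff semiring_norm(76))

end

context appell_setting
begin

section \<open>Distributions and germs under the transform\<close>

lemma S_transform_eq: "S_transform \<mu> \<Phi> = (\<lambda>\<theta>. \<Sum>n. kernels \<mu> \<Phi> n (tensor_power n \<theta>))"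
  by (auto simp: S_transform_def)

text \<open>A single term of the series is bounded by the whole sum.\<close>

lemma kbound_of_dist_norm:
  assumes \<Phi>: "\<Phi> \<in> polys_dual" and le: "dist_norm_sq \<mu> p q \<Phi> \<le> ennreal (s\<^sup>2)" and s: "s \<ge> 0"
  shows "kbound p (2 ^ q) s (kernels \<mu> \<Phi>)"
proof -
  have "dual_norm p n (kernels \<mu> \<Phi> n) \<le> ennreal (s * (2 ^ q) ^ n)" for n
  proof -
    let ?d = "dual_norm p n (kernels \<mu> \<Phi> n)"
    have "(\<Sum>i\<in>{n}. ennreal (1 / 2 ^ (q * i)) * (dual_norm p i (kernels \<mu> \<Phi> i))\<^sup>2) \<le> dist_norm_sq \<mu> p q \<Phi>"
      unfolding dist_norm_sq_def by (intro sum_le_suminf) auto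
    then have t: "ennreal (1 / 2 ^ (q * n)) * ?d\<^sup>2 \<le> ennreal (s\<^sup>2)" using le by simp
    show ?thesis
    proof (cases ?d)
      case (real d)
      have "ennreal (1 / 2 ^ (q * n)) * ?d\<^sup>2 = ennreal (1 / 2 ^ (q * n) * d\<^sup>2)"
        using real by (simp add: ennreal_power flip: ennreal_mult)
      then have "1 / 2 ^ (q * n) * d\<^sup>2 \<le> s\<^sup>2" using t by simp
      then have "d\<^sup>2 \<le> s\<^sup>2 * 2 ^ (q * n)" by (simp add: field_simps)
      \<comment> \<open>The true rate is the square root of \<open>2 ^ q\<close>; giving this root
        away yields the rate \<open>2 ^ q\<close>, a power of 2 with integer exponent.\<close>
      also have "\<dots> \<le> s\<^sup>2 * (2 ^ (q * n))\<^sup>2"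
        by (intro mult_left_mono) (auto simp: power2_eq_square)
      also have "\<dots> = (s * (2 ^ q) ^ n)\<^sup>2" by (simp add: power_mult power_mult_distrib)
      finally have "d\<^sup>2 \<le> (s * (2 ^ q) ^ n)\<^sup>2" .
      then have "d \<le> s * (2 ^ q) ^ n" by (rule power2_le_imp_le) (use s in simp)
      then show ?thesis using real by (simp add: ennreal_leI)
    next
      case top
      then have "ennreal (1 / 2 ^ (q * n)) * ?d\<^sup>2 = \<top>" by (simp add: ennreal_mult_top power2_eq_square)
      then show ?thesis using t by (simp add: top_unique)
    qed
  qed
  then show ?thesis using s kernels_dual[OF \<Phi>] by (simp add: kbound_def)
qed

lemma dist_step_kbound:
  assumes "\<Phi> \<in> dist_step \<mu> p q"
  obtains s where "kbound p (2 ^ q) s (kernels \<mu> \<Phi>)"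
proof -
  have \<Phi>: "\<Phi> \<in> polys_dual" "dist_norm_sq \<mu> p q \<Phi> < \<infinity>" using assms by (auto simp: dist_step_def)
  define s where "s = sqrt (enn2real (dist_norm_sq \<mu> p q \<Phi>))"
  have "dist_norm_sq \<mu> p q \<Phi> \<le> ennreal (s\<^sup>2)" using \<Phi>(2) by (simp add: s_def)
  then have "kbound p (2 ^ q) s (kernels \<mu> \<Phi>)" by (intro kbound_of_dist_norm[OF \<Phi>(1)]) (auto simp: s_def)
  then show ?thesis by (rule that)
qed

text \<open>The condition on \<open>q\<close> makes the ratio \<open>R\<^sup>2 / 2 ^ q\<close> at
  most 1/2, so the geometric series contributes a factor of at most 2.\<close>

lemma dist_norm_of_kbound:
  assumes K: "kbound p R s (kernels \<mu> \<Phi>)" and q: "2 * R\<^sup>2 \<le> 2 ^ q"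
  shows "dist_norm_sq \<mu> p q \<Phi> \<le> ennreal (2 * s\<^sup>2)"
proof -
  have R: "R > 0" "s \<ge> 0" using K by (auto simp: kbound_def)
  have gs: "(\<lambda>n. s\<^sup>2 * (1 / 2) ^ n) sums (s\<^sup>2 * (1 / (1 - 1 / 2)))" by (intro sums_mult geometric_sums) auto
  have tm: "ennreal (1 / 2 ^ (q * n)) * (dual_norm p n (kernels \<mu> \<Phi> n))\<^sup>2 \<le> ennreal (s\<^sup>2 * (1 / 2) ^ n)" for n
  proof -
    have "ennreal (1 / 2 ^ (q * n)) * (dual_norm p n (kernels \<mu> \<Phi> n))\<^sup>2 \<le> ennreal (1 / 2 ^ (q * n)) * (ennreal (s * R ^ n))\<^sup>2"
      using K by (intro mult_left_mono power_mono) (auto simp: kbound_def)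
    also have "\<dots> = ennreal (1 / 2 ^ (q * n) * (s * R ^ n)\<^sup>2)"
      using R by (simp add: ennreal_power flip: ennreal_mult)
    also have "1 / 2 ^ (q * n) * (s * R ^ n)\<^sup>2 = s\<^sup>2 * (R\<^sup>2 / 2 ^ q) ^ n"
    proof -
      have "(R ^ n)\<^sup>2 = (R\<^sup>2) ^ n" by (metis power_mult mult.commute)
      then show ?thesis unfolding power_mult[of 2 q n] power_mult_distrib power_divide by simp
    qed
    also have "\<dots> \<le> s\<^sup>2 * (1 / 2) ^ n"
      using q by (intro mult_left_mono power_mono) (auto simp: field_simps)
    finally show ?thesis by (simp add: ennreal_leI)
  qed
  have "dist_norm_sq \<mu> p q \<Phi> \<le> (\<Sum>n. ennreal (s\<^sup>2 * (1 / 2) ^ n))"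
    unfolding dist_norm_sq_def by (intro suminf_le tm) auto
  also have "\<dots> = ennreal (s\<^sup>2 * (1 / (1 - 1 / 2)))"
    using gs by (intro suminf_ennreal_eq) auto
  finally show ?thesis by (simp add: mult.commute)
qed

lemma distributions_kbound:
  assumes "\<Phi> \<in> distributions \<mu>"
  obtains p R s where "\<Phi> \<in> polys_dual" "kbound p R s (kernels \<mu> \<Phi>)"
proof -
  obtain p q where \<Phi>: "\<Phi> \<in> dist_step \<mu> p q" using assms unfolding distributions_def by blast
  then obtain s where "kbound p (2 ^ q) s (kernels \<mu> \<Phi>)" by (rule dist_step_kbound)
  moreover have "\<Phi> \<in> polys_dual" using \<Phi> by (simp add: dist_step_def)
  ultimately show ?thesis by (intro that)
qed

lemma kbound_distributions:
  assumes "\<Phi> \<in> polys_dual" "kbound p R s (kernels \<mu> \<Phi>)"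
  shows "\<Phi> \<in> distributions \<mu>"
proof -
  obtain q where "2 * R\<^sup>2 \<le> 2 ^ q" using two_power_ge[of R] by metis
  from dist_norm_of_kbound[OF assms(2) this] have "dist_norm_sq \<mu> p q \<Phi> < \<infinity>" by (simp add: order_le_less_trans)
  then show ?thesis using assms(1) unfolding distributions_def dist_step_def by blast
qed

lemma distributions_lc:
  assumes \<Phi>: "\<Phi> \<in> distributions \<mu>" and \<Psi>: "\<Psi> \<in> distributions \<mu>"
  shows "fadd (fscl a \<Phi>) (fscl b \<Psi>) \<in> distributions \<mu>"
    "germ (S_transform \<mu> (fadd (fscl a \<Phi>) (fscl b \<Psi>))) =
       germ_add (germ_scl a (germ (S_transform \<mu> \<Phi>))) (germ_scl b (germ (S_transform \<mu> \<Psi>)))"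
proof -
  obtain p R s where 1: "\<Phi> \<in> polys_dual" "kbound p R s (kernels \<mu> \<Phi>)" using distributions_kbound[OF \<Phi>] by metis
  obtain p' R' s' where 2: "\<Psi> \<in> polys_dual" "kbound p' R' s' (kernels \<mu> \<Psi>)" using distributions_kbound[OF \<Psi>] by metis
  note lc = kernels_lc[OF 1(1) 2(1), of a b]
  show "fadd (fscl a \<Phi>) (fscl b \<Psi>) \<in> distributions \<mu>"
    using kbound_lc[OF 1(2) 2(2), of a b] unfolding lc[symmetric] by (rule kbound_distributions[OF polys_dual_lc[OF 1(1) 2(1)]])
  have R: "R > 0" "R' > 0" using 1 2 by (auto simp: kbound_def)
  show "germ (S_transform \<mu> (fadd (fscl a \<Phi>) (fscl b \<Psi>))) =
       germ_add (germ_scl a (germ (S_transform \<mu> \<Phi>))) (germ_scl b (germ (S_transform \<mu> \<Psi>)))"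
    unfolding germ_scl_germ germ_add_germ
  proof (rule germ_eqI[OF open_NC_Int[OF open_NC_ball[of p "1 / R"] open_NC_ball[of p' "1 / R'"]]])
    fix \<theta> assume "\<theta> \<in> {\<theta> \<in> NC. cnorm p \<theta> < 1 / R} \<inter> {\<theta> \<in> NC. cnorm p' \<theta> < 1 / R'}"
    then have \<theta>: "\<theta> \<in> NC" "R * cnorm p \<theta> < 1" "R' * cnorm p' \<theta> < 1" using R by (auto simp: field_simps)
    note s1 = kbound_sum(1)[OF 1(2) \<theta>(1) order_refl \<theta>(2)] and s2 = kbound_sum(1)[OF 2(2) \<theta>(1) order_refl \<theta>(3)]
    show "S_transform \<mu> (fadd (fscl a \<Phi>) (fscl b \<Psi>)) \<theta> = fadd (fscl a (S_transform \<mu> \<Phi>)) (fscl b (S_transform \<mu> \<Psi>)) \<theta>"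
      unfolding S_transform_def lc
      by (simp add: fadd_def fscl_def suminf_add[symmetric] suminf_mult[symmetric] summable_mult s1 s2)
  qed (use R in auto)
qed

lemma S_transform_Hol0:
  assumes "\<Phi> \<in> distributions \<mu>"
  shows "germ (S_transform \<mu> \<Phi>) \<in> Hol0"
proof -
  obtain p R s where K: "kbound p R s (kernels \<mu> \<Phi>)" using distributions_kbound[OF assms] by metis
  then have "R > 0" by (simp add: kbound_def)
  then show ?thesis
    unfolding Hol0_def S_transform_eq using kbound_holomorphic[OF K] open_NC_ball[of p "1 / R"]
    by (intro CollectI exI conjI refl) auto
qed

text \<open>Equal germs agree on a neighbourhood on which both series converge, which identifies the
  kernels and hence the functionals.\<close>

lemma S_transform_inj:
  assumes \<Phi>: "\<Phi> \<in> distributions \<mu>" and \<Psi>: "\<Psi> \<in> distributions \<mu>"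
    and eq: "germ (S_transform \<mu> \<Phi>) = germ (S_transform \<mu> \<Psi>)"
  shows "\<Phi> = \<Psi>"
proof -
  obtain p R s where 1: "\<Phi> \<in> polys_dual" "kbound p R s (kernels \<mu> \<Phi>)" using distributions_kbound[OF \<Phi>] by metis
  obtain p' R' s' where 2: "\<Psi> \<in> polys_dual" "kbound p' R' s' (kernels \<mu> \<Psi>)" using distributions_kbound[OF \<Psi>] by metis
  have R: "R > 0" "R' > 0" using 1 2 by (auto simp: kbound_def)
  have "S_transform \<mu> \<Phi> \<in> germ (S_transform \<mu> \<Psi>)" using eq germ_self by metis
  then obtain U where U: "open_NC U" "0 \<in> U" "\<And>\<theta>. \<theta> \<in> U \<Longrightarrow> S_transform \<mu> \<Phi> \<theta> = S_transform \<mu> \<Psi> \<theta>"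
    using germ_memD by metis
  let ?U = "U \<inter> ({\<theta> \<in> NC. cnorm p \<theta> < 1 / R} \<inter> {\<theta> \<in> NC. cnorm p' \<theta> < 1 / R'})"
  have "kernels \<mu> \<Phi> = kernels \<mu> \<Psi>"
  proof (rule kernels_unique[where U="?U" and c="\<lambda>_. 1" and f="S_transform \<mu> \<Phi>"])
    show "open_NC ?U" by (intro open_NC_Int U(1) open_NC_ball)
    show "0 \<in> ?U" using U(2) R by auto
    fix \<theta> assume "\<theta> \<in> ?U"
    then have \<theta>: "\<theta> \<in> U" "\<theta> \<in> NC" "R * cnorm p \<theta> < 1" "R' * cnorm p' \<theta> < 1" using R by (auto simp: field_simps)
    show "(\<lambda>n. kernels \<mu> \<Phi> n (tensor_power n \<theta>) / 1) sums S_transform \<mu> \<Phi> \<theta>"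
      unfolding S_transform_def using kbound_sum(1)[OF 1(2) \<theta>(2) order_refl \<theta>(3)] by (simp add: summable_sums)
    show "(\<lambda>n. kernels \<mu> \<Psi> n (tensor_power n \<theta>) / 1) sums S_transform \<mu> \<Phi> \<theta>"
      unfolding U(3)[OF \<theta>(1)] unfolding S_transform_def
      using kbound_sum(1)[OF 2(2) \<theta>(2) order_refl \<theta>(4)] by (simp add: summable_sums)
  qed (use kernels_dual 1 2 in auto)
  then show ?thesis by (rule kernels_inj[OF 1(1) 2(1)])
qed

text \<open>The step \<open>(p', q)\<close> depends on the ball only, and the norm of the preimage
  is controlled by the supremum \<open>M\<close>. This gives surjectivity and openness
  together.\<close>

lemma S_transform_preimage:
  assumes r: "r > 0"
  obtains p' q where "\<And>M G. bounded_hol p r M G \<Longrightarrow> \<exists>\<Phi>\<in>dist_step \<mu> p' q.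
    germ (S_transform \<mu> \<Phi>) = germ G \<and> dist_norm_sq \<mu> p' q \<Phi> \<le> ennreal (2 * M\<^sup>2)"
proof -
  obtain p' \<kappa> where k: "\<kappa> > 0" and T: "\<And>r M G. bounded_hol p r M G \<Longrightarrow> \<exists>L. (\<forall>n. L n \<in> NC_tensor_dual n \<and>
        dual_norm p' n (L n) \<le> ennreal (M * (\<kappa> / r) ^ n) \<and>
        (\<forall>\<theta>\<in>NC. L n (tensor_power n \<theta>) = tcoeff G n \<theta>))"
    by (rule Taylor_kernels[of p]) blast
  obtain q where q: "2 * (\<kappa> / r)\<^sup>2 \<le> 2 ^ q" using two_power_ge[of "\<kappa> / r"] by metis
  have "\<exists>\<Phi>\<in>dist_step \<mu> p' q. germ (S_transform \<mu> \<Phi>) = germ G \<and> dist_norm_sq \<mu> p' q \<Phi> \<le> ennreal (2 * M\<^sup>2)"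
    if G: "bounded_hol p r M G" for M G
  proof -
    obtain L where L: "\<And>n. L n \<in> NC_tensor_dual n" "\<And>n. dual_norm p' n (L n) \<le> ennreal (M * (\<kappa> / r) ^ n)"
      "\<And>n \<theta>. \<theta> \<in> NC \<Longrightarrow> L n (tensor_power n \<theta>) = tcoeff G n \<theta>"
      using T[OF G] by blast
    obtain \<Phi> where \<Phi>: "\<Phi> \<in> polys_dual" "kernels \<mu> \<Phi> = L" using kernels_surj[OF L(1)] by metis
    have "kbound p' (\<kappa> / r) M (kernels \<mu> \<Phi>)"
      unfolding \<Phi>(2) kbound_def using k r L bounded_hol_M[OF G] by simp
    from dist_norm_of_kbound[OF this q] have n: "dist_norm_sq \<mu> p' q \<Phi> \<le> ennreal (2 * M\<^sup>2)" .
    then have "dist_norm_sq \<mu> p' q \<Phi> < \<infinity>" by (simp add: order_le_less_trans)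
    then have "\<Phi> \<in> dist_step \<mu> p' q" using \<Phi>(1) by (simp add: dist_step_def)
    moreover have "germ (S_transform \<mu> \<Phi>) = germ G"
    proof (rule germ_eqI[OF open_NC_ball[of p r]])
      fix \<theta> assume "\<theta> \<in> {\<theta> \<in> NC. cnorm p \<theta> < r}"
      then have \<theta>: "\<theta> \<in> NC" "cnorm p \<theta> < r" by auto
      show "S_transform \<mu> \<Phi> \<theta> = G \<theta>"
        unfolding S_transform_def \<Phi>(2) L(3)[OF \<theta>(1)] using sums_unique[OF tcoeff_sums[OF G \<theta>]] by simp
    qed (use r in simp)
    ultimately show ?thesis using n by blast
  qed
  then show ?thesis by (rule that)
qed

lemma S_transform_bij: "bij_betw (\<lambda>\<Phi>. germ (S_transform \<mu> \<Phi>)) (distributions \<mu>) Hol0"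
  unfolding bij_betw_def
proof (intro conjI equalityI subsetI)
  show "inj_on (\<lambda>\<Phi>. germ (S_transform \<mu> \<Phi>)) (distributions \<mu>)"
    using S_transform_inj by (auto intro: inj_onI)
  show "g \<in> Hol0" if "g \<in> (\<lambda>\<Phi>. germ (S_transform \<mu> \<Phi>)) ` distributions \<mu>" for g
    using that S_transform_Hol0 by auto
  fix g assume "g \<in> Hol0"
  then obtain G U where G: "g = germ G" "open_NC U" "0 \<in> U" "holomorphic_NC G U" by (auto simp: Hol0_def)
  obtain p r M where b: "bounded_hol p r M G" using holomorphic_NC_bounded_hol[OF G(2-4)] by metis
  then have "r > 0" by (simp add: bounded_hol_def)
  then obtain p' q where "\<exists>\<Phi>\<in>dist_step \<mu> p' q. germ (S_transform \<mu> \<Phi>) = germ G"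
    using S_transform_preimage[of r p] b by metis
  then show "g \<in> (\<lambda>\<Phi>. germ (S_transform \<mu> \<Phi>)) ` distributions \<mu>"
    unfolding distributions_def G(1) by blast
qed

text \<open>The linear structure is transported from the distributions through the
  bijection.\<close>

lemma Hol0_lc:
  assumes "g \<in> Hol0" "h \<in> Hol0"
  shows "germ_add (germ_scl a g) (germ_scl b h) \<in> Hol0"
proof -
  have im: "Hol0 = (\<lambda>\<Phi>. germ (S_transform \<mu> \<Phi>)) ` distributions \<mu>" using S_transform_bij by (simp add: bij_betw_def)
  obtain \<Phi> \<Psi> where *: "\<Phi> \<in> distributions \<mu>" "\<Psi> \<in> distributions \<mu>" "g = germ (S_transform \<mu> \<Phi>)" "h = germ (S_transform \<mu> \<Psi>)"
    using assms unfolding im by blast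
  then show ?thesis
    using distributions_lc(2)[OF *(1,2), of a b] S_transform_Hol0[OF distributions_lc(1)[OF *(1,2)], of a b] by simp
qed

lemma Hol0_scl_1: "g \<in> Hol0 \<Longrightarrow> germ_scl 1 g = g"
  unfolding Hol0_def by (auto simp: germ_scl_germ)

text \<open>The series converges on the open ball of radius \<open>1 / 2 ^ q\<close>; on the closed
  ball of half that radius its ratio is at most 1/2, whence the factor 2.\<close>

lemma germ_norm_S_transform:
  assumes \<Phi>: "\<Phi> \<in> dist_step \<mu> p q" and n: "dist_norm_sq \<mu> p q \<Phi> \<le> ennreal (s\<^sup>2)" and s: "s \<ge> 0"
  shows "germ_norm p (q + 1) (germ (S_transform \<mu> \<Phi>)) \<le> ennreal (2 * s)"
proof -
  have K: "kbound p (2 ^ q) s (kernels \<mu> \<Phi>)"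
    using \<Phi> by (intro kbound_of_dist_norm n s) (auto simp: dist_step_def)
  have "\<exists>U. open_NC U \<and> {\<theta> \<in> NC. cnorm p \<theta> \<le> 1 / 2 ^ (q + 1)} \<subseteq> U \<and> holomorphic_NC (S_transform \<mu> \<Phi>) U"
  proof (intro exI conjI)
    have "(1::real) / 2 ^ (q + 1) < 1 / 2 ^ q" by (simp add: field_simps)
    then show "{\<theta> \<in> NC. cnorm p \<theta> \<le> 1 / 2 ^ (q + 1)} \<subseteq> {\<theta> \<in> NC. cnorm p \<theta> < 1 / 2 ^ q}" by auto
  qed (unfold S_transform_eq, rule open_NC_ball, rule kbound_holomorphic[OF K])
  then have "germ_norm p (q + 1) (germ (S_transform \<mu> \<Phi>)) \<le>
      (SUP \<theta>\<in>{\<theta> \<in> NC. cnorm p \<theta> \<le> 1 / 2 ^ (q + 1)}. ennreal (cmod (S_transform \<mu> \<Phi> \<theta>)))"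
    unfolding germ_norm_def by (intro INF_lower) auto
  also have "\<dots> \<le> ennreal (2 * s)"
  proof (rule SUP_least)
    fix \<theta> assume "\<theta> \<in> {\<theta> \<in> NC. cnorm p \<theta> \<le> 1 / 2 ^ (q + 1)}"
    then have \<theta>: "\<theta> \<in> NC" "2 ^ q * cnorm p \<theta> \<le> 1 / 2" by (auto simp: field_simps)
    have "cmod (S_transform \<mu> \<Phi> \<theta>) \<le> s / (1 - 1 / 2)"
      unfolding S_transform_def by (rule kbound_sum(2)[OF K \<theta>]) simp
    then show "ennreal (cmod (S_transform \<mu> \<Phi> \<theta>)) \<le> ennreal (2 * s)" by (intro ennreal_leI) simp
  qed
  finally show ?thesis .
qed

text \<open>An infimum below \<open>\<epsilon>\<close> is witnessed by one representative; being
  holomorphic on a neighbourhood of the closed ball, it is analytic along lines at boundary points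
  too.\<close>

lemma germ_norm_lessD:
  assumes g: "g \<in> Hol0" and less: "germ_norm p l g < ennreal \<epsilon>"
  obtains G where "g = germ G" "bounded_hol p (1 / 2 ^ l) \<epsilon> G"
proof -
  obtain G U where G: "G \<in> g" and U: "open_NC U" "{\<theta> \<in> NC. cnorm p \<theta> \<le> 1 / 2 ^ l} \<subseteq> U" "holomorphic_NC G U"
    and sup: "(SUP \<theta>\<in>{\<theta> \<in> NC. cnorm p \<theta> \<le> 1 / 2 ^ l}. ennreal (cmod (G \<theta>))) < ennreal \<epsilon>"
    using less unfolding germ_norm_def INF_less_iff by blast
  have \<epsilon>: "\<epsilon> \<ge> 0"
  proof (rule ccontr)
    assume "\<not> \<epsilon> \<ge> 0"
    then have "ennreal \<epsilon> = 0" by (simp add: ennreal_neg)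
    then show False using less by simp
  qed
  have "bounded_hol p (1 / 2 ^ l) \<epsilon> G"
    unfolding bounded_hol_def
  proof (intro conjI ballI impI)
    fix \<theta> assume \<theta>: "\<theta> \<in> NC" "cnorm p \<theta> \<le> 1 / 2 ^ l"
    have "ennreal (cmod (G \<theta>)) \<le> (SUP \<theta>\<in>{\<theta> \<in> NC. cnorm p \<theta> \<le> 1 / 2 ^ l}. ennreal (cmod (G \<theta>)))"
      using \<theta> by (intro SUP_upper) auto
    then have "ennreal (cmod (G \<theta>)) \<le> ennreal \<epsilon>" using sup by order
    then show "cmod (G \<theta>) \<le> \<epsilon>" using \<epsilon> by simp
    show "(\<lambda>z. G (\<theta> + cscale z \<eta>)) analytic_on {0}" if "\<eta> \<in> NC" for \<eta>
      using U(2,3) \<theta> that unfolding holomorphic_NC_def by blast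
  qed simp
  moreover have "g = germ G" using g G germ_mem_eq by (auto simp: Hol0_def)
  ultimately show ?thesis using that by blast
qed

lemma S_transform_homeomorphic:
  "homeomorphic_map (dist_topology \<mu>) Hol0_topology (\<lambda>\<Phi>. germ (S_transform \<mu> \<Phi>))"
  unfolding dist_topology_def Hol0_topology_def
proof (rule homeomorphic_final_lc)
  let ?S = "\<lambda>\<Phi>. germ (S_transform \<mu> \<Phi>)"
  let ?A = "\<lambda>(p, q). {{\<Phi> \<in> dist_step \<mu> p q. dist_norm_sq \<mu> p q \<Phi> < ennreal (\<epsilon>\<^sup>2)} | \<epsilon>. \<epsilon> > 0}"
  let ?B = "\<lambda>(p, l). {{g \<in> Hol0. germ_norm p l g < ennreal \<epsilon>} | \<epsilon>. \<epsilon> > 0}"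
  show "\<exists>C\<in>?A i. C \<subseteq> A \<inter> B" if AB: "A \<in> ?A i" "B \<in> ?A i" for i A B
  proof -
    obtain p q where i: "i = (p, q)" by (cases i)
    obtain e d where e: "e > 0" "A = {\<Phi> \<in> dist_step \<mu> p q. dist_norm_sq \<mu> p q \<Phi> < ennreal (e\<^sup>2)}"
      and d: "d > 0" "B = {\<Phi> \<in> dist_step \<mu> p q. dist_norm_sq \<mu> p q \<Phi> < ennreal (d\<^sup>2)}" using AB i by auto
    have le: "ennreal ((min e d)\<^sup>2) \<le> ennreal (e\<^sup>2)" "ennreal ((min e d)\<^sup>2) \<le> ennreal (d\<^sup>2)"
      using e(1) d(1) by (intro ennreal_leI power_mono; simp)+
    have "{\<Phi> \<in> dist_step \<mu> p q. dist_norm_sq \<mu> p q \<Phi> < ennreal ((min e d)\<^sup>2)} \<subseteq> A \<inter> B"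
      unfolding e(2) d(2) using order_less_le_trans[OF _ le(1)] order_less_le_trans[OF _ le(2)] by blast
    then show ?thesis
      unfolding i prod.case using e(1) d(1)
      by (intro bexI[of _ "{\<Phi> \<in> dist_step \<mu> p q. dist_norm_sq \<mu> p q \<Phi> < ennreal ((min e d)\<^sup>2)}"] CollectI exI[of _ "min e d"] conjI refl)
        auto
  qed
  show "\<exists>C\<in>?B i. C \<subseteq> A \<inter> B" if AB: "A \<in> ?B i" "B \<in> ?B i" for i A B
  proof -
    obtain p q where i: "i = (p, q)" by (cases i)
    obtain e d where e: "e > 0" "A = {g \<in> Hol0. germ_norm p q g < ennreal e}"
      and d: "d > 0" "B = {g \<in> Hol0. germ_norm p q g < ennreal d}" using AB i by auto
    have le: "ennreal (min e d) \<le> ennreal e" "ennreal (min e d) \<le> ennreal d"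
      by (intro ennreal_leI; simp)+
    have "{g \<in> Hol0. germ_norm p q g < ennreal (min e d)} \<subseteq> A \<inter> B"
      unfolding e(2) d(2) using order_less_le_trans[OF _ le(1)] order_less_le_trans[OF _ le(2)] by blast
    then show ?thesis
      unfolding i prod.case using e(1) d(1)
      by (intro bexI[of _ "{g \<in> Hol0. germ_norm p q g < ennreal (min e d)}"] CollectI exI[of _ "min e d"] conjI refl)
        auto
  qed
  have lcD: "fadd (fscl a u) (fscl b v) \<in> distributions \<mu>" if "u \<in> distributions \<mu>" "v \<in> distributions \<mu>" for u v a b
    by (rule distributions_lc(1)[OF that])
  show "abs_convex fadd fscl (distributions \<mu>)" unfolding abs_convex_def using lcD by blast
  show "fadd u v \<in> distributions \<mu>" if "u \<in> distributions \<mu>" "v \<in> distributions \<mu>" for u v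
    using lcD[OF that, of 1 1] by simp
  have stepD: "dist_step \<mu> p q \<subseteq> distributions \<mu>" for p q by (auto simp: distributions_def)
  show "\<exists>B\<in>?A i. B \<subseteq> distributions \<mu>" for i
  proof -
    obtain p q where i: "i = (p, q)" by (cases i)
    show ?thesis unfolding i prod.case
      by (intro bexI[of _ "{\<Phi> \<in> dist_step \<mu> p q. dist_norm_sq \<mu> p q \<Phi> < ennreal (1\<^sup>2)}"] CollectI exI[of _ "1::real"] conjI refl)
        (use stepD in auto)
  qed
  show "abs_convex germ_add germ_scl Hol0" unfolding abs_convex_def using Hol0_lc by blast
  show "germ_add g h \<in> Hol0" if "g \<in> Hol0" "h \<in> Hol0" for g h
    using Hol0_lc[OF that, of 1 1] that by (simp add: Hol0_scl_1)
  show "\<exists>B\<in>?B i. B \<subseteq> Hol0" for i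
  proof -
    obtain p q where i: "i = (p, q)" by (cases i)
    show ?thesis unfolding i prod.case
      by (intro bexI[of _ "{g \<in> Hol0. germ_norm p q g < ennreal 1}"] CollectI exI[of _ "1::real"] conjI refl) auto
  qed
  show "bij_betw ?S (distributions \<mu>) Hol0" by (rule S_transform_bij)
  show lin: "?S (fadd (fscl a u) (fscl b v)) = germ_add (germ_scl a (?S u)) (germ_scl b (?S v))"
    if "u \<in> distributions \<mu>" "v \<in> distributions \<mu>" for u v a b
    by (rule distributions_lc(2)[OF that])
  show "?S (fadd u v) = germ_add (?S u) (?S v)" if "u \<in> distributions \<mu>" "v \<in> distributions \<mu>" for u v
    using lin[OF that, of 1 1] S_transform_Hol0 that by (simp add: Hol0_scl_1)
  show "\<exists>j. \<forall>C\<in>?B j. \<exists>B\<in>?A i. B \<subseteq> distributions \<mu> \<and> ?S ` B \<subseteq> C" for i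
  proof -
    obtain p q where i: "i = (p, q)" by (cases i)
    have "\<exists>B\<in>?A i. B \<subseteq> distributions \<mu> \<and> ?S ` B \<subseteq> C" if C: "C \<in> ?B (p, q + 1)" for C
    proof -
      obtain e where e: "e > 0" "C = {g \<in> Hol0. germ_norm p (q + 1) g < ennreal e}" using C by auto
      \<comment> \<open>Radius \<open>e / 4\<close>, because the germ norm is at most twice the norm
        of the distribution and \<open>e / 2\<close> is strictly below \<open>e\<close>.\<close>
      let ?B = "{\<Phi> \<in> dist_step \<mu> p q. dist_norm_sq \<mu> p q \<Phi> < ennreal ((e / 4)\<^sup>2)}"
      have "?S \<Phi> \<in> C" if "\<Phi> \<in> ?B" for \<Phi>
      proof -
        have \<Phi>: "\<Phi> \<in> dist_step \<mu> p q" "dist_norm_sq \<mu> p q \<Phi> \<le> ennreal ((e / 4)\<^sup>2)" using that by auto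
        have "germ_norm p (q + 1) (?S \<Phi>) \<le> ennreal (2 * (e / 4))"
          using e(1) by (intro germ_norm_S_transform[OF \<Phi>]) simp
        also have "\<dots> < ennreal e" using e(1) by (intro ennreal_lessI) auto
        finally show ?thesis using e(2) S_transform_Hol0 stepD \<Phi>(1) by auto
      qed
      then show ?thesis
        unfolding i prod.case using e(1) stepD
        by (intro bexI[of _ ?B] CollectI exI[of _ "e / 4"] conjI refl) auto
    qed
    then show ?thesis by blast
  qed
  show "\<exists>i. \<forall>B\<in>?A i. \<exists>C\<in>?B j. C \<subseteq> ?S ` B" for j
  proof -
    obtain p l where j: "j = (p, l)" by (cases j)
    have "(1::real) / 2 ^ l > 0" by simp
    then obtain p' q where pq: "\<And>M G. bounded_hol p (1 / 2 ^ l) M G \<Longrightarrow> \<exists>\<Phi>\<in>dist_step \<mu> p' q.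
        ?S \<Phi> = germ G \<and> dist_norm_sq \<mu> p' q \<Phi> \<le> ennreal (2 * M\<^sup>2)"
      by (rule S_transform_preimage) blast
    have "\<exists>C\<in>?B j. C \<subseteq> ?S ` B" if B: "B \<in> ?A (p', q)" for B
    proof -
      obtain e where e: "e > 0" "B = {\<Phi> \<in> dist_step \<mu> p' q. dist_norm_sq \<mu> p' q \<Phi> < ennreal (e\<^sup>2)}" using B by auto
      \<comment> \<open>With supremum below \<open>e / 2\<close> the squared norm of the preimage is
        at most \<open>2 * (e / 2)\<^sup>2\<close>, half of \<open>e\<^sup>2\<close>.\<close>
      let ?C = "{g \<in> Hol0. germ_norm p l g < ennreal (e / 2)}"
      have "g \<in> ?S ` B" if "g \<in> ?C" for g
      proof -
        have g: "g \<in> Hol0" "germ_norm p l g < ennreal (e / 2)" using that by auto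
        obtain G where G: "g = germ G" "bounded_hol p (1 / 2 ^ l) (e / 2) G" by (rule germ_norm_lessD[OF g])
        obtain \<Phi> where \<Phi>: "\<Phi> \<in> dist_step \<mu> p' q" "?S \<Phi> = germ G" "dist_norm_sq \<mu> p' q \<Phi> \<le> ennreal (2 * (e / 2)\<^sup>2)"
          using pq[OF G(2)] by blast
        have "ennreal (2 * (e / 2)\<^sup>2) < ennreal (e\<^sup>2)" using e(1) by (intro ennreal_lessI) (auto simp: power2_eq_square)
        then have "\<Phi> \<in> B" using \<Phi> e(2) by (auto intro: order_le_less_trans)
        then show ?thesis using \<Phi>(2) G(1) by auto
      qed
      then show ?thesis
        unfolding j prod.case using e(1) by (intro bexI[of _ ?C] CollectI exI[of _ "e / 2"] conjI refl) auto
    qed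
    then show ?thesis by blast
  qed
qed

end

theorem theorem34:
  fixes Hp :: "nat \<Rightarrow> 'h::{real_inner, complete_space, second_countable_topology} set"
    and ip :: "nat \<Rightarrow> 'h \<Rightarrow> 'h \<Rightarrow> real"
    and \<mu> :: "('h \<Rightarrow> real) measure"
  defines "S \<equiv> \<lambda>\<Phi>. nuclear_triple.germ Hp ip (nuclear_triple.S_transform Hp ip \<mu> \<Phi>)"
  assumes "nuclear_triple Hp ip"
    and "\<mu> \<in> nuclear_triple.M_a Hp ip"
    and "prob_space \<mu>"
    and "nuclear_triple.nondegenerate Hp ip \<mu>"
  shows "(\<forall>\<Phi>\<in>nuclear_triple.distributions Hp ip \<mu>. \<forall>\<Psi>\<in>nuclear_triple.distributions Hp ip \<mu>. \<forall>a b.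
            S (fadd (fscl a \<Phi>) (fscl b \<Psi>)) =
              nuclear_triple.germ_add Hp ip
                (nuclear_triple.germ_scl Hp ip a (S \<Phi>)) (nuclear_triple.germ_scl Hp ip b (S \<Psi>))) \<and>
         bij_betw S (nuclear_triple.distributions Hp ip \<mu>) (nuclear_triple.Hol0 Hp ip) \<and>
         homeomorphic_map (nuclear_triple.dist_topology Hp ip \<mu>) (nuclear_triple.Hol0_topology Hp ip) S"
proof -
  interpret appell_setting Hp ip \<mu>
    using \<open>nuclear_triple Hp ip\<close> \<open>\<mu> \<in> nuclear_triple.M_a Hp ip\<close> \<open>prob_space \<mu>\<close>
    by (intro appell_setting.intro appell_setting_axioms.intro)
  show ?thesis
    unfolding S_def
    by (intro conjI ballI allI distributions_lc(2) S_transform_bij S_transform_homeomorphic)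
qed

end
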